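(* Let $X$ be a separable infinite dimensional Fréchet space. Then the following are equivalent: (1) there is a hypercyclic non-mixing operator $T\in L(X)$; (2) there is a mixing uniformly continuous operator semigroup $\{T_t\}_{t\in\mathbb R_+}$ on $X$; (3) there is a supercyclic strongly continuous operator semigroup $\{T_t\}_{t\in\mathbb R_+}$ on $X$; (4) $X$ is non-isomorphic to $\omega$.
   Context: Spaces are over $\mathbb K$, which is $\mathbb R$ or $\mathbb C$; $\mathbb Z_+=\{0,1,2,\dots\}$; $\mathbb R_+=[0,\infty)$. A Fréchet space is a complete metrizable locally convex space. $\omega=\mathbb K^{\mathbb N}$ is the space of all scalar sequences with the topology of coordinatewise convergence. Isomorphic means linearly homeomorphic. $L(X)$ is the space of continuous linear operators on $X$. $T\in L(X)$ is hypercyclic if $\{T^nx:n\in\mathbb Z_+\}$ is dense in $X$ for some $x\in X$; it is mixing if for any non-empty open $U,V\subseteq X$ there is $r>0$ such that $T^n(U)\cap V\neq\varnothing$ for all integers $n>r$; non-mixing means not mixing. An operator semigroup $\{T_t\}_{t\in\mathbb R_+}$ on $X$ is a family in $L(X)$ with $T_0=I$ and $T_{s+t}=T_tT_s$ for all $s,t\ge0$. It is strongly continuous if $t\mapsto T_tx$ is continuous for each $x\in X$. It is uniformly continuous if there is a neighborhood $U$ of zero in $X$ such that for any sequence $t_n\to t$ in $\mathbb R_+$, $T_{t_n}x\to T_tx$ uniformly for $x\in U$. It is mixing if for any non-empty open $U,V\subseteq X$ there is $r>0$ such that $T_t(U)\cap V\neq\varnothing$ for all $t>r$. It is supercyclic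 if there is $x\in X$ such that $\{zT_tx:z\in\mathbb K,\ t\in\mathbb R_+\}$ is dense in $X$. *)

theory Defs
  imports "HOL-Analysis.Analysis" "HOL-Library.Function_Algebras"
begin

text \<open>
  The scalar field: up to an isometric isomorphism of real algebras, a type of this class is
  either the real or the complex numbers, with the usual absolute value.
\<close>

class real_or_complex = real_normed_field +
  assumes real_or_complex:
    "(\<exists>f :: 'a \<Rightarrow> real. bij f \<and> (\<forall>x y. f (x + y) = f x + f y) \<and>
        (\<forall>r x. f (scaleR r x) = scaleR r (f x)) \<and> (\<forall>x y. f (x * y) = f x * f y) \<and>
        (\<forall>x. norm (f x) = norm x)) \<or>
     (\<exists>f :: 'a \<Rightarrow> complex. bij f \<and> (\<forall>x y. f (x + y) = f x + f y) \<and>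
        (\<forall>r x. f (scaleR r x) = scaleR r (f x)) \<and> (\<forall>x y. f (x * y) = f x * f y) \<and>
        (\<forall>x. norm (f x) = norm x))"

instance real :: real_or_complex
  by standard
    (rule disjI1, rule exI[of _ "\<lambda>x. x"], intro conjI allI bij_id[unfolded id_def] refl)

instance complex :: real_or_complex
  by standard
    (rule disjI2, rule exI[of _ "\<lambda>x. x"], intro conjI allI bij_id[unfolded id_def] refl)

definition convex_wrt :: "('k::real_or_complex \<Rightarrow> 'a::ab_group_add \<Rightarrow> 'a) \<Rightarrow> 'a set \<Rightarrow> bool" where
  "convex_wrt smul C \<longleftrightarrow>
     (\<forall>x\<in>C. \<forall>y\<in>C. \<forall>u\<ge>0. \<forall>v\<ge>0. u + v = 1 \<longrightarrow>
        smul (of_real u) x + smul (of_real v) y \<in> C)"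

text \<open>
  Addition and negation are uniformly continuous by the class constraint on the space, which
  forces the uniformity to be the one given by the topology and the group structure. Hence
  \<open>complete UNIV\<close> (convergence of Cauchy filters) is completeness as a topological vector space.
\<close>

locale frechet_space = vector_space smul
  for smul :: "'k::real_or_complex \<Rightarrow> 'a::{uniform_topological_group_add, ab_group_add} \<Rightarrow> 'a" +
  assumes continuous_smul: "continuous_on UNIV (\<lambda>(c, x). smul c x)"
    and locally_convex:
      "\<And>U. open U \<Longrightarrow> 0 \<in> U \<Longrightarrow> \<exists>V. convex_wrt smul V \<and> 0 \<in> interior V \<and> V \<subseteq> U"
    and metrizable: "metrizable_space (euclidean :: 'a topology)"
    and complete_space: "complete (UNIV :: 'a set)"

definition infinite_dimensional :: "('k::field \<Rightarrow> 'a::ab_group_add \<Rightarrow> 'a) \<Rightarrow> bool" where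
  "infinite_dimensional smul \<longleftrightarrow> (\<nexists>B. finite B \<and> module.span smul B = UNIV)"

definition continuous_operators ::
    "('k::field \<Rightarrow> 'a::{topological_space, ab_group_add} \<Rightarrow> 'a) \<Rightarrow> ('a \<Rightarrow> 'a) set" where
  "continuous_operators smul = {T. Vector_Spaces.linear smul smul T \<and> continuous_on UNIV T}"

definition hypercyclic :: "('a::topological_space \<Rightarrow> 'a) \<Rightarrow> bool" where
  "hypercyclic T \<longleftrightarrow> (\<exists>x. closure (range (\<lambda>n. (T ^^ n) x)) = UNIV)"

definition mixing :: "('a::topological_space \<Rightarrow> 'a) \<Rightarrow> bool" where
  "mixing T \<longleftrightarrow>
     (\<forall>U V. open U \<and> U \<noteq> {} \<and> open V \<and> V \<noteq> {} \<longrightarrow>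
        (\<exists>r::real. r > 0 \<and> (\<forall>n::nat. real n > r \<longrightarrow> (T ^^ n) ` U \<inter> V \<noteq> {})))"

text \<open>
  Families indexed by the nonnegative reals are functions on \<^typ>\<open>real\<close> whose values at negative
  arguments are ignored.
\<close>

definition operator_semigroup ::
    "('k::field \<Rightarrow> 'a::{topological_space, ab_group_add} \<Rightarrow> 'a) \<Rightarrow> (real \<Rightarrow> 'a \<Rightarrow> 'a) \<Rightarrow> bool" where
  "operator_semigroup smul T \<longleftrightarrow>
     (\<forall>t\<ge>0. T t \<in> continuous_operators smul) \<and> T 0 = id \<and>
     (\<forall>s\<ge>0. \<forall>t\<ge>0. T (s + t) = T t \<circ> T s)"

definition strongly_continuous_semigroup ::
    "(real \<Rightarrow> 'a::topological_space \<Rightarrow> 'a) \<Rightarrow> bool" where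
  "strongly_continuous_semigroup T \<longleftrightarrow> (\<forall>x. continuous_on {0..} (\<lambda>t. T t x))"

definition uniformly_continuous_semigroup ::
    "(real \<Rightarrow> 'a::{topological_space, ab_group_add} \<Rightarrow> 'a) \<Rightarrow> bool" where
  "uniformly_continuous_semigroup T \<longleftrightarrow>
     (\<exists>U. 0 \<in> interior U \<and>
        (\<forall>(\<tau> :: nat \<Rightarrow> real) t. (\<forall>n. \<tau> n \<ge> 0) \<and> t \<ge> 0 \<and> \<tau> \<longlonglongrightarrow> t \<longrightarrow>
           (\<forall>V. open V \<and> 0 \<in> V \<longrightarrow>
              (\<forall>\<^sub>F n in sequentially. \<forall>x\<in>U. T (\<tau> n) x - T t x \<in> V))))"

definition mixing_semigroup :: "(real \<Rightarrow> 'a::topological_space \<Rightarrow> 'a) \<Rightarrow> bool" where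
  "mixing_semigroup T \<longleftrightarrow>
     (\<forall>U V. open U \<and> U \<noteq> {} \<and> open V \<and> V \<noteq> {} \<longrightarrow>
        (\<exists>r>0. \<forall>t>r. T t ` U \<inter> V \<noteq> {}))"

definition supercyclic_semigroup ::
    "('k \<Rightarrow> 'a::topological_space \<Rightarrow> 'a) \<Rightarrow> (real \<Rightarrow> 'a \<Rightarrow> 'a) \<Rightarrow> bool" where
  "supercyclic_semigroup smul T \<longleftrightarrow> (\<exists>x. closure {smul z (T t x) | z t. t \<ge> 0} = UNIV)"

definition isomorphic_tvs ::
    "('k::field \<Rightarrow> 'a::{topological_space, ab_group_add} \<Rightarrow> 'a) \<Rightarrow>
     ('k \<Rightarrow> 'b::{topological_space, ab_group_add} \<Rightarrow> 'b) \<Rightarrow> bool" where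
  "isomorphic_tvs smul1 smul2 \<longleftrightarrow>
     (\<exists>f g. Vector_Spaces.linear smul1 smul2 f \<and> homeomorphism UNIV UNIV f g)"

text \<open>
  The space of all scalar sequences is the type \<open>nat \<Rightarrow> 'k\<close>, which carries the product topology
  and pointwise addition; only its scalar multiplication has to be named.
\<close>

definition omega_smul :: "'k::real_or_complex \<Rightarrow> (nat \<Rightarrow> 'k) \<Rightarrow> (nat \<Rightarrow> 'k)" where
  "omega_smul c x = (\<lambda>n. c * x n)"

end

theory Submission
  imports Defs "HOL-Computational_Algebra.Fundamental_Theorem_Algebra"
begin

text \<open>
  A separable space is isomorphic to \<open>\<omega>\<close> as soon as every continuous seminorm bounds only a
  finite-dimensional space of functionals. Otherwise there are functionals \<open>f i\<close>, all bounded by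
  one seminorm, that are biorthogonal to a sequence \<open>x i\<close> with dense span. The \<open>f i\<close> map the space
  into the bounded sequences and the \<open>x i\<close>, suitably weighted by \<open>w i\<close>, map the bounded sequences
  back, so bounded operators on \<open>\<ell>\<^sup>\<infinity>\<close> can be transported. The exponentials of a weighted backward shift
  form a uniformly continuous semigroup which acts on a dense copy of the polynomials by translation
  of the argument; it is mixing because there are polynomials close to a given one that translation
  takes close to \<open>0\<close>, and conversely. For a hypercyclic operator that is not mixing, one looks at
  \<open>1 + L\<close> with \<open>L\<close> in the closure of the finite nilpotent matrices. By the Baire category theorem, a generic
  such \<open>L\<close> makes the operator transitive, while a functional close to \<open>f 0\<close> is brought back to the unit ball of the
  dual by arbitrarily high powers of the adjoint. The latter excludes mixing.

  On \<open>\<omega>\<close>, every continuous functional depends on finitely many coordinates. If \<open>T\<close> is hypercyclic, its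
  adjoint has no eigenvector, so the dual is a torsion-free module over the polynomials in the
  adjoint. Hence high powers of the adjoint move the span of finitely many coordinates off itself, and
  this is mixing. For a strongly continuous semigroup, a Baire argument yields a finite-dimensional space
  of functionals which contains three coordinates and is invariant under the adjoints. If there is
  a supercyclic vector, a triangular basis of this space leads to a contradiction: there are at most two
  joint eigenvectors that take the value \<open>1\<close> at that vector, and no proper Jordan chain.
\<close>

section \<open>Scalars\<close>

text \<open>Statement (4) decides the other three. On a copy of \<omega>, (1) and (3) are refuted
  and (2) falls with (3); on every other space (1) and (2) are constructed, and (2) gives (3)
  because a mixing semigroup on a separable space has a dense orbit. Nilpotent matrices occur in the
  construction for (1) because the powers of \<open>1 + a\<close> are then polynomial in the
  exponent, so a scalar factor of higher degree can force a motion to start or to end at 0. One such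
  matrix is far from transitive, hence the closure. Transitivity perturbs a matrix and recurrence
  perturbs its transpose, and only a category argument yields both at once, infinitely often. Real
  and complex scalars are treated together by composing functionals with an embedding into the
  complex numbers, where eigenvalues exist. The rotations of the real plane form a supercyclic
  semigroup with two conjugate joint eigenvectors; two coordinates therefore cannot lead to a
  contradiction, and three are taken.\<close>

lemma ex_scalar_embedding:
  "\<exists>f :: 'k::real_or_complex \<Rightarrow> complex. (\<forall>x y. f (x + y) = f x + f y) \<and> (\<forall>x y. f (x * y) = f x * f y) \<and>
     (\<forall>x. norm (f x) = norm x) \<and> (\<forall>r. f (of_real r) = of_real r) \<and> (range f = UNIV \<or> range f = \<real>)"
  using real_or_complex[where 'a='k]
proof
  assume "\<exists>f :: 'k \<Rightarrow> real. bij f \<and> (\<forall>x y. f (x + y) = f x + f y) \<and>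
        (\<forall>r x. f (scaleR r x) = scaleR r (f x)) \<and> (\<forall>x y. f (x * y) = f x * f y) \<and>
        (\<forall>x. norm (f x) = norm x)"
  then obtain f :: "'k \<Rightarrow> real" where f: "bij f" "\<And>x y. f (x + y) = f x + f y"
    "\<And>r x. f (scaleR r x) = scaleR r (f x)" "\<And>x y. f (x * y) = f x * f y" "\<And>x. norm (f x) = norm x"
    by blast
  \<comment> \<open>Multiplicativity makes \<open>f 1\<close> idempotent and the isometry makes it
    nonzero; with \<open>f 1 = 1\<close>, real linearity fixes the real scalars.\<close>
  have "f 1 = f 1 * f 1" using f(4)[of 1 1] by simp
  moreover have "f 1 \<noteq> 0" using f(5)[of 1] by auto
  ultimately have one: "f 1 = 1" by simp
  have "range (\<lambda>x. complex_of_real (f x)) = \<real>"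
    using f(1) by (auto simp: bij_def Reals_def image_iff) (metis surjD)
  then show ?thesis
    using f one f(3)[of _ 1] by (intro exI[of _ "\<lambda>x. complex_of_real (f x)"]) (auto simp: of_real_def[where 'a='k])
next
  assume "\<exists>f :: 'k \<Rightarrow> complex. bij f \<and> (\<forall>x y. f (x + y) = f x + f y) \<and>
        (\<forall>r x. f (scaleR r x) = scaleR r (f x)) \<and> (\<forall>x y. f (x * y) = f x * f y) \<and>
        (\<forall>x. norm (f x) = norm x)"
  then obtain f :: "'k \<Rightarrow> complex" where f: "bij f" "\<And>x y. f (x + y) = f x + f y"
    "\<And>r x. f (scaleR r x) = scaleR r (f x)" "\<And>x y. f (x * y) = f x * f y" "\<And>x. norm (f x) = norm x"
    by blast
  have "f 1 = f 1 * f 1" using f(4)[of 1 1] by simp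
  moreover have "f 1 \<noteq> 0" using f(5)[of 1] by auto
  ultimately have one: "f 1 = 1" by simp
  show ?thesis
    using f one f(3)[of _ 1] by (intro exI[of _ f]) (auto simp: of_real_def bij_def)
qed

text \<open>One embedding serves both scalar fields, so that norms, limits and eigenvalues can be
  handled in the complex numbers without a case distinction; \<open>range_emb\<close> restores it
  where it matters.\<close>

definition emb :: "'k::real_or_complex \<Rightarrow> complex" where
  "emb = (SOME f. (\<forall>x y. f (x + y) = f x + f y) \<and> (\<forall>x y. f (x * y) = f x * f y) \<and>
     (\<forall>x. norm (f x) = norm x) \<and> (\<forall>r. f (of_real r) = of_real r) \<and> (range f = UNIV \<or> range f = \<real>))"

lemma emb_properties:
  "(\<forall>x y :: 'k::real_or_complex. emb (x + y) = emb x + emb y) \<and> (\<forall>x y :: 'k. emb (x * y) = emb x * emb y) \<and>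
     (\<forall>x :: 'k. norm (emb x) = norm x) \<and> (\<forall>r. emb (of_real r :: 'k) = of_real r) \<and>
     (range (emb :: 'k \<Rightarrow> complex) = UNIV \<or> range (emb :: 'k \<Rightarrow> complex) = \<real>)"
  unfolding emb_def by (rule someI_ex[OF ex_scalar_embedding])

lemma emb_add: "emb (x + y) = emb x + emb y"
  and emb_mult: "emb (x * y) = emb x * emb y"
  and norm_emb [simp]: "norm (emb x) = norm x"
  and emb_of_real [simp]: "emb (of_real r) = of_real r"
  using emb_properties by auto

lemma range_emb: "range (emb :: 'k::real_or_complex \<Rightarrow> complex) = UNIV \<or> range (emb :: 'k \<Rightarrow> complex) = \<real>"
  using emb_properties by blast

lemma emb_0 [simp]: "emb 0 = 0" and emb_1 [simp]: "emb 1 = 1"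
  using emb_of_real[of 0] emb_of_real[of 1] by simp_all

lemma emb_minus: "emb (- x) = - emb x"
  using emb_add[of "-x" x] by (simp add: add_eq_0_iff2)

lemma emb_diff: "emb (x - y) = emb x - emb y"
  using emb_add[of x "-y"] by (simp add: emb_minus)

lemma emb_sum: "emb (sum f A) = (\<Sum>i\<in>A. emb (f i))"
  by (induction A rule: infinite_finite_induct) (auto simp: emb_add)

lemma emb_eq_iff: "emb x = emb y \<longleftrightarrow> x = y"
  by (metis emb_diff norm_emb right_minus_eq norm_eq_zero)

lemma emb_eq_0_iff [simp]: "emb x = 0 \<longleftrightarrow> x = 0"
  using emb_eq_iff[of x 0] by simp

lemma dist_emb: "dist (emb x) (emb y) = dist x y"
  by (simp add: dist_norm flip: emb_diff)

text \<open>Completeness passes from the complex numbers along the isometry \<open>emb\<close>,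
  whose range is closed in either case. It is needed for scalar series and for the completeness of
  \<open>nat \<Rightarrow>\<^sub>C 'k\<close>.\<close>

instance real_or_complex \<subseteq> banach
proof
  fix X :: "nat \<Rightarrow> 'a"
  assume "Cauchy X"
  then have "Cauchy (\<lambda>n. emb (X n))" by (simp add: Cauchy_def dist_emb)
  then obtain l where l: "(\<lambda>n. emb (X n)) \<longlonglongrightarrow> l" using Cauchy_convergent convergentD by blast
  have "closed (range (emb :: 'a \<Rightarrow> complex))" using range_emb[where 'k='a] closed_complex_Reals by auto
  then have "l \<in> range (emb :: 'a \<Rightarrow> complex)" using closed_sequentially[of _ "\<lambda>n. emb (X n)" l] l by blast
  then obtain y :: 'a where "l = emb y" by auto
  then have "X \<longlonglongrightarrow> y" using l by (simp add: tendsto_iff dist_emb)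
  then show "convergent X" by (rule convergentI)
qed

lemma tendsto_emb: "(f \<longlongrightarrow> l) F \<Longrightarrow> ((\<lambda>x. emb (f x)) \<longlongrightarrow> emb l) F"
  by (simp add: tendsto_iff dist_emb)

lemma continuous_on_emb [continuous_intros]:
  "continuous_on S f \<Longrightarrow> continuous_on S (\<lambda>x. emb (f x))"
  by (auto simp: continuous_on_def intro: tendsto_emb)

section \<open>Seminorms defining the topology\<close>

definition seminorm :: "('k::real_or_complex \<Rightarrow> 'a::ab_group_add \<Rightarrow> 'a) \<Rightarrow> ('a \<Rightarrow> real) \<Rightarrow> bool" where
  "seminorm smul p \<longleftrightarrow> (\<forall>x y. p (x + y) \<le> p x + p y) \<and> (\<forall>c x. p (smul c x) = norm c * p x)"

locale scaled_space = vector_space smul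
  for smul :: "'k::real_or_complex \<Rightarrow> 'a::ab_group_add \<Rightarrow> 'a"
begin

lemma seminorm_add: "seminorm smul p \<Longrightarrow> p (x + y) \<le> p x + p y"
  and seminorm_smul: "seminorm smul p \<Longrightarrow> p (smul c x) = norm c * p x"
  by (auto simp: seminorm_def)

lemma seminorm_0: "seminorm smul p \<Longrightarrow> p 0 = 0"
  using seminorm_smul[of p 0 0] by simp

lemma seminorm_minus: "seminorm smul p \<Longrightarrow> p (- x) = p x"
  using seminorm_smul[of p "-1" x] by simp

lemma seminorm_diff: "seminorm smul p \<Longrightarrow> p (x - y) \<le> p x + p y"
  using seminorm_add[of p x "-y"] by (simp add: seminorm_minus)

lemma seminorm_commute: "seminorm smul p \<Longrightarrow> p (x - y) = p (y - x)"
  using seminorm_minus[of p "x - y"] by simp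

lemma seminorm_nonneg: "seminorm smul p \<Longrightarrow> 0 \<le> p x"
  using seminorm_add[of p x "-x"] by (simp add: seminorm_minus seminorm_0)

lemma seminorm_triangle: "seminorm smul p \<Longrightarrow> p (x - z) \<le> p (x - y) + p (y - z)"
  using seminorm_add[of p "x - y" "y - z"] by simp

lemma seminorm_sum: "seminorm smul p \<Longrightarrow> p (sum f A) \<le> (\<Sum>i\<in>A. p (f i))"
proof (induction A rule: infinite_finite_induct)
  case (insert x F)
  then show ?case using seminorm_add[of p "f x" "sum f F"] by auto
qed (auto simp: seminorm_0)

end

sublocale frechet_space \<subseteq> scaled_space ..

context frechet_space
begin

lemma continuous_on_smul: "continuous_on S f \<Longrightarrow> continuous_on S g \<Longrightarrow> continuous_on S (\<lambda>x. smul (f x) (g x))"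
  using continuous_on_compose2[OF continuous_smul, of S "\<lambda>x. (f x, g x)"]
  by (auto intro: continuous_on_Pair)

lemma continuous_on_add': 
  fixes f g :: "'b::topological_space \<Rightarrow> 'a"
  shows "continuous_on S f \<Longrightarrow> continuous_on S g \<Longrightarrow> continuous_on S (\<lambda>x. f x + g x)"
  by (auto simp: continuous_on_def intro: tendsto_add)

lemma open_affine_preimage:
  assumes "open S" shows "open {y. smul c y + a \<in> S}"
proof -
  have "continuous_on UNIV (\<lambda>y. smul c y + a)"
    by (intro continuous_on_add' continuous_on_smul continuous_intros)
  from open_vimage[OF assms this] show ?thesis by (simp add: vimage_def)
qed

lemma balanced_nhd:
  assumes "open U" "0 \<in> U"
  obtains W \<delta> where "open W" "0 \<in> W" "\<delta> > 0" "\<And>c w. norm c < \<delta> \<Longrightarrow> w \<in> W \<Longrightarrow> smul c w \<in> U"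
proof -
  have "open ((\<lambda>(c, x). smul c x) -` U)"
    using open_vimage[OF assms(1) continuous_smul] .
  moreover have "(0, 0) \<in> (\<lambda>(c, x). smul c x) -` U" using assms by simp
  ultimately obtain A B where AB: "open A" "open B" "0 \<in> A" "0 \<in> B" "A \<times> B \<subseteq> (\<lambda>(c, x). smul c x) -` U"
    by (rule open_prod_elim) auto
  then obtain \<delta> where "\<delta> > 0" "ball 0 \<delta> \<subseteq> A" using openE by blast
  with AB show ?thesis by (intro that[of B \<delta>]) (auto simp: subset_iff)
qed

text \<open>\<open>p\<close> is the Minkowski functional of the balanced core \<open>C\<close> of a
  convex neighbourhood \<open>V\<close>. The core inherits convexity, and it absorbs every point
  because it contains small multiples of \<open>W\<close>. The last conclusion will make
  \<open>p\<close> continuous.\<close>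

lemma ex_seminorm_nhd:
  assumes "open U" "0 \<in> U"
  obtains p where "seminorm smul p" "\<And>x. p x < 1 \<Longrightarrow> x \<in> U"
    "\<exists>W. open W \<and> 0 \<in> W \<and> (\<forall>x\<in>W. p x \<le> 1)"
proof -
  obtain V where V: "convex_wrt smul V" "0 \<in> interior V" "V \<subseteq> U" using locally_convex[OF assms] by blast
  obtain W \<delta> where W: "open W" "0 \<in> W" "\<delta> > 0" "\<And>c w. norm c < \<delta> \<Longrightarrow> w \<in> W \<Longrightarrow> smul c w \<in> interior V"
    using balanced_nhd[of "interior V"] V by auto
  define C where "C = {x. \<forall>c. norm c \<le> 1 \<longrightarrow> smul c x \<in> V}"
  have CV: "C \<subseteq> V" unfolding C_def by (auto dest: spec[of _ 1])
  have Cbal: "smul c x \<in> C" if "x \<in> C" "norm c \<le> 1" for c x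
    using that by (auto simp: C_def norm_mult mult_le_one)
  have Cconv: "smul (of_real u) x + smul (of_real v) y \<in> C" if "x \<in> C" "y \<in> C" "0 \<le> u" "0 \<le> v" "u + v = 1" for x y u v
  proof -
    { fix c :: 'k assume "norm c \<le> 1"
      then have "smul c x \<in> V" "smul c y \<in> V" using that by (auto simp: C_def)
      then have "smul (of_real u) (smul c x) + smul (of_real v) (smul c y) \<in> V"
        using V(1) that unfolding convex_wrt_def by blast
      then have "smul c (smul (of_real u) x + smul (of_real v) y) \<in> V"
        by (simp add: scale_right_distrib mult.commute) }
    then show ?thesis by (auto simp: C_def)
  qed
  have C0: "0 \<in> C" using V(2) interior_subset by (auto simp: C_def)
  have WC: "smul c w \<in> C" if "norm c < \<delta>" "w \<in> W" for c w
  proof -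
    { fix d :: 'k assume "norm d \<le> 1"
      then have "norm (d * c) < \<delta>" using that by (simp add: norm_mult) (smt (verit) mult_left_le_one_le norm_ge_zero)
      then have "smul d (smul c w) \<in> V" using W(4)[of "d * c" w] that interior_subset by auto }
    then show ?thesis by (auto simp: C_def)
  qed
  define S where "S x = {r::real. r > 0 \<and> smul (of_real (1 / r)) x \<in> C}" for x
  define p where "p x = Inf (S x)" for x
  have bdd: "bdd_below (S x)" for x by (rule bdd_belowI[of _ 0]) (auto simp: S_def)
  have nonempty: "S x \<noteq> {}" for x
  proof -
    have "open {c. smul (of_real c) x \<in> W}"
    proof -
      have "continuous_on UNIV (\<lambda>c. smul (of_real c) x)" by (intro continuous_on_smul continuous_intros)
      from open_vimage[OF W(1) this] show ?thesis by (simp add: vimage_def)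
    qed
    moreover have "0 \<in> {c. smul (of_real c) x \<in> W}" using W by simp
    ultimately obtain e :: real where e: "e > 0" "ball 0 e \<subseteq> {c. smul (of_real c) x \<in> W}" using openE by blast
    have "e / 2 \<in> ball 0 e" using e by simp
    with e have "smul (of_real (e / 2)) x \<in> W" by blast
    then have "smul (of_real (\<delta> / 2)) (smul (of_real (e / 2)) x) \<in> C" using W by (intro WC) auto
    then have "smul (of_real (1 / (1 / (\<delta> / 2 * (e / 2))))) x \<in> C" by (simp add: mult.commute)
    moreover have "1 / (\<delta> / 2 * (e / 2)) > 0" using W e by simp
    ultimately show ?thesis unfolding S_def by blast
  qed
  have up: "s \<in> S x" if "r \<in> S x" "r \<le> s" for r s x
  proof -
    have rs: "0 < r" "0 < s" "smul (of_real (1 / r)) x \<in> C" using that by (auto simp: S_def)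
    have "norm (of_real (r / s) :: 'k) \<le> 1" using rs that(2) by (simp only: norm_of_real) simp
    with rs(3) have "smul (of_real (r / s)) (smul (of_real (1 / r)) x) \<in> C" by (rule Cbal)
    then show ?thesis using rs by (simp add: S_def)
  qed
  have less: "r \<in> S x" if "p x < r" for x r
  proof -
    have "Inf (S x) < r" using that by (simp add: p_def)
    then obtain s where "s \<in> S x" "s < r" unfolding cInf_less_iff[OF nonempty[of x] bdd[of x]] by blast
    then show ?thesis using up by auto
  qed
  have p_le: "p x \<le> r" if "r \<in> S x" for x r unfolding p_def using that bdd by (rule cInf_lower)
  have nn: "0 \<le> p x" for x unfolding p_def using nonempty by (rule cInf_greatest) (auto simp: S_def)
  have add: "p (x + y) \<le> p x + p y" for x y
  proof (rule field_le_epsilon)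
    fix e :: real assume e: "e > 0"
    define r where "r = p x + e / 2"
    define s where "s = p y + e / 2"
    have rs: "r \<in> S x" "s \<in> S y" using e by (auto simp: r_def s_def intro: less)
    have pos: "r > 0" "s > 0" using rs by (auto simp: S_def)
    \<comment> \<open>A convex combination of \<open>x / r\<close> and \<open>y / s\<close> with
      these weights is \<open>(x + y) / (r + s)\<close>.\<close>
    have "smul (of_real (r / (r + s))) (smul (of_real (1 / r)) x) + smul (of_real (s / (r + s))) (smul (of_real (1 / s)) y) \<in> C"
      using rs pos by (intro Cconv) (auto simp: S_def simp flip: add_divide_distrib)
    moreover have "r / (r + s) * (1 / r) = 1 / (r + s)" "s / (r + s) * (1 / s) = 1 / (r + s)" using pos by auto
    ultimately have "smul (of_real (1 / (r + s))) x + smul (of_real (1 / (r + s))) y \<in> C"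
      by (simp only: scale_scale flip: of_real_mult)
    then have "r + s \<in> S (x + y)" using pos by (simp add: S_def scale_right_distrib)
    then show "p (x + y) \<le> p x + p y + e" using p_le[of "r + s" "x + y"] by (simp add: r_def s_def)
  qed
  \<comment> \<open>The reverse inequality is this one for \<open>inverse c\<close>, which is how
    \<open>scale\<close> uses it.\<close>
  have half: "p (smul c x) \<le> norm c * p x" if "c \<noteq> 0" for c x
  proof (rule field_le_epsilon)
    fix e :: real assume e: "e > 0"
    define r where "r = p x + e / norm c"
    have r: "r \<in> S x" using e that by (auto simp: r_def intro: less)
    have "smul (c / of_real (norm c)) (smul (of_real (1 / r)) x) \<in> C"
      using r that by (intro Cbal[of "smul _ x"]) (auto simp: S_def norm_divide)
    then have "norm c * r \<in> S (smul c x)" using r that by (simp add: S_def mult.commute)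
    then show "p (smul c x) \<le> norm c * p x + e" using p_le[of "norm c * r" "smul c x"] that by (simp add: r_def distrib_left)
  qed
  have p0: "p 0 = 0"
  proof (rule antisym[OF field_le_epsilon nn])
    fix e :: real assume "e > 0"
    then show "p 0 \<le> 0 + e" using p_le[of e 0] C0 by (simp add: S_def)
  qed
  have scale: "p (smul c x) = norm c * p x" for c x
  proof (cases "c = 0")
    case False
    have "norm (inverse c) * p (smul c x) \<ge> p (smul (inverse c) (smul c x))" using False by (intro half) auto
    then have "norm c * p x \<le> p (smul c x)" using False by (simp add: norm_inverse norm_divide field_simps)
    then show ?thesis using half[OF False, of x] by simp
  qed (simp add: p0)
  show ?thesis
  proof (rule that[of p])
    show "seminorm smul p" using add scale by (simp add: seminorm_def)
    show "x \<in> U" if "p x < 1" for x using less[OF that] CV V(3) by (auto simp: S_def)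
    have "open {y. smul (of_real (2 / \<delta>)) y + 0 \<in> W}" using W(1) by (rule open_affine_preimage)
    moreover have "p x \<le> 1" if "smul (of_real (2 / \<delta>)) x \<in> W" for x
    proof -
      have "smul (of_real (\<delta> / 2)) (smul (of_real (2 / \<delta>)) x) \<in> C" using that W(3) by (intro WC) auto
      then have "1 \<in> S x" using W(3) by (simp add: S_def)
      then show ?thesis by (rule p_le)
    qed
    ultimately show "\<exists>W. open W \<and> 0 \<in> W \<and> (\<forall>x\<in>W. p x \<le> 1)"
      using W(2) by (intro exI[of _ "{y. smul (of_real (2 / \<delta>)) y + 0 \<in> W}"]) auto
  qed
qed

text \<open>Partial sums of the gauges of a countable neighbourhood base at zero. They increase with
  the index, so finitely many seminorm conditions can always be merged into one.\<close>

lemma ex_seminorm_sequence: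
  "\<exists>P :: nat \<Rightarrow> 'a \<Rightarrow> real. (\<forall>n. seminorm smul (P n)) \<and> (\<forall>m n x. m \<le> n \<longrightarrow> P m x \<le> P n x) \<and>
     (\<forall>S. open S \<longleftrightarrow> (\<forall>x\<in>S. \<exists>n. \<exists>e>0. \<forall>y. P n (y - x) < e \<longrightarrow> y \<in> S))"
proof -
  have "first_countable (euclidean :: 'a topology)" using metrizable by (rule metrizable_imp_first_countable)
  then have "\<exists>B. countable B \<and> (\<forall>V\<in>B. open V) \<and> (\<forall>U. open U \<and> (0::'a) \<in> U \<longrightarrow> (\<exists>V\<in>B. 0 \<in> V \<and> V \<subseteq> U))"
    unfolding first_countable_def topspace_euclidean open_openin[symmetric] by (rule bspec) simp
  then obtain B :: "'a set set" where B: "countable B" "\<And>V. V \<in> B \<Longrightarrow> open V" 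
    "\<And>U. open U \<Longrightarrow> 0 \<in> U \<Longrightarrow> \<exists>V\<in>B. 0 \<in> V \<and> V \<subseteq> U"
    by auto
  define B' where "B' = {V\<in>B. 0 \<in> V}"
  have "countable B'" unfolding B'_def using B(1) by simp
  moreover have "B' \<noteq> {}" unfolding B'_def using B(3)[of UNIV] by auto
  ultimately obtain V :: "nat \<Rightarrow> 'a set" where V: "range V = B'" using uncountable_def by metis
  have V1: "open (V n)" "0 \<in> V n" for n using V B(2) unfolding B'_def by auto
  have V2: "\<exists>n. V n \<subseteq> U" if "open U" "0 \<in> U" for U
  proof -
    obtain W where "W \<in> B" "0 \<in> W" "W \<subseteq> U" using B(3) \<open>open U\<close> \<open>0 \<in> U\<close> by blast
    then have "W \<in> range V" unfolding V B'_def by simp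
    with \<open>W \<subseteq> U\<close> show ?thesis by auto
  qed
  have "\<forall>n. \<exists>p. seminorm smul p \<and> (\<forall>x. p x < 1 \<longrightarrow> x \<in> V n) \<and> (\<exists>W. open W \<and> 0 \<in> W \<and> (\<forall>x\<in>W. p x \<le> 1))"
    using ex_seminorm_nhd V1 by metis
  then obtain p where p: "\<And>n. seminorm smul (p n)" "\<And>n x. p n x < 1 \<Longrightarrow> x \<in> V n"
    "\<And>n. \<exists>W. open W \<and> 0 \<in> W \<and> (\<forall>x\<in>W. p n x \<le> 1)" by metis
  define P where "P n x = (\<Sum>i\<le>n. p i x)" for n x
  have pnn: "0 \<le> p n x" for n x using p(1) by (rule seminorm_nonneg)
  have P1: "seminorm smul (P n)" for n
    unfolding seminorm_def P_def using p(1)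
    by (auto simp: sum_distrib_left seminorm_smul simp flip: sum.distrib intro!: sum_mono seminorm_add)
  have P2: "P m x \<le> P n x" if "m \<le> n" for m n x
    unfolding P_def using that pnn by (intro sum_mono2) auto
  have pP: "p n x \<le> P n x" for n x unfolding P_def using pnn by (intro member_le_sum) auto
  have small: "\<exists>W. open W \<and> 0 \<in> W \<and> (\<forall>x\<in>W. P n x < e)" if e: "e > 0" for n e
  proof -
    obtain W where W: "\<And>i. open (W i) \<and> 0 \<in> W i \<and> (\<forall>x\<in>W i. p i x \<le> 1)" using p(3) by metis
    \<comment> \<open>There are \<open>n + 1\<close> summands, each at most \<open>1 / c\<close> on
      \<open>G\<close>; the numerator \<open>n + 2\<close> makes their total strictly less than
      \<open>e\<close>.\<close>
    define c where "c = real (n + 2) / e"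
    have c: "c > 0" using e by (simp add: c_def)
    define G where "G = (\<Inter>i\<le>n. {x. smul (of_real c) x + 0 \<in> W i})"
    have "open G" unfolding G_def using W by (intro open_INT ballI open_affine_preimage) auto
    moreover have "0 \<in> G" using W by (auto simp: G_def)
    moreover have "P n x < e" if "x \<in> G" for x
    proof -
      have "p i x \<le> 1 / c" if "i \<le> n" for i
      proof -
        have "p i (smul (of_real c) x) \<le> 1" using W \<open>x \<in> G\<close> that by (auto simp: G_def)
        then show ?thesis using c by (simp add: seminorm_smul[OF p(1)] field_simps)
      qed
      then have "P n x \<le> (\<Sum>i\<le>n. 1 / c)" unfolding P_def by (intro sum_mono) auto
      also have "\<dots> = (real n + 1) / (real n + 2) * e" by (simp add: c_def add.commute)
      also have "\<dots> < e" using e by (simp add: field_simps)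
      finally show ?thesis .
    qed
    ultimately show ?thesis by blast
  qed
  have op: "open S \<longleftrightarrow> (\<forall>x\<in>S. \<exists>n. \<exists>e>0. \<forall>y. P n (y - x) < e \<longrightarrow> y \<in> S)" for S
  proof
    assume S: "open S"
    show "\<forall>x\<in>S. \<exists>n. \<exists>e>0. \<forall>y. P n (y - x) < e \<longrightarrow> y \<in> S"
    proof
      fix x assume x: "x \<in> S"
      have "open {y. smul 1 y + x \<in> S}" using S by (rule open_affine_preimage)
      with x V2[of "{y. smul 1 y + x \<in> S}"] obtain n where n: "V n \<subseteq> {y. smul 1 y + x \<in> S}" by auto
      have "y \<in> S" if "P n (y - x) < 1" for y
      proof -
        have "p n (y - x) < 1" using that pP[of n "y - x"] by simp
        then have "y - x \<in> V n" by (rule p(2))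
        then show ?thesis using n by auto
      qed
      then show "\<exists>n. \<exists>e>0. \<forall>y. P n (y - x) < e \<longrightarrow> y \<in> S" using zero_less_one by blast
    qed
  next
    assume *: "\<forall>x\<in>S. \<exists>n. \<exists>e>0. \<forall>y. P n (y - x) < e \<longrightarrow> y \<in> S"
    show "open S"
    proof (rule topological_space_class.openI)
      fix x assume "x \<in> S"
      with * obtain n e where ne: "e > 0" "\<And>y. P n (y - x) < e \<Longrightarrow> y \<in> S" by blast
      from small[OF ne(1)] obtain W where W: "open W" "0 \<in> W" "\<forall>x\<in>W. P n x < e" by blast
      have "open {y. smul 1 y + (-x) \<in> W}" using W(1) by (rule open_affine_preimage)
      moreover have "x \<in> {y. smul 1 y + (-x) \<in> W}" using W by simp
      moreover have "{y. smul 1 y + (-x) \<in> W} \<subseteq> S" using W ne(2) by auto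
      ultimately show "\<exists>T. open T \<and> x \<in> T \<and> T \<subseteq> S" by blast
    qed
  qed
  show ?thesis by (rule exI[of _ P]) (intro conjI allI impI P1 P2 op)
qed

definition P :: "nat \<Rightarrow> 'a \<Rightarrow> real" where
  "P = (SOME P. (\<forall>n. seminorm smul (P n)) \<and> (\<forall>m n x. m \<le> n \<longrightarrow> P m x \<le> P n x) \<and>
     (\<forall>S. open S \<longleftrightarrow> (\<forall>x\<in>S. \<exists>n. \<exists>e>0. \<forall>y. P n (y - x) < e \<longrightarrow> y \<in> S)))"

lemma P_properties:
  "(\<forall>n. seminorm smul (P n)) \<and> (\<forall>m n x. m \<le> n \<longrightarrow> P m x \<le> P n x) \<and>
     (\<forall>S. open S \<longleftrightarrow> (\<forall>x\<in>S. \<exists>n. \<exists>e>0. \<forall>y. P n (y - x) < e \<longrightarrow> y \<in> S))"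
  unfolding P_def by (rule someI_ex[OF ex_seminorm_sequence])

lemma P_seminorm: "seminorm smul (P n)"
  using P_properties[THEN conjunct1] by (rule spec)

lemma P_mono: "m \<le> n \<Longrightarrow> P m x \<le> P n x"
  using P_properties[THEN conjunct2, THEN conjunct1] by blast

lemma open_iff_P: "open S \<longleftrightarrow> (\<forall>x\<in>S. \<exists>n. \<exists>e>0. \<forall>y. P n (y - x) < e \<longrightarrow> y \<in> S)"
  using P_properties[THEN conjunct2, THEN conjunct2] by (rule spec)

lemmas P_add = seminorm_add[OF P_seminorm] and P_smul = seminorm_smul[OF P_seminorm]
  and P_0 [simp] = seminorm_0[OF P_seminorm] and P_minus [simp] = seminorm_minus[OF P_seminorm]
  and P_diff = seminorm_diff[OF P_seminorm] and P_commute = seminorm_commute[OF P_seminorm]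
  and P_nonneg [simp] = seminorm_nonneg[OF P_seminorm] and P_triangle = seminorm_triangle[OF P_seminorm]
  and P_sum = seminorm_sum[OF P_seminorm]

lemma openE_P:
  assumes "open S" "x \<in> S"
  obtains n e where "e > 0" "\<And>y. P n (y - x) < e \<Longrightarrow> y \<in> S"
  using assms(1)[unfolded open_iff_P, THEN bspec, OF assms(2)] by blast

lemma open_P_ball: "open {y. P n (y - x) < e}"
  unfolding open_iff_P
proof
  fix z assume "z \<in> {y. P n (y - x) < e}"
  then have "e - P n (z - x) > 0" by simp
  moreover have "P n (y - x) < e" if "P n (y - z) < e - P n (z - x)" for y
    using that P_triangle[of n y x z] by simp
  ultimately show "\<exists>n' e'. 0 < e' \<and> (\<forall>y. P n' (y - z) < e' \<longrightarrow> y \<in> {y. P n (y - x) < e})" by blast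
qed

lemma eventually_nhds_P: "eventually Q (nhds x) \<longleftrightarrow> (\<exists>n. \<exists>e>0. \<forall>y. P n (y - x) < e \<longrightarrow> Q y)"
proof
  assume "eventually Q (nhds x)"
  then obtain S where S: "open S" "x \<in> S" "\<forall>y\<in>S. Q y" by (auto simp: eventually_nhds)
  obtain n e where "e > 0" "\<And>y. P n (y - x) < e \<Longrightarrow> y \<in> S" using S(1,2) by (rule openE_P) (rule that)
  with S(3) show "\<exists>n. \<exists>e>0. \<forall>y. P n (y - x) < e \<longrightarrow> Q y" by (intro exI[of _ n] exI[of _ e]) simp
next
  assume "\<exists>n. \<exists>e>0. \<forall>y. P n (y - x) < e \<longrightarrow> Q y"
  then obtain n e where "e > 0" "\<forall>y. P n (y - x) < e \<longrightarrow> Q y" by blast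
  then show "eventually Q (nhds x)"
    unfolding eventually_nhds using open_P_ball[of n x e] by (intro exI[of _ "{y. P n (y - x) < e}"]) auto
qed

lemma tendsto_P: "(f \<longlongrightarrow> l) F \<longleftrightarrow> (\<forall>n. ((\<lambda>x. P n (f x - l)) \<longlongrightarrow> 0) F)"
proof
  assume f: "(f \<longlongrightarrow> l) F"
  show "\<forall>n. ((\<lambda>x. P n (f x - l)) \<longlongrightarrow> 0) F"
  proof (intro allI tendstoI)
    fix n and e :: real assume e: "e > 0"
    have "eventually (\<lambda>y. P n (y - l) < e) (nhds l)" unfolding eventually_nhds_P using e by blast
    then have "\<forall>\<^sub>F x in F. P n (f x - l) < e" using f filterlim_iff by blast
    then show "\<forall>\<^sub>F x in F. dist (P n (f x - l)) 0 < e" by (simp add: dist_real_def)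
  qed
next
  assume *: "\<forall>n. ((\<lambda>x. P n (f x - l)) \<longlongrightarrow> 0) F"
  show "(f \<longlongrightarrow> l) F" unfolding filterlim_iff
  proof (intro allI impI)
    fix Q assume "eventually Q (nhds l)"
    then obtain n e where ne: "e > 0" "\<And>y. P n (y - l) < e \<Longrightarrow> Q y" unfolding eventually_nhds_P by blast
    have "\<forall>\<^sub>F x in F. P n (f x - l) < e" using * ne(1) order_tendstoD(2) by blast
    then show "\<forall>\<^sub>F x in F. Q (f x)" by (rule eventually_mono) (use ne in auto)
  qed
qed

text \<open>Hausdorff separation is obtained from metrizability, since the sort of \<open>'a\<close>
  only provides a topological group.\<close>

lemma P_separates: "(\<And>n. P n x = 0) \<Longrightarrow> x = 0"
proof (rule ccontr)
  assume x: "\<And>n. P n x = 0" "x \<noteq> 0"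
  have "Hausdorff_space (euclidean :: 'a topology)" using metrizable by (rule metrizable_imp_Hausdorff_space)
  then obtain U V where U: "open U" "open V" "0 \<in> U" "x \<in> V" "disjnt U V"
    using x(2) unfolding Hausdorff_space_def topspace_euclidean open_openin[symmetric] by (metis UNIV_I)
  obtain n e where "e > 0" "\<And>y. P n (y - 0) < e \<Longrightarrow> y \<in> U" using U(1,3) by (rule openE_P) (rule that)
  then have "x \<in> U" using x(1)[of n] by simp
  then show False using U by (auto simp: disjnt_iff)
qed

lemma P_Cauchy_convergent:
  assumes "\<And>n e. e > 0 \<Longrightarrow> \<exists>N. \<forall>i\<ge>N. \<forall>j\<ge>N. P n (X i - X j) < e"
  shows "\<exists>l. X \<longlonglongrightarrow> l"
proof -
  have "Cauchy X"
    unfolding Cauchy_uniform_iff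
  proof (intro allI impI)
    fix Q :: "'a \<times> 'a \<Rightarrow> bool" assume "eventually Q uniformity"
    \<comment> \<open>The rewriting fact describes the uniformity: its entourages are generated by
      the pairs whose difference lies in a neighbourhood of zero.\<close>
    then have "\<exists>S. open S \<and> 0 \<in> S \<and> (\<forall>x. (case x of (x, y) \<Rightarrow> y - x) \<in> S \<longrightarrow> Q x)"
      unfolding cauchy_seq_finset_iff_vanishing eventually_filtercomap_nhds .
    then obtain S where S: "open S" "0 \<in> S" "\<forall>x. (case x of (x, y) \<Rightarrow> y - x) \<in> S \<longrightarrow> Q x" by blast
    obtain n e where ne: "e > 0" "\<And>y. P n (y - 0) < e \<Longrightarrow> y \<in> S" using S(1,2) by (rule openE_P) (rule that)
    obtain N where N: "\<forall>i\<ge>N. \<forall>j\<ge>N. P n (X i - X j) < e" using assms[OF ne(1)] by blast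
    have "Q (X i, X j)" if "i \<ge> N" "j \<ge> N" for i j
    proof -
      have "X j - X i \<in> S" using N that by (intro ne(2)) simp
      then show ?thesis using S(3)[rule_format, of "(X i, X j)"] by simp
    qed
    then show "\<exists>N. \<forall>n\<ge>N. \<forall>m\<ge>N. Q (X n, X m)" by blast
  qed
  then have "cauchy_filter (filtermap X sequentially)" by (simp only: Cauchy_uniform)
  then obtain x where "filtermap X sequentially \<le> nhds x"
    using cauchy_filter_complete_converges[OF _ complete_space, of "filtermap X sequentially"] by (auto simp: filtermap_bot_iff)
  then show ?thesis unfolding filterlim_def by blast
qed

lemma tendsto_unique_P:
  fixes X :: "nat \<Rightarrow> 'a"
  assumes "X \<longlonglongrightarrow> a" "X \<longlonglongrightarrow> b" shows "a = b"
proof -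
  have "P n (a - b) = 0" for n
  proof -
    have "(\<lambda>k. P n (X k - a) + P n (X k - b)) \<longlonglongrightarrow> 0 + 0"
      using assms unfolding tendsto_P by (intro tendsto_add) auto
    moreover have "P n (a - b) \<le> P n (X k - a) + P n (X k - b)" for k
      using P_triangle[of n a b "X k"] P_commute[of n a "X k"] by simp
    ultimately have "P n (a - b) \<le> 0" by (intro LIMSEQ_le_const) auto
    then show ?thesis using P_nonneg[of n "a - b"] by simp
  qed
  then show ?thesis using P_separates[of "a - b"] by simp
qed

end

section \<open>Baire category and orbits\<close>

lemma closure_eq_UNIV_iff:
  fixes S :: "'a::topological_space set"
  shows "closure S = UNIV \<longleftrightarrow> (\<forall>U. open U \<longrightarrow> U \<noteq> {} \<longrightarrow> U \<inter> S \<noteq> {})"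
proof
  assume "closure S = UNIV"
  then show "\<forall>U. open U \<longrightarrow> U \<noteq> {} \<longrightarrow> U \<inter> S \<noteq> {}" using open_Int_closure_eq_empty[of _ S] by fastforce
next
  assume *: "\<forall>U. open U \<longrightarrow> U \<noteq> {} \<longrightarrow> U \<inter> S \<noteq> {}"
  have "- closure S \<inter> S = {}" using closure_subset by blast
  then have "- closure S = {}" using * by (metis closed_closure open_Compl)
  then show "closure S = UNIV" by blast
qed

context frechet_space
begin

text \<open>Nested closed seminorm balls, coded by triples of centre, seminorm index and radius. In
  round \<open>j\<close> the radius is at most \<open>(1/2) ^ j\<close> and the index at least
  \<open>j\<close>, so the centres are Cauchy for every seminorm.\<close>

lemma Baire_open:
  fixes W :: "nat \<Rightarrow> 'a set"
  assumes op: "\<And>j. open (W j)" and dense: "\<And>j G. open G \<Longrightarrow> G \<noteq> {} \<Longrightarrow> G \<inter> W j \<noteq> {}"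
    and G: "open G" "G \<noteq> {}"
  shows "\<exists>x\<in>G. \<forall>j. x \<in> W j"
proof -
  define C where "C = (\<lambda>(x, n, e). {y. P n (y - x) \<le> e})"
  define A where "A = (\<lambda>(j::nat) (x :: 'a, n :: nat, e :: real). 0 < e \<and> e \<le> (1/2) ^ j \<and> j \<le> n)"
  have ball: "\<exists>s. A j s \<and> C s \<subseteq> S" if S: "open S" "S \<noteq> {}" for S :: "'a set" and j
  proof -
    obtain x where x: "x \<in> S" using S by blast
    obtain n e where e: "e > 0" "\<And>y. P n (y - x) < e \<Longrightarrow> y \<in> S" using S(1) x by (rule openE_P) (rule that)
    define s where "s = (x, max n j, min (e / 2) ((1/2) ^ j))"
    have "A j s" using e(1) by (auto simp: A_def s_def)
    moreover have "y \<in> S" if "y \<in> C s" for y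
    proof -
      have "P n (y - x) \<le> P (max n j) (y - x)" by (rule P_mono) simp
      also have "\<dots> \<le> e / 2" using that by (auto simp: C_def s_def)
      also have "\<dots> < e" using e(1) by simp
      finally show ?thesis by (rule e(2))
    qed
    ultimately show ?thesis by blast
  qed
  define R where "R = (\<lambda>j (s :: 'a \<times> nat \<times> real) s'. C s' \<subseteq> W j \<inter> C s)"
  obtain s0 where s0: "A 0 s0" "C s0 \<subseteq> G" using ball[OF G] by blast
  have step: "\<exists>s'. A (Suc j) s' \<and> R j s s'" if "A j s" for j s
  proof -
    obtain x n e where s: "s = (x, n, e)" by (cases s)
    have "x \<in> {y. P n (y - x) < e}" using that by (auto simp: s A_def)
    then have "{y. P n (y - x) < e} \<inter> W j \<noteq> {}" by (intro dense open_P_ball) blast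
    then obtain s' where "A (Suc j) s'" "C s' \<subseteq> {y. P n (y - x) < e} \<inter> W j"
      using ball[of "{y. P n (y - x) < e} \<inter> W j" "Suc j"] op open_P_ball by blast
    then show ?thesis by (intro exI[of _ s']) (auto simp: R_def C_def s)
  qed
  obtain f where f: "f 0 = s0" "\<And>j. A j (f j)" "\<And>j. R j (f j) (f (Suc j))"
  proof -
    define f where "f = rec_nat s0 (\<lambda>j s. SOME s'. A (Suc j) s' \<and> R j s s')"
    have f0: "f 0 = s0" and fS: "f (Suc j) = (SOME s'. A (Suc j) s' \<and> R j (f j) s')" for j by (simp_all add: f_def)
    have A: "A j (f j)" for j
    proof (induction j)
      case (Suc j)
      show ?case unfolding fS using someI_ex[OF step[OF Suc]] by blast
    qed (simp add: f0 s0)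
    have "R j (f j) (f (Suc j))" for j unfolding fS using someI_ex[OF step[OF A[of j]]] by blast
    with f0 A show ?thesis using that by blast
  qed
  define X where "X j = fst (f j)" for j
  define n where "n j = fst (snd (f j))" for j
  define e where "e j = snd (snd (f j))" for j
  have Ceq: "C (f j) = {y. P (n j) (y - X j) \<le> e j}" for j
    by (auto simp: C_def X_def n_def e_def case_prod_unfold)
  have Aj: "0 < e j" "e j \<le> (1/2) ^ j" "j \<le> n j" for j
    using f(2)[of j] by (auto simp: A_def X_def n_def e_def case_prod_unfold)
  have dec: "C (f i) \<subseteq> C (f j)" if "j \<le> i" for i j
    using that by (induction i rule: dec_induct) (use f(3) in \<open>auto simp: R_def\<close>)
  have XC: "X i \<in> C (f j)" if "j \<le> i" for i j
  proof -
    have "X i \<in> C (f i)" using Aj(1)[of i] by (simp add: Ceq)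
    then show ?thesis using dec[OF that] by blast
  qed
  have "\<exists>l. X \<longlonglongrightarrow> l"
  proof (rule P_Cauchy_convergent)
    fix m and d :: real assume d: "d > 0"
    obtain N where N: "(1/2) ^ N < d / 2" using real_arch_pow_inv[of "d / 2" "1/2"] d by auto
    define M where "M = max N m"
    have M: "(1/2) ^ M \<le> ((1/2) ^ N :: real)" by (rule power_decreasing) (auto simp: M_def)
    have "P m (X i - X j) < d" if "i \<ge> M" "j \<ge> M" for i j
    proof -
      have "P m (X i - X j) \<le> P (n M) (X i - X j)" using Aj(3)[of M] by (intro P_mono) (simp add: M_def)
      also have "\<dots> \<le> P (n M) (X i - X M) + P (n M) (X M - X j)" by (rule P_triangle)
      also have "\<dots> \<le> e M + e M" using XC[OF that(1)] XC[OF that(2)] by (intro add_mono) (auto simp: Ceq P_commute[of _ "X M" "X j"])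
      also have "\<dots> < d" using Aj(2)[of M] M N by linarith
      finally show ?thesis .
    qed
    then show "\<exists>N. \<forall>i\<ge>N. \<forall>j\<ge>N. P m (X i - X j) < d" by blast
  qed
  then obtain l where l: "X \<longlonglongrightarrow> l" ..
  have lC: "l \<in> C (f j)" for j
  proof -
    have "(\<lambda>i. P (n j) (X i - l) + e j) \<longlonglongrightarrow> 0 + e j"
      using l unfolding tendsto_P by (intro tendsto_add tendsto_const) auto
    moreover have "P (n j) (l - X j) \<le> P (n j) (X i - l) + e j" if "i \<ge> j" for i
      using P_triangle[of "n j" l "X j" "X i"] XC[OF that] P_commute[of "n j" l "X i"] by (simp add: Ceq)
    ultimately have "P (n j) (l - X j) \<le> 0 + e j" by (intro LIMSEQ_le_const[of _ "0 + e j"]) auto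
    then show ?thesis by (simp add: Ceq)
  qed
  have "l \<in> G" using lC[of 0] s0 f(1) by auto
  moreover have "l \<in> W j" for j using lC[of "Suc j"] f(3)[of j] by (auto simp: R_def)
  ultimately show ?thesis by blast
qed

lemma Baire_closed:
  fixes F :: "nat \<Rightarrow> 'a set"
  assumes "\<And>j. closed (F j)" "(\<Union>j. F j) = UNIV"
  obtains j x n e where "e > 0" "\<And>y. P n (y - x) < e \<Longrightarrow> y \<in> F j"
proof -
  have "\<not> (\<forall>j G. open G \<longrightarrow> G \<noteq> {} \<longrightarrow> G \<inter> - F j \<noteq> {})"
  proof
    assume *: "\<forall>j G. open G \<longrightarrow> G \<noteq> {} \<longrightarrow> G \<inter> - F j \<noteq> {}"
    have "\<exists>x\<in>UNIV. \<forall>j. x \<in> - F j" using assms(1) * by (intro Baire_open) auto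
    then show False using assms(2) by auto
  qed
  then obtain j G x where "open G" "x \<in> G" "G \<subseteq> F j" by blast
  then show ?thesis using openE_P[of G x] that by (metis subsetD)
qed

text \<open>Birkhoff's transitivity theorem: for each ball of a countable base, the points that some
  \<open>T i\<close> sends into it form a dense open set. Only the base has to be countable, so the
  index set may be the natural numbers or the half line.\<close>

lemma dense_orbit_of_transitive:
  fixes T :: "'i \<Rightarrow> 'a \<Rightarrow> 'a"
  assumes sep: "separable_space (euclidean :: 'a topology)"
    and cont: "\<And>i. i \<in> I \<Longrightarrow> continuous_on UNIV (T i)"
    and trans: "\<And>U V. open U \<Longrightarrow> U \<noteq> {} \<Longrightarrow> open V \<Longrightarrow> V \<noteq> {} \<Longrightarrow> \<exists>i\<in>I. T i ` U \<inter> V \<noteq> {}"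
  shows "\<exists>x. closure ((\<lambda>i. T i x) ` I) = UNIV"
proof -
  obtain D :: "'a set" where D: "countable D" "closure D = UNIV"
    using sep unfolding separable_space_def euclidean_closure_of topspace_euclidean by blast
  have Dn: "D \<noteq> {}" using D(2) by auto
  define B where "B = (\<lambda>(d, n, k). {y. P n (y - d) < 1 / real (Suc k)})"
  define J where "J = D \<times> (UNIV :: (nat \<times> nat) set)"
  have J: "countable J" "J \<noteq> {}" using D(1) Dn by (auto simp: J_def)
  define W where "W j = (\<Union>i\<in>I. T i -` B (from_nat_into J j))" for j
  have Bop: "open (B s)" for s by (auto simp: B_def case_prod_unfold open_P_ball)
  have Bne: "B s \<noteq> {}" for s
  proof -
    have "fst s \<in> B s" by (auto simp: B_def case_prod_unfold)
    then show ?thesis by blast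
  qed
  have "\<exists>x\<in>UNIV. \<forall>j. x \<in> W j"
  proof (rule Baire_open)
    show "open (W j)" for j unfolding W_def using Bop cont by (intro open_UN ballI open_vimage) auto
    show "G \<inter> W j \<noteq> {}" if "open G" "G \<noteq> {}" for j G
      using trans[OF that Bop Bne, of "from_nat_into J j"] by (auto simp: W_def)
  qed auto
  then obtain x where x: "\<And>j. x \<in> W j" by blast
  have "U \<inter> (\<lambda>i. T i x) ` I \<noteq> {}" if U: "open U" "U \<noteq> {}" for U
  proof -
    obtain y where y: "y \<in> U" using U by blast
    obtain n e where e: "e > 0" "\<And>z. P n (z - y) < e \<Longrightarrow> z \<in> U" using U(1) y by (rule openE_P) (rule that)
    obtain k where k: "1 / real (Suc k) < e / 2" using e(1) reals_Archimedean[of "e/2"] by (auto simp: inverse_eq_divide)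
    have "y \<in> {z. P n (z - y) < 1 / real (Suc k)}" by simp
    then obtain d where d: "d \<in> D" "P n (d - y) < 1 / real (Suc k)"
      using D(2) open_P_ball[of n y "1 / real (Suc k)"] unfolding closure_eq_UNIV_iff by blast
    then have "(d, n, k) \<in> J" by (simp add: J_def)
    then obtain j where j: "from_nat_into J j = (d, n, k)" using J from_nat_into_surj by metis
    then obtain i where i: "i \<in> I" "P n (T i x - d) < 1 / real (Suc k)" using x[of j] by (auto simp: W_def B_def)
    have "P n (T i x - y) \<le> P n (T i x - d) + P n (d - y)" by (rule P_triangle)
    then have "T i x \<in> U" using i d k by (intro e(2)) simp
    then show ?thesis using i by blast
  qed
  then show ?thesis unfolding closure_eq_UNIV_iff by blast
qed

section \<open>Implications between properties of semigroups\<close>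

lemma linear_operator_iff:
  "Vector_Spaces.linear smul smul T \<longleftrightarrow> (\<forall>x y. T (x + y) = T x + T y) \<and> (\<forall>c x. T (smul c x) = smul c (T x))"
  unfolding Vector_Spaces.linear_iff using vector_space_axioms by blast

lemma absorbing:
  assumes "open U" "0 \<in> U" obtains c where "c \<noteq> 0" "smul c x \<in> U"
proof -
  obtain n e where e: "e > 0" "\<And>z. P n (z - 0) < e \<Longrightarrow> z \<in> U" using assms by (rule openE_P) (rule that)
  define c :: 'k where "c = of_real (e / (P n x + 1))"
  have pos: "P n x + 1 > 0" using P_nonneg[of n x] by linarith
  have "c \<noteq> 0" using e(1) pos unfolding c_def of_real_eq_0_iff by simp
  moreover have "P n (smul c x - 0) < e"
  proof -
    have "P n (smul c x - 0) = e * (P n x / (P n x + 1))" using e(1) pos unfolding c_def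
      by (simp add: P_smul norm_divide flip: of_real_divide)
    also have "\<dots> < e * 1" using e(1) pos by (intro mult_strict_left_mono) auto
    finally show ?thesis by simp
  qed
  ultimately show ?thesis using e(2) that by blast
qed

text \<open>Every \<open>x\<close> has a nonzero multiple in the neighbourhood \<open>U\<close> of
  uniform convergence; the factor \<open>norm c\<close> in the radius below undoes the
  scaling.\<close>

lemma uniformly_imp_strongly_continuous:
  assumes T: "operator_semigroup smul T" and "uniformly_continuous_semigroup T"
  shows "strongly_continuous_semigroup T"
  unfolding strongly_continuous_semigroup_def continuous_on_sequentially
proof (intro allI ballI impI)
  fix x :: 'a and \<tau> :: "nat \<Rightarrow> real" and t
  assume t: "t \<in> {0..}" and \<tau>: "(\<forall>n. \<tau> n \<in> {0..}) \<and> \<tau> \<longlonglongrightarrow> t"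
  obtain U where U: "0 \<in> interior U"
    "\<forall>(\<tau> :: nat \<Rightarrow> real) t. (\<forall>n. \<tau> n \<ge> 0) \<and> t \<ge> 0 \<and> \<tau> \<longlonglongrightarrow> t \<longrightarrow>
           (\<forall>V. open V \<and> 0 \<in> V \<longrightarrow> (\<forall>\<^sub>F n in sequentially. \<forall>x\<in>U. T (\<tau> n) x - T t x \<in> V))"
    using assms(2) unfolding uniformly_continuous_semigroup_def by (elim exE conjE) (rule that)
  obtain c where c: "c \<noteq> 0" "smul c x \<in> interior U" using absorbing[OF open_interior U(1)] by blast
  have lin: "T s (smul c x) = smul c (T s x)" if "s \<ge> 0" for s
    using T that by (auto simp: operator_semigroup_def continuous_operators_def linear_operator_iff)
  have "((\<lambda>n. P m (T (\<tau> n) x - T t x)) \<longlonglongrightarrow> 0)" for m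
  proof (rule tendstoI)
    fix e :: real assume e: "e > 0"
    have "open {y. P m (y - 0) < norm c * e} \<and> 0 \<in> {y. P m (y - 0) < norm c * e}" using e c open_P_ball[of m 0 "norm c * e"] by simp
    moreover have "\<forall>n. \<tau> n \<ge> 0" "t \<ge> 0" "\<tau> \<longlonglongrightarrow> t" using t \<tau> by auto
    ultimately have "\<forall>\<^sub>F n in sequentially. \<forall>x\<in>U. T (\<tau> n) x - T t x \<in> {y. P m (y - 0) < norm c * e}"
      using U(2)[rule_format, of \<tau> t] by blast
    then show "\<forall>\<^sub>F n in sequentially. dist (P m (T (\<tau> n) x - T t x)) 0 < e"
    proof (rule eventually_mono)
      fix n assume "\<forall>x\<in>U. T (\<tau> n) x - T t x \<in> {y. P m (y - 0) < norm c * e}"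
      then have "P m (T (\<tau> n) (smul c x) - T t (smul c x)) < norm c * e" using c(2) interior_subset by auto
      then have "norm c * P m (T (\<tau> n) x - T t x) < norm c * e" using \<tau> t by (simp add: lin flip: scale_right_diff_distrib P_smul)
      then show "dist (P m (T (\<tau> n) x - T t x)) 0 < e" using c by (simp add: dist_real_def)
    qed
  qed
  then show "((\<lambda>t. T t x) \<circ> \<tau>) \<longlonglongrightarrow> T t x" unfolding tendsto_P by simp
qed

text \<open>Mixing provides transitivity and hence a dense orbit, which is the part with
  \<open>z = 1\<close> of the set required to be dense.\<close>

lemma mixing_imp_supercyclic_semigroup:
  assumes sep: "separable_space (euclidean :: 'a topology)"
    and T: "operator_semigroup smul T" and mix: "mixing_semigroup T"
  shows "supercyclic_semigroup smul T"
proof -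
  have "\<exists>x. closure ((\<lambda>t. T t x) ` {0..}) = UNIV"
  proof (rule dense_orbit_of_transitive[OF sep])
    show "continuous_on UNIV (T t)" if "t \<in> {0..}" for t
      using T that by (auto simp: operator_semigroup_def continuous_operators_def)
    fix U V :: "'a set" assume "open U" "U \<noteq> {}" "open V" "V \<noteq> {}"
    then obtain r where "r > 0" "\<forall>t>r. T t ` U \<inter> V \<noteq> {}" using mix unfolding mixing_semigroup_def by blast
    then show "\<exists>t\<in>{0..}. T t ` U \<inter> V \<noteq> {}" by (intro bexI[of _ "r + 1"]) auto
  qed
  then obtain x where x: "closure ((\<lambda>t. T t x) ` {0..}) = UNIV" ..
  have "(\<lambda>t. T t x) ` {0..} \<subseteq> {smul z (T t x) | z t. t \<ge> 0}"
  proof (rule image_subsetI)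
    fix t :: real assume "t \<in> {0..}"
    then have "T t x = smul 1 (T t x) \<and> t \<ge> 0" by simp
    then show "T t x \<in> {smul z (T t x) | z t. t \<ge> 0}" by blast
  qed
  from closure_mono[OF this] x show ?thesis unfolding supercyclic_semigroup_def by blast
qed

end

context scaled_space
begin

section \<open>The Hahn-Banach theorem\<close>

definition lin_form :: "('a \<Rightarrow> 'k) \<Rightarrow> bool" where
  "lin_form g \<longleftrightarrow> (\<forall>x y. g (x + y) = g x + g y) \<and> (\<forall>c x. g (smul c x) = c * g x)"

text \<open>Homogeneity concerns positive real scalars only, so that the notion is the same over
  both fields.\<close>

definition sublinear :: "('a \<Rightarrow> real) \<Rightarrow> bool" where
  "sublinear q \<longleftrightarrow> (\<forall>x y. q (x + y) \<le> q x + q y) \<and> (\<forall>r>0. \<forall>x. q (smul (of_real r) x) \<le> r * q x)"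

lemma sublinear_add: "sublinear q \<Longrightarrow> q (x + y) \<le> q x + q y"
  by (simp add: sublinear_def)

lemma sublinear_0: "sublinear q \<Longrightarrow> q 0 = 0"
proof -
  assume q: "sublinear q"
  have "q (smul (of_real (1/2)) 0) \<le> 1/2 * q 0" "q (smul (of_real 2) 0) \<le> 2 * q 0"
    using q unfolding sublinear_def by (meson half_gt_zero zero_less_one zero_less_numeral)+
  then show ?thesis by simp
qed

lemma sublinear_scale:
  assumes q: "sublinear q" and r: "r \<ge> 0" shows "q (smul (of_real r) x) = r * q x"
proof (cases "r = 0")
  case False
  then have r: "r > 0" using r by simp
  have "q (smul (of_real (1/r)) (smul (of_real r) x)) \<le> 1/r * q (smul (of_real r) x)"
    using q r unfolding sublinear_def by (meson zero_less_divide_1_iff)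
  then have "r * q x \<le> q (smul (of_real r) x)" using r by (simp add: field_simps)
  moreover have "q (smul (of_real r) x) \<le> r * q x" using q r by (simp add: sublinear_def)
  ultimately show ?thesis by simp
qed (use sublinear_0[OF q] in simp)

lemma sublinear_neg: "sublinear q \<Longrightarrow> - q (- x) \<le> q x"
  using sublinear_add[of q x "- x"] sublinear_0[of q] by simp

text \<open>A sublinear functional that is minimal among those below it must agree with this one,
  and agreement for every \<open>y\<close> means additivity.\<close>

definition lower :: "('a \<Rightarrow> real) \<Rightarrow> 'a \<Rightarrow> 'a \<Rightarrow> real" where
  "lower q y x = (INF t\<in>{0..}. q (x + smul (of_real t) y) - t * q y)"

lemma lower_bdd: "sublinear q \<Longrightarrow> bdd_below ((\<lambda>t. q (x + smul (of_real t) y) - t * q y) ` {0..})"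
proof (rule bdd_belowI2)
  fix t :: real assume q: "sublinear q" and t: "t \<in> {0..}"
  have "q (smul (of_real t) y) \<le> q (x + smul (of_real t) y) + q (- x)"
    using sublinear_add[OF q, of "x + smul (of_real t) y" "- x"] by simp
  then show "- q (- x) \<le> q (x + smul (of_real t) y) - t * q y" using sublinear_scale[OF q, of t y] t by simp
qed

lemma lower_le: "sublinear q \<Longrightarrow> t \<ge> 0 \<Longrightarrow> lower q y x \<le> q (x + smul (of_real t) y) - t * q y"
  unfolding lower_def by (rule cINF_lower[OF lower_bdd]) auto

lemma lower_greatest: "(\<And>t. t \<ge> 0 \<Longrightarrow> c \<le> q (x + smul (of_real t) y) - t * q y) \<Longrightarrow> c \<le> lower q y x"
  unfolding lower_def by (rule cINF_greatest) auto

lemma sublinear_lower: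
  assumes q: "sublinear q" shows "sublinear (lower q y)"
  unfolding sublinear_def
proof (intro conjI allI impI)
  fix x z
  have "lower q y (x + z) \<le> (q (x + smul (of_real t) y) - t * q y) + (q (z + smul (of_real s) y) - s * q y)"
    if "t \<ge> 0" "s \<ge> 0" for s t
  proof -
    have "lower q y (x + z) \<le> q (x + z + smul (of_real (t + s)) y) - (t + s) * q y"
      using that by (intro lower_le[OF q]) simp
    moreover have "x + z + smul (of_real (t + s)) y = (x + smul (of_real t) y) + (z + smul (of_real s) y)"
      by (simp add: scale_left_distrib algebra_simps)
    ultimately show ?thesis using sublinear_add[OF q, of "x + smul (of_real t) y" "z + smul (of_real s) y"]
      by (simp add: algebra_simps)
  qed
  then have "lower q y (x + z) - (q (z + smul (of_real s) y) - s * q y) \<le> lower q y x" if "s \<ge> 0" for s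
    using that by (intro lower_greatest) (simp add: algebra_simps)
  then have "lower q y (x + z) - lower q y x \<le> lower q y z"
    by (intro lower_greatest) (simp add: algebra_simps)
  then show "lower q y (x + z) \<le> lower q y x + lower q y z" by simp
next
  fix r :: real and x assume r: "r > 0"
  have "lower q y (smul (of_real r) x) / r \<le> q (x + smul (of_real t) y) - t * q y" if "t \<ge> 0" for t
  proof -
    have "lower q y (smul (of_real r) x) \<le> q (smul (of_real r) x + smul (of_real (r * t)) y) - (r * t) * q y"
      using that r by (intro lower_le[OF q]) simp
    also have "smul (of_real r) x + smul (of_real (r * t)) y = smul (of_real r) (x + smul (of_real t) y)"
      by (simp add: scale_right_distrib)
    also have "q \<dots> = r * q (x + smul (of_real t) y)" using r by (simp add: sublinear_scale[OF q])
    finally have "lower q y (smul (of_real r) x) \<le> r * (q (x + smul (of_real t) y) - t * q y)" by (simp add: algebra_simps)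
    then show ?thesis using r by (simp add: pos_divide_le_eq mult.commute)
  qed
  then have "lower q y (smul (of_real r) x) / r \<le> lower q y x" by (rule lower_greatest)
  then show "lower q y (smul (of_real r) x) \<le> r * lower q y x" using r by (simp add: pos_divide_le_eq mult.commute)
qed

text \<open>A minimal sublinear functional is linear. Minimality is sought below
  \<open>lower p x0\<close> instead of \<open>p\<close>: that functional is at most
  \<open>- p x0\<close> at \<open>- x0\<close>, which forces equality at \<open>x0\<close>.\<close>

lemma Hahn_Banach_real:
  assumes p: "sublinear p"
  obtains f where "\<And>x y. f (x + y) = f x + f y" "\<And>r x. f (smul (of_real r) x) = r * f x"
    "\<And>x. f x \<le> p x" "f x0 = (p x0 :: real)"
proof -
  define A where "A = {q. sublinear q \<and> (\<forall>x. q x \<le> lower p x0 x)}"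
  \<comment> \<open>The order is reversed, so that the upper bounds in Zorn's lemma are pointwise
    infima of chains.\<close>
  define R where "R = (\<lambda>a b :: 'a \<Rightarrow> real. \<forall>x. b x \<le> a x)"
  have "\<exists>m\<in>A. \<forall>a\<in>A. R m a \<longrightarrow> a = m"
  proof (rule predicate_Zorn)
    show "partial_order_on A (relation_of R A)"
      by (auto simp: partial_order_on_def preorder_on_def refl_on_def trans_def antisym_def relation_of_def R_def
          intro: order_trans intro!: ext antisym)
    fix C assume C: "C \<in> Chains (relation_of R A)"
    then have CA: "C \<subseteq> A" and ch: "\<And>a b. a \<in> C \<Longrightarrow> b \<in> C \<Longrightarrow> R a b \<or> R b a"
      by (auto simp: Chains_def relation_of_def)
    show "\<exists>u\<in>A. \<forall>a\<in>C. R a u"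
    proof (cases "C = {}")
      case True
      then show ?thesis using sublinear_lower[OF p] by (auto simp: A_def intro!: exI[of _ "lower p x0"])
    next
      case False
      have sub: "sublinear c" if "c \<in> C" for c using that CA by (auto simp: A_def)
      define u where "u x = (INF c\<in>C. c x)" for x
      have bdd: "bdd_below ((\<lambda>c. c x) ` C)" for x
      proof (rule bdd_belowI2)
        fix c assume c: "c \<in> C"
        then have "c (- x) \<le> lower p x0 (- x)" using CA by (auto simp: A_def)
        then show "- lower p x0 (- x) \<le> c x" using sublinear_neg[OF sub[OF c], of x] by simp
      qed
      have ul: "u x \<le> c x" if "c \<in> C" for c x unfolding u_def using bdd that by (rule cINF_lower)
      have ug: "a \<le> u x" if "\<And>c. c \<in> C \<Longrightarrow> a \<le> c x" for a x
        unfolding u_def using False that by (rule cINF_greatest)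
      have "u (x + y) \<le> u x + u y" for x y
      proof -
        have cd: "u (x + y) \<le> c x + d y" if cC: "c \<in> C" and dC: "d \<in> C" for c d
        proof -
          \<comment> \<open>The smaller of the two members of the chain serves for both.\<close>
          obtain m where m: "m \<in> C" "m x \<le> c x" "m y \<le> d y"
            using ch[OF cC dC] cC dC unfolding R_def by (metis order_refl)
          have "u (x + y) \<le> m (x + y)" using m(1) by (rule ul)
          also have "\<dots> \<le> m x + m y" using sub[OF m(1)] by (rule sublinear_add)
          finally show ?thesis using m by simp
        qed
        have "u (x + y) - d y \<le> u x" if "d \<in> C" for d
          by (rule ug) (use cd[OF _ that] in \<open>auto simp: algebra_simps\<close>)
        then have "u (x + y) - u x \<le> u y" by (intro ug) (auto simp: algebra_simps)
        then show ?thesis by simp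
      qed
      moreover have "u (smul (of_real r) x) \<le> r * u x" if r: "r > 0" for r x
      proof -
        have "u (smul (of_real r) x) / r \<le> u x"
        proof (rule ug)
          fix c assume c: "c \<in> C"
          have "u (smul (of_real r) x) \<le> c (smul (of_real r) x)" using c by (rule ul)
          also have "\<dots> = r * c x" using r by (simp add: sublinear_scale[OF sub[OF c]])
          finally show "u (smul (of_real r) x) / r \<le> c x" using r by (simp add: pos_divide_le_eq mult.commute)
        qed
        then show ?thesis using r by (simp add: pos_divide_le_eq mult.commute)
      qed
      ultimately have "sublinear u" by (simp add: sublinear_def)
      moreover have "u x \<le> lower p x0 x" for x
      proof -
        obtain c where c: "c \<in> C" using False by blast
        then have "c x \<le> lower p x0 x" using CA by (auto simp: A_def)
        then show ?thesis using ul[OF c, of x] by simp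
      qed
      ultimately show ?thesis using ul by (intro bexI[of _ u]) (auto simp: A_def R_def)
    qed
  qed
  then obtain m where m: "m \<in> A" "\<And>a. a \<in> A \<Longrightarrow> R m a \<Longrightarrow> a = m" by blast
  have sm: "sublinear m" and ml: "m x \<le> lower p x0 x" for x using m(1) by (auto simp: A_def)
  have low: "lower m y x \<le> m x" for x y using lower_le[OF sm, of 0 y x] by simp
  \<comment> \<open>Minimality forces this agreement; the parameter 1 in \<open>lower\<close> then
    turns it into superadditivity of \<open>m\<close>.\<close>
  have lm: "lower m y = m" for y
    using low ml by (intro m(2)) (auto simp: A_def R_def sublinear_lower[OF sm] intro: order_trans)
  have add: "m (x + y) = m x + m y" for x y
    using lower_le[OF sm, of 1 y x] sublinear_add[OF sm, of x y] by (simp add: lm)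
  have neg: "m (- x) = - m x" for x using add[of x "- x"] sublinear_0[OF sm] by simp
  show ?thesis
  proof (rule that[of m])
    show "m (smul (of_real r) x) = r * m x" for r x
    proof (cases "r \<ge> 0")
      case False
      have "m (smul (of_real (- r)) x) = - r * m x" using False by (intro sublinear_scale[OF sm]) simp
      then show ?thesis by (simp add: neg)
    qed (simp add: sublinear_scale[OF sm])
    have le: "m x \<le> p x" for x using ml[of x] lower_le[OF p, of 0 x0 x] by simp
    then show "m x \<le> p x" for x .
    have "m (- x0) \<le> p (- x0 + smul (of_real 1) x0) - 1 * p x0" using ml[of "- x0"] lower_le[OF p, of 1 x0 "- x0"] by simp
    then show "m x0 = p x0" using le[of x0] sublinear_0[OF p] by (simp add: neg)
  qed (rule add)
qed

text \<open>Over the reals the real functional \<open>f\<close> is used as it stands; over the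
  complex numbers it is the real part of \<open>g x = f x - \<i> f (\<i> x)\<close>.\<close>

lemma Hahn_Banach_seminorm:
  assumes p: "seminorm smul p"
  obtains g where "lin_form g" "\<And>x. norm (g x) \<le> p x" "norm (g x0) = p x0"
proof -
  have "sublinear p" using seminorm_add[OF p] seminorm_smul[OF p] by (auto simp: sublinear_def)
  then obtain f :: "'a \<Rightarrow> real" where f: "\<And>x y. f (x + y) = f x + f y" "\<And>r x. f (smul (of_real r) x) = r * f x"
    "\<And>x. f x \<le> p x" "f x0 = p x0" by (rule Hahn_Banach_real) (rule that)
  have f0: "f 0 = 0" using f(1)[of 0 0] by simp
  have fneg: "f (- x) = - f x" for x using f(1)[of x "- x"] f0 by simp
  have fabs: "\<bar>f x\<bar> \<le> p x" for x using f(3)[of x] f(3)[of "- x"] by (simp add: fneg seminorm_minus[OF p])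
  from range_emb[where 'k='k] show ?thesis
  proof
    assume R: "range (emb :: 'k \<Rightarrow> complex) = \<real>"
    have real: "\<exists>r. c = of_real r" for c :: 'k
    proof -
      have "emb c \<in> \<real>" using R by auto
      then obtain r where "emb c = emb (of_real r :: 'k)" by (auto elim: Reals_cases)
      then have "c = of_real r" unfolding emb_eq_iff .
      then show ?thesis ..
    qed
    have "of_real (f (smul c x)) = c * of_real (f x)" for c x
      using real[of c] by (auto simp: f(2))
    then show ?thesis using f fabs seminorm_nonneg[OF p]
      by (intro that[of "\<lambda>x. of_real (f x)"]) (auto simp: lin_form_def)
  next
    assume C: "range (emb :: 'k \<Rightarrow> complex) = UNIV"
    then obtain j :: 'k where j: "emb j = \<i>" by (metis UNIV_I rangeE)
    have "emb (j * j) = emb (- 1 :: 'k)" by (simp add: emb_mult emb_minus j)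
    then have jj: "j * j = - 1" unfolding emb_eq_iff .
    have cart: "\<exists>a b. c = of_real a + of_real b * j" for c :: 'k
    proof -
      have "emb c = emb (of_real (Re (emb c)) + of_real (Im (emb c)) * j)"
        by (simp add: emb_add emb_mult j complex_eq_iff)
      then show ?thesis by (auto simp: emb_eq_iff)
    qed
    define g where "g x = of_real (f x) - j * of_real (f (smul j x))" for x
    have gadd: "g (x + y) = g x + g y" for x y
      by (simp add: g_def f(1) scale_right_distrib algebra_simps)
    have gr: "g (smul (of_real r) x) = of_real r * g x" for r x
    proof -
      have "smul j (smul (of_real r) x) = smul (of_real r) (smul j x)" by (simp add: mult.commute)
      then show ?thesis unfolding g_def by (simp only: f(2)) (simp add: algebra_simps)
    qed
    have gj: "g (smul j x) = j * g x" for x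
      by (simp add: g_def jj fneg algebra_simps flip: mult.assoc)
    have gs: "g (smul c x) = c * g x" for c x
    proof -
      obtain a b where c: "c = of_real a + of_real b * j" using cart by blast
      have "smul c x = smul (of_real a) x + smul (of_real b) (smul j x)" by (simp add: c scale_left_distrib)
      then show ?thesis by (simp only: gadd gr gj) (simp add: c algebra_simps)
    qed
    have Re: "Re (emb (g x)) = f x" for x by (simp add: g_def emb_diff emb_mult j)
    have le: "norm (g x) \<le> p x" for x
    proof (cases "g x = 0")
      case False
      \<comment> \<open>Rotating \<open>x\<close> makes the value of \<open>g\<close> real and
        positive, and there it coincides with the dominated functional \<open>f\<close>.\<close>
      define c where "c = of_real (norm (g x)) / g x"
      have "norm c = 1" using False by (simp add: c_def norm_divide)
      have "g (smul c x) = of_real (norm (g x))" using False by (simp add: gs c_def)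
      then have "f (smul c x) = norm (g x)" using Re[of "smul c x"] by simp
      then show ?thesis using f(3)[of "smul c x"] \<open>norm c = 1\<close> by (simp add: seminorm_smul[OF p])
    qed (simp add: seminorm_nonneg[OF p])
    have "p x0 \<le> norm (g x0)" using complex_Re_le_cmod[of "emb (g x0)"] by (simp add: Re f(4))
    then show ?thesis using gadd gs le by (intro that[of g]) (auto simp: lin_form_def intro: antisym)
  qed
qed

end

section \<open>Functionals bounded by a seminorm\<close>

lemma tendsto_0_sandwich:
  fixes f g :: "'b \<Rightarrow> real"
  assumes "(g \<longlongrightarrow> 0) F" "\<And>x. 0 \<le> f x" "\<And>x. f x \<le> g x"
  shows "(f \<longlongrightarrow> 0) F"
  by (rule tendsto_sandwich[of "\<lambda>_. 0" f F g 0]) (use assms in auto)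

text \<open>Functionals are vectors in the space of all scalar-valued functions, so that span,
  independence and dimension are available for sets of functionals, over \<open>'k\<close> as well
  as over the complex numbers.\<close>

interpretation fun_space: vector_space "\<lambda>(c::'k::field) (g::'a \<Rightarrow> 'k) x. c * g x"
  by standard (auto simp: fun_eq_iff algebra_simps)

lemma sum_in_fun_span:
  fixes g :: "'i \<Rightarrow> 'a \<Rightarrow> 'f::field"
  shows
  "(\<And>i. i \<in> A \<Longrightarrow> g i \<in> S) \<Longrightarrow> (\<lambda>x. \<Sum>i\<in>A. c i * g i x) \<in> fun_space.span S"
proof (induction A rule: infinite_finite_induct)
  case (insert i A)
  have "(\<lambda>x. c i * g i x) + (\<lambda>x. \<Sum>i\<in>A. c i * g i x) \<in> fun_space.span S"
    using insert by (intro fun_space.span_add[OF fun_space.span_scale[OF fun_space.span_base]]) auto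
  then show ?case using insert by (simp add: plus_fun_def)
qed (use fun_space.span_zero[of S] in \<open>simp_all add: zero_fun_def\<close>)

lemma vector_space_omega: "vector_space (omega_smul :: 'k::real_or_complex \<Rightarrow> (nat \<Rightarrow> 'k) \<Rightarrow> nat \<Rightarrow> 'k)"
proof (unfold_locales, goal_cases)
  case (1 a x y)
  show ?case by (rule ext) (simp add: omega_smul_def distrib_left)
next
  case (2 a b x)
  show ?case by (rule ext) (simp add: omega_smul_def distrib_right)
next
  case (3 a b x)
  show ?case by (rule ext) (simp add: omega_smul_def)
next
  case (4 x)
  show ?case by (rule ext) (simp add: omega_smul_def)
qed

context scaled_space
begin

lemma lin_form_add: "lin_form g \<Longrightarrow> g (x + y) = g x + g y"
  and lin_form_smul: "lin_form g \<Longrightarrow> g (smul c x) = c * g x"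
  by (auto simp: lin_form_def)

lemma lin_form_0: "lin_form g \<Longrightarrow> g 0 = 0"
  using lin_form_smul[of g 0 0] by simp

lemma lin_form_minus: "lin_form g \<Longrightarrow> g (- x) = - g x"
  using lin_form_smul[of g "-1" x] by simp

lemma lin_form_diff: "lin_form g \<Longrightarrow> g (x - y) = g x - g y"
  using lin_form_add[of g x "-y"] by (simp add: lin_form_minus)

lemma lin_form_sum: "lin_form g \<Longrightarrow> g (sum h A) = (\<Sum>i\<in>A. g (h i))"
  by (induction A rule: infinite_finite_induct) (auto simp: lin_form_0 lin_form_add)

lemma lin_form_combination:
  "(\<And>i. i \<in> A \<Longrightarrow> lin_form (g i)) \<Longrightarrow> lin_form (\<lambda>x. \<Sum>i\<in>A. c i * g i x)"
  by (simp add: lin_form_def sum.distrib sum_distrib_left algebra_simps)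

lemma lin_form_kernel:
  fixes N :: nat
  assumes g: "\<And>i. i < N \<Longrightarrow> lin_form (g i)" and v: "\<And>i j. i < N \<Longrightarrow> j < N \<Longrightarrow> g i (v j) = (if i = j then 1 else 0)"
    and i: "i < N"
  shows "g i (x - (\<Sum>j<N. smul (g j x) (v j))) = 0"
proof -
  have "g i (\<Sum>j<N. smul (g j x) (v j)) = (\<Sum>j<N. g j x * (if i = j then 1 else 0))"
    using i by (simp add: lin_form_sum[OF g] lin_form_smul[OF g] v)
  also have "\<dots> = g i x" using i by (simp add: if_distrib cong: if_cong)
  finally show ?thesis using i by (simp add: lin_form_diff[OF g])
qed

text \<open>A vector minus its projection along the dual vectors lies in the common kernel, so
  \<open>h\<close> is determined by its values at the \<open>v i\<close>.\<close>

lemma lin_form_in_span: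
  fixes N :: nat
  assumes g: "\<And>i. i < N \<Longrightarrow> lin_form (g i)" and v: "\<And>i j. i < N \<Longrightarrow> j < N \<Longrightarrow> g i (v j) = (if i = j then 1 else 0)"
    and h: "lin_form h" and ker: "\<And>x. (\<And>i. i < N \<Longrightarrow> g i x = 0) \<Longrightarrow> h x = 0"
  shows "h x = (\<Sum>i<N. h (v i) * g i x)"
proof -
  have "h (x - (\<Sum>j<N. smul (g j x) (v j))) = 0" using lin_form_kernel[of N g v] g v by (intro ker) blast
  then show ?thesis by (simp add: lin_form_diff[OF h] lin_form_sum[OF h] lin_form_smul[OF h] mult.commute)
qed

text \<open>Induction: a functional outside the span of its predecessors does not vanish on their
  common kernel. A normalised vector from this kernel becomes the new dual vector, and the old ones
  are corrected by multiples of it.\<close>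

lemma dual_vectors:
  fixes N :: nat
  assumes "\<And>i. i < N \<Longrightarrow> lin_form (g i)" and "\<And>i. i < N \<Longrightarrow> g i \<notin> fun_space.span (g ` {..<i})"
  shows "\<exists>v. \<forall>i<N. \<forall>j<N. g i (v j) = (if i = j then 1 else 0)"
  using assms
proof (induction N)
  case (Suc N)
  have "\<exists>v. \<forall>i<N. \<forall>j<N. g i (v j) = (if i = j then 1 else 0)"
    using Suc.prems by (intro Suc.IH) simp_all
  then obtain v where "\<forall>i<N. \<forall>j<N. g i (v j) = (if i = j then 1 else 0)" ..
  then have v: "g i (v j) = (if i = j then 1 else 0)" if "i < N" "j < N" for i j using that by simp
  have lin: "lin_form (g i)" if "i < Suc N" for i using Suc.prems(1) that .
  have "\<exists>x. (\<forall>i<N. g i x = 0) \<and> g N x \<noteq> 0"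
  proof (rule ccontr)
    assume "\<not> ?thesis"
    then have ker: "\<forall>x. (\<forall>i<N. g i x = 0) \<longrightarrow> g N x = 0" by metis
    have "g N = (\<lambda>x. \<Sum>i<N. g N (v i) * g i x)"
      using lin v ker by (intro ext lin_form_in_span) auto
    also have "\<dots> \<in> fun_space.span (g ` {..<N})" by (rule sum_in_fun_span) auto
    finally show False using Suc.prems(2)[of N] by simp
  qed
  then obtain x where x: "\<And>i. i < N \<Longrightarrow> g i x = 0" "g N x \<noteq> 0" by blast
  define w where "w = smul (inverse (g N x)) x"
  have w: "g i w = (if i = N then 1 else 0)" if "i < Suc N" for i
    using x that by (auto simp: w_def lin_form_smul[OF lin] less_Suc_eq)
  define v' where "v' j = (if j = N then w else v j - smul (g N (v j)) w)" for j
  have "g i (v' j) = (if i = j then 1 else 0)" if "i < Suc N" "j < Suc N" for i j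
    using that w v by (auto simp: v'_def lin_form_diff[OF lin] lin_form_smul[OF lin] less_Suc_eq)
  then show ?case by blast
qed auto

end

context frechet_space
begin

text \<open>The dual of the space seminormed by \<open>P n\<close> alone; the union over
  \<open>n\<close> is the whole continuous dual.\<close>

definition bdd_forms :: "nat \<Rightarrow> ('a \<Rightarrow> 'k) set" where
  "bdd_forms n = {g. lin_form g \<and> (\<exists>C. \<forall>x. norm (g x) \<le> C * P n x)}"

lemma bdd_formsE:
  assumes "g \<in> bdd_forms n"
  obtains C where "lin_form g" "C > 0" "\<And>x. norm (g x) \<le> C * P n x"
proof -
  obtain C where C: "lin_form g" "\<And>x. norm (g x) \<le> C * P n x" using assms by (auto simp: bdd_forms_def)
  have "norm (g x) \<le> max C 1 * P n x" for x
    using C(2)[of x] mult_right_mono[of C "max C 1" "P n x"] by simp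
  then show ?thesis using C(1) that[of "max C 1"] by simp
qed

lemma bdd_forms_lin: "g \<in> bdd_forms n \<Longrightarrow> lin_form g"
  by (simp add: bdd_forms_def)

lemma bdd_forms_tendsto:
  assumes "g \<in> bdd_forms n" "(X \<longlongrightarrow> x) F" shows "((\<lambda>k. g (X k)) \<longlongrightarrow> g x) F"
proof -
  obtain C where C: "lin_form g" "C > 0" "\<And>x. norm (g x) \<le> C * P n x" using assms(1) by (rule bdd_formsE) (rule that)
  have "((\<lambda>k. C * P n (X k - x)) \<longlongrightarrow> C * 0) F" using assms(2) unfolding tendsto_P by (intro tendsto_mult_left) auto
  moreover have "norm (g (X k) - g x) \<le> C * P n (X k - x)" for k
    using C(3)[of "X k - x"] by (simp add: lin_form_diff[OF C(1)])
  ultimately have "((\<lambda>k. g (X k) - g x) \<longlongrightarrow> 0) F" by (intro Lim_null_comparison[of "\<lambda>k. g (X k) - g x" "\<lambda>k. C * P n (X k - x)"]) auto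
  then show ?thesis by (simp add: LIM_zero_iff)
qed

lemma bdd_forms_continuous: "g \<in> bdd_forms n \<Longrightarrow> continuous_on S g"
  unfolding continuous_on_def by (intro ballI bdd_forms_tendsto) (auto intro: tendsto_ident_at)

text \<open>The coordinates are an algebraic basis of the dual, countable because each
  \<open>bdd_forms n\<close> has finite dimension. By the Hahn-Banach theorem \<open>P n\<close>
  vanishes wherever finitely many coordinates do, which gives surjectivity as well as continuity of
  the inverse.\<close>

lemma isomorphic_omega:
  assumes inf: "infinite_dimensional smul"
    and fin: "\<And>n. \<exists>B. finite B \<and> bdd_forms n \<subseteq> fun_space.span B"
  shows "isomorphic_tvs smul (omega_smul :: 'k \<Rightarrow> (nat \<Rightarrow> 'k) \<Rightarrow> nat \<Rightarrow> 'k)"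
proof -
  define X' where "X' = (\<Union>n. bdd_forms n)"
  obtain \<B> where \<B>: "\<B> \<subseteq> X'" "fun_space.independent \<B>" "X' \<subseteq> fun_space.span \<B>"
    using fun_space.maximal_independent_subset[of X'] by metis
  have finB: "finite (\<B> \<inter> bdd_forms n)" for n
  proof -
    obtain B where B: "finite B" "bdd_forms n \<subseteq> fun_space.span B" using fin by blast
    have "fun_space.independent (\<B> \<inter> bdd_forms n)" using fun_space.independent_mono[OF \<B>(2)] by blast
    then show ?thesis using fun_space.independent_span_bound[OF B(1)] B(2) by blast
  qed
  have "\<B> = (\<Union>n. \<B> \<inter> bdd_forms n)" using \<B>(1) by (auto simp: X'_def)
  then have cnt: "countable \<B>" using finB by (metis countable_UN countable_finite countableI_type)
  have lin: "lin_form g" if "g \<in> \<B>" for g using that \<B>(1) by (auto simp: X'_def bdd_forms_lin)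
  \<comment> \<open>The part of the basis inside \<open>bdd_forms n\<close> might not span it, so a
    finite subset that does is collected from the representations of a basis of
    \<open>bdd_forms n\<close>.\<close>
  have reduce: "\<exists>S. finite S \<and> S \<subseteq> \<B> \<and> bdd_forms n \<subseteq> fun_space.span S" for n
  proof -
    obtain B where B: "finite B" "bdd_forms n \<subseteq> fun_space.span B" using fin by blast
    obtain C where C: "C \<subseteq> bdd_forms n" "fun_space.independent C" "bdd_forms n \<subseteq> fun_space.span C"
      using fun_space.maximal_independent_subset[of "bdd_forms n"] by metis
    have finC: "finite C" using fun_space.independent_span_bound[OF B(1) C(2)] C(1) B(2) by blast
    have "\<forall>c\<in>C. \<exists>S. finite S \<and> S \<subseteq> \<B> \<and> c \<in> fun_space.span S"
    proof
      fix c assume "c \<in> C"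
      then have "c \<in> fun_space.span \<B>" using C(1) \<B>(3) by (auto simp: X'_def)
      then obtain S r where S: "finite S" "S \<subseteq> \<B>" "c = (\<Sum>a\<in>S. (\<lambda>x. r a * a x))"
        unfolding fun_space.span_explicit by blast
      have "c \<in> fun_space.span S" unfolding S(3)
        by (intro fun_space.span_sum fun_space.span_scale fun_space.span_base)
      then show "\<exists>S. finite S \<and> S \<subseteq> \<B> \<and> c \<in> fun_space.span S" using S by blast
    qed
    then obtain S where S: "\<And>c. c \<in> C \<Longrightarrow> finite (S c) \<and> S c \<subseteq> \<B> \<and> c \<in> fun_space.span (S c)" by metis
    define S' where "S' = (\<Union>c\<in>C. S c)"
    have "C \<subseteq> fun_space.span S'" using S fun_space.span_mono[of _ S'] unfolding S'_def by blast
    then have "bdd_forms n \<subseteq> fun_space.span S'" using C(3) fun_space.span_minimal[OF _ fun_space.subspace_span] by blast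
    moreover have "finite S'" "S' \<subseteq> \<B>" using finC S by (auto simp: S'_def)
    ultimately show ?thesis by blast
  qed
  have vanish: "h x = 0" if "h \<in> fun_space.span S" "\<And>g. g \<in> S \<Longrightarrow> g x = 0" for h :: "'a \<Rightarrow> 'k" and S x
    using that(1) by (induction rule: fun_space.span_induct_alt) (auto simp: that(2))
  have P_zero: "P n x = 0" if "\<And>h. h \<in> bdd_forms n \<Longrightarrow> h x = 0" for n x
  proof -
    obtain g where g: "lin_form g" "\<And>y. norm (g y) \<le> P n y" "norm (g x) = P n x"
      using P_seminorm[of n] by (rule Hahn_Banach_seminorm[of _ x]) (rule that)
    then have "g \<in> bdd_forms n" by (auto simp: bdd_forms_def intro: exI[of _ 1])
    then show ?thesis using that g(3) by force
  qed
  \<comment> \<open>Vectors dual to a finite basis would span the whole space, as all seminorms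
    vanish on the remainder.\<close>
  have notfin: "infinite \<B>"
  proof
    assume "finite \<B>"
    then obtain g and N :: nat where g: "\<B> = g ` {..<N}" "inj_on g {..<N}"
      using finite_imp_nat_seg_image_inj_on[of \<B>] by (auto simp: lessThan_def)
    have "\<exists>v. \<forall>i<N. \<forall>j<N. g i (v j) = (if i = j then 1 else 0)"
    proof (rule dual_vectors)
      show "lin_form (g i)" if "i < N" for i using that g lin by auto
      show "g i \<notin> fun_space.span (g ` {..<i})" if "i < N" for i
      proof
        assume *: "g i \<in> fun_space.span (g ` {..<i})"
        have "g ` {..<i} \<subseteq> \<B> - {g i}" using g that by (auto simp: inj_on_def)
        then have "g i \<in> fun_space.span (\<B> - {g i})" using * fun_space.span_mono by blast
        moreover have "g i \<in> \<B>" using g that by auto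
        ultimately show False using \<B>(2) unfolding fun_space.dependent_def by blast
      qed
    qed
    then obtain v where v: "\<And>i j. i < N \<Longrightarrow> j < N \<Longrightarrow> g i (v j) = (if i = j then 1 else 0)" by blast
    have "x \<in> span (v ` {..<N})" for x
    proof -
      define y where "y = x - (\<Sum>j<N. smul (g j x) (v j))"
      have "b y = 0" if bB: "b \<in> \<B>" for b
      proof -
        obtain i where "i < N" "b = g i" using bB g(1) by auto
        then show ?thesis unfolding y_def using lin_form_kernel[of N g v i x] v g lin by auto
      qed
      then have "h y = 0" if "h \<in> X'" for h using that \<B>(3) vanish[of h \<B> y] by blast
      then have "P n y = 0" for n by (intro P_zero) (auto simp: X'_def)
      then have "y = 0" by (rule P_separates)
      then have "x = (\<Sum>j<N. smul (g j x) (v j))" by (simp add: y_def)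
      also have "\<dots> \<in> span (v ` {..<N})" by (intro span_sum span_scale span_base) auto
      finally show ?thesis .
    qed
    then have "span (v ` {..<N}) = UNIV" by blast
    then show False using inf unfolding infinite_dimensional_def by (metis finite_imageI finite_lessThan)
  qed
  define g where "g = from_nat_into \<B>"
  have gB: "bij_betw g UNIV \<B>" unfolding g_def using cnt notfin by (rule bij_betw_from_nat_into)
  have gmem: "g i \<in> \<B>" for i using gB by (auto simp: bij_betw_def)
  have glin: "lin_form (g i)" for i using gmem lin by blast
  have gind: "g i \<notin> fun_space.span (g ` {..<i})" for i
  proof
    assume *: "g i \<in> fun_space.span (g ` {..<i})"
    have "g ` {..<i} \<subseteq> \<B> - {g i}" using gB gmem by (auto simp: bij_betw_def inj_on_def)
    then have "g i \<in> fun_space.span (\<B> - {g i})" using * fun_space.span_mono by blast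
    then show False using gmem[of i] \<B>(2) unfolding fun_space.dependent_def by blast
  qed
  \<comment> \<open>A separate dual family for each \<open>N\<close>: its vectors satisfy no
    condition on the later coordinates.\<close>
  have "\<exists>v. \<forall>i<N. \<forall>j<N. g i (v j) = (if i = j then 1 else 0)" for N :: nat
    using glin gind by (intro dual_vectors) auto
  then have "\<exists>v. \<forall>N. \<forall>i<N. \<forall>j<N. g i (v N j) = (if i = j then 1 else 0)" by (intro choice allI)
  then obtain v where "\<forall>N. \<forall>i<N. \<forall>j<N. g i (v N j) = (if i = j then 1 else 0)" ..
  then have v: "g i (v N j) = (if i = j then 1 else 0)" if "i < N" "j < N" for N i j using that by simp
  have "\<exists>N. \<forall>x. (\<forall>i<N. g i x = 0) \<longrightarrow> P n x = 0" for n
  proof -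
    obtain S where S: "finite S" "S \<subseteq> \<B>" "bdd_forms n \<subseteq> fun_space.span S" using reduce by blast
    have "finite (g -` S)" using S(1) gB by (intro finite_vimageI) (auto simp: bij_betw_def)
    then obtain N where "\<forall>i\<in>g -` S. i < N" unfolding finite_nat_set_iff_bounded ..
    then have N: "i < N" if "i \<in> g -` S" for i using that by blast
    have "P n x = 0" if x: "\<forall>i<N. g i x = 0" for x
    proof (rule P_zero)
      fix h assume "h \<in> bdd_forms n"
      then have "h \<in> fun_space.span S" using S by blast
      then show "h x = 0"
      proof (rule vanish)
        fix b assume b: "b \<in> S"
        then obtain i where i: "b = g i" using S(2) gB by (auto simp: bij_betw_def)
        then show "b x = 0" using N[of i] x b by auto
      qed
    qed
    then show ?thesis by blast
  qed
  then obtain N where N: "\<And>n x. (\<And>i. i < N n \<Longrightarrow> g i x = 0) \<Longrightarrow> P n x = 0" by metis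
  define f where "f x = (\<lambda>i. g i x)" for x
  have gX: "\<exists>n. g i \<in> bdd_forms n" for i using gmem[of i] \<B>(1) by (auto simp: X'_def)
  have inj: "x = y" if "f x = f y" for x y
  proof -
    have "P n (x - y) = 0" for n
      using that by (intro N) (auto simp: f_def fun_eq_iff lin_form_diff[OF glin])
    then show ?thesis using P_separates[of "x - y"] by simp
  qed
  have surj: "\<exists>x. f x = c" for c
  proof -
    \<comment> \<open>\<open>y M\<close> has the prescribed first \<open>M\<close> coordinates. Two
      such vectors with indices at least \<open>N n\<close> are at \<open>P n\<close>-distance zero,
      so the sequence is Cauchy.\<close>
    define y where "y M = (\<Sum>j<M. smul (c j) (v M j))" for M
    have gy: "g i (y M) = c i" if "i < M" for i M
    proof -
      have "g i (y M) = (\<Sum>j<M. c j * (if i = j then 1 else 0))"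
        using that by (simp add: y_def lin_form_sum[OF glin] lin_form_smul[OF glin] v)
      also have "\<dots> = c i" using that by (simp add: if_distrib cong: if_cong)
      finally show ?thesis .
    qed
    have "\<exists>l. y \<longlonglongrightarrow> l"
    proof (rule P_Cauchy_convergent)
      fix n and e :: real assume e: "e > 0"
      have "P n (y i - y j) < e" if "i \<ge> N n" "j \<ge> N n" for i j
      proof -
        have "P n (y i - y j) = 0" using that by (intro N) (auto simp: lin_form_diff[OF glin] gy)
        then show ?thesis using e by simp
      qed
      then show "\<exists>N. \<forall>i\<ge>N. \<forall>j\<ge>N. P n (y i - y j) < e" by blast
    qed
    then obtain l where l: "y \<longlonglongrightarrow> l" ..
    have "g i l = c i" for i
    proof (rule LIMSEQ_unique)
      show "(\<lambda>M. g i (y M)) \<longlonglongrightarrow> g i l" using gX[of i] l bdd_forms_tendsto by blast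
      have "\<forall>\<^sub>F M in sequentially. g i (y M) = c i" using eventually_gt_at_top[of i] by eventually_elim (rule gy)
      then show "(\<lambda>M. g i (y M)) \<longlonglongrightarrow> c i" by (rule tendsto_eventually)
    qed
    then show ?thesis by (auto simp: f_def)
  qed
  have bij: "bij f" unfolding bij_def inj_def surj_def using inj surj by metis
  have lin: "Vector_Spaces.linear smul omega_smul f"
    unfolding Vector_Spaces.linear_iff
  proof (intro conjI allI)
    show "vector_space smul" by (rule vector_space_axioms)
    show "vector_space (omega_smul :: 'k \<Rightarrow> (nat \<Rightarrow> 'k) \<Rightarrow> _)" by (rule vector_space_omega)
    show "f (x + y) = f x + f y" for x y by (rule ext) (simp add: f_def lin_form_add[OF glin])
    show "f (smul c x) = omega_smul c (f x)" for c x by (rule ext) (simp add: f_def omega_smul_def lin_form_smul[OF glin])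
  qed
  have "continuous_on UNIV f"
  proof (rule continuous_on_coordinatewise_then_product)
    fix i
    obtain n where "g i \<in> bdd_forms n" using gX by blast
    then show "continuous_on UNIV (\<lambda>x. f x i)" unfolding f_def by (rule bdd_forms_continuous)
  qed
  moreover have "continuous_on UNIV (inv f)"
    unfolding continuous_on_def tendsto_P
  proof (intro ballI allI)
    fix h0 :: "nat \<Rightarrow> 'k" and n
    \<comment> \<open>An upper bound for \<open>P n\<close> that involves the first
      \<open>N n\<close> coordinates only: expansion in the dual vectors leaves a remainder on which
      \<open>P n\<close> is zero.\<close>
    define V where "V h = (\<Sum>i<N n. norm (h i - h0 i) * P n (v (N n) i))" for h
    have fi: "g i (inv f h) = h i" for h i
      using bij surj_f_inv_f[of f h] by (auto simp: bij_def f_def fun_eq_iff)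
    have "P n (inv f h - inv f h0) \<le> V h" for h
    proof -
      define x where "x = inv f h - inv f h0"
      have gx: "g i x = h i - h0 i" for i by (simp add: x_def lin_form_diff[OF glin] fi)
      have "P n (x - (\<Sum>i<N n. smul (g i x) (v (N n) i))) = 0"
        using lin_form_kernel[of "N n" g "v (N n)"] v glin by (intro N) blast
      then have "P n x \<le> P n (\<Sum>i<N n. smul (g i x) (v (N n) i))"
        using P_add[of n "x - (\<Sum>i<N n. smul (g i x) (v (N n) i))" "\<Sum>i<N n. smul (g i x) (v (N n) i)"] by simp
      also have "\<dots> \<le> (\<Sum>i<N n. P n (smul (g i x) (v (N n) i)))" by (rule P_sum)
      finally have "P n x \<le> V h" by (simp only: V_def P_smul gx)
      then show ?thesis by (simp only: x_def)
    qed
    moreover have "((\<lambda>h. V h) \<longlongrightarrow> 0) (at h0 within UNIV)"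
    proof -
      have coord: "((\<lambda>h. h i) \<longlongrightarrow> h0 i) (at h0 within UNIV)" for i
        using continuous_on_product_coordinates[of i] unfolding continuous_on_def by auto
      have "((\<lambda>h. V h) \<longlongrightarrow> V h0) (at h0 within UNIV)" unfolding V_def
        by (intro tendsto_intros coord)
      then show ?thesis by (simp add: V_def)
    qed
    ultimately show "((\<lambda>h. P n (inv f h - inv f h0)) \<longlongrightarrow> 0) (at h0 within UNIV)"
      by - (rule tendsto_0_sandwich[of V "at h0 within UNIV"], auto)
  qed
  ultimately have "homeomorphism UNIV UNIV f (inv f)"
    using bij_is_surj[OF bij] bij_is_surj[OF bij_imp_bij_inv[OF bij]] bij_is_inj[OF bij]
    by (intro homeomorphismI) (simp_all add: inv_f_f surj_f_inv_f)
  with lin show ?thesis unfolding isomorphic_tvs_def by (intro exI conjI)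
qed

section \<open>Biorthogonal systems\<close>

text \<open>The new functional comes from one outside the span of the \<open>f i\<close>, corrected
  to vanish at the \<open>x i\<close>; the new vector comes from the projection of \<open>d\<close>
  to the common kernel of the \<open>f i\<close>, so that the enlarged span comes close to
  \<open>d\<close>.\<close>

lemma biorthogonal_step:
  fixes k :: nat
  assumes big: "\<nexists>B. finite B \<and> bdd_forms n \<subseteq> fun_space.span B"
    and lin: "\<And>i. i < k \<Longrightarrow> lin_form (f i)"
    and fx: "\<And>i j. i < k \<Longrightarrow> j < k \<Longrightarrow> f i (x j) = (if i = j then 1 else 0)"
    and fb: "\<And>i v. i < k \<Longrightarrow> norm (f i v) \<le> P n v"
    and e: "e > 0"
  obtains h y where "lin_form h" "\<And>v. norm (h v) \<le> P n v" "\<And>i. i < k \<Longrightarrow> h (x i) = 0"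
    "\<And>i. i < k \<Longrightarrow> f i y = 0" "h y = 1" "\<exists>w\<in>span (insert y (x ` {..<k})). P m (d - w) < e"
proof -
  have "\<not> bdd_forms n \<subseteq> fun_space.span (f ` {..<k})" using big by (metis finite_imageI finite_lessThan)
  then obtain g where g: "g \<in> bdd_forms n" "g \<notin> fun_space.span (f ` {..<k})" by blast
  have "\<not> (\<forall>v. (\<forall>i<k. f i v = 0) \<longrightarrow> g v = 0)"
  proof
    assume *: "\<forall>v. (\<forall>i<k. f i v = 0) \<longrightarrow> g v = 0"
    have "g = (\<lambda>v. \<Sum>i<k. g (x i) * f i v)"
      using lin fx bdd_forms_lin[OF g(1)] * by (intro ext lin_form_in_span) auto
    then have "g \<in> fun_space.span (f ` {..<k})" using sum_in_fun_span[of "{..<k}" f "f ` {..<k}" "\<lambda>i. g (x i)"] by simp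
    then show False using g(2) by blast
  qed
  then obtain z where z: "\<And>i. i < k \<Longrightarrow> f i z = 0" "g z \<noteq> 0" by blast
  have glin: "lin_form g" using bdd_forms_lin[OF g(1)] .
  define h0 where "h0 v = g (v - (\<Sum>j<k. smul (f j v) (x j)))" for v
  have h0lin: "lin_form h0"
    unfolding lin_form_def h0_def
    using lin by (auto simp: lin_form_diff[OF glin] lin_form_sum[OF glin] lin_form_smul[OF glin] lin_form_add[OF glin] lin_form_add lin_form_smul
        sum.distrib sum_distrib_left algebra_simps)
  have h0x: "h0 (x i) = 0" if "i < k" for i
  proof -
    have "(\<Sum>j<k. smul (f j (x i)) (x j)) = (\<Sum>j<k. if j = i then x j else 0)"
      using that by (intro sum.cong) (auto simp: fx)
    then show ?thesis using that by (simp add: h0_def lin_form_0[OF glin])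
  qed
  have h0z: "h0 z = g z" using z by (simp add: h0_def)
  obtain C0 where C0: "C0 > 0" "\<And>v. norm (g v) \<le> C0 * P n v" using g(1) by (rule bdd_formsE) (rule that)
  \<comment> \<open>The correction costs this factor, and dividing by it restores the bound by
    \<open>P n\<close> with constant 1.\<close>
  define C where "C = C0 + (\<Sum>j<k. norm (g (x j)))"
  have Cpos: "C > 0" unfolding C_def using C0(1) by (intro add_pos_nonneg sum_nonneg) auto
  have C: "norm (h0 v) \<le> C * P n v" for v
  proof -
    have "h0 v = g v - (\<Sum>j<k. f j v * g (x j))"
      by (simp add: h0_def lin_form_diff[OF glin] lin_form_sum[OF glin] lin_form_smul[OF glin])
    then have "norm (h0 v) \<le> norm (g v) + (\<Sum>j<k. norm (f j v * g (x j)))"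
      using norm_triangle_ineq4[of "g v" "\<Sum>j<k. f j v * g (x j)"] norm_sum[of "\<lambda>j. f j v * g (x j)" "{..<k}"] by simp
    also have "\<dots> \<le> C0 * P n v + (\<Sum>j<k. P n v * norm (g (x j)))"
      using C0(2) fb by (intro add_mono sum_mono) (auto simp: norm_mult intro: mult_right_mono)
    also have "\<dots> = C * P n v" by (simp add: C_def distrib_right sum_distrib_right mult.commute[of "P n v"])
    finally show ?thesis .
  qed
  define h where "h v = h0 v / of_real C" for v
  have hlin: "lin_form h" using h0lin by (simp add: lin_form_def h_def add_divide_distrib)
  have hb: "norm (h v) \<le> P n v" for v
    using C[of v] Cpos by (simp add: h_def norm_divide pos_divide_le_eq mult.commute)
  have hx: "h (x i) = 0" if "i < k" for i using h0x[OF that] by (simp add: h_def)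
  have hz: "h z \<noteq> 0" using h0z z(2) Cpos by (simp add: h_def)
  define d0 where "d0 = d - (\<Sum>j<k. smul (f j d) (x j))"
  have fd0: "f i d0 = 0" if "i < k" for i
    unfolding d0_def using that lin fx by (intro lin_form_kernel[of k f x])
  define r where "r = e / (2 * (P m z + 1))"
  have pos: "P m z + 1 > 0" using P_nonneg[of m z] by linarith
  have r: "r > 0" using e pos by (simp add: r_def)
  have rz: "r * P m z < e"
  proof -
    have "r * P m z \<le> r * (P m z + 1)" using r by simp
    also have "\<dots> = e / (2 * (P m z + 1)) * (P m z + 1)" by (simp only: r_def)
    also have "\<dots> = e / 2" using pos by (metis less_irrefl nonzero_divide_mult_cancel_right times_divide_eq_right divide_divide_eq_left mult.commute nonzero_eq_divide_eq)
    finally show ?thesis using e by simp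
  qed
  \<comment> \<open>If \<open>h\<close> vanishes at \<open>d0\<close>, no multiple of
    \<open>d0\<close> can take the value 1. A small multiple of \<open>z\<close> is added to
    \<open>d0\<close>: at least one of the factors \<open>r\<close> and \<open>r / 2\<close> gives a
    nonzero value.\<close>
  obtain s where s: "0 \<le> s" "s \<le> r" "h d0 + of_real s * h z \<noteq> 0"
  proof (cases "h d0 + of_real r * h z = 0")
    case True
    have "h d0 + of_real (r / 2) * h z = (h d0 + of_real r * h z) - of_real (r / 2) * h z"
      by (simp add: algebra_simps)
    also have "\<dots> \<noteq> 0" using True hz r by simp
    finally show ?thesis using r that[of "r / 2"] by simp
  qed (use r that[of r] in simp)
  define w where "w = d0 + smul (of_real s) z"
  define y where "y = smul (inverse (h w)) w"
  have hw: "h w \<noteq> 0" using s(3) by (simp add: w_def lin_form_add[OF hlin] lin_form_smul[OF hlin])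
  have fw: "f i w = 0" if "i < k" for i
    using that fd0 z(1) by (simp add: w_def lin_form_add[OF lin] lin_form_smul[OF lin])
  show ?thesis
  proof (rule that[OF hlin hb hx])
    show "f i y = 0" if "i < k" for i using fw that by (simp add: y_def lin_form_smul[OF lin])
    show "h y = 1" using hw by (simp add: y_def lin_form_smul[OF hlin])
    define u where "u = smul (h w) y + (\<Sum>j<k. smul (f j d) (x j))"
    have "u \<in> span (insert y (x ` {..<k}))"
      unfolding u_def by (intro span_add span_sum span_scale span_base) auto
    moreover have "d - u = - smul (of_real s) z"
      using hw by (simp add: u_def y_def w_def d0_def)
    then have "P m (d - u) \<le> r * P m z" using s by (simp add: P_smul mult_right_mono)
    then have "P m (d - u) < e" using rz by simp
    ultimately show "\<exists>w\<in>span (insert y (x ` {..<k})). P m (d - w) < e" by blast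
  qed
qed

text \<open>Round \<open>k\<close> treats the dense point whose index is the first component of
  \<open>prod_decode k\<close>, so every dense point recurs for arbitrarily large \<open>k\<close>,
  with error below \<open>(1/2) ^ k\<close> in \<open>P k\<close>.\<close>

lemma ex_biorthogonal_system:
  assumes sep: "separable_space (euclidean :: 'a topology)"
    and big: "\<nexists>B. finite B \<and> bdd_forms n \<subseteq> fun_space.span B"
  shows "\<exists>(x :: nat \<Rightarrow> 'a) f. (\<forall>i. lin_form (f i)) \<and> (\<forall>i v. norm (f i v) \<le> P n v) \<and>
    (\<forall>i j. f i (x j) = (if i = j then 1 else 0)) \<and> closure (span (range x)) = UNIV"
proof -
  obtain D :: "'a set" where D: "countable D" "closure D = UNIV"
    using sep unfolding separable_space_def euclidean_closure_of topspace_euclidean by blast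
  have Dn: "D \<noteq> {}" using D(2) by auto
  define d where "d k = from_nat_into D (fst (prod_decode k))" for k
  define A where "A = (\<lambda>k (s :: nat \<Rightarrow> 'a \<times> ('a \<Rightarrow> 'k)). (\<forall>i<k. lin_form (snd (s i))) \<and>
      (\<forall>i<k. \<forall>v. norm (snd (s i) v) \<le> P n v) \<and>
      (\<forall>i<k. \<forall>j<k. snd (s i) (fst (s j)) = (if i = j then 1 else 0)))"
  define R where "R = (\<lambda>k (s :: nat \<Rightarrow> 'a \<times> ('a \<Rightarrow> 'k)) s'. (\<forall>i<k. s' i = s i) \<and>
      (\<exists>w\<in>span ((\<lambda>i. fst (s' i)) ` {..<Suc k}). P k (d k - w) < (1/2) ^ k))"
  have step: "\<exists>s'. A (Suc k) s' \<and> R k s s'" if As: "A k s" for k s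
  proof -
    have lin: "\<And>i. i < k \<Longrightarrow> lin_form (snd (s i))" and fb: "\<And>i v. i < k \<Longrightarrow> norm (snd (s i) v) \<le> P n v"
      and fx: "\<And>i j. i < k \<Longrightarrow> j < k \<Longrightarrow> snd (s i) (fst (s j)) = (if i = j then 1 else 0)"
      using As by (simp_all add: A_def)
    have pk: "(1/2) ^ k > (0::real)" by simp
    show ?thesis
    proof (rule biorthogonal_step[OF big, where f="\<lambda>i. snd (s i)" and x="\<lambda>i. fst (s i)" and k=k and e="(1/2)^k" and m=k and d="d k"])
      fix h y
      assume hy: "lin_form h" "\<And>v. norm (h v) \<le> P n v" "\<And>i. i < k \<Longrightarrow> h (fst (s i)) = 0"
        "\<And>i. i < k \<Longrightarrow> snd (s i) y = 0" "h y = 1"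
        and w: "\<exists>w\<in>span (insert y ((\<lambda>i. fst (s i)) ` {..<k})). P k (d k - w) < (1/2) ^ k"
      define s' where "s' = s(k := (y, h))"
      have "A (Suc k) s'"
        using hy lin fb fx by (auto simp: A_def s'_def less_Suc_eq)
      moreover have "(\<lambda>i. fst (s' i)) ` {..<Suc k} = insert y ((\<lambda>i. fst (s i)) ` {..<k})"
        by (auto simp: s'_def lessThan_Suc)
      then have "R k s s'" using w by (simp add: R_def s'_def)
      ultimately show "\<exists>s'. A (Suc k) s' \<and> R k s s'" by blast
    qed (fact lin fx fb pk)+
  qed
  \<comment> \<open>Stage \<open>k\<close> settles the pairs with index below \<open>k\<close> only,
    so any start is admissible; by \<open>R\<close> the settled pairs are kept in all later
    stages.\<close>
  define S where "S = rec_nat undefined (\<lambda>k s. SOME s'. A (Suc k) s' \<and> R k s s')"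
  have SS: "S (Suc k) = (SOME s'. A (Suc k) s' \<and> R k (S k) s')" for k by (simp add: S_def)
  have A: "A k (S k)" for k
  proof (induction k)
    case 0
    show ?case by (simp add: A_def)
  next
    case (Suc k)
    show ?case unfolding SS using someI_ex[OF step[OF Suc]] by blast
  qed
  have R: "R k (S k) (S (Suc k))" for k unfolding SS using someI_ex[OF step[OF A[of k]]] by blast
  have agree: "S l i = S (Suc i) i" if "i < l" for i l
    using that
  proof (induction l)
    case (Suc l)
    then show ?case using R[of l] by (cases "i = l") (auto simp: R_def)
  qed simp
  define x where "x i = fst (S (Suc i) i)" for i
  define f where "f i = snd (S (Suc i) i)" for i
  have x: "x i = fst (S l i)" and f: "f i = snd (S l i)" if "i < l" for i l
    using agree[OF that] by (simp_all add: x_def f_def)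
  have "lin_form (f i)" for i using A[of "Suc i"] by (simp add: A_def f_def)
  moreover have "norm (f i v) \<le> P n v" for i v using A[of "Suc i"] by (simp add: A_def f_def)
  moreover have "f i (x j) = (if i = j then 1 else 0)" for i j
  proof -
    have "i < Suc (max i j)" "j < Suc (max i j)" by auto
    then show ?thesis using A[of "Suc (max i j)"] x[of j "Suc (max i j)"] f[of i "Suc (max i j)"] by (simp add: A_def)
  qed
  moreover have "closure (span (range x)) = UNIV"
    unfolding closure_eq_UNIV_iff
  proof (intro allI impI)
    fix U :: "'a set" assume U: "open U" "U \<noteq> {}"
    then obtain y where y: "y \<in> U" by blast
    obtain m e where e: "e > 0" "\<And>z. P m (z - y) < e \<Longrightarrow> z \<in> U" using U(1) y by (rule openE_P) (rule that)
    have "y \<in> {z. P m (z - y) < e / 2}" using e by simp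
    then have "{z. P m (z - y) < e / 2} \<inter> D \<noteq> {}" using D(2) open_P_ball unfolding closure_eq_UNIV_iff by blast
    then obtain c where c: "c \<in> D" "P m (c - y) < e / 2" by blast
    then obtain i where i: "from_nat_into D i = c" using from_nat_into_surj[OF D(1)] by blast
    obtain N where N: "(1/2) ^ N < e / 2" using real_arch_pow_inv[of "e / 2" "1/2"] e by auto
    define k where "k = prod_encode (i, max N m)"
    have k: "max N m \<le> k" unfolding k_def by (rule le_prod_encode_2)
    have dk: "d k = c" by (simp add: d_def k_def i)
    obtain w where w: "w \<in> span ((\<lambda>i. fst (S (Suc k) i)) ` {..<Suc k})" "P k (d k - w) < (1/2) ^ k"
      using R[of k] by (auto simp: R_def)
    have "(\<lambda>i. fst (S (Suc k) i)) ` {..<Suc k} \<subseteq> range x"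
      using x[of _ "Suc k", symmetric] by auto
    then have wx: "w \<in> span (range x)" using w(1) span_mono by blast
    have "P m (w - c) \<le> P k (w - c)" using k by (intro P_mono) simp
    also have "\<dots> < (1/2) ^ k" using w(2) by (simp add: dk P_commute[of k w c])
    also have "\<dots> \<le> (1/2) ^ N" using k by (intro power_decreasing) auto
    finally have "P m (w - y) < e" using N c(2) P_triangle[of m w y c] by linarith
    then show "U \<inter> span (range x) \<noteq> {}" using e(2) wx by blast
  qed
  ultimately show ?thesis by (intro exI[of _ x] exI[of _ f] conjI allI)
qed

end

section \<open>Synthesis of vectors from bounded coefficient sequences\<close>

locale biorthogonal_space = frechet_space smul
  for smul :: "'k::real_or_complex \<Rightarrow> 'a::{uniform_topological_group_add, ab_group_add} \<Rightarrow> 'a" +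
  fixes x :: "nat \<Rightarrow> 'a" and f :: "nat \<Rightarrow> 'a \<Rightarrow> 'k" and n0 :: nat
  assumes f_lin: "lin_form (f i)" and f_bound: "norm (f i v) \<le> P n0 v"
    and f_x: "f i (x j) = (if i = j then 1 else 0)" and span_dense: "closure (span (range x)) = UNIV"
begin

text \<open>These weights make \<open>P m (b i) \<le> (1/2) ^ i\<close> for all
  \<open>i \<ge> m\<close>, so that series in the \<open>b i\<close> with bounded coefficients
  converge in every seminorm. They also stay at most 1.\<close>

definition w :: "nat \<Rightarrow> real" where "w i = (1/2) ^ i / (1 + P i (x i))"

lemma one_plus_P_pos: "0 < 1 + P i v"
  using P_nonneg[of i v] by linarith

lemma w_pos: "w i > 0"
  using one_plus_P_pos by (simp add: w_def)

lemma w_le_1: "w i \<le> 1"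
proof -
  have "(1/2) ^ i \<le> (1 :: real)" by (rule power_le_one) auto
  also have "1 \<le> 1 + P i (x i)" by simp
  finally show ?thesis using one_plus_P_pos by (simp add: w_def)
qed

definition b :: "nat \<Rightarrow> 'a" where "b i = smul (of_real (w i)) (x i)"

lemma P_b_le: "m \<le> i \<Longrightarrow> P m (b i) \<le> (1/2) ^ i"
proof -
  assume "m \<le> i"
  then have "P m (b i) \<le> P i (b i)" by (rule P_mono)
  also have "\<dots> = (1/2) ^ i * (P i (x i) / (1 + P i (x i)))"
    using w_pos[of i] by (simp add: b_def P_smul) (simp add: w_def)
  also have "\<dots> \<le> (1/2) ^ i * 1" using one_plus_P_pos by (intro mult_left_mono) auto
  finally show ?thesis by simp
qed

lemma summable_P_b: "summable (\<lambda>i. P m (b i))"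
proof (rule summable_comparison_test[OF _ summable_geometric[of "1/2::real"]])
  show "\<exists>N. \<forall>i\<ge>N. norm (P m (b i)) \<le> (1/2) ^ i" using P_b_le by auto
qed simp

definition M :: "nat \<Rightarrow> real" where "M m = (\<Sum>i. P m (b i))"

lemma M_nonneg: "0 \<le> M m"
  unfolding M_def by (intro suminf_nonneg summable_P_b) simp

lemma P_partial_sum_le:
  assumes "\<And>i. norm (c i) \<le> K"
  shows "P m (\<Sum>i=k..<l. smul (c i) (b i)) \<le> K * (\<Sum>i=k..<l. P m (b i))"
proof -
  have "P m (\<Sum>i=k..<l. smul (c i) (b i)) \<le> (\<Sum>i=k..<l. P m (smul (c i) (b i)))" by (rule P_sum)
  also have "\<dots> \<le> (\<Sum>i=k..<l. K * P m (b i))"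
    using assms by (intro sum_mono) (simp add: P_smul mult_right_mono)
  finally show ?thesis by (simp add: sum_distrib_left)
qed

lemma ex_series:
  assumes "\<And>i. norm (c i) \<le> K"
  shows "\<exists>l. (\<lambda>N. \<Sum>i<N. smul (c i) (b i)) \<longlonglongrightarrow> l"
proof (rule P_Cauchy_convergent)
  fix m and e :: real assume e: "e > 0"
  have K: "K \<ge> 0" using assms[of 0] norm_ge_zero order_trans by blast
  then have "e / (K + 1) > 0" using e by simp
  then obtain N where N: "\<And>k l. k \<ge> N \<Longrightarrow> norm (\<Sum>i=k..<l. P m (b i)) < e / (K + 1)"
    using summable_P_b[of m] unfolding summable_Cauchy by blast
  have *: "P m ((\<Sum>i<l. smul (c i) (b i)) - (\<Sum>i<k. smul (c i) (b i))) < e" if "k \<ge> N" "l \<ge> k" for k l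
  proof -
    have "(\<Sum>i<l. smul (c i) (b i)) - (\<Sum>i<k. smul (c i) (b i)) = (\<Sum>i=k..<l. smul (c i) (b i))"
      using that by (simp add: sum_diff_nat_ivl[of 0 k l] lessThan_atLeast0 sum_diff_nat_ivl)
    then have "P m ((\<Sum>i<l. smul (c i) (b i)) - (\<Sum>i<k. smul (c i) (b i))) \<le> K * (\<Sum>i=k..<l. P m (b i))"
      using P_partial_sum_le[OF assms] by simp
    also have "\<dots> \<le> (K + 1) * (\<Sum>i=k..<l. P m (b i))" by (intro mult_right_mono sum_nonneg) auto
    also have "\<dots> < (K + 1) * (e / (K + 1))"
      using N[OF that(1), of l] K by (intro mult_strict_left_mono) (auto simp: sum_nonneg)
    also have "\<dots> = e" using K by simp
    finally show ?thesis .
  qed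
  have "P m ((\<Sum>i<k. smul (c i) (b i)) - (\<Sum>i<l. smul (c i) (b i))) < e" if "k \<ge> N" "l \<ge> N" for k l
    using *[of k l] *[of l k] that P_commute[of m "\<Sum>i<k. smul (c i) (b i)" "\<Sum>i<l. smul (c i) (b i)"]
    by (cases "k \<le> l") auto
  then show "\<exists>N. \<forall>k\<ge>N. \<forall>l\<ge>N. P m ((\<Sum>i<k. smul (c i) (b i)) - (\<Sum>i<l. smul (c i) (b i))) < e" by blast
qed

definition series :: "(nat \<Rightarrow> 'k) \<Rightarrow> 'a" where
  "series c = (SOME l. (\<lambda>N. \<Sum>i<N. smul (c i) (b i)) \<longlonglongrightarrow> l)"

lemma series_tendsto: "(\<And>i. norm (c i) \<le> K) \<Longrightarrow> (\<lambda>N. \<Sum>i<N. smul (c i) (b i)) \<longlonglongrightarrow> series c"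
  unfolding series_def by (rule someI_ex[OF ex_series])

lemma series_eqI: "(\<And>i. norm (c i) \<le> K) \<Longrightarrow> (\<lambda>N. \<Sum>i<N. smul (c i) (b i)) \<longlonglongrightarrow> l \<Longrightarrow> series c = l"
  using series_tendsto tendsto_unique_P by blast

lemma series_finite:
  assumes "\<And>i. i \<ge> N \<Longrightarrow> c i = 0" shows "series c = (\<Sum>i<N. smul (c i) (b i))"
proof -
  have "(\<lambda>L. \<Sum>i<L. smul (c i) (b i)) \<longlonglongrightarrow> (\<Sum>i<N. smul (c i) (b i))"
  proof (rule tendsto_eventually)
    show "\<forall>\<^sub>F L in sequentially. (\<Sum>i<L. smul (c i) (b i)) = (\<Sum>i<N. smul (c i) (b i))"
      using eventually_ge_at_top[of N]
    proof eventually_elim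
      case (elim L)
      then show ?case using assms by (intro sum.mono_neutral_right) auto
    qed
  qed
  moreover have "norm (c i) \<le> (\<Sum>i<N. norm (c i))" for i
    using assms[of i] by (cases "i < N") (auto intro: member_le_sum sum_nonneg)
  ultimately show ?thesis by (intro series_eqI)
qed

lemma tendsto_smul: "(X \<longlongrightarrow> a) F \<Longrightarrow> ((\<lambda>n. smul k (X n)) \<longlongrightarrow> smul k a) F"
  unfolding tendsto_P by (auto simp: P_smul simp flip: scale_right_diff_distrib intro!: tendsto_mult_right_zero)

lemma series_add:
  assumes "\<And>i. norm (c i) \<le> K" "\<And>i. norm (d i) \<le> L"
  shows "series (\<lambda>i. c i + d i) = series c + series d"
proof (rule series_eqI)
  show "norm (c i + d i) \<le> K + L" for i using norm_triangle_mono[OF assms(1) assms(2)] .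
  show "(\<lambda>N. \<Sum>i<N. smul (c i + d i) (b i)) \<longlonglongrightarrow> series c + series d"
    using tendsto_add[OF series_tendsto[OF assms(1)] series_tendsto[OF assms(2)]]
    by (simp add: scale_left_distrib sum.distrib)
qed

lemma series_smul:
  assumes "\<And>i. norm (c i) \<le> K"
  shows "series (\<lambda>i. k * c i) = smul k (series c)"
proof (rule series_eqI)
  show "norm (k * c i) \<le> norm k * K" for i using assms by (simp add: norm_mult mult_left_mono)
  show "(\<lambda>N. \<Sum>i<N. smul (k * c i) (b i)) \<longlonglongrightarrow> smul k (series c)"
    using tendsto_smul[OF series_tendsto[OF assms], of k] by (simp add: scale_sum_right)
qed

lemma P_series_le:
  assumes "\<And>i. norm (c i) \<le> K" shows "P m (series c) \<le> K * M m"
proof -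
  have K: "K \<ge> 0" using assms[of 0] norm_ge_zero order_trans by blast
  have "(\<lambda>N. P m ((\<Sum>i<N. smul (c i) (b i)) - series c) + K * M m) \<longlonglongrightarrow> 0 + K * M m"
    using series_tendsto[OF assms] unfolding tendsto_P by (intro tendsto_add tendsto_const) auto
  moreover have "P m (series c) \<le> P m ((\<Sum>i<N. smul (c i) (b i)) - series c) + K * M m" for N
  proof -
    have "P m (\<Sum>i<N. smul (c i) (b i)) \<le> K * (\<Sum>i<N. P m (b i))"
      using P_partial_sum_le[OF assms, where k=0 and l=N and m=m] by (simp add: lessThan_atLeast0)
    also have "\<dots> \<le> K * M m" unfolding M_def using K by (intro mult_left_mono sum_le_suminf summable_P_b) auto
    finally show ?thesis
      using P_triangle[of m "series c" 0 "\<Sum>i<N. smul (c i) (b i)"] P_commute[of m "series c" "\<Sum>i<N. smul (c i) (b i)"] by simp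
  qed
  ultimately have "P m (series c) \<le> 0 + K * M m" by (intro LIMSEQ_le_const) auto
  then show ?thesis by simp
qed

lemma f_bdd: "f i \<in> bdd_forms n0"
  using f_lin f_bound by (auto simp: bdd_forms_def intro!: exI[of _ 1])

lemma f_series:
  assumes "\<And>i. norm (c i) \<le> K" shows "f j (series c) = c j * of_real (w j)"
proof (rule LIMSEQ_unique)
  show "(\<lambda>N. f j (\<Sum>i<N. smul (c i) (b i))) \<longlonglongrightarrow> f j (series c)"
    by (rule bdd_forms_tendsto[OF f_bdd series_tendsto[OF assms]])
  show "(\<lambda>N. f j (\<Sum>i<N. smul (c i) (b i))) \<longlonglongrightarrow> c j * of_real (w j)"
  proof (rule tendsto_eventually)
    show "\<forall>\<^sub>F N in sequentially. f j (\<Sum>i<N. smul (c i) (b i)) = c j * of_real (w j)"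
      using eventually_gt_at_top[of j]
    proof eventually_elim
      case (elim N)
      have "f j (\<Sum>i<N. smul (c i) (b i)) = (\<Sum>i<N. if i = j then c j * of_real (w j) else 0)"
        unfolding lin_form_sum[OF f_lin] by (intro sum.cong) (auto simp: b_def lin_form_smul[OF f_lin] f_x)
      then show ?case using elim by simp
    qed
  qed
qed

text \<open>The semigroup and the hypercyclic operator are both of this form: the identity plus a
  map that factors through the bounded sequences.\<close>

lemma perturbation_operator:
  assumes lin: "\<And>i. lin_form (c i)" and bound: "\<And>i v. norm (c i v) \<le> K * P n0 v"
  shows "(\<lambda>v. v + series (\<lambda>i. c i v)) \<in> continuous_operators smul"
proof -
  have add: "series (\<lambda>i. c i (u + v)) = series (\<lambda>i. c i u) + series (\<lambda>i. c i v)" for u v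
    using series_add[OF bound bound] by (simp add: lin_form_add[OF lin])
  have smul: "series (\<lambda>i. c i (smul k v)) = smul k (series (\<lambda>i. c i v))" for k v
    using series_smul[OF bound] by (simp add: lin_form_smul[OF lin])
  have "continuous_on UNIV (\<lambda>v. series (\<lambda>i. c i v))"
    unfolding continuous_on_def tendsto_P
  proof (intro ballI allI)
    fix v m
    have le: "P m (series (\<lambda>i. c i u) - series (\<lambda>i. c i v)) \<le> K * P n0 (u - v) * M m" for u
    proof -
      have "series (\<lambda>i. c i u) = series (\<lambda>i. c i (u - v)) + series (\<lambda>i. c i v)" using add[of "u - v" v] by simp
      then show ?thesis using P_series_le[OF bound[of _ "u - v"], of m] by simp
    qed
    have "((\<lambda>u. P n0 (u - v)) \<longlongrightarrow> 0) (at v within UNIV)"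
      using tendsto_ident_at[of v UNIV] unfolding tendsto_P by blast
    then have "((\<lambda>u. K * P n0 (u - v) * M m) \<longlongrightarrow> K * 0 * M m) (at v within UNIV)"
      by (intro tendsto_intros)
    then show "((\<lambda>u. P m (series (\<lambda>i. c i u) - series (\<lambda>i. c i v))) \<longlongrightarrow> 0) (at v within UNIV)"
      using le by - (rule tendsto_0_sandwich[of "\<lambda>u. K * P n0 (u - v) * M m" "at v within UNIV"], auto)
  qed
  then have "continuous_on UNIV (\<lambda>v. v + series (\<lambda>i. c i v))" by (intro continuous_on_add' continuous_on_id)
  then show ?thesis
    by (simp add: continuous_operators_def linear_operator_iff add smul scale_right_distrib algebra_simps)
qed

section \<open>A mixing semigroup\<close>

text \<open>The exponentials of the backward shift \<open>x k \<mapsto> w (k - 1) \<cdot> x (k - 1)\<close>, \<open>x 0 \<mapsto> 0\<close>.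
  In the rescaled basis \<open>basis_mono k\<close> they act as the translations \<open>p \<mapsto> p (\<cdot> + t)\<close> on polynomials.\<close>

definition shift_term :: "nat \<Rightarrow> real \<Rightarrow> 'a \<Rightarrow> nat \<Rightarrow> 'k" where
  "shift_term n t v j = of_real (t ^ Suc j / fact (Suc j) * (\<Prod>i<j. w (n + Suc i))) * f (n + Suc j) v"

text \<open>The coefficient at \<open>b n\<close> of the exponential minus the identity. The power
  \<open>j + 1\<close> of the shift takes \<open>x (n + j + 1)\<close> to
  \<open>w n * ... * w (n + j)\<close> times \<open>x n\<close>; the factor \<open>w n\<close> is
  already part of \<open>b n\<close>, which leaves the product over \<open>i < j\<close> in
  \<open>shift_term\<close>.\<close>

definition shift_coord :: "nat \<Rightarrow> real \<Rightarrow> 'a \<Rightarrow> 'k" where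
  "shift_coord n t v = (\<Sum>j. shift_term n t v j)"

definition shift_exp :: "real \<Rightarrow> 'a \<Rightarrow> 'a" where
  "shift_exp t v = v + series (\<lambda>n. shift_coord n t v)"

lemma prod_w: "0 \<le> (\<Prod>i<j. w (n + Suc i))" "(\<Prod>i<j. w (n + Suc i)) \<le> 1"
  using less_imp_le[OF w_pos] w_le_1 by (auto intro!: prod_nonneg prod_le_1 simp del: add_Suc_right)

lemma exp_tail: "(\<lambda>j. t ^ Suc j / fact (Suc j)) sums (exp t - 1)" for t :: real
proof -
  have "(\<lambda>j. t ^ j / fact j) sums exp t" using exp_converges[of t] by (simp add: divide_inverse mult.commute)
  then show ?thesis using sums_Suc_iff[of "\<lambda>j. t ^ j / fact j" "exp t - 1"] by simp
qed

lemma norm_shift_term_diff: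
  assumes "0 \<le> s" "s \<le> t"
  shows "norm (shift_term n t v j - shift_term n s v j) \<le> (t ^ Suc j / fact (Suc j) - s ^ Suc j / fact (Suc j)) * P n0 v"
proof -
  have mono: "s ^ Suc j / fact (Suc j) \<le> t ^ Suc j / fact (Suc j)"
    using assms by (intro divide_right_mono power_mono) auto
  have "shift_term n t v j - shift_term n s v j =
      of_real ((t ^ Suc j / fact (Suc j) - s ^ Suc j / fact (Suc j)) * (\<Prod>i<j. w (n + Suc i))) * f (n + Suc j) v"
    unfolding shift_term_def of_real_mult of_real_diff by (simp only: left_diff_distrib)
  then have "norm (shift_term n t v j - shift_term n s v j) =
      \<bar>t ^ Suc j / fact (Suc j) - s ^ Suc j / fact (Suc j)\<bar> * (\<Prod>i<j. w (n + Suc i)) * norm (f (n + Suc j) v)"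
    using prod_w(1)[where n=n and j=j] by (simp only: norm_mult norm_of_real abs_mult abs_of_nonneg)
  also have "\<dots> \<le> \<bar>t ^ Suc j / fact (Suc j) - s ^ Suc j / fact (Suc j)\<bar> * 1 * P n0 v"
    using prod_w f_bound by (intro mult_mono mult_nonneg_nonneg) auto
  finally show ?thesis using mono by simp
qed

lemma norm_shift_term: "norm (shift_term n t v j) \<le> \<bar>t\<bar> ^ Suc j / fact (Suc j) * P n0 v"
proof -
  have "norm (shift_term n t v j) = \<bar>t\<bar> ^ Suc j / fact (Suc j) * (\<Prod>i<j. w (n + Suc i)) * norm (f (n + Suc j) v)"
    unfolding shift_term_def using prod_w(1)[where n=n and j=j]
    by (simp only: norm_mult norm_of_real abs_mult abs_of_nonneg abs_divide power_abs fact_ge_zero)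
  also have "\<dots> \<le> \<bar>t\<bar> ^ Suc j / fact (Suc j) * 1 * P n0 v"
    using prod_w f_bound by (intro mult_mono mult_nonneg_nonneg) auto
  finally show ?thesis by simp
qed

lemma summable_exp_tail: "summable (\<lambda>j. \<bar>t\<bar> ^ Suc j / fact (Suc j) * P n0 v)" for t :: real
  using exp_tail by (intro summable_mult2) (simp only: sums_iff)

lemma summable_shift_term: "summable (shift_term n t v)"
  by (rule summable_comparison_test'[OF summable_exp_tail norm_shift_term])

lemma norm_suminf_le:
  fixes g :: "nat \<Rightarrow> 'k"
  assumes "\<And>j. norm (g j) \<le> h j" "h sums c" shows "norm (suminf g) \<le> c"
proof -
  have h: "summable h" using assms(2) by (simp add: sums_iff)
  have nn: "0 \<le> h j" for j using norm_ge_zero[of "g j"] assms(1)[of j] by linarith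
  have "norm (suminf g) \<le> (\<Sum>j. norm (g j))"
    using assms(1) h nn by (intro summable_norm summable_comparison_test'[OF h, of 0]) auto
  also have "\<dots> \<le> suminf h"
    using assms(1) h nn by (intro suminf_le summable_comparison_test'[OF h, of 0]) auto
  finally show ?thesis using assms(2) by (simp add: sums_iff)
qed

lemma norm_shift_coord: "norm (shift_coord n t v) \<le> exp \<bar>t\<bar> * P n0 v"
proof -
  have "norm (shift_coord n t v) \<le> (exp \<bar>t\<bar> - 1) * P n0 v"
    unfolding shift_coord_def by (rule norm_suminf_le[OF norm_shift_term sums_mult2[OF exp_tail]])
  also have "\<dots> \<le> exp \<bar>t\<bar> * P n0 v" by (intro mult_right_mono) auto
  finally show ?thesis .
qed

text \<open>The exponential series dominates termwise because products of weights are at most 1. The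
  bound is uniform in \<open>n\<close> and on the unit ball of \<open>P n0\<close>, and this ball is
  the neighbourhood that witnesses uniform continuity.\<close>

lemma norm_shift_coord_diff:
  assumes "0 \<le> s" "0 \<le> t"
  shows "norm (shift_coord n t v - shift_coord n s v) \<le> \<bar>exp t - exp s\<bar> * P n0 v"
proof -
  have *: "norm (shift_coord n t v - shift_coord n s v) \<le> (exp t - exp s) * P n0 v" if "0 \<le> s" "s \<le> t" for s t
  proof -
    have "shift_coord n t v - shift_coord n s v = (\<Sum>j. shift_term n t v j - shift_term n s v j)"
      unfolding shift_coord_def by (intro suminf_diff summable_shift_term)
    moreover have "(\<lambda>j. (t ^ Suc j / fact (Suc j) - s ^ Suc j / fact (Suc j)) * P n0 v) sums ((exp t - 1 - (exp s - 1)) * P n0 v)"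
      by (intro sums_mult2 sums_diff exp_tail)
    ultimately show ?thesis using norm_suminf_le[OF norm_shift_term_diff[OF that]] by simp
  qed
  show ?thesis
  proof (cases "s \<le> t")
    case True
    then show ?thesis using *[of s t] assms by simp
  next
    case False
    then show ?thesis using *[of t s] assms by (simp add: norm_minus_commute)
  qed
qed

lemma lin_form_shift_coord: "lin_form (shift_coord n t)"
proof -
  have "shift_coord n t (u + v) = shift_coord n t u + shift_coord n t v" for u v
    unfolding shift_coord_def suminf_add[OF summable_shift_term summable_shift_term]
    by (rule arg_cong[where f=suminf], rule ext) (simp only: shift_term_def lin_form_add[OF f_lin] distrib_left)
  moreover have "shift_coord n t (smul c v) = c * shift_coord n t v" for c v
    unfolding shift_coord_def suminf_mult[OF summable_shift_term, symmetric]
    by (rule arg_cong[where f=suminf], rule ext) (simp only: shift_term_def lin_form_smul[OF f_lin] mult.left_commute)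
  ultimately show ?thesis by (simp add: lin_form_def)
qed

lemma shift_exp_operator: "shift_exp t \<in> continuous_operators smul"
proof -
  have "(\<lambda>v. v + series (\<lambda>n. shift_coord n t v)) \<in> continuous_operators smul"
    by (rule perturbation_operator[OF lin_form_shift_coord norm_shift_coord])
  then show ?thesis by (simp add: shift_exp_def[abs_def])
qed

lemma shift_exp_add: "shift_exp t (u + v) = shift_exp t u + shift_exp t v"
  and shift_exp_smul: "shift_exp t (smul c v) = smul c (shift_exp t v)"
  and shift_exp_continuous: "continuous_on UNIV (shift_exp t)"
  using shift_exp_operator[of t] by (auto simp: continuous_operators_def linear_operator_iff)

lemma shift_exp_0_right: "shift_exp t 0 = 0"
  using shift_exp_smul[of t 0 0] by simp

lemma shift_exp_sum: "shift_exp t (sum g A) = (\<Sum>i\<in>A. shift_exp t (g i))"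
  by (induction A rule: infinite_finite_induct) (auto simp: shift_exp_0_right shift_exp_add)

text \<open>Normalised so that the shift becomes differentiation: it takes
  \<open>basis_mono k\<close> to \<open>k\<close> times \<open>basis_mono (k - 1)\<close>.\<close>

definition basis_mono :: "nat \<Rightarrow> 'a" where
  "basis_mono k = smul (of_real (fact k / (\<Prod>i<k. w i))) (x k)"

lemma prod_w_pos: "(\<Prod>i<k. w i) > 0"
  using w_pos by (intro prod_pos) auto

lemma shift_coord_x:
  "shift_coord n t (x k) = (if n < k then of_real (t ^ (k - n) / fact (k - n) * (\<Prod>i<k - Suc n. w (n + Suc i))) else 0)"
proof (cases "n < k")
  case True
  have "shift_coord n t (x k) = (\<Sum>j\<in>{k - Suc n}. shift_term n t (x k) j)"
    unfolding shift_coord_def using True by (intro suminf_finite) (auto simp: shift_term_def f_x)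
  moreover have "Suc (k - Suc n) = k - n" "n + Suc (k - Suc n) = k" using True by auto
  ultimately show ?thesis using True by (simp only: sum.insert_remove sum.empty finite.intros shift_term_def f_x) simp
next
  case False
  then have "shift_term n t (x k) = (\<lambda>j. 0)" by (auto simp: shift_term_def f_x fun_eq_iff)
  then show ?thesis using False by (simp add: shift_coord_def)
qed

text \<open>The binomial expansion of a translated monomial: all products of weights cancel against
  those in \<open>basis_mono\<close>.\<close>

lemma shift_exp_mono:
  "shift_exp t (basis_mono k) = (\<Sum>n\<le>k. smul (of_real (real (k choose n) * t ^ (k - n))) (basis_mono n))"
proof -
  define c where "c = fact k / (\<Prod>i<k. w i)"
  have coef: "smul (of_real c) (smul (shift_coord n t (x k)) (b n)) = smul (of_real (real (k choose n) * t ^ (k - n))) (basis_mono n)"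
    if n: "n < k" for n
  proof -
    have "(\<Prod>i<k. w i) = (\<Prod>i<n. w i) * (\<Prod>i=n..<k. w i)"
      using n by (simp add: lessThan_atLeast0 prod.atLeastLessThan_concat)
    also have "(\<Prod>i=n..<k. w i) = w n * (\<Prod>i=Suc n..<k. w i)"
      using n by (simp add: prod.atLeast_Suc_lessThan)
    also have "(\<Prod>i=Suc n..<k. w i) = (\<Prod>i<k - Suc n. w (n + Suc i))"
      using prod.shift_bounds_nat_ivl[of w 0 "Suc n" "k - Suc n"] n by (simp add: lessThan_atLeast0 add.commute)
    finally have split: "(\<Prod>i<k. w i) = (\<Prod>i<n. w i) * (w n * (\<Prod>i<k - Suc n. w (n + Suc i)))" .
    have pos: "(\<Prod>i<n. w i) > 0" "w n > 0" "(\<Prod>i<k - Suc n. w (n + Suc i)) > 0"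
      using w_pos by (auto intro!: prod_pos)
    have calc: "fact k / (A * (B * C)) * (t ^ (k - n) / fact (k - n) * C * B) = real (k choose n) * t ^ (k - n) * (fact n / A)"
      if "A > 0" "B > 0" "C > 0" for A B C :: real
      using that n by (simp add: binomial_fact field_simps)
    have "c * (t ^ (k - n) / fact (k - n) * (\<Prod>i<k - Suc n. w (n + Suc i)) * w n)
        = real (k choose n) * t ^ (k - n) * (fact n / (\<Prod>i<n. w i))"
      unfolding c_def split by (rule calc[OF pos])
    then have "of_real c * (of_real (t ^ (k - n) / fact (k - n) * (\<Prod>i<k - Suc n. w (n + Suc i))) * of_real (w n))
        = (of_real (real (k choose n) * t ^ (k - n)) * of_real (fact n / (\<Prod>i<n. w i)) :: 'k)"
      by (simp only: of_real_mult[symmetric] mult.assoc)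
    then show ?thesis
      unfolding shift_coord_x basis_mono_def b_def scale_scale using n by (simp only: if_True mult.assoc)
  qed
  have "series (\<lambda>n. shift_coord n t (x k)) = (\<Sum>n<k. smul (shift_coord n t (x k)) (b n))"
    by (rule series_finite) (simp add: shift_coord_x)
  then have "shift_exp t (basis_mono k) = basis_mono k + (\<Sum>n<k. smul (of_real c) (smul (shift_coord n t (x k)) (b n)))"
    by (simp add: basis_mono_def shift_exp_smul) (simp add: shift_exp_def scale_right_distrib scale_sum_right c_def)
  also have "\<dots> = basis_mono k + (\<Sum>n<k. smul (of_real (real (k choose n) * t ^ (k - n))) (basis_mono n))"
    using coef by (intro arg_cong2[of _ _ _ _ "(+)"] refl sum.cong) auto
  also have "\<dots> = (\<Sum>n\<le>k. smul (of_real (real (k choose n) * t ^ (k - n))) (basis_mono n))"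
    by (simp add: lessThan_Suc_atMost[symmetric] add.commute)
  finally show ?thesis .
qed

definition of_poly :: "'k poly \<Rightarrow> 'a" where
  "of_poly p = (\<Sum>k\<le>degree p. smul (coeff p k) (basis_mono k))"

lemma of_poly_bound:
  assumes "degree p \<le> N" shows "of_poly p = (\<Sum>k\<le>N. smul (coeff p k) (basis_mono k))"
  unfolding of_poly_def using assms by (intro sum.mono_neutral_left) (auto simp: coeff_eq_0)

lemma of_poly_add: "of_poly (p + q) = of_poly p + of_poly q"
proof -
  define N where "N = max (degree p) (degree q)"
  have "degree (p + q) \<le> N" "degree p \<le> N" "degree q \<le> N" by (auto simp: N_def degree_add_le)
  then show ?thesis by (simp add: of_poly_bound[of _ N] scale_left_distrib sum.distrib)
qed

lemma of_poly_smult: "of_poly (smult c p) = smul c (of_poly p)"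
  by (simp add: of_poly_bound[OF degree_smult_le] of_poly_def scale_sum_right)

lemma of_poly_0: "of_poly 0 = 0"
  by (simp add: of_poly_def)

lemma of_poly_sum: "of_poly (sum g A) = (\<Sum>i\<in>A. of_poly (g i))"
  by (induction A rule: infinite_finite_induct) (auto simp: of_poly_0 of_poly_add)

lemma of_poly_monom: "of_poly (monom c k) = smul c (basis_mono k)"
proof -
  have "of_poly (monom c k) = (\<Sum>i\<le>k. smul (coeff (monom c k) i) (basis_mono i))"
    by (rule of_poly_bound) (rule degree_monom_le)
  also have "\<dots> = (\<Sum>i\<le>k. if i = k then smul c (basis_mono i) else 0)" by (intro sum.cong) auto
  finally show ?thesis by simp
qed

lemma pcompose_power: "pcompose (p ^ n) q = pcompose p q ^ n" for p q :: "'b::comm_semiring_1 poly"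
  by (induction n) (simp_all add: pcompose_1 pcompose_mult)

lemma shift_exp_of_poly: "shift_exp t (of_poly p) = of_poly (pcompose p [:of_real t, 1:])"
proof -
  have "shift_exp t (basis_mono k) = of_poly ([:of_real t, 1:] ^ k)" for k
  proof -
    have "of_poly ([:of_real t, 1:] ^ k) = (\<Sum>n\<le>k. smul (coeff ([:of_real t, 1:] ^ k) n) (basis_mono n))"
      by (rule of_poly_bound) (simp add: degree_linear_power)
    also have "\<dots> = shift_exp t (basis_mono k)"
      unfolding shift_exp_mono by (intro sum.cong refl) (simp add: coeff_linear_poly_power)
    finally show ?thesis by simp
  qed
  then have "shift_exp t (of_poly (monom c k)) = of_poly (pcompose (monom c k) [:of_real t, 1:])" for c k
    by (simp add: of_poly_monom shift_exp_smul) (simp add: monom_altdef pcompose_smult pcompose_power pcompose_pCons of_poly_smult)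
  then have "shift_exp t (of_poly (\<Sum>k\<le>degree p. monom (coeff p k) k)) = of_poly (pcompose (\<Sum>k\<le>degree p. monom (coeff p k) k) [:of_real t, 1:])"
    by (simp add: of_poly_sum shift_exp_sum pcompose_sum)
  then show ?thesis by (simp only: poly_as_sum_of_monoms)
qed

lemma of_poly_surj: "v \<in> span (range x) \<Longrightarrow> \<exists>p. v = of_poly p"
proof (induction rule: span_induct_alt)
  case base
  show ?case by (metis of_poly_0)
next
  case (step c u v)
  then obtain k p where k: "u = x k" and p: "v = of_poly p" by auto
  have "x k = of_poly (monom (of_real ((\<Prod>i<k. w i) / fact k)) k)"
    using less_imp_neq[OF prod_w_pos[of k]] unfolding of_poly_monom basis_mono_def scale_scale of_real_mult[symmetric] by (simp del: prod_zero_iff)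
  then have "smul c u + v = of_poly (smult c (monom (of_real ((\<Prod>i<k. w i) / fact k)) k) + p)"
    unfolding of_poly_add of_poly_smult k p by simp
  then show ?case by blast
qed

lemma closed_dense_eq:
  fixes S :: "'a set" and g h :: "'a \<Rightarrow> 'a"
  assumes "closure S = UNIV" "continuous_on UNIV g" "continuous_on UNIV h" "\<And>v. v \<in> S \<Longrightarrow> g v = h v"
  shows "g v = h v"
proof (rule ccontr)
  assume "g v \<noteq> h v"
  then obtain n where n: "P n (g v - h v) \<noteq> 0" using P_separates[of "g v - h v"] by (metis right_minus_eq)
  define e where "e = P n (g v - h v)"
  have e: "e > 0" unfolding e_def by (rule order.not_eq_order_implies_strict[OF n[symmetric] P_nonneg])
  define U where "U = g -` {z. P n (z - g v) < e / 2} \<inter> h -` {z. P n (z - h v) < e / 2}"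
  have "open U" unfolding U_def using assms(2,3) by (intro open_Int open_vimage open_P_ball)
  moreover have "v \<in> U" using e by (simp add: U_def)
  ultimately obtain u where u: "u \<in> U" "u \<in> S" using assms(1) unfolding closure_eq_UNIV_iff by blast
  have "e \<le> P n (g v - g u) + P n (g u - h v)" unfolding e_def by (rule P_triangle)
  then show False using u assms(4)[OF u(2)] P_commute[of n "g v" "g u"] by (simp add: U_def)
qed

text \<open>Translations of polynomials compose additively, and the polynomials are dense.\<close>

lemma shift_exp_semigroup: "shift_exp (s + t) v = shift_exp t (shift_exp s v)"
proof (rule closed_dense_eq[OF span_dense, where g="shift_exp (s + t)" and h="\<lambda>v. shift_exp t (shift_exp s v)"])
  show "continuous_on UNIV (shift_exp (s + t))" by (rule shift_exp_continuous)
  show "continuous_on UNIV (\<lambda>v. shift_exp t (shift_exp s v))"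
    by (rule continuous_on_compose2[OF shift_exp_continuous shift_exp_continuous]) auto
  fix v assume "v \<in> span (range x)"
  then obtain p where p: "v = of_poly p" using of_poly_surj by blast
  have "pcompose [:of_real s, 1:] [:of_real t, 1:] = ([:of_real (s + t), 1:] :: 'k poly)"
    by (simp add: pcompose_pCons add.commute)
  then show "shift_exp (s + t) v = shift_exp t (shift_exp s v)"
    unfolding p shift_exp_of_poly by (simp add: pcompose_assoc[symmetric])
qed

lemma shift_exp_0: "shift_exp 0 = id"
  by (rule ext) (simp add: shift_exp_def shift_coord_def shift_term_def series_finite[of 0])

lemma operator_semigroup_shift_exp: "operator_semigroup smul shift_exp"
  unfolding operator_semigroup_def
  by (auto simp: shift_exp_operator shift_exp_0 shift_exp_semigroup fun_eq_iff)

lemma uniformly_continuous_shift_exp: "uniformly_continuous_semigroup shift_exp"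
  unfolding uniformly_continuous_semigroup_def
proof (intro exI[of _ "{v. P n0 (v - 0) < 1}"] conjI allI impI)
  show "0 \<in> interior {v. P n0 (v - 0) < 1}" using open_P_ball[of n0 0 1] by (simp add: interior_open)
  fix \<tau> :: "nat \<Rightarrow> real" and t and V :: "'a set"
  assume \<tau>: "(\<forall>n. 0 \<le> \<tau> n) \<and> 0 \<le> t \<and> \<tau> \<longlonglongrightarrow> t" and V: "open V \<and> 0 \<in> V"
  obtain m e where e: "e > 0" "\<And>z. P m (z - 0) < e \<Longrightarrow> z \<in> V" using V by (elim conjE) (rule openE_P, assumption, assumption, rule that)
  have "(\<lambda>n. \<bar>exp (\<tau> n) - exp t\<bar> * M m) \<longlonglongrightarrow> \<bar>exp t - exp t\<bar> * M m"
    using \<tau> by (intro tendsto_intros) auto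
  then have "\<forall>\<^sub>F n in sequentially. \<bar>exp (\<tau> n) - exp t\<bar> * M m < e" using e(1) by (intro order_tendstoD(2)) auto
  then show "\<forall>\<^sub>F n in sequentially. \<forall>v\<in>{v. P n0 (v - 0) < 1}. shift_exp (\<tau> n) v - shift_exp t v \<in> V"
  proof (rule eventually_mono, intro ballI)
    fix n v assume n: "\<bar>exp (\<tau> n) - exp t\<bar> * M m < e" and v: "v \<in> {v. P n0 (v - 0) < 1}"
    have le: "norm (shift_coord i (\<tau> n) v - shift_coord i t v) \<le> \<bar>exp (\<tau> n) - exp t\<bar>" for i
    proof -
      have "norm (shift_coord i (\<tau> n) v - shift_coord i t v) \<le> \<bar>exp (\<tau> n) - exp t\<bar> * P n0 v"
        using \<tau> by (intro norm_shift_coord_diff) auto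
      also have "\<dots> \<le> \<bar>exp (\<tau> n) - exp t\<bar> * 1" using v by (intro mult_left_mono) auto
      finally show ?thesis by simp
    qed
    have "series (\<lambda>i. shift_coord i (\<tau> n) v)
        = series (\<lambda>i. (shift_coord i (\<tau> n) v - shift_coord i t v) + shift_coord i t v)" by simp
    also have "\<dots> = series (\<lambda>i. shift_coord i (\<tau> n) v - shift_coord i t v) + series (\<lambda>i. shift_coord i t v)"
      by (rule series_add[OF le norm_shift_coord])
    finally have "shift_exp (\<tau> n) v - shift_exp t v = series (\<lambda>i. shift_coord i (\<tau> n) v - shift_coord i t v)"
      by (simp add: shift_exp_def)
    then have "P m (shift_exp (\<tau> n) v - shift_exp t v) \<le> \<bar>exp (\<tau> n) - exp t\<bar> * M m"
      using P_series_le[OF le] by simp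
    then show "shift_exp (\<tau> n) v - shift_exp t v \<in> V" using n e(2) by simp
  qed
qed

text \<open>Under a common degree bound only finitely many basis vectors occur, so coefficientwise
  convergence suffices.\<close>

lemma of_poly_tendsto:
  assumes deg: "\<And>t. degree (q t) \<le> N" "degree p \<le> N"
    and coeff: "\<And>k. k \<le> N \<Longrightarrow> ((\<lambda>t. coeff (q t) k) \<longlongrightarrow> coeff p k) F"
  shows "((\<lambda>t. of_poly (q t)) \<longlongrightarrow> of_poly p) F"
  unfolding tendsto_P
proof
  fix m
  have le: "P m (of_poly (q t) - of_poly p) \<le> (\<Sum>k\<le>N. norm (coeff (q t) k - coeff p k) * P m (basis_mono k))" for t
  proof -
    have "of_poly (q t) - of_poly p = (\<Sum>k\<le>N. smul (coeff (q t) k - coeff p k) (basis_mono k))"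
      using deg by (simp add: of_poly_bound[of _ N] scale_left_diff_distrib sum_subtractf)
    then show ?thesis using P_sum[of m "\<lambda>k. smul (coeff (q t) k - coeff p k) (basis_mono k)" "{..N}"] by (simp add: P_smul)
  qed
  have "((\<lambda>t. \<Sum>k\<le>N. norm (coeff (q t) k - coeff p k) * P m (basis_mono k)) \<longlongrightarrow> (\<Sum>k\<le>N. norm (coeff p k - coeff p k) * P m (basis_mono k))) F"
    using coeff by (intro tendsto_intros) auto
  then show "((\<lambda>t. P m (of_poly (q t) - of_poly p)) \<longlongrightarrow> 0) F"
    using le by - (rule tendsto_0_sandwich[of "\<lambda>t. \<Sum>k\<le>N. norm (coeff (q t) k - coeff p k) * P m (basis_mono k)"], auto)
qed

text \<open>Points near \<open>v\<close> reach points near \<open>v'\<close> at all late times. As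
  the relation respects sums and multiples, it only has to be checked for basis vectors paired with
  0.\<close>

definition steers :: "'a \<Rightarrow> 'a \<Rightarrow> bool" where
  "steers v v' \<longleftrightarrow> (\<exists>u. (u \<longlongrightarrow> v) at_top \<and> ((\<lambda>t. shift_exp t (u t)) \<longlongrightarrow> v') at_top)"

lemma steers_add: "steers v v' \<Longrightarrow> steers u u' \<Longrightarrow> steers (v + u) (v' + u')"
proof -
  assume "steers v v'" "steers u u'"
  then obtain g h where "(g \<longlongrightarrow> v) at_top" "((\<lambda>t. shift_exp t (g t)) \<longlongrightarrow> v') at_top"
    "(h \<longlongrightarrow> u) at_top" "((\<lambda>t. shift_exp t (h t)) \<longlongrightarrow> u') at_top" by (auto simp: steers_def)
  then show ?thesis unfolding steers_def
    by (intro exI[of _ "\<lambda>t. g t + h t"] conjI) (auto simp: shift_exp_add intro: tendsto_add)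
qed

lemma steers_smul: "steers v v' \<Longrightarrow> steers (smul c v) (smul c v')"
proof -
  assume "steers v v'"
  then obtain g where "(g \<longlongrightarrow> v) at_top" "((\<lambda>t. shift_exp t (g t)) \<longlongrightarrow> v') at_top" by (auto simp: steers_def)
  then show ?thesis unfolding steers_def
    by (intro exI[of _ "\<lambda>t. smul c (g t)"] conjI) (auto simp: shift_exp_smul intro: tendsto_smul)
qed

lemma linear_power_0: "[:0, c:] ^ k = monom (c ^ k) k" for c :: 'k
  by (induction k) (simp_all add: monom_0 monom_Suc one_pCons smult_monom)

lemma coeff_linear_power_all: "coeff ([:a, c:] ^ n) i = of_nat (n choose i) * c ^ i * a ^ (n - i)" for a c :: 'k
proof (cases "i \<le> n")
  case False
  have "degree ([:a, c:] ^ n) \<le> degree [:a, c:] * n" by (rule degree_power_le)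
  also have "\<dots> \<le> 1 * n" by (intro mult_right_mono) auto
  finally have "coeff ([:a, c:] ^ n) i = 0" using False by (intro coeff_eq_0) simp
  then show ?thesis using False by (simp add: binomial_eq_0)
qed (rule coeff_linear_poly_power)

lemma degree_linear_power_le: "degree ([:a, c:] ^ n) \<le> n" for a c :: 'k
proof -
  have "degree ([:a, c:] ^ n) \<le> degree [:a, c:] * n" by (rule degree_power_le)
  also have "\<dots> \<le> 1 * n" by (intro mult_right_mono) auto
  finally show ?thesis by simp
qed

text \<open>The polynomials are \<open>s ^ n (1 - s / t) ^ (n + 1)\<close> and \<open>(s - t) ^ n (s / t) ^ (n + 1)\<close>.\<close>

lemma steers_mono: "steers (basis_mono n) 0" "steers 0 (basis_mono n)"
proof -
  define E :: "real \<Rightarrow> 'k" where "E t = of_real (inverse t)" for t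
  have E0: "(E \<longlongrightarrow> 0) at_top"
  proof -
    have "((\<lambda>t. of_real (inverse t) :: 'k) \<longlongrightarrow> of_real 0) at_top"
      by (intro tendsto_of_real tendsto_inverse_0_at_top filterlim_ident)
    then show ?thesis by (simp add: E_def[abs_def])
  qed
  have Ek: "((\<lambda>t. E t ^ k) \<longlongrightarrow> (if k = 0 then 1 else 0)) at_top" for k
    using tendsto_power[OF E0, of k] by (cases k) auto
  have one: "((\<lambda>t. coeff ([:1, d * E t:] ^ Suc n) i) \<longlongrightarrow> coeff 1 i) at_top" for i and d :: 'k
  proof -
    have "((\<lambda>t. of_nat (Suc n choose i) * (d ^ i * E t ^ i) * 1) \<longlongrightarrow> of_nat (Suc n choose i) * (d ^ i * (if i = 0 then 1 else 0)) * 1) at_top"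
      by (intro tendsto_intros Ek)
    then show ?thesis unfolding coeff_linear_power_all power_mult_distrib power_one by (cases i) (simp_all del: binomial_Suc_Suc power_Suc)
  qed
  \<comment> \<open>In degree \<open>n + 1 + j\<close> the factor \<open>t ^ (n - j)\<close> meets
    the inverse of \<open>t ^ (n + 1)\<close>, which leaves the inverse of
    \<open>t ^ (j + 1)\<close>. With exponent \<open>n\<close> in the second factor the term for
    \<open>j = 0\<close> would not tend to 0.\<close>
  have zero: "((\<lambda>t. coeff ([:d * of_real t, 1:] ^ n * [:0, d' * E t:] ^ Suc n) i) \<longlongrightarrow> coeff 0 i) at_top" for i and d d' :: 'k
  proof (cases "Suc n \<le> i \<and> i - Suc n \<le> n")
    case True
    define j where "j = i - Suc n"
    have j: "j \<le> n" using True by (simp add: j_def)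
    have "((\<lambda>t. of_nat (n choose j) * d ^ (n - j) * d' ^ Suc n * E t ^ Suc j) \<longlongrightarrow> of_nat (n choose j) * d ^ (n - j) * d' ^ Suc n * (if Suc j = 0 then 1 else 0)) at_top"
      by (intro tendsto_intros Ek)
    moreover have "\<forall>\<^sub>F t in at_top. of_nat (n choose j) * d ^ (n - j) * d' ^ Suc n * E t ^ Suc j
        = coeff ([:d * of_real t, 1:] ^ n * [:0, d' * E t:] ^ Suc n) i"
      using eventually_gt_at_top[of 0]
    proof eventually_elim
      case (elim t)
      have tE: "of_real t * E t = 1" using elim by (simp add: E_def flip: of_real_mult)
      have "of_real t ^ (n - j) * E t ^ Suc n = of_real t ^ (n - j) * E t ^ (n - j) * E t ^ Suc j"
        using j by (simp flip: power_add)
      also have "\<dots> = E t ^ Suc j" using tE by (simp flip: power_mult_distrib)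
      finally have *: "of_real t ^ (n - j) * E t ^ Suc n = E t ^ Suc j" .
      have "coeff ([:d * of_real t, 1:] ^ n * [:0, d' * E t:] ^ Suc n) i
          = coeff ([:d * of_real t, 1:] ^ n) j * (d' * E t) ^ Suc n"
        using leD[OF True[THEN conjunct1]] unfolding linear_power_0
        by (simp only: mult.commute[of _ "monom _ _"] coeff_monom_mult j_def if_False) (simp only: mult.commute)
      also have "\<dots> = of_nat (n choose j) * (d ^ (n - j) * of_real t ^ (n - j)) * (d' ^ Suc n * E t ^ Suc n)"
        by (simp only: coeff_linear_power_all power_mult_distrib power_one mult_1_right)
      also have "\<dots> = of_nat (n choose j) * d ^ (n - j) * d' ^ Suc n * (of_real t ^ (n - j) * E t ^ Suc n)"
        by (simp only: mult.assoc mult.left_commute mult.commute)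
      finally show ?case unfolding * by simp
    qed
    ultimately show ?thesis by (simp add: tendsto_cong)
  next
    case False
    have "coeff ([:d * of_real t, 1:] ^ n * [:0, d' * E t:] ^ Suc n) i = 0" for t
      using False unfolding linear_power_0
      by (auto simp: mult.commute[of _ "monom _ _"] coeff_monom_mult coeff_linear_power_all binomial_eq_0)
    then show ?thesis by simp
  qed
  have deg: "degree (p * q) \<le> Suc (2 * n)" if "degree p \<le> n" "degree q \<le> Suc n" for p q :: "'k poly"
    using degree_mult_le[of p q] that by simp
  have monic: "((\<lambda>t. of_poly ([:0, 1:] ^ n * [:1, d * E t:] ^ Suc n)) \<longlongrightarrow> basis_mono n) at_top" for d
  proof -
    have "((\<lambda>t. of_poly ([:0, 1:] ^ n * [:1, d * E t:] ^ Suc n)) \<longlongrightarrow> of_poly (monom 1 n)) at_top"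
    proof (rule of_poly_tendsto[where N="Suc (2 * n)"])
      show "((\<lambda>t. coeff ([:0, 1:] ^ n * [:1, d * E t:] ^ Suc n) k) \<longlongrightarrow> coeff (monom 1 n) k) at_top" for k
      proof (cases "n \<le> k")
        case True
        have "coeff (monom 1 n) k = (coeff 1 (k - n) :: 'k)" using True by (auto simp: coeff_1)
        then show ?thesis using one[of d "k - n"] leD[OF True] unfolding linear_power_0 by (simp only: coeff_monom_mult power_one if_False mult_1)
      next
        case False
        then show ?thesis unfolding linear_power_0 by (simp add: coeff_monom_mult)
      qed
      show "degree ([:0, 1:] ^ n * [:1, d * E t:] ^ Suc n) \<le> Suc (2 * n)" for t
        by (intro deg degree_linear_power_le)
      show "degree (monom 1 n :: 'k poly) \<le> Suc (2 * n)" by (rule order_trans[OF degree_monom_le]) simp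
    qed
    then show ?thesis by (simp add: of_poly_monom)
  qed
  have null: "((\<lambda>t. of_poly ([:d * of_real t, 1:] ^ n * [:0, d' * E t:] ^ Suc n)) \<longlongrightarrow> 0) at_top" for d d'
  proof -
    have "((\<lambda>t. of_poly ([:d * of_real t, 1:] ^ n * [:0, d' * E t:] ^ Suc n)) \<longlongrightarrow> of_poly 0) at_top"
    proof (rule of_poly_tendsto[where N="Suc (2 * n)"])
      show "degree ([:d * of_real t, 1:] ^ n * [:0, d' * E t:] ^ Suc n) \<le> Suc (2 * n)" for t
        by (intro deg degree_linear_power_le)
    qed (simp, rule zero)
    then show ?thesis by (simp add: of_poly_0)
  qed
  show "steers (basis_mono n) 0" unfolding steers_def
  proof (intro exI conjI)
    show "((\<lambda>t. of_poly ([:0, 1:] ^ n * [:1, -1 * E t:] ^ Suc n)) \<longlongrightarrow> basis_mono n) at_top" by (rule monic)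
    \<comment> \<open>Translation by \<open>t\<close> turns
      \<open>s ^ n (1 - s / t) ^ (n + 1)\<close> into
      \<open>(s + t) ^ n (- s / t) ^ (n + 1)\<close>.\<close>
    have "\<forall>\<^sub>F t in at_top. of_poly ([:1 * of_real t, 1:] ^ n * [:0, -1 * E t:] ^ Suc n)
        = shift_exp t (of_poly ([:0, 1:] ^ n * [:1, -1 * E t:] ^ Suc n))"
      using eventually_gt_at_top[of 0]
    proof eventually_elim
      case (elim t)
      have tE: "of_real t * E t = 1" using elim by (simp add: E_def flip: of_real_mult)
      then have "pcompose [:1, -1 * E t:] [:of_real t, 1:] = [:0, -1 * E t:]" by (simp add: pcompose_pCons mult.commute)
      moreover have "pcompose [:0, 1:] [:of_real t, 1:] = [:1 * of_real t, 1 :: 'k:]" by (simp add: pcompose_pCons)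
      ultimately show ?case unfolding shift_exp_of_poly pcompose_mult pcompose_power by (simp only:)
    qed
    then show "((\<lambda>t. shift_exp t (of_poly ([:0, 1:] ^ n * [:1, -1 * E t:] ^ Suc n))) \<longlongrightarrow> 0) at_top"
      using null[of 1 "-1"] by (rule Lim_transform_eventually[rotated])
  qed
  show "steers 0 (basis_mono n)" unfolding steers_def
  proof (intro exI conjI)
    show "((\<lambda>t. of_poly ([:-1 * of_real t, 1:] ^ n * [:0, 1 * E t:] ^ Suc n)) \<longlongrightarrow> 0) at_top" by (rule null)
    \<comment> \<open>Translation by \<open>t\<close> turns
      \<open>(s - t) ^ n (s / t) ^ (n + 1)\<close> into
      \<open>s ^ n (1 + s / t) ^ (n + 1)\<close>.\<close>
    have "\<forall>\<^sub>F t in at_top. of_poly ([:0, 1:] ^ n * [:1, 1 * E t:] ^ Suc n)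
        = shift_exp t (of_poly ([:-1 * of_real t, 1:] ^ n * [:0, 1 * E t:] ^ Suc n))"
      using eventually_gt_at_top[of 0]
    proof eventually_elim
      case (elim t)
      have tE: "of_real t * E t = 1" using elim by (simp add: E_def flip: of_real_mult)
      then have "pcompose [:0, 1 * E t:] [:of_real t, 1:] = [:1, 1 * E t:]" by (simp add: pcompose_pCons mult.commute)
      moreover have "pcompose [:-1 * of_real t, 1:] [:of_real t, 1:] = [:0, 1 :: 'k:]" by (simp add: pcompose_pCons)
      ultimately show ?case unfolding shift_exp_of_poly pcompose_mult pcompose_power by (simp only:)
    qed
    then show "((\<lambda>t. shift_exp t (of_poly ([:-1 * of_real t, 1:] ^ n * [:0, 1 * E t:] ^ Suc n))) \<longlongrightarrow> basis_mono n) at_top"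
      using monic[of 1] by (rule Lim_transform_eventually[rotated])
  qed
qed

lemma steers_of_poly: "steers (of_poly p) (of_poly q)"
proof -
  have 0: "steers 0 0" unfolding steers_def by (intro exI[of _ "\<lambda>_. 0"]) (simp add: shift_exp_0_right)
  have "steers (\<Sum>k\<in>A. smul (c k) (basis_mono k)) 0" if "finite A" for A c
    using that
  proof induction
    case (insert k A)
    then show ?case using steers_add[OF steers_smul[OF steers_mono(1)[of k], of "c k"]] by fastforce
  qed (use 0 in simp)
  moreover have "steers 0 (\<Sum>k\<in>A. smul (c k) (basis_mono k))" if "finite A" for A c
    using that
  proof induction
    case (insert k A)
    then show ?case using steers_add[OF steers_smul[OF steers_mono(2)[of k], of "c k"]] by fastforce
  qed (use 0 in simp)
  ultimately show ?thesis using steers_add[of "of_poly p" 0 0 "of_poly q"] by (simp add: of_poly_def)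
qed

lemma mixing_shift_exp: "mixing_semigroup shift_exp"
  unfolding mixing_semigroup_def
proof (intro allI impI)
  fix U V :: "'a set" assume UV: "open U \<and> U \<noteq> {} \<and> open V \<and> V \<noteq> {}"
  have dense: "W \<noteq> {} \<Longrightarrow> \<exists>y. y \<in> W \<and> y \<in> span (range x)" if "open W" for W
    using that span_dense unfolding closure_eq_UNIV_iff by blast
  obtain y y' where y: "y \<in> U" "y \<in> span (range x)" "y' \<in> V" "y' \<in> span (range x)"
    using dense[of U] dense[of V] UV by blast
  then have "steers y y'" using of_poly_surj steers_of_poly by metis
  then obtain u where u: "(u \<longlongrightarrow> y) at_top" "((\<lambda>t. shift_exp t (u t)) \<longlongrightarrow> y') at_top" by (auto simp: steers_def)
  have "\<forall>\<^sub>F t in at_top. u t \<in> U" "\<forall>\<^sub>F t in at_top. shift_exp t (u t) \<in> V"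
    using UV y u by (auto intro: topological_tendstoD)
  then have "\<forall>\<^sub>F t in at_top. u t \<in> U \<and> shift_exp t (u t) \<in> V" by (rule eventually_conj)
  then obtain r where r: "\<And>t. t \<ge> r \<Longrightarrow> u t \<in> U \<and> shift_exp t (u t) \<in> V" unfolding eventually_at_top_linorder by blast
  have "shift_exp t ` U \<inter> V \<noteq> {}" if "t > max r 1" for t using r[of t] that by auto
  then show "\<exists>r>0. \<forall>t>r. shift_exp t ` U \<inter> V \<noteq> {}" by (intro exI[of _ "max r 1"]) auto
qed

end

section \<open>Steering extensions of nilpotent matrices\<close>

definition fdiff :: "(nat \<Rightarrow> 'k::ab_group_add) \<Rightarrow> nat \<Rightarrow> 'k" where
  "fdiff g t = g (Suc t) - g t"

lemma fdiff_linear: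
  fixes g h :: "nat \<Rightarrow> 'k::comm_ring_1"
  shows "(fdiff ^^ N) (\<lambda>t. c * g t + h t) = (\<lambda>t. c * (fdiff ^^ N) g t + (fdiff ^^ N) h t)"
proof (induction N arbitrary: g h)
  case (Suc N)
  have "fdiff (\<lambda>t. c * g t + h t) = (\<lambda>t. c * fdiff g t + fdiff h t)" by (auto simp: fdiff_def fun_eq_iff algebra_simps)
  then show ?case using Suc[of "fdiff g" "fdiff h"] by (simp add: funpow_swap1)
qed simp

text \<open>In characteristic zero these are the polynomials of degree less than \<open>N\<close>.
  They are described by differences because iterated differences are what the blocks of
  \<open>chain\<close> will have to contain.\<close>

definition poly_fun :: "nat \<Rightarrow> (nat \<Rightarrow> 'k::comm_ring_1) set" where
  "poly_fun N = {g. (fdiff ^^ N) g = (\<lambda>_. 0)}"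

lemma poly_fun_combine: "g \<in> poly_fun N \<Longrightarrow> h \<in> poly_fun N \<Longrightarrow> (\<lambda>t. c * g t + h t) \<in> poly_fun N"
  by (simp add: poly_fun_def fdiff_linear)

lemma poly_fun_0: "(\<lambda>_. 0) \<in> poly_fun N"
proof -
  have "(fdiff ^^ N) (\<lambda>t. 0 :: 'a) = (\<lambda>_. 0)" by (induction N) (simp_all add: fdiff_def fun_eq_iff)
  then show ?thesis by (simp add: poly_fun_def)
qed

lemma poly_fun_cmult: "g \<in> poly_fun N \<Longrightarrow> (\<lambda>t. c * g t) \<in> poly_fun N"
  using poly_fun_combine[OF _ poly_fun_0] by fastforce

lemma poly_fun_add: "g \<in> poly_fun N \<Longrightarrow> h \<in> poly_fun N \<Longrightarrow> (\<lambda>t. g t + h t) \<in> poly_fun N"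
  using poly_fun_combine[of g N h 1] by simp

lemma poly_fun_diff: "g \<in> poly_fun N \<Longrightarrow> h \<in> poly_fun N \<Longrightarrow> (\<lambda>t. h t - g t) \<in> poly_fun N"
  using poly_fun_combine[of g N h "-1"] by simp

lemma poly_fun_sum: "(\<And>i. i \<in> A \<Longrightarrow> g i \<in> poly_fun N) \<Longrightarrow> (\<lambda>t. \<Sum>i\<in>A. g i t) \<in> poly_fun N"
  by (induction A rule: infinite_finite_induct) (auto simp: poly_fun_0 poly_fun_add)

lemma poly_fun_Suc: "g \<in> poly_fun (Suc N) \<longleftrightarrow> fdiff g \<in> poly_fun N"
  by (simp add: poly_fun_def funpow_swap1)

lemma poly_fun_Suc_mono: "g \<in> poly_fun N \<Longrightarrow> g \<in> poly_fun (Suc N)"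
  by (simp add: poly_fun_def fdiff_def fun_eq_iff)

lemma poly_fun_mono: "g \<in> poly_fun N \<Longrightarrow> N \<le> N' \<Longrightarrow> g \<in> poly_fun N'"
proof -
  assume "g \<in> poly_fun N" "N \<le> N'"
  from this(2,1) show ?thesis by (induction N' rule: dec_induct) (auto intro: poly_fun_Suc_mono)
qed

text \<open>The discrete Leibniz rule.\<close>

lemma poly_fun_times: "g \<in> poly_fun N \<Longrightarrow> (\<lambda>t. of_nat t * g t) \<in> poly_fun (Suc N)"
proof (induction N arbitrary: g)
  case 0
  then have "g = (\<lambda>_. 0)" by (simp add: poly_fun_def)
  then show ?case using poly_fun_0 by simp
next
  case (Suc N)
  have "fdiff (\<lambda>t. of_nat t * g t) = (\<lambda>t. of_nat t * fdiff g t + (fdiff g t + g t))"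
    by (auto simp: fdiff_def fun_eq_iff algebra_simps)
  moreover have "fdiff g \<in> poly_fun N" using Suc.prems by (simp add: poly_fun_Suc)
  ultimately show ?case unfolding poly_fun_Suc[of "\<lambda>t. of_nat t * g t"]
    using Suc.IH[of "fdiff g"] Suc.prems poly_fun_Suc_mono by (auto intro!: poly_fun_add)
qed

lemma poly_fun_affine_power:
  "g \<in> poly_fun N \<Longrightarrow> (\<lambda>t. (\<alpha> + \<beta> * of_nat t) ^ k * g t) \<in> poly_fun (N + k)"
proof (induction k)
  case (Suc k)
  let ?h = "\<lambda>t. (\<alpha> + \<beta> * of_nat t) ^ k * g t"
  have "(\<lambda>t. \<beta> * (of_nat t * ?h t) + \<alpha> * ?h t) \<in> poly_fun (Suc (N + k))"
    using Suc by (intro poly_fun_combine poly_fun_times poly_fun_cmult[OF poly_fun_Suc_mono]) auto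
  then show ?case by (simp add: algebra_simps)
qed simp

text \<open>Pascal's rule: taking the difference lowers the index \<open>l\<close> by one.\<close>

lemma poly_fun_gbinomial: "(\<lambda>t. (of_nat t + c :: 'k::field_char_0) gchoose l) \<in> poly_fun (Suc l)"
proof (induction l arbitrary: c)
  case 0
  show ?case by (simp add: poly_fun_def fdiff_def fun_eq_iff)
next
  case (Suc l)
  have "fdiff (\<lambda>t. (of_nat t + c) gchoose Suc l) = (\<lambda>t. (of_nat t + c) gchoose l)"
  proof
    fix t
    have "((of_nat t + c) + 1 gchoose Suc l) = (of_nat t + c gchoose l) + (of_nat t + c gchoose Suc l)"
      by (rule gbinomial_Suc_Suc)
    then show "fdiff (\<lambda>t. (of_nat t + c) gchoose Suc l) t = (of_nat t + c) gchoose l"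
      by (simp add: fdiff_def algebra_simps)
  qed
  then show ?case using Suc[of c] by (simp add: poly_fun_Suc[of _ "Suc l"])
qed

lemma poly_fun_gbinomial_minus: "(\<lambda>t. (c - of_nat t :: 'k::field_char_0) gchoose l) \<in> poly_fun (Suc l)"
proof (induction l arbitrary: c)
  case 0
  show ?case by (simp add: poly_fun_def fdiff_def fun_eq_iff)
next
  case (Suc l)
  have "fdiff (\<lambda>t. (c - of_nat t) gchoose Suc l) = (\<lambda>t. - 1 * ((c - 1 - of_nat t) gchoose l))"
  proof
    fix t
    have "((c - 1 - of_nat t) + 1 gchoose Suc l) = (c - 1 - of_nat t gchoose l) + (c - 1 - of_nat t gchoose Suc l)"
      by (rule gbinomial_Suc_Suc)
    then show "fdiff (\<lambda>t. (c - of_nat t) gchoose Suc l) t = - 1 * ((c - 1 - of_nat t) gchoose l)"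
      by (simp add: fdiff_def algebra_simps)
  qed
  then show ?case using poly_fun_cmult[OF Suc[of "c - 1"], of "-1"] by (simp only: poly_fun_Suc[of _ "Suc l"])
qed

text \<open>Induction on the order: recovering \<open>g\<close> from its differences costs one power
  of \<open>t + 1\<close>.\<close>

lemma poly_fun_growth:
  fixes g :: "nat \<Rightarrow> 'k::real_normed_field"
  assumes "g \<in> poly_fun N"
  shows "\<exists>C\<ge>0. \<forall>t. norm (g t) \<le> C * (real t + 1) ^ N"
  using assms
proof (induction N arbitrary: g)
  case 0
  then show ?case by (intro exI[of _ 0]) (simp add: poly_fun_def)
next
  case (Suc N)
  then obtain C where C: "C \<ge> 0" "\<And>t. norm (fdiff g t) \<le> C * (real t + 1) ^ N"
    using Suc.IH[of "fdiff g"] by (auto simp: poly_fun_Suc)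
  have "norm (g t) \<le> norm (g 0) + C * real t * (real t + 1) ^ N" for t
  proof (induction t)
    case (Suc t)
    have "norm (g (Suc t)) \<le> norm (g t) + norm (fdiff g t)"
      using norm_triangle_ineq[of "g t" "fdiff g t"] by (simp add: fdiff_def)
    also have "\<dots> \<le> norm (g 0) + C * real t * (real t + 1) ^ N + C * (real t + 1) ^ N"
      using Suc C(2)[of t] by simp
    also have "\<dots> = norm (g 0) + C * real (Suc t) * (real t + 1) ^ N" by (simp add: algebra_simps)
    also have "\<dots> \<le> norm (g 0) + C * real (Suc t) * (real (Suc t) + 1) ^ N"
      using C(1) by (intro add_left_mono mult_left_mono power_mono) auto
    finally show ?case .
  qed simp
  moreover have "norm (g 0) + C * real t * (real t + 1) ^ N \<le> (norm (g 0) + C) * (real t + 1) ^ Suc N" for t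
  proof -
    have "norm (g 0) * 1 \<le> norm (g 0) * (real t + 1) ^ Suc N" by (intro mult_left_mono one_le_power) auto
    moreover have "C * (real t * (real t + 1) ^ N) \<le> C * ((real t + 1) * (real t + 1) ^ N)"
      using C(1) by (intro mult_left_mono mult_right_mono) auto
    ultimately show ?thesis by (simp add: distrib_right mult.assoc)
  qed
  ultimately show ?case using C(1) by (intro exI[of _ "norm (g 0) + C"]) (auto intro: order_trans)
qed

lemma poly_fun_div_power:
  fixes g :: "nat \<Rightarrow> 'k::real_normed_field"
  assumes "g \<in> poly_fun N" "N < k"
  shows "(\<lambda>n. g (n + j) / of_nat n ^ k) \<longlonglongrightarrow> 0"
proof -
  obtain C where C: "C \<ge> 0" "\<And>t. norm (g t) \<le> C * (real t + 1) ^ N" using poly_fun_growth[OF assms(1)] by blast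
  have "(\<lambda>n. C * (real j + 2) ^ N * (1 / real n)) \<longlonglongrightarrow> C * (real j + 2) ^ N * 0"
    by (intro tendsto_mult tendsto_const lim_1_over_n)
  moreover have "\<forall>\<^sub>F n in sequentially. norm (g (n + j) / of_nat n ^ k) \<le> C * (real j + 2) ^ N * (1 / real n)"
    using eventually_ge_at_top[of 1]
  proof eventually_elim
    case (elim n)
    have n: "real n \<ge> 1" using elim by simp
    have "real (n + j) + 1 \<le> (real j + 2) * real n"
    proof -
      have "(real j + 1) * 1 \<le> (real j + 1) * real n" using n by (intro mult_left_mono) auto
      then show ?thesis by (simp add: algebra_simps)
    qed
    then have "norm (g (n + j)) \<le> C * ((real j + 2) * real n) ^ N"
      using C by (intro order_trans[OF C(2)] mult_left_mono power_mono) auto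
    then have "norm (g (n + j) / of_nat n ^ k) \<le> C * ((real j + 2) * real n) ^ N / real n ^ k"
      by (simp add: norm_divide norm_power divide_right_mono)
    also have "\<dots> = C * (real j + 2) ^ N * (real n ^ N / real n ^ k)" by (simp add: power_mult_distrib)
    also have "\<dots> \<le> C * (real j + 2) ^ N * (1 / real n)"
    proof (intro mult_left_mono)
      have "real n ^ Suc N \<le> real n ^ k" using assms(2) n by (intro power_increasing) auto
      then show "real n ^ N / real n ^ k \<le> 1 / real n" using n by (simp add: field_simps)
    qed (use C in auto)
    finally show ?case .
  qed
  ultimately show ?thesis by (intro Lim_null_comparison[of "\<lambda>n. g (n + j) / of_nat n ^ k"]) auto
qed

text \<open>Iterated differences at \<open>\<tau> n\<close> involve only finitely many values at
  points \<open>\<tau> n + j\<close>.\<close>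

lemma fdiff_funpow_tendsto:
  fixes F :: "nat \<Rightarrow> nat \<Rightarrow> 'k::real_normed_field"
  assumes "\<And>j. (\<lambda>n. F n (\<tau> n + j)) \<longlonglongrightarrow> 0"
  shows "(\<lambda>n. (fdiff ^^ r) (F n) (\<tau> n + j)) \<longlonglongrightarrow> 0"
proof (induction r arbitrary: j)
  case (Suc r)
  have "(\<lambda>n. (fdiff ^^ r) (F n) (\<tau> n + Suc j) - (fdiff ^^ r) (F n) (\<tau> n + j)) \<longlonglongrightarrow> 0 - 0"
    by (intro tendsto_diff Suc)
  moreover have "(fdiff ^^ Suc r) (F n) (\<tau> n + j) = (fdiff ^^ r) (F n) (\<tau> n + Suc j) - (fdiff ^^ r) (F n) (\<tau> n + j)" for n
    by (simp add: fdiff_def[of "(fdiff ^^ r) (F n)"])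
  ultimately show ?case by (simp only: diff_0_right)
qed (use assms in simp)

section \<open>Finite matrices and motions with prescribed ends\<close>

definition act :: "(nat \<Rightarrow> nat \<Rightarrow> 'k::comm_ring_1) \<Rightarrow> nat \<Rightarrow> (nat \<Rightarrow> 'k) \<Rightarrow> nat \<Rightarrow> 'k" where
  "act a d y n = (if n < d then \<Sum>m<d. a n m * y m else 0)"

definition step :: "(nat \<Rightarrow> nat \<Rightarrow> 'k::comm_ring_1) \<Rightarrow> nat \<Rightarrow> (nat \<Rightarrow> 'k) \<Rightarrow> nat \<Rightarrow> 'k" where
  "step a d y n = y n + act a d y n"

text \<open>A perturbation of \<open>a\<close> of size controlled by \<open>\<delta>\<close> that
  makes room for steering. Cut off after finitely many blocks it is still nilpotent.\<close>

definition chain :: "(nat \<Rightarrow> nat \<Rightarrow> 'k::comm_ring_1) \<Rightarrow> nat \<Rightarrow> 'k \<Rightarrow> nat \<Rightarrow> nat \<Rightarrow> 'k" where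
  "chain a d \<delta> n m = (if n < d \<and> m < d then a n m else 0) + (if m = n + d then \<delta> else 0)"

definition nilpotent :: "(nat \<Rightarrow> nat \<Rightarrow> 'k::comm_ring_1) \<Rightarrow> nat \<Rightarrow> nat \<Rightarrow> bool" where
  "nilpotent a d K \<longleftrightarrow> (\<forall>y. (act a d ^^ K) y = (\<lambda>_. 0))"

lemma act_chain:
  assumes "d \<le> N"
  shows "act (chain a d \<delta>) N y n = act a d y n + (if n + d < N then \<delta> * y (n + d) else 0)"
proof (cases "n < N")
  case True
  have "(\<Sum>m<N. chain a d \<delta> n m * y m)
      = (\<Sum>m<N. if m < d then (if n < d then a n m * y m else 0) else 0) + (\<Sum>m<N. if m = n + d then \<delta> * y m else 0)"
    unfolding sum.distrib[symmetric] by (intro sum.cong) (auto simp: chain_def algebra_simps)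
  also have "(\<Sum>m<N. if m < d then (if n < d then a n m * y m else 0) else 0) = act a d y n"
  proof -
    have "{..<N} \<inter> {m. m < d} = {..<d}" using assms by auto
    then show ?thesis by (simp add: sum.If_cases act_def)
  qed
  also have "(\<Sum>m<N. if m = n + d then \<delta> * y m else 0) = (if n + d < N then \<delta> * y (n + d) else 0)" by simp
  finally show ?thesis using True by (simp add: act_def[of "chain a d \<delta>"])
next
  case False
  then show ?thesis using assms by (simp add: act_def)
qed

text \<open>Beyond the first block the map only shifts by one block towards the first. After
  \<open>R\<close> steps everything lies in the first block, where \<open>a\<close> takes
  \<open>K\<close> further steps to reach 0.\<close>

lemma nilpotent_chain:
  assumes "nilpotent a d K" "d > 0"
  shows "nilpotent (chain a d \<delta>) (d * Suc R) (K + R)"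
proof -
  let ?A = "act (chain a d \<delta>) (d * Suc R)"
  have A: "?A y n = act a d y n + (if n + d < d * Suc R then \<delta> * y (n + d) else 0)" for y n
    by (rule act_chain) simp
  have A0: "?A z n = 0" if "n \<ge> d" "n + d \<ge> d * Suc R \<or> z (n + d) = 0" for z n
    using that by (simp only: A) (auto simp: act_def[of a d])
  have supp: "(?A ^^ j) y n = 0" if "j \<le> R" "j > 0" "n \<ge> d * (Suc R - j)" for j y n
    using that
  proof (induction j arbitrary: n)
    case (Suc j)
    have nd: "n \<ge> d" using Suc.prems by (metis One_nat_def Suc_diff_le diff_is_0_eq le_trans mult.right_neutral mult_le_mono2 not_less_eq_eq zero_less_Suc Suc_leI zero_less_diff le_imp_less_Suc)
    have *: "n + d \<ge> d * (Suc R - j)"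
    proof -
      have "Suc R - j = Suc (Suc R - Suc j)" using Suc.prems by simp
      then show ?thesis using Suc.prems by simp
    qed
    show ?case
    proof (cases "j = 0")
      case True
      then show ?thesis using nd * A0[of n y] by simp
    next
      case False
      then have "(?A ^^ j) y (n + d) = 0" using Suc.prems * by (intro Suc.IH) auto
      then show ?thesis using nd A0[of n "(?A ^^ j) y"] by simp
    qed
  qed simp
  have low: "(?A ^^ j) y = (act a d ^^ j) y" if "\<And>n. n \<ge> d \<Longrightarrow> y n = 0" for j y
  proof (induction j)
    case (Suc j)
    have "(act a d ^^ j) y n = 0" if "n \<ge> d" for n
      using that \<open>\<And>n. n \<ge> d \<Longrightarrow> y n = 0\<close> by (cases j) (auto simp: act_def)
    then have "?A ((act a d ^^ j) y) = act a d ((act a d ^^ j) y)" by (intro ext) (simp only: A, simp)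
    then show ?case using Suc by simp
  qed simp
  show ?thesis
  proof (cases "R = 0")
    case True
    have "(?A ^^ K) y = (act a d ^^ K) y" for y
    proof -
      have "?A = act a d" by (intro ext) (simp only: A, simp add: True)
      then show ?thesis by simp
    qed
    then show ?thesis using assms(1) True by (simp add: nilpotent_def)
  next
    case False
    have "(?A ^^ K) ((?A ^^ R) y) = (act a d ^^ K) ((?A ^^ R) y)" for y
      using supp[of R] False by (intro low) auto
    then show ?thesis using assms(1) by (simp add: nilpotent_def funpow_add)
  qed
qed

text \<open>In the matrix \<open>chain a d \<delta>\<close>, each block of \<open>d\<close> coordinates is driven by \<open>\<delta>\<close> times the next one. Hence
  a motion of the first block whose defect \<open>F\<close> is a polynomial in time can be prescribed: the
  further blocks must be the iterated differences of \<open>F\<close> divided by powers of \<open>\<delta>\<close>, and they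
  vanish eventually.\<close>

lemma trajectory:
  fixes Y :: "nat \<Rightarrow> nat \<Rightarrow> 'k::real_normed_field" and R :: nat
  assumes d: "d > 0" and \<delta>: "\<delta> \<noteq> 0"
    and F: "\<And>t i. F i t = Y (Suc t) i - step a d (Y t) i"
    and poly: "\<And>i. F i \<in> poly_fun R"
    and U: "\<And>t n. U t n = (if n < d then Y t n else if n < d * Suc R
      then (fdiff ^^ (n div d - 1)) (F (n mod d)) t / \<delta> ^ (n div d) else 0)"
  shows "(step (chain a d \<delta>) (d * Suc R) ^^ n) (U t) = U (t + n)"
proof -
  have one: "step (chain a d \<delta>) (d * Suc R) (U t) n = U (Suc t) n" for t n
  proof -
    have st: "step (chain a d \<delta>) (d * Suc R) (U t) n = U t n + (act a d (U t) n + (if n + d < d * Suc R then \<delta> * U t (n + d) else 0))"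
      unfolding step_def by (subst act_chain) auto
    show ?thesis
    proof (cases "n < d")
      case True
      have "act a d (U t) n = act a d (Y t) n" by (simp add: act_def U)
      moreover have "(if n + d < d * Suc R then \<delta> * U t (n + d) else 0) = F n t"
      proof (cases "R = 0")
        case True
        then have "F n = (\<lambda>_. 0)" using poly[of n] by (simp add: poly_fun_def)
        then show ?thesis using True by simp
      next
        case False
        have "n + d < d * Suc R" using \<open>n < d\<close> False
          by (cases R) auto
        moreover have "(n + d) div d = 1" "(n + d) mod d = n" using \<open>n < d\<close> d by auto
        ultimately show ?thesis using \<delta> by (simp add: U)
      qed
      ultimately show ?thesis unfolding st using True by (simp add: U F step_def)
    next
      case False
      define r where "r = n div d"
      define i where "i = n mod d"
      have r: "r > 0" using False d by (simp add: r_def div_greater_zero_iff)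
      have act0: "act a d (U t) n = 0" using False by (simp add: act_def)
      have nd: "(n + d) div d = Suc r" "(n + d) mod d = i" using d by (simp_all add: r_def i_def)
      show ?thesis
      proof (cases "n < d * Suc R")
        case n: True
        have eq: "(if n + d < d * Suc R then \<delta> * U t (n + d) else 0) = (fdiff ^^ r) (F i) t / \<delta> ^ r"
        proof (cases "n + d < d * Suc R")
          case True
          then show ?thesis using \<delta> nd by (simp add: U)
        next
          case False
          \<comment> \<open>There is no block behind the last one to drive it, but there
            \<open>R\<close> differences have already annihilated \<open>F i\<close>.\<close>
          have "r \<ge> R"
          proof (rule ccontr)
            assume "\<not> r \<ge> R"
            then have "d * Suc r \<le> d * R" by (intro mult_le_mono2) simp
            moreover have "n < d * Suc r" using d dividend_less_times_div[of d n] by (simp add: r_def)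
            ultimately show False using False by simp
          qed
          then have "F i \<in> poly_fun r" using poly poly_fun_mono by blast
          then show ?thesis using False by (simp add: poly_fun_def)
        qed
        obtain q where q: "r = Suc q" using r by (cases r) auto
        have "(fdiff ^^ r) (F i) t = (fdiff ^^ q) (F i) (Suc t) - (fdiff ^^ q) (F i) t"
          unfolding q by (simp add: fdiff_def)
        then show ?thesis unfolding st act0 eq using n False q
          by (simp add: U r_def[symmetric] i_def[symmetric] diff_divide_distrib)
      next
        case n: False
        then show ?thesis unfolding st act0 using False by (simp add: U)
      qed
    qed
  qed
  have "step (chain a d \<delta>) (d * Suc R) (U t) = U (Suc t)" for t by (rule ext) (rule one)
  then show ?thesis by (induction n) simp_all
qed

text \<open>The power \<open>(1 + a) ^ s\<close> of a unipotent matrix with a scalar exponent, applied to \<open>y\<close>. The motions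
  steered below are \<open>(1 - t / n) ^ (K + 1) (1 + a) ^ t y\<close> and \<open>(t / n) ^ (K + 1) (1 + a) ^ (t - n) y\<close>.\<close>

definition gpow :: "(nat \<Rightarrow> nat \<Rightarrow> 'k::field_char_0) \<Rightarrow> nat \<Rightarrow> nat \<Rightarrow> (nat \<Rightarrow> 'k) \<Rightarrow> 'k \<Rightarrow> nat \<Rightarrow> 'k" where
  "gpow a d K y s i = (\<Sum>l<K. (s gchoose l) * (act a d ^^ l) y i)"

lemma act_sum: "act a d (\<lambda>i. \<Sum>l\<in>A. c l * z l i) = (\<lambda>i. \<Sum>l\<in>A. c l * act a d (z l) i)"
  by (auto simp: act_def fun_eq_iff sum_distrib_left mult.left_commute intro!: sum.swap[THEN trans] sum.cong)

text \<open>Pascal's rule for generalized binomial coefficients; the top term of the shifted sum is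
  killed by nilpotency.\<close>

lemma step_gpow:
  assumes "nilpotent a d K"
  shows "step a d (gpow a d K y s) = gpow a d K y (s + 1)"
proof
  fix i
  have nil: "(act a d ^^ K) y i = 0" using assms by (simp add: nilpotent_def)
  have "act a d (gpow a d K y s) i = (\<Sum>l<K. (s gchoose l) * (act a d ^^ Suc l) y i)"
    unfolding gpow_def[abs_def] act_sum by simp
  then have "step a d (gpow a d K y s) i = (\<Sum>l<K. (s gchoose l) * (act a d ^^ l) y i) + (\<Sum>l<K. (s gchoose l) * (act a d ^^ Suc l) y i)"
    by (simp add: step_def gpow_def)
  also have "\<dots> = (\<Sum>l<K. (s + 1 gchoose l) * (act a d ^^ l) y i)"
  proof (cases K)
    case (Suc k)
    have "(\<Sum>l<K. (s gchoose l) * (act a d ^^ Suc l) y i) = (\<Sum>l<k. (s gchoose l) * (act a d ^^ Suc l) y i)"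
      using nil by (simp add: Suc)
    moreover have "(\<Sum>l<K. (s gchoose l) * (act a d ^^ l) y i) = y i + (\<Sum>l<k. (s gchoose Suc l) * (act a d ^^ Suc l) y i)"
      unfolding Suc sum.lessThan_Suc_shift by simp
    moreover have "(\<Sum>l<K. (s + 1 gchoose l) * (act a d ^^ l) y i) = y i + (\<Sum>l<k. (s + 1 gchoose Suc l) * (act a d ^^ Suc l) y i)"
      unfolding Suc sum.lessThan_Suc_shift by simp
    ultimately show ?thesis unfolding gbinomial_Suc_Suc distrib_right sum.distrib by (simp add: add.commute add.left_commute)
  qed simp
  finally show "step a d (gpow a d K y s) i = gpow a d K y (s + 1) i" by (simp add: gpow_def)
qed

lemma gpow_0: "K > 0 \<Longrightarrow> gpow a d K y 0 i = y i"
  by (cases K) (simp_all add: gpow_def sum.lessThan_Suc_shift del: sum.lessThan_Suc)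

lemma step_scale: "step a d (\<lambda>i. c * z i) = (\<lambda>i. c * step a d z i)"
  by (auto simp: step_def act_def fun_eq_iff sum_distrib_left distrib_left mult.left_commute)

lemma poly_fun_gpow: "(\<lambda>t. gpow a d K y (of_nat t + c) i) \<in> poly_fun K"
  and poly_fun_gpow_minus: "(\<lambda>t. gpow a d K y (c - of_nat t) i) \<in> poly_fun K"
  unfolding gpow_def mult.commute[of "_ gchoose _"]
  by (auto intro!: poly_fun_sum poly_fun_cmult poly_fun_mono[OF poly_fun_gbinomial] poly_fun_mono[OF poly_fun_gbinomial_minus])

text \<open>Shared by both directions of steering. The factor \<open>gpow\<close> is advanced
  exactly, so the defect comes from the change of the affine power alone. It is small near time 0
  and near time \<open>n\<close>, hence the auxiliary blocks vanish in the limit at both ends. Its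
  order \<open>K + k\<close> is the number of auxiliary blocks.\<close>

lemma steer_aux:
  fixes a :: "nat \<Rightarrow> nat \<Rightarrow> 'k::real_normed_field"
  assumes nil: "nilpotent a d K" and d: "d > 0" and \<delta>: "\<delta> \<noteq> 0" and supp: "\<And>i. i \<ge> d \<Longrightarrow> y i = 0"
    and Y: "\<And>n t i. Y n t i = (\<alpha> n + \<beta> n * of_nat t) ^ k * gpow a d K y (of_nat t + \<gamma> n) i"
    and start: "\<And>j i. (\<lambda>n. ((\<alpha> n + \<beta> n * of_nat (Suc j)) ^ k - (\<alpha> n + \<beta> n * of_nat j) ^ k) *
        gpow a d K y (of_nat (Suc j) + \<gamma> n) i) \<longlonglongrightarrow> 0"
    and stop: "\<And>j i. (\<lambda>n. ((\<alpha> n + \<beta> n * of_nat (Suc (n + j))) ^ k - (\<alpha> n + \<beta> n * of_nat (n + j)) ^ k) *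
        gpow a d K y (of_nat (Suc (n + j)) + \<gamma> n) i) \<longlonglongrightarrow> 0"
    and y0: "\<And>i. (\<lambda>n. Y n 0 i) \<longlonglongrightarrow> y0 i" and y1: "\<And>i. (\<lambda>n. Y n n i) \<longlonglongrightarrow> y1 i"
    and supp01: "\<And>i. i \<ge> d \<Longrightarrow> y0 i = 0" "\<And>i. i \<ge> d \<Longrightarrow> y1 i = 0"
  shows "\<exists>u. (\<forall>n i. i \<ge> d * Suc (K + k) \<longrightarrow> u n i = 0) \<and> (\<forall>i. (\<lambda>n. u n i) \<longlonglongrightarrow> y0 i) \<and>
    (\<forall>n i. i \<ge> d * Suc (K + k) \<longrightarrow> (step (chain a d \<delta>) (d * Suc (K + k)) ^^ n) (u n) i = 0) \<and>
    (\<forall>i. (\<lambda>n. (step (chain a d \<delta>) (d * Suc (K + k)) ^^ n) (u n) i) \<longlonglongrightarrow> y1 i)"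
proof -
  define R where "R = K + k"
  define F where "F n i t = Y n (Suc t) i - step a d (Y n t) i" for n i t
  have F_eq: "F n i t = ((\<alpha> n + \<beta> n * of_nat (Suc t)) ^ k - (\<alpha> n + \<beta> n * of_nat t) ^ k) * gpow a d K y (of_nat (Suc t) + \<gamma> n) i" for n i t
  proof -
    have "step a d (Y n t) i = (\<alpha> n + \<beta> n * of_nat t) ^ k * gpow a d K y (of_nat t + \<gamma> n + 1) i"
      unfolding Y[abs_def] step_scale step_gpow[OF nil] ..
    moreover have "of_nat t + \<gamma> n + 1 = of_nat (Suc t) + \<gamma> n" by simp
    ultimately show ?thesis unfolding F_def Y left_diff_distrib by (simp only:)
  qed
  have F_poly: "F n i \<in> poly_fun R" for n i
  proof -
    have g: "(\<lambda>t. gpow a d K y (of_nat (Suc t) + \<gamma> n) i) \<in> poly_fun K"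
      using poly_fun_gpow[of a d K y "1 + \<gamma> n" i] by (simp add: add.assoc add.left_commute)
    have "(\<lambda>t. ((\<alpha> n + \<beta> n) + \<beta> n * of_nat t) ^ k * gpow a d K y (of_nat (Suc t) + \<gamma> n) i) \<in> poly_fun R"
      unfolding R_def by (rule poly_fun_affine_power[OF g])
    moreover have "(\<lambda>t. (\<alpha> n + \<beta> n * of_nat t) ^ k * gpow a d K y (of_nat (Suc t) + \<gamma> n) i) \<in> poly_fun R"
      unfolding R_def by (rule poly_fun_affine_power[OF g])
    ultimately have "(\<lambda>t. ((\<alpha> n + \<beta> n) + \<beta> n * of_nat t) ^ k * gpow a d K y (of_nat (Suc t) + \<gamma> n) i
        - (\<alpha> n + \<beta> n * of_nat t) ^ k * gpow a d K y (of_nat (Suc t) + \<gamma> n) i) \<in> poly_fun R"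
      by (intro poly_fun_diff)
    moreover have "\<alpha> n + \<beta> n + \<beta> n * of_nat t = \<alpha> n + \<beta> n * of_nat (Suc t)" for t by (simp add: distrib_left)
    ultimately show ?thesis unfolding F_eq[abs_def] left_diff_distrib by (simp only:)
  qed
  define U where "U n t i = (if i < d then Y n t i else if i < d * Suc R
      then (fdiff ^^ (i div d - 1)) (F n (i mod d)) t / \<delta> ^ (i div d) else 0)" for n t i
  have traj: "(step (chain a d \<delta>) (d * Suc R) ^^ n) (U n 0) = U n n" for n
    using trajectory[where Y="Y n" and F="F n" and U="U n" and t=0 and n=n and R=R and a=a, OF d \<delta> F_def F_poly U_def] by simp
  have F0: "(\<lambda>n. F n i (0 + j)) \<longlonglongrightarrow> 0" for i j unfolding F_eq using start by simp
  have F1: "(\<lambda>n. F n i (n + j)) \<longlonglongrightarrow> 0" for i j unfolding F_eq using stop by simp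
  have lim0: "(\<lambda>n. U n 0 i) \<longlonglongrightarrow> y0 i" for i
  proof (cases "i < d")
    case True
    then show ?thesis using y0 by (simp add: U_def)
  next
    case False
    have "(\<lambda>n. (fdiff ^^ (i div d - 1)) (F n (i mod d)) 0 / \<delta> ^ (i div d)) \<longlonglongrightarrow> 0 / \<delta> ^ (i div d)"
      using fdiff_funpow_tendsto[of "\<lambda>n. F n (i mod d)" "\<lambda>_. 0" "i div d - 1" 0, OF F0] \<delta> by (intro tendsto_divide tendsto_const) auto
    then show ?thesis using False supp01(1)[of i] by (cases "i < d * Suc R") (simp_all add: U_def del: mult_Suc_right)
  qed
  have lim1: "(\<lambda>n. U n n i) \<longlonglongrightarrow> y1 i" for i
  proof (cases "i < d")
    case True
    then show ?thesis using y1 by (simp add: U_def)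
  next
    case False
    have "(\<lambda>n. (fdiff ^^ (i div d - 1)) (F n (i mod d)) n / \<delta> ^ (i div d)) \<longlonglongrightarrow> 0 / \<delta> ^ (i div d)"
      using fdiff_funpow_tendsto[of "\<lambda>n. F n (i mod d)" "\<lambda>n. n" "i div d - 1" 0, OF F1] \<delta> by (intro tendsto_divide tendsto_const) auto
    then show ?thesis using False supp01(2)[of i] by (cases "i < d * Suc R") (simp_all add: U_def del: mult_Suc_right)
  qed
  have "d \<le> d * Suc R" by simp
  then have "U n t i = 0" if "i \<ge> d * Suc R" for n t i using that by (simp add: U_def)
  then show ?thesis using lim0 lim1 traj unfolding R_def by (intro exI[of _ "\<lambda>n. U n 0"]) simp
qed

text \<open>Near time \<open>n\<close> the factor \<open>gpow\<close> can grow like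
  \<open>n ^ K\<close>, while the scalar factor is there of the order of the inverse of
  \<open>n ^ Suc K\<close> and outweighs it.\<close>

lemma steer_to_0:
  fixes a :: "nat \<Rightarrow> nat \<Rightarrow> 'k::real_normed_field"
  assumes nil: "nilpotent a d K" and K: "K > 0" and d: "d > 0" and \<delta>: "\<delta> \<noteq> 0" and supp: "\<And>i. i \<ge> d \<Longrightarrow> y i = 0"
    and N: "N = d * Suc (K + Suc K)"
  shows "\<exists>u. (\<forall>n i. i \<ge> N \<longrightarrow> u n i = 0) \<and> (\<forall>i. (\<lambda>n. u n i) \<longlonglongrightarrow> y i) \<and>
    (\<forall>n i. i \<ge> N \<longrightarrow> (step (chain a d \<delta>) N ^^ n) (u n) i = 0) \<and>
    (\<forall>i. (\<lambda>n. (step (chain a d \<delta>) N ^^ n) (u n) i) \<longlonglongrightarrow> 0)"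
proof -
  define q where "q n s = (1 - s / of_nat n) ^ Suc K" for n and s :: 'k
  have inv0: "(\<lambda>n. c / of_nat n :: 'k) \<longlonglongrightarrow> 0" for c
    using tendsto_mult[OF tendsto_const[of c] lim_inverse_n] by (simp add: divide_inverse)
  have q0: "(\<lambda>n. q n s) \<longlonglongrightarrow> 1" for s
  proof -
    have "(\<lambda>n. q n s) \<longlonglongrightarrow> (1 - 0) ^ Suc K" unfolding q_def by (intro tendsto_power tendsto_diff tendsto_const inv0)
    then show ?thesis by simp
  qed
  have q1: "q n (of_nat (n + j)) = (- of_nat j) ^ Suc K / of_nat n ^ Suc K" if "n > 0" for n j
  proof -
    have "1 - of_nat (n + j) / of_nat n = - of_nat j / (of_nat n :: 'k)" using that by (simp add: field_simps)
    then show ?thesis by (simp only: q_def power_divide)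
  qed
  show ?thesis
    unfolding N
  proof (rule steer_aux[OF nil d \<delta> supp, where Y="\<lambda>n t i. q n (of_nat t) * gpow a d K y (of_nat t) i" and \<alpha>="\<lambda>_. 1" and \<beta>="\<lambda>n. - inverse (of_nat n)" and \<gamma>="\<lambda>_. 0"
        and ?y0.0=y and ?y1.0="\<lambda>_. 0"])
    have qe: "(1 + - inverse (of_nat n) * s) ^ Suc K = q n s" for n and s :: 'k
      unfolding q_def by (simp only: divide_inverse diff_conv_add_uminus mult_minus_left mult_minus_right mult.commute)
    show "q n (of_nat t) * gpow a d K y (of_nat t) i = (1 + - inverse (of_nat n) * of_nat t) ^ Suc K * gpow a d K y (of_nat t + 0) i" for n t i
      unfolding qe by simp
    show "(\<lambda>n. ((1 + - inverse (of_nat n) * of_nat (Suc j)) ^ Suc K - (1 + - inverse (of_nat n) * of_nat j) ^ Suc K) *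
        gpow a d K y (of_nat (Suc j) + 0) i) \<longlonglongrightarrow> 0" for j i
    proof -
      have "(\<lambda>n. (q n (of_nat (Suc j)) - q n (of_nat j)) * gpow a d K y (of_nat (Suc j) + 0) i) \<longlonglongrightarrow> (1 - 1) * gpow a d K y (of_nat (Suc j) + 0) i"
        by (intro tendsto_mult tendsto_diff q0 tendsto_const)
      then show ?thesis unfolding qe by simp
    qed
    show "(\<lambda>n. ((1 + - inverse (of_nat n) * of_nat (Suc (n + j))) ^ Suc K - (1 + - inverse (of_nat n) * of_nat (n + j)) ^ Suc K) *
        gpow a d K y (of_nat (Suc (n + j)) + 0) i) \<longlonglongrightarrow> 0" for j i
    proof -
      have "(\<lambda>n. ((- of_nat (Suc j)) ^ Suc K - (- of_nat j) ^ Suc K) * (gpow a d K y (of_nat (n + Suc j) + 0) i / of_nat n ^ Suc K)) \<longlonglongrightarrow> 0"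
        using tendsto_mult[OF tendsto_const poly_fun_div_power[OF poly_fun_gpow[of a d K y 0 i], of "Suc K" "Suc j"]] by fastforce
      moreover have "\<forall>\<^sub>F n in sequentially. ((- of_nat (Suc j)) ^ Suc K - (- of_nat j) ^ Suc K) * (gpow a d K y (of_nat (n + Suc j) + 0) i / of_nat n ^ Suc K)
          = (q n (of_nat (Suc (n + j))) - q n (of_nat (n + j))) * gpow a d K y (of_nat (Suc (n + j)) + 0) i"
        using eventually_gt_at_top[of 0]
      proof eventually_elim
        case (elim n)
        show ?case using q1[OF elim, of "Suc j"] q1[OF elim, of j] by (simp only: add_Suc_right diff_divide_distrib[symmetric]) simp
      qed
      ultimately show ?thesis unfolding qe by (rule Lim_transform_eventually)
    qed
    show "(\<lambda>n. q n (of_nat 0) * gpow a d K y (of_nat 0) i) \<longlonglongrightarrow> y i" for i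
      using K by (simp add: q_def gpow_0)
    have "\<forall>\<^sub>F n in sequentially. q n (of_nat n) * gpow a d K y (of_nat n) i = 0" for i
      using eventually_gt_at_top[of 0] by eventually_elim (use q1[of _ 0] in simp)
    then show "(\<lambda>n. q n (of_nat n) * gpow a d K y (of_nat n) i) \<longlonglongrightarrow> 0" for i by (rule tendsto_eventually)
  qed (use supp in auto)
qed

text \<open>The unipotent motion is run backwards from \<open>y\<close>: the exponent
  \<open>t - n\<close> is negative before the end, which is why powers are defined through
  generalized binomial coefficients. The growth to be outweighed now occurs near time 0.\<close>

lemma steer_from_0:
  fixes a :: "nat \<Rightarrow> nat \<Rightarrow> 'k::real_normed_field"
  assumes nil: "nilpotent a d K" and K: "K > 0" and d: "d > 0" and \<delta>: "\<delta> \<noteq> 0" and supp: "\<And>i. i \<ge> d \<Longrightarrow> y i = 0"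
    and N: "N = d * Suc (K + Suc K)"
  shows "\<exists>u. (\<forall>n i. i \<ge> N \<longrightarrow> u n i = 0) \<and> (\<forall>i. (\<lambda>n. u n i) \<longlonglongrightarrow> 0) \<and>
    (\<forall>n i. i \<ge> N \<longrightarrow> (step (chain a d \<delta>) N ^^ n) (u n) i = 0) \<and>
    (\<forall>i. (\<lambda>n. (step (chain a d \<delta>) N ^^ n) (u n) i) \<longlonglongrightarrow> y i)"
proof -
  define q where "q n s = (s / of_nat n) ^ Suc K" for n and s :: 'k
  have inv0: "(\<lambda>n. c / of_nat n :: 'k) \<longlonglongrightarrow> 0" for c
    using tendsto_mult[OF tendsto_const[of c] lim_inverse_n] by (simp add: divide_inverse)
  have q1: "(\<lambda>n. q n (of_nat (n + j))) \<longlonglongrightarrow> 1" for j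
  proof -
    have "(\<lambda>n. (1 + of_nat j / of_nat n) ^ Suc K) \<longlonglongrightarrow> (1 + 0 :: 'k) ^ Suc K" by (intro tendsto_power tendsto_add tendsto_const inv0)
    moreover have "\<forall>\<^sub>F n in sequentially. (1 + of_nat j / of_nat n) ^ Suc K = q n (of_nat (n + j))"
      using eventually_gt_at_top[of 0]
    proof eventually_elim
      case (elim n)
      then have "1 + of_nat j / of_nat n = of_nat (n + j) / (of_nat n :: 'k)" by (simp add: field_simps)
      then show ?case by (simp only: q_def)
    qed
    ultimately have "(\<lambda>n. q n (of_nat (n + j))) \<longlonglongrightarrow> (1 + 0) ^ Suc K" by (rule Lim_transform_eventually)
    then show ?thesis by simp
  qed
  show ?thesis
    unfolding N
  proof (rule steer_aux[OF nil d \<delta> supp, where Y="\<lambda>n t i. q n (of_nat t) * gpow a d K y (of_nat t - of_nat n) i" and \<alpha>="\<lambda>_. 0" and \<beta>="\<lambda>n. inverse (of_nat n)" and \<gamma>="\<lambda>n. - of_nat n"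
        and ?y1.0=y and ?y0.0="\<lambda>_. 0"])
    have qe: "(0 + inverse (of_nat n) * s) ^ Suc K = q n s" for n and s :: 'k
      unfolding q_def by (simp only: divide_inverse add_0_left mult.commute)
    show "q n (of_nat t) * gpow a d K y (of_nat t - of_nat n) i = (0 + inverse (of_nat n) * of_nat t) ^ Suc K * gpow a d K y (of_nat t + - of_nat n) i" for n t i
      unfolding qe by simp
    show "(\<lambda>n. ((0 + inverse (of_nat n) * of_nat (Suc j)) ^ Suc K - (0 + inverse (of_nat n) * of_nat j) ^ Suc K) *
        gpow a d K y (of_nat (Suc j) + - of_nat n) i) \<longlonglongrightarrow> 0" for j i
    proof -
      have "(\<lambda>n. (of_nat (Suc j) ^ Suc K - of_nat j ^ Suc K) * (gpow a d K y (of_nat (Suc j) - of_nat (n + 0)) i / of_nat n ^ Suc K)) \<longlonglongrightarrow> 0"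
        using tendsto_mult[OF tendsto_const poly_fun_div_power[OF poly_fun_gpow_minus[of a d K y "of_nat (Suc j)" i], of "Suc K" 0]] by fastforce
      moreover have "(of_nat (Suc j) ^ Suc K - of_nat j ^ Suc K) * (gpow a d K y (of_nat (Suc j) - of_nat (n + 0)) i / of_nat n ^ Suc K)
          = (q n (of_nat (Suc j)) - q n (of_nat j)) * gpow a d K y (of_nat (Suc j) + - of_nat n) i" for n
        unfolding q_def power_divide by (simp add: diff_divide_distrib[symmetric])
      ultimately show ?thesis unfolding qe by (simp only:)
    qed
    show "(\<lambda>n. ((0 + inverse (of_nat n) * of_nat (Suc (n + j))) ^ Suc K - (0 + inverse (of_nat n) * of_nat (n + j)) ^ Suc K) *
        gpow a d K y (of_nat (Suc (n + j)) + - of_nat n) i) \<longlonglongrightarrow> 0" for j i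
    proof -
      have e: "of_nat (Suc (n + j)) + - of_nat n = (of_nat (Suc j) :: 'k)" for n by simp
      have "(\<lambda>n. (q n (of_nat (n + Suc j)) - q n (of_nat (n + j))) * gpow a d K y (of_nat (Suc j)) i) \<longlonglongrightarrow> (1 - 1) * gpow a d K y (of_nat (Suc j)) i"
        by (intro tendsto_mult tendsto_diff q1 tendsto_const)
      then show ?thesis unfolding qe e by simp
    qed
    show "(\<lambda>n. q n (of_nat 0) * gpow a d K y (of_nat 0 - of_nat n) i) \<longlonglongrightarrow> 0" for i
      by (simp add: q_def)
    show "(\<lambda>n. q n (of_nat n) * gpow a d K y (of_nat n - of_nat n) i) \<longlonglongrightarrow> y i" for i
      using tendsto_mult[OF q1[of 0] tendsto_const[of "y i"]] K by (simp add: gpow_0)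
  qed (use supp in auto)
qed

section \<open>A hypercyclic operator that is not mixing\<close>

text \<open>The library knows that \<open>'a \<Rightarrow>\<^sub>C 'b\<close> is complete only for metric domains.\<close>

instantiation nat :: metric_space
begin

definition dist_nat :: "nat \<Rightarrow> nat \<Rightarrow> real" where
  "dist_nat m n = \<bar>real m - real n\<bar>"

definition uniformity_nat :: "(nat \<times> nat) filter" where
  "uniformity_nat = (INF e\<in>{0<..}. principal {(x, y). dist x y < e})"

instance
proof
  show "(uniformity :: (nat \<times> nat) filter) = (INF e\<in>{0<..}. principal {(x, y). dist x y < e})"
    by (rule uniformity_nat_def)
  show "open U \<longleftrightarrow> (\<forall>x\<in>U. \<forall>\<^sub>F (x', y) in uniformity. x' = x \<longrightarrow> y \<in> U)" for U :: "nat set"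
  proof -
    have eq: "m = n" if "\<bar>real m - real n\<bar> < 1" for m n using that by linarith
    have "\<forall>\<^sub>F (x', y) in uniformity. x' = x \<longrightarrow> y \<in> U" if "x \<in> U" for x
      unfolding uniformity_nat_def
      by (rule eventually_INF1[of 1]) (use that eq in \<open>auto simp: eventually_principal dist_nat_def\<close>)
    then show ?thesis by (simp add: open_discrete)
  qed
qed (auto simp: dist_nat_def)

end

instance bcontfun :: (metric_space, banach) banach ..

text \<open>The centres of the nested balls are taken in \<open>C\<close>, so perturbations are only
  made at points of \<open>C\<close> while the common point lies in its closure. This fits
  \<open>nil_ops\<close>, where matrices can be perturbed but their sizes are unbounded.\<close>

lemma Baire_along:
  fixes C :: "'b::complete_space set" and W :: "nat \<Rightarrow> 'b set"
  assumes ne: "C \<noteq> {}" and op: "\<And>j. open (W j)"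
    and dense: "\<And>j c e. c \<in> C \<Longrightarrow> e > 0 \<Longrightarrow> \<exists>c'\<in>C. dist c' c < e \<and> c' \<in> W j"
  shows "\<exists>x\<in>closure C. \<forall>j. x \<in> W j"
proof -
  define A where "A = (\<lambda>(j::nat) (c, e). c \<in> C \<and> 0 < e \<and> e \<le> (1/2::real) ^ j)"
  define R where "R = (\<lambda>j (c, e) (c' :: 'b, e' :: real). cball c' e' \<subseteq> W j \<inter> cball c e)"
  have "\<exists>f. \<forall>j. A j (f j) \<and> R j (f j) (f (Suc j))"
  proof (rule dependent_nat_choice)
    obtain c where "c \<in> C" using ne by blast
    then show "\<exists>s. A 0 s" by (intro exI[of _ "(c, 1)"]) (simp add: A_def)
  next
    fix s j assume "A j s"
    then obtain c e where s: "s = (c, e)" and ce: "c \<in> C" "0 < e" "e \<le> (1/2) ^ j" by (cases s) (auto simp: A_def)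
    obtain c' where c': "c' \<in> C" "dist c' c < e / 2" "c' \<in> W j" using dense[OF ce(1), of "e / 2" j] ce(2) by auto
    obtain r where r: "r > 0" "ball c' r \<subseteq> W j" using op c'(3) openE by blast
    define e' where "e' = min (r / 2) (e / 2)"
    have "A (Suc j) (c', e')" using c' ce r by (simp add: A_def e'_def min_def)
    moreover have "cball c' e' \<subseteq> W j \<inter> cball c e"
    proof
      fix z assume z: "z \<in> cball c' e'"
      have "dist c' z < r" using z r by (simp add: e'_def)
      moreover have "dist c z \<le> e" using dist_triangle[of c z c'] z c'(2) by (simp add: e'_def dist_commute)
      ultimately show "z \<in> W j \<inter> cball c e" using r(2) by auto
    qed
    ultimately show "\<exists>s'. A (Suc j) s' \<and> R j s s'" by (intro exI[of _ "(c', e')"]) (simp add: R_def s)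
  qed
  then obtain f where f: "\<And>j. A j (f j)" "\<And>j. R j (f j) (f (Suc j))" by blast
  define c where "c j = fst (f j)" for j
  define e where "e j = snd (f j)" for j
  have Aj: "c j \<in> C" "0 < e j" "e j \<le> (1/2) ^ j" for j using f(1)[of j] by (auto simp: A_def c_def e_def case_prod_unfold)
  have Rj: "cball (c (Suc j)) (e (Suc j)) \<subseteq> W j \<inter> cball (c j) (e j)" for j
    using f(2)[of j] by (auto simp: R_def c_def e_def case_prod_unfold)
  have dec: "cball (c i) (e i) \<subseteq> cball (c j) (e j)" if "j \<le> i" for i j
    using that by (induction i rule: dec_induct) (use Rj in auto)
  have mem: "c i \<in> cball (c j) (e j)" if "j \<le> i" for i j using dec[OF that] Aj(2)[of i] by (meson centre_in_cball less_imp_le subsetD)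
  have "Cauchy c"
  proof (rule metric_CauchyI)
    fix d :: real assume "d > 0"
    then obtain N where N: "(1/2) ^ N < d / 2" using real_arch_pow_inv[of "d / 2" "1/2"] by auto
    have "dist (c m) (c n) < d" if "m \<ge> N" "n \<ge> N" for m n
      using mem[OF that(1)] mem[OF that(2)] dist_triangle[of "c m" "c n" "c N"] Aj(3)[of N] N by (simp add: dist_commute)
    then show "\<exists>N. \<forall>m\<ge>N. \<forall>n\<ge>N. dist (c m) (c n) < d" by blast
  qed
  then obtain l where l: "c \<longlonglongrightarrow> l" using Cauchy_convergent convergentD by blast
  have "l \<in> closure C" using l Aj(1) closure_sequential by blast
  moreover have "l \<in> W j" for j
  proof -
    have "l \<in> cball (c (Suc j)) (e (Suc j))"
    proof (rule Lim_in_closed_set[OF closed_cball])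
      show "\<forall>\<^sub>F i in sequentially. c i \<in> cball (c (Suc j)) (e (Suc j))"
        using eventually_ge_at_top[of "Suc j"] by eventually_elim (rule mem)
    qed (use l in auto)
    then show ?thesis using Rj by blast
  qed
  ultimately show ?thesis by blast
qed

lemma apply_Bcontfun_nat:
  fixes g :: "nat \<Rightarrow> 'k::metric_space"
  assumes "bounded (range g)" shows "apply_bcontfun (Bcontfun g) = g"
  using assms by (intro Bcontfun_inverse) (simp add: bcontfun_def)

lemma apply_Bcontfun_bound:
  fixes g :: "nat \<Rightarrow> 'k::real_normed_vector"
  assumes "\<And>n. norm (g n) \<le> K" shows "apply_bcontfun (Bcontfun g) = g"
  using assms by (intro apply_Bcontfun_nat) (auto simp: bounded_iff)

lemma ex_blinfun_bcontfun:
  fixes c :: "nat \<Rightarrow> 'e::real_normed_vector \<Rightarrow> 'k::real_normed_vector"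
  assumes add: "\<And>n y z. c n (y + z) = c n y + c n z" and scale: "\<And>n r y. c n (r *\<^sub>R y) = r *\<^sub>R c n y"
    and bound: "\<And>n y. norm (c n y) \<le> K * norm y"
  shows "\<exists>L :: 'e \<Rightarrow>\<^sub>L (nat \<Rightarrow>\<^sub>C 'k). \<forall>y n. apply_bcontfun (blinfun_apply L y) n = c n y"
proof -
  define F where "F y = Bcontfun (\<lambda>n. c n y)" for y
  have F: "apply_bcontfun (F y) n = c n y" for y n
    unfolding F_def using apply_Bcontfun_bound[of "\<lambda>n. c n y", OF bound] by simp
  have "bounded_linear F"
  proof (rule bounded_linear_intro)
    show "F (y + z) = F y + F z" for y z by (rule bcontfun_eqI) (simp add: F add)
    show "F (r *\<^sub>R y) = r *\<^sub>R F y" for r y by (rule bcontfun_eqI) (simp add: F scale)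
    show "norm (F y) \<le> norm y * K" for y by (rule norm_bound) (use bound in \<open>simp add: F mult.commute\<close>)
  qed
  then show ?thesis using F by (intro exI[of _ "Blinfun F"]) (simp add: bounded_linear_Blinfun_apply)
qed

primrec pw :: "('e::real_normed_vector \<Rightarrow>\<^sub>L 'e) \<Rightarrow> nat \<Rightarrow> 'e \<Rightarrow>\<^sub>L 'e" where
  "pw T 0 = id_blinfun"
| "pw T (Suc n) = T o\<^sub>L pw T n"

lemma continuous_pw: "continuous_on S g \<Longrightarrow> continuous_on S (\<lambda>x. pw (g x) n)"
  by (induction n) (auto intro!: continuous_intros bounded_bilinear.continuous_on[OF bounded_bilinear_blinfun_compose])

lemma nilpotent_Suc: "nilpotent a d K \<Longrightarrow> nilpotent a d (Suc K)"
  by (simp add: nilpotent_def act_def fun_eq_iff)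

lemma act_pairing:
  "(\<Sum>n<N. \<phi> n * act a N y n) = (\<Sum>m<N. act (\<lambda>n m. a m n) N \<phi> m * y m)"
proof -
  have "(\<Sum>n<N. \<phi> n * act a N y n) = (\<Sum>n<N. \<Sum>m<N. \<phi> n * (a n m * y m))"
    by (simp add: act_def sum_distrib_left)
  also have "\<dots> = (\<Sum>m<N. \<Sum>n<N. \<phi> n * (a n m * y m))" by (rule sum.swap)
  also have "\<dots> = (\<Sum>m<N. act (\<lambda>n m. a m n) N \<phi> m * y m)"
  proof (rule sum.cong[OF refl])
    fix m assume "m \<in> {..<N}"
    then have "act (\<lambda>n m. a m n) N \<phi> m * y m = (\<Sum>n<N. a n m * \<phi> n * y m)"
      by (simp add: act_def sum_distrib_right)
    then show "(\<Sum>n<N. \<phi> n * (a n m * y m)) = act (\<lambda>n m. a m n) N \<phi> m * y m" by (simp add: mult_ac)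
  qed
  finally show ?thesis .
qed

text \<open>By duality the \<open>K\<close>-th power of the transpose vanishes on the first
  \<open>d\<close> coordinates. One more step clears the remaining ones, which matters when
  \<open>K = 0\<close>.\<close>

lemma nilpotent_transpose:
  assumes "nilpotent a d K" shows "nilpotent (\<lambda>n m. a m n) d (Suc K)"
proof -
  let ?B = "act (\<lambda>n m. a m n) d"
  have pair: "(\<Sum>n<d. \<phi> n * (act a d ^^ k) y n) = (\<Sum>n<d. (?B ^^ k) \<phi> n * y n)" for k \<phi> y
  proof (induction k arbitrary: \<phi>)
    case (Suc k)
    have "(\<Sum>n<d. \<phi> n * (act a d ^^ Suc k) y n) = (\<Sum>n<d. ?B \<phi> n * (act a d ^^ k) y n)"
      by (simp add: act_pairing)
    then show ?case using Suc by (simp add: funpow_swap1)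
  qed simp
  have zero: "(?B ^^ K) \<phi> m = 0" if "m < d" for \<phi> m
  proof -
    have "(\<Sum>n<d. (?B ^^ K) \<phi> n * (if n = m then 1 else 0)) = (\<Sum>n<d. \<phi> n * (act a d ^^ K) (\<lambda>n. if n = m then 1 else 0) n)"
      by (rule pair[symmetric])
    also have "\<dots> = 0" using assms by (simp add: nilpotent_def)
    finally show ?thesis using that by (simp add: if_distrib cong: if_cong)
  qed
  have "?B ((?B ^^ K) \<phi>) = (\<lambda>_. 0)" for \<phi>
    using zero by (auto simp: act_def fun_eq_iff)
  then show ?thesis by (simp add: nilpotent_def)
qed

lemma norm_bcontfun_le_sum:
  fixes z :: "nat \<Rightarrow>\<^sub>C 'k::real_normed_vector"
  assumes "\<And>k. k \<ge> N \<Longrightarrow> apply_bcontfun z k = 0"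
  shows "norm z \<le> (\<Sum>k<N. norm (apply_bcontfun z k))"
proof (rule norm_bound)
  fix k
  show "norm (apply_bcontfun z k) \<le> (\<Sum>k<N. norm (apply_bcontfun z k))"
    using assms[of k] by (cases "k < N") (auto intro: member_le_sum sum_nonneg)
qed

context biorthogonal_space
begin

definition diag :: "(nat \<Rightarrow>\<^sub>C 'k) \<Rightarrow>\<^sub>L (nat \<Rightarrow>\<^sub>C 'k)" where
  "diag = (SOME L. \<forall>y n. apply_bcontfun (blinfun_apply L y) n = of_real (w n) * apply_bcontfun y n)"

lemma diag_apply: "apply_bcontfun (blinfun_apply diag y) n = of_real (w n) * apply_bcontfun y n"
proof -
  have "\<exists>L :: (nat \<Rightarrow>\<^sub>C 'k) \<Rightarrow>\<^sub>L (nat \<Rightarrow>\<^sub>C 'k). \<forall>y n. apply_bcontfun (blinfun_apply L y) n = of_real (w n) * apply_bcontfun y n"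
  proof (rule ex_blinfun_bcontfun[where K=1])
    show "norm (of_real (w n) * apply_bcontfun y n :: 'k) \<le> 1 * norm y" for n and y :: "nat \<Rightarrow>\<^sub>C 'k"
      unfolding norm_mult norm_of_real using w_pos[of n] w_le_1[of n] by (intro mult_mono norm_bounded) auto
  qed (simp_all add: distrib_left)
  from someI_ex[OF this] show ?thesis unfolding diag_def by blast
qed

definition mult_op :: "'k \<Rightarrow> (nat \<Rightarrow>\<^sub>C 'k) \<Rightarrow>\<^sub>L (nat \<Rightarrow>\<^sub>C 'k)" where
  "mult_op c = (SOME L. \<forall>y n. apply_bcontfun (blinfun_apply L y) n = c * apply_bcontfun y n)"

lemma mult_op_apply: "apply_bcontfun (blinfun_apply (mult_op c) y) n = c * apply_bcontfun y n"
proof -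
  have "\<exists>L :: (nat \<Rightarrow>\<^sub>C 'k) \<Rightarrow>\<^sub>L (nat \<Rightarrow>\<^sub>C 'k). \<forall>y n. apply_bcontfun (blinfun_apply L y) n = c * apply_bcontfun y n"
  proof (rule ex_blinfun_bcontfun[where K="norm c"])
    show "norm (c * apply_bcontfun y n) \<le> norm c * norm y" for n and y :: "nat \<Rightarrow>\<^sub>C 'k"
      unfolding norm_mult by (intro mult_left_mono norm_bounded) auto
  qed (simp_all add: distrib_left)
  from someI_ex[OF this] show ?thesis unfolding mult_op_def by blast
qed

text \<open>The division by \<open>w n\<close> cancels the weight in \<open>diag\<close>, so that
  \<open>hat (mat_op a d)\<close> acts on coordinates as \<open>1 + a\<close>. It is harmless
  because only \<open>d\<close> rows are nonzero.\<close>

definition mat_op :: "(nat \<Rightarrow> nat \<Rightarrow> 'k) \<Rightarrow> nat \<Rightarrow> (nat \<Rightarrow>\<^sub>C 'k) \<Rightarrow>\<^sub>L (nat \<Rightarrow>\<^sub>C 'k)" where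
  "mat_op a d = (SOME L. \<forall>y n. apply_bcontfun (blinfun_apply L y) n = act a d (apply_bcontfun y) n / of_real (w n))"

lemma mat_op_apply: "apply_bcontfun (blinfun_apply (mat_op a d) y) n = act a d (apply_bcontfun y) n / of_real (w n)"
proof -
  define K where "K = (\<Sum>n<d. (\<Sum>m<d. norm (a n m)) / w n)"
  have "\<exists>L :: (nat \<Rightarrow>\<^sub>C 'k) \<Rightarrow>\<^sub>L (nat \<Rightarrow>\<^sub>C 'k). \<forall>y n. apply_bcontfun (blinfun_apply L y) n = act a d (apply_bcontfun y) n / of_real (w n)"
  proof (rule ex_blinfun_bcontfun[where K=K])
    have Kn: "(\<Sum>m<d. norm (a n m)) / w n \<le> K" if "n < d" for n
      unfolding K_def using that w_pos by (intro member_le_sum) (auto intro!: divide_nonneg_pos sum_nonneg)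
    have K0: "K \<ge> 0" unfolding K_def using w_pos by (auto intro!: sum_nonneg divide_nonneg_pos)
    show "norm (act a d (apply_bcontfun y) n / of_real (w n)) \<le> K * norm y" for n and y :: "nat \<Rightarrow>\<^sub>C 'k"
    proof (cases "n < d")
      case True
      have "norm (act a d (apply_bcontfun y) n) \<le> (\<Sum>m<d. norm (a n m * apply_bcontfun y m))"
        using True by (simp add: act_def norm_sum)
      also have "\<dots> \<le> (\<Sum>m<d. norm (a n m) * norm y)"
        unfolding norm_mult by (intro sum_mono mult_left_mono norm_bounded) auto
      also have "\<dots> = (\<Sum>m<d. norm (a n m)) * norm y" by (simp add: sum_distrib_right)
      finally have "norm (act a d (apply_bcontfun y) n) / w n \<le> (\<Sum>m<d. norm (a n m)) / w n * norm y"
        using w_pos[of n] by (simp add: divide_right_mono)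
      also have "\<dots> \<le> K * norm y" using Kn[OF True] by (intro mult_right_mono) auto
      finally show ?thesis using w_pos[of n] by (simp add: norm_divide)
    next
      case False
      then show ?thesis using K0 by (simp add: act_def)
    qed
  qed (auto simp: act_def sum.distrib distrib_left add_divide_distrib scaleR_conv_of_real sum_distrib_left mult_ac)
  from someI_ex[OF this] show ?thesis unfolding mat_op_def by blast
qed

definition coord0 :: "(nat \<Rightarrow>\<^sub>C 'k) \<Rightarrow>\<^sub>L 'k" where
  "coord0 = Blinfun (\<lambda>y. apply_bcontfun y 0)"

lemma coord0_apply: "blinfun_apply coord0 y = apply_bcontfun y 0"
proof -
  have "bounded_linear (\<lambda>y :: nat \<Rightarrow>\<^sub>C 'k. apply_bcontfun y 0)"
    by (rule bounded_linear_intro[where K=1]) (auto simp: norm_bounded)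
  then show ?thesis by (simp add: coord0_def bounded_linear_Blinfun_apply)
qed

text \<open>With \<open>D = diag\<close>, \<open>hat L = 1 + D L\<close> acts on coordinates, \<open>chk L = 1 + L D\<close> on coefficients with respect
  to \<open>b\<close>; both represent the same operator on the space, and \<open>D (chk L) = (hat L) D\<close>.\<close>

definition hat :: "((nat \<Rightarrow>\<^sub>C 'k) \<Rightarrow>\<^sub>L (nat \<Rightarrow>\<^sub>C 'k)) \<Rightarrow> (nat \<Rightarrow>\<^sub>C 'k) \<Rightarrow>\<^sub>L (nat \<Rightarrow>\<^sub>C 'k)" where
  "hat L = id_blinfun + (diag o\<^sub>L L)"

definition chk :: "((nat \<Rightarrow>\<^sub>C 'k) \<Rightarrow>\<^sub>L (nat \<Rightarrow>\<^sub>C 'k)) \<Rightarrow> (nat \<Rightarrow>\<^sub>C 'k) \<Rightarrow>\<^sub>L (nat \<Rightarrow>\<^sub>C 'k)" where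
  "chk L = id_blinfun + (L o\<^sub>L diag)"

lemma w_nz: "of_real (w n) \<noteq> (0 :: 'k)"
  and w_neq_0: "w n \<noteq> 0"
  using less_imp_neq[OF w_pos[of n]] by simp_all

lemma hat_mat_op: "apply_bcontfun (blinfun_apply (pw (hat (mat_op a d)) n) y) = (step a d ^^ n) (apply_bcontfun y)"
proof (induction n)
  case (Suc n)
  have "apply_bcontfun (blinfun_apply (hat (mat_op a d)) z) = step a d (apply_bcontfun z)" for z
    by (rule ext) (simp add: hat_def blinfun.add_left diag_apply mat_op_apply step_def w_neq_0)
  then show ?case using Suc by simp
qed simp

lemma chk_mat_op: "(\<lambda>k. of_real (w k) * apply_bcontfun (blinfun_apply (pw (chk (mat_op a d)) n) y) k)
    = (step a d ^^ n) (\<lambda>k. of_real (w k) * apply_bcontfun y k)"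
proof (induction n)
  case (Suc n)
  have "(\<lambda>k. of_real (w k) * apply_bcontfun (blinfun_apply (chk (mat_op a d)) z) k) = step a d (\<lambda>k. of_real (w k) * apply_bcontfun z k)" for z
  proof
    fix k
    have "apply_bcontfun (blinfun_apply diag z) = (\<lambda>k. of_real (w k) * apply_bcontfun z k)" by (rule ext) (rule diag_apply)
    then show "of_real (w k) * apply_bcontfun (blinfun_apply (chk (mat_op a d)) z) k = step a d (\<lambda>k. of_real (w k) * apply_bcontfun z k) k"
      by (simp add: chk_def blinfun.add_left mat_op_apply step_def distrib_left w_neq_0)
  qed
  then show ?case using Suc by simp
qed simp

definition nil_ops :: "((nat \<Rightarrow>\<^sub>C 'k) \<Rightarrow>\<^sub>L (nat \<Rightarrow>\<^sub>C 'k)) set" where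
  "nil_ops = {mat_op a d | a d K. nilpotent a d K}"

definition e :: "nat \<Rightarrow> nat \<Rightarrow>\<^sub>C 'k" where
  "e i = Bcontfun (\<lambda>n. if n = i then 1 else 0)"

lemma e_apply: "apply_bcontfun (e i) n = (if n = i then 1 else 0)"
  unfolding e_def by (subst apply_Bcontfun_bound[of _ 1]) auto

text \<open>The first set expresses transitivity between finite combinations of the \<open>b i\<close>; the second,
  that a fixed small neighbourhood of the functional \<open>f 0\<close> recurs to the unit ball of the dual.\<close>

definition trans_set :: "nat \<Rightarrow> ((nat \<Rightarrow>\<^sub>C 'k) \<Rightarrow>\<^sub>L (nat \<Rightarrow>\<^sub>C 'k)) set" where
  "trans_set N = (\<Union>n. \<Inter>i\<in>{..N}. \<Union>u\<in>ball (e i) (1 / real (Suc N)). \<Union>u'\<in>ball 0 (1 / real (Suc N)).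
     {L. norm (blinfun_apply (pw (chk L) n) u) < 1 / real (Suc N)} \<inter>
     {L. norm (blinfun_apply (pw (chk L) n) u' - e i) < 1 / real (Suc N)})"

definition rec_set :: "nat \<Rightarrow> ((nat \<Rightarrow>\<^sub>C 'k) \<Rightarrow>\<^sub>L (nat \<Rightarrow>\<^sub>C 'k)) set" where
  "rec_set j = (\<Union>m\<in>{j..}. \<Union>\<Phi>\<in>ball coord0 (1/2). {L. norm (\<Phi> o\<^sub>L pw (hat L) m) < 1})"

lemma continuous_chk: "continuous_on UNIV chk" and continuous_hat: "continuous_on UNIV hat"
  unfolding chk_def[abs_def] hat_def[abs_def]
  by (intro continuous_intros bounded_bilinear.continuous_on[OF bounded_bilinear_blinfun_compose])+

lemma open_trans_set: "open (trans_set N)"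
proof -
  have "open {L. norm (blinfun_apply (pw (chk L) n) u - z) < r}" for n u z and r :: real
    by (intro open_Collect_less continuous_intros blinfun.continuous_on continuous_pw continuous_chk)
  from this[of _ _ 0] this show ?thesis
    unfolding trans_set_def by (intro open_UN ballI open_INT open_Int) auto
qed

lemma open_rec_set: "open (rec_set j)"
proof -
  have "open {L. norm (\<Phi> o\<^sub>L pw (hat L) m) < 1}" for \<Phi> :: "(nat \<Rightarrow>\<^sub>C 'k) \<Rightarrow>\<^sub>L 'k" and m
    by (intro open_Collect_less continuous_intros bounded_bilinear.continuous_on[OF bounded_bilinear_blinfun_compose] continuous_pw continuous_hat)
  then show ?thesis unfolding rec_set_def by (intro open_UN ballI) auto
qed

text \<open>Padding with zeros makes room for the coordinates that a given condition
  involves.\<close>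

lemma mat_op_enlarge:
  assumes nil: "nilpotent a d K" and "d \<le> d'"
  obtains a' where "nilpotent a' d' K" "mat_op a' d' = mat_op a d"
proof -
  define a' where "a' n m = (if n < d \<and> m < d then a n m else 0)" for n m
  have "act a' d' y = act a d y" for y
  proof
    fix n
    have *: "(\<Sum>m<d'. a' n m * y m) = (\<Sum>m<d. a' n m * y m)"
      using assms(2) by (intro sum.mono_neutral_right) (auto simp: a'_def)
    show "act a' d' y n = act a d y n"
      unfolding act_def * using assms(2) by (auto simp: a'_def)
  qed
  then have eq: "act a' d' = act a d" by (rule ext)
  have "mat_op a' d' = mat_op a d" by (simp add: mat_op_def eq)
  moreover have "nilpotent a' d' K" using nil by (simp add: nilpotent_def eq)
  ultimately show ?thesis by (rule that[rotated])
qed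

text \<open>In both perturbations a row changes by at most one entry \<open>\<delta>\<close>, in
  column \<open>g n\<close>; the sum of the \<open>1 / w n\<close> pays for the division in
  \<open>mat_op\<close>.\<close>

lemma norm_mat_op_diff:
  assumes "\<And>y n. norm (act a' N y n - act a d y n) \<le> (if n < N then \<delta> * norm (y (g n)) else 0)" and \<delta>: "\<delta> \<ge> 0"
  shows "norm (mat_op a' N - mat_op a d) \<le> \<delta> * (\<Sum>n<N. 1 / w n)"
proof (rule norm_blinfun_bound)
  show "0 \<le> \<delta> * (\<Sum>n<N. 1 / w n)" using \<delta> less_imp_le[OF w_pos] by (intro mult_nonneg_nonneg sum_nonneg) auto
  fix y :: "nat \<Rightarrow>\<^sub>C 'k"
  have W: "1 / w n \<le> (\<Sum>n<N. 1 / w n)" if "n < N" for n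
    using that less_imp_le[OF w_pos] by (intro member_le_sum) auto
  show "norm (blinfun_apply (mat_op a' N - mat_op a d) y) \<le> \<delta> * (\<Sum>n<N. 1 / w n) * norm y"
  proof (rule norm_bound)
    fix n
    have "norm (apply_bcontfun (blinfun_apply (mat_op a' N - mat_op a d) y) n)
        = norm (act a' N (apply_bcontfun y) n - act a d (apply_bcontfun y) n) / w n"
      using w_pos[of n] by (simp add: blinfun.diff_left mat_op_apply norm_divide flip: diff_divide_distrib)
    also have "\<dots> \<le> (if n < N then \<delta> * norm (apply_bcontfun y (g n)) else 0) / w n"
      using assms(1) less_imp_le[OF w_pos] by (intro divide_right_mono) auto
    also have "\<dots> \<le> \<delta> * (\<Sum>n<N. 1 / w n) * norm y"
    proof (cases "n < N")
      case True
      have "\<delta> * norm (apply_bcontfun y (g n)) / w n \<le> \<delta> * (1 / w n) * norm y"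
        using \<delta> less_imp_le[OF w_pos[of n]] norm_bounded[of y "g n"] by (simp add: divide_right_mono mult_left_mono)
      also have "\<dots> \<le> \<delta> * (\<Sum>n<N. 1 / w n) * norm y"
        using W[OF True] \<delta> by (intro mult_right_mono mult_left_mono) auto
      finally show ?thesis using True by simp
    next
      case False
      then show ?thesis using \<delta> less_imp_le[OF w_pos] by (auto intro!: mult_nonneg_nonneg sum_nonneg)
    qed
    finally show "norm (apply_bcontfun (blinfun_apply (mat_op a' N - mat_op a d) y) n) \<le> \<delta> * (\<Sum>n<N. 1 / w n) * norm y" .
  qed
qed

lemma ex_small_delta:
  assumes "r > 0"
  obtains \<delta> :: real where "\<delta> > 0" "\<delta> * (\<Sum>n<N. 1 / w n) < r"
proof -
  define W where "W = (\<Sum>n<N. 1 / w n)"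
  have W: "W \<ge> 0" unfolding W_def using less_imp_le[OF w_pos] by (intro sum_nonneg) auto
  have "r / (W + 1) * W < r / (W + 1) * (W + 1)" using assms W by (intro mult_strict_left_mono) auto
  then show ?thesis using assms W by (intro that[of "r / (W + 1)"]) (auto simp: W_def[symmetric])
qed

lemma eventually_norm_bcontfun_less:
  fixes z :: "nat \<Rightarrow> nat \<Rightarrow>\<^sub>C 'k"
  assumes "\<And>n k. k \<ge> N \<Longrightarrow> apply_bcontfun (z n) k = 0" "\<And>k. (\<lambda>n. apply_bcontfun (z n) k) \<longlonglongrightarrow> 0" "r > 0"
  shows "\<forall>\<^sub>F n in sequentially. norm (z n) < r"
proof -
  have "(\<lambda>n. \<Sum>k<N. norm (apply_bcontfun (z n) k)) \<longlonglongrightarrow> (\<Sum>k<N. 0)"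
    using assms(2) by (intro tendsto_sum tendsto_norm_zero)
  then have "\<forall>\<^sub>F n in sequentially. (\<Sum>k<N. norm (apply_bcontfun (z n) k)) < r" using assms(3) by (intro order_tendstoD(2)) auto
  then show ?thesis by (rule eventually_mono) (use norm_bcontfun_le_sum[OF assms(1)] in \<open>auto intro: le_less_trans\<close>)
qed

text \<open>The matrix is padded until its block contains the coordinates up to \<open>Q\<close>,
  and is coupled to a chain with small \<open>\<delta>\<close>. Steering to 0 and from 0 provides
  the two families of vectors that \<open>trans_set\<close> asks for.\<close>

lemma trans_set_dense:
  assumes "L \<in> nil_ops" "r > 0"
  shows "\<exists>L'\<in>nil_ops. dist L' L < r \<and> L' \<in> trans_set Q"
proof -
  obtain a0 d0 K0 where "nilpotent a0 d0 K0" "L = mat_op a0 d0" using assms(1) by (auto simp: nil_ops_def)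
  then obtain a where nil: "nilpotent a (max d0 (Suc Q)) (Suc K0)" and L: "mat_op a (max d0 (Suc Q)) = L"
    using mat_op_enlarge[OF nilpotent_Suc, of a0 d0 K0 "max d0 (Suc Q)"] by (metis max.cobounded1)
  define d where "d = max d0 (Suc Q)"
  define K where "K = Suc K0"
  have nil: "nilpotent a d K" and L: "L = mat_op a d" and d: "d > Q" "d > 0" and K: "K > 0"
    using nil L by (auto simp: d_def K_def)
  define N where "N = d * Suc (K + Suc K)"
  have dN: "d \<le> N" by (simp add: N_def)
  obtain \<delta> where \<delta>: "\<delta> > 0" "\<delta> * (\<Sum>n<N. 1 / w n) < r" using ex_small_delta[OF assms(2)] by blast
  define a' where "a' = chain a d (of_real \<delta>)"
  have a'nil: "nilpotent a' N (K + (K + Suc K))" unfolding a'_def N_def using nil d(2) by (rule nilpotent_chain)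
  have dist: "dist (mat_op a' N) L < r"
  proof -
    have "norm (mat_op a' N - mat_op a d) \<le> \<delta> * (\<Sum>n<N. 1 / w n)"
    proof (rule norm_mat_op_diff[where g="\<lambda>n. n + d"])
      show "norm (act a' N y n - act a d y n) \<le> (if n < N then \<delta> * norm (y (n + d)) else 0)" for y n
        unfolding a'_def act_chain[OF dN] using \<delta>(1) by (auto simp: norm_mult)
    qed (use \<delta> in simp)
    then show ?thesis using \<delta>(2) by (simp add: dist_norm L)
  qed
  define \<epsilon> where "\<epsilon> = 1 / real (Suc Q)"
  have \<epsilon>: "\<epsilon> > 0" by (simp add: \<epsilon>_def)
  \<comment> \<open>\<open>chk\<close> acts on coefficients, and multiplication by the weights turns
    it into \<open>step\<close>. So \<open>e i\<close> is steered in weighted form, and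
    \<open>lift\<close> leads back.\<close>
  define y where "y i k = of_real (w k) * apply_bcontfun (e i) k" for i k
  have ysupp: "y i k = 0" if "i \<le> Q" "k \<ge> d" for i k using that d(1) by (auto simp: y_def e_apply)
  have \<delta>0: "of_real \<delta> \<noteq> (0 :: 'k)" using \<delta>(1) by simp
  define lift where "lift u = Bcontfun (\<lambda>k. u k / of_real (w k))" for u :: "nat \<Rightarrow> 'k"
  have lift: "apply_bcontfun (lift u) k = u k / of_real (w k)" if "\<And>k. k \<ge> N \<Longrightarrow> u k = 0" for u k
  proof -
    have "norm (u k / of_real (w k)) \<le> (\<Sum>k<N. norm (u k / of_real (w k)))" for k
      using that[of k] by (cases "k < N") (auto intro: member_le_sum sum_nonneg)
    then show ?thesis unfolding lift_def by (subst apply_Bcontfun_bound[of _ "\<Sum>k<N. norm (u k / of_real (w k))"]) auto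
  qed
  have pwl: "of_real (w k) * apply_bcontfun (blinfun_apply (pw (chk (mat_op a' N)) n) (lift u)) k = (step a' N ^^ n) u k"
    if "\<And>k. k \<ge> N \<Longrightarrow> u k = 0" for n u k
  proof -
    have "(\<lambda>k. of_real (w k) * apply_bcontfun (lift u) k) = u" by (rule ext) (simp add: lift[OF that] w_neq_0)
    then show ?thesis using fun_cong[OF chk_mat_op[of a' N n "lift u"], of k] by simp
  qed
  have close: "\<forall>\<^sub>F n in sequentially. norm (z n - e') < \<epsilon>"
    if "\<And>n k. of_real (w k) * apply_bcontfun (z n) k = v n k" "\<And>n k. k \<ge> N \<Longrightarrow> v n k = 0"
      "\<And>k. k \<ge> N \<Longrightarrow> apply_bcontfun e' k = 0" "\<And>k. (\<lambda>n. v n k) \<longlonglongrightarrow> of_real (w k) * apply_bcontfun e' k"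
    for z :: "nat \<Rightarrow> nat \<Rightarrow>\<^sub>C 'k" and e' v
  proof (rule eventually_norm_bcontfun_less[OF _ _ \<epsilon>])
    have z: "apply_bcontfun (z n) k = v n k / of_real (w k)" for n k
      using that(1)[of k n] by (simp add: w_neq_0 field_simps)
    show "apply_bcontfun (z n - e') k = 0" if "k \<ge> N" for n k
      using z \<open>\<And>n k. k \<ge> N \<Longrightarrow> v n k = 0\<close> \<open>\<And>k. k \<ge> N \<Longrightarrow> apply_bcontfun e' k = 0\<close> that by simp
    fix k
    have "(\<lambda>n. v n k / of_real (w k) - apply_bcontfun e' k) \<longlonglongrightarrow> of_real (w k) * apply_bcontfun e' k / of_real (w k) - apply_bcontfun e' k"
      by (intro tendsto_diff tendsto_divide that(4) tendsto_const) (simp add: w_neq_0)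
    then show "(\<lambda>n. apply_bcontfun (z n - e') k) \<longlonglongrightarrow> 0" by (simp add: z w_neq_0)
  qed
  have e0: "apply_bcontfun (e i) k = 0" if "i \<le> Q" "k \<ge> N" for i k using that d(1) dN by (auto simp: e_apply)
  define good where "good n i \<longleftrightarrow> (\<exists>u u'. norm (u - e i) < \<epsilon> \<and> norm u' < \<epsilon> \<and> norm (blinfun_apply (pw (chk (mat_op a' N)) n) u) < \<epsilon> \<and>
      norm (blinfun_apply (pw (chk (mat_op a' N)) n) u' - e i) < \<epsilon>)" for n i
  have "\<forall>\<^sub>F n in sequentially. good n i" if i: "i \<le> Q" for i
  proof -
    obtain u where u: "\<And>n k. k \<ge> N \<Longrightarrow> u n k = 0" "\<And>k. (\<lambda>n. u n k) \<longlonglongrightarrow> y i k"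
      "\<And>n k. k \<ge> N \<Longrightarrow> (step a' N ^^ n) (u n) k = 0" "\<And>k. (\<lambda>n. (step a' N ^^ n) (u n) k) \<longlonglongrightarrow> 0"
      using steer_to_0[where y="y i", OF nil K d(2) \<delta>0 ysupp[OF i] N_def] unfolding a'_def by blast
    obtain u' where u': "\<And>n k. k \<ge> N \<Longrightarrow> u' n k = 0" "\<And>k. (\<lambda>n. u' n k) \<longlonglongrightarrow> 0"
      "\<And>n k. k \<ge> N \<Longrightarrow> (step a' N ^^ n) (u' n) k = 0" "\<And>k. (\<lambda>n. (step a' N ^^ n) (u' n) k) \<longlonglongrightarrow> y i k"
      using steer_from_0[where y="y i", OF nil K d(2) \<delta>0 ysupp[OF i] N_def] unfolding a'_def by blast
    have "\<forall>\<^sub>F n in sequentially. norm (lift (u n) - e i) < \<epsilon>"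
      by (rule close[where v=u]) (use u e0[OF i] in \<open>auto simp: lift y_def w_neq_0\<close>)
    moreover have "\<forall>\<^sub>F n in sequentially. norm (lift (u' n) - 0) < \<epsilon>"
      by (rule close[where v=u']) (use u' in \<open>auto simp: lift w_neq_0\<close>)
    moreover have "\<forall>\<^sub>F n in sequentially. norm (blinfun_apply (pw (chk (mat_op a' N)) n) (lift (u n)) - 0) < \<epsilon>"
      by (rule close[where v="\<lambda>n. (step a' N ^^ n) (u n)"]) (use u in \<open>auto simp: pwl\<close>)
    moreover have "\<forall>\<^sub>F n in sequentially. norm (blinfun_apply (pw (chk (mat_op a' N)) n) (lift (u' n)) - e i) < \<epsilon>"
      by (rule close[where v="\<lambda>n. (step a' N ^^ n) (u' n)"]) (use u' e0[OF i] in \<open>auto simp: pwl y_def\<close>)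
    ultimately show ?thesis
    proof eventually_elim
      case (elim n)
      then show ?case unfolding good_def by (intro exI[of _ "lift (u n)"] exI[of _ "lift (u' n)"]) simp
    qed
  qed
  \<comment> \<open>Steering succeeds at all late times, so one \<open>n\<close> serves all
    \<open>i \<le> Q\<close>; a common \<open>n\<close> is what allows linear combinations to be
    moved later.\<close>
  then have "\<forall>\<^sub>F n in sequentially. \<forall>i\<in>{..Q}. good n i" by (intro eventually_ball_finite) auto
  then obtain n where n: "\<And>i. i \<le> Q \<Longrightarrow> good n i" unfolding eventually_sequentially by auto
  have "mat_op a' N \<in> trans_set Q"
    unfolding trans_set_def
  proof (rule UN_I[of n], simp, rule INT_I)
    fix i assume "i \<in> {..Q}"
    then have "good n i" using n by simp
    then obtain u u' where uu: "norm (u - e i) < \<epsilon>" "norm u' < \<epsilon>" "norm (blinfun_apply (pw (chk (mat_op a' N)) n) u) < \<epsilon>"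
      "norm (blinfun_apply (pw (chk (mat_op a' N)) n) u' - e i) < \<epsilon>" unfolding good_def by blast
    then have "u \<in> ball (e i) (1 / real (Suc Q))" "u' \<in> ball 0 (1 / real (Suc Q))"
      unfolding \<epsilon>_def by (auto simp: dist_norm norm_minus_commute simp del: of_nat_Suc)
    then show "mat_op a' N \<in> (\<Union>u\<in>ball (e i) (1 / real (Suc Q)). \<Union>u'\<in>ball 0 (1 / real (Suc Q)).
        {L. norm (blinfun_apply (pw (chk L) n) u) < 1 / real (Suc Q)} \<inter>
        {L. norm (blinfun_apply (pw (chk L) n) u' - e i) < 1 / real (Suc Q)})"
      using uu(3,4) unfolding \<epsilon>_def by blast
  qed
  moreover have "mat_op a' N \<in> nil_ops" using a'nil by (auto simp: nil_ops_def)
  ultimately show ?thesis using dist by blast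
qed

lemma ex_row_functional:
  assumes "\<And>k. k \<ge> N \<Longrightarrow> \<phi> k = 0"
  obtains \<Phi> :: "(nat \<Rightarrow>\<^sub>C 'k) \<Rightarrow>\<^sub>L 'k" where "\<And>y. blinfun_apply \<Phi> y = (\<Sum>k<N. \<phi> k * apply_bcontfun y k)"
proof -
  have "bounded_linear (\<lambda>y :: nat \<Rightarrow>\<^sub>C 'k. \<Sum>k<N. \<phi> k * apply_bcontfun y k)"
  proof (rule bounded_linear_intro[where K="\<Sum>k<N. norm (\<phi> k)"])
    fix y :: "nat \<Rightarrow>\<^sub>C 'k"
    have "norm (\<Sum>k<N. \<phi> k * apply_bcontfun y k) \<le> (\<Sum>k<N. norm y * norm (\<phi> k))"
      by (rule sum_norm_le) (simp add: norm_mult mult.commute[of "norm y"] mult_left_mono norm_bounded)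
    then show "norm (\<Sum>k<N. \<phi> k * apply_bcontfun y k) \<le> norm y * (\<Sum>k<N. norm (\<phi> k))" by (simp add: sum_distrib_left)
  qed (simp_all add: distrib_left sum.distrib scaleR_sum_right)
  from bounded_linear_Blinfun_apply[OF this] show ?thesis
    by (intro that[of "Blinfun (\<lambda>y. \<Sum>k<N. \<phi> k * apply_bcontfun y k)"]) simp
qed

lemma norm_row_functional:
  fixes N :: nat and \<phi> :: "nat \<Rightarrow> 'k"
  assumes "\<And>y. blinfun_apply \<Phi> y = (\<Sum>k<N. \<phi> k * apply_bcontfun y k)"
  shows "norm \<Phi> \<le> (\<Sum>k<N. norm (\<phi> k))"
proof (rule norm_blinfun_bound)
  fix y :: "nat \<Rightarrow>\<^sub>C 'k"
  have "norm (\<Sum>k<N. \<phi> k * apply_bcontfun y k) \<le> (\<Sum>k<N. norm (\<phi> k) * norm y)"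
    by (rule sum_norm_le) (simp add: norm_mult mult_left_mono norm_bounded)
  then show "norm (blinfun_apply \<Phi> y) \<le> (\<Sum>k<N. norm (\<phi> k)) * norm y" by (simp add: assms sum_distrib_right)
qed (simp add: sum_nonneg)

text \<open>The same steering on the dual side: the chain is attached to the transpose of
  \<open>a\<close> and the result is transposed back, so that the adjoint moves a row vector close
  to the first coordinate towards 0.\<close>

lemma rec_set_dense:
  assumes "L \<in> nil_ops" "r > 0"
  shows "\<exists>L'\<in>nil_ops. dist L' L < r \<and> L' \<in> rec_set j"
proof -
  obtain a0 d0 K0 where "nilpotent a0 d0 K0" "L = mat_op a0 d0" using assms(1) by (auto simp: nil_ops_def)
  then obtain a where nil0: "nilpotent a (Suc d0) K0" and L: "L = mat_op a (Suc d0)"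
    using mat_op_enlarge[of a0 d0 K0 "Suc d0"] by (metis le_SucI order_refl)
  define d where "d = Suc d0"
  define K where "K = Suc K0"
  have nil: "nilpotent (\<lambda>n m. a m n) d K" unfolding d_def K_def by (rule nilpotent_transpose[OF nil0])
  have L: "L = mat_op a d" and d: "d > 0" and K: "K > 0"
    using L by (auto simp: d_def K_def)
  define N where "N = d * Suc (K + Suc K)"
  have dN: "d \<le> N" by (simp add: N_def)
  obtain \<delta> where \<delta>: "\<delta> > 0" "\<delta> * (\<Sum>n<N. 1 / w n) < r" using ex_small_delta[OF assms(2)] by blast
  have \<delta>0: "of_real \<delta> \<noteq> (0 :: 'k)" using \<delta>(1) by simp
  define b where "b = chain (\<lambda>n m. a m n) d (of_real \<delta>)"
  define a' where "a' n m = b m n" for n m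
  have bnil: "nilpotent b N (K + (K + Suc K))" unfolding b_def N_def using nil d by (rule nilpotent_chain)
  then have a'nil: "nilpotent a' N (Suc (K + (K + Suc K)))" unfolding a'_def by (rule nilpotent_transpose)
  have act_a': "act a' N y n = act a d y n + (if d \<le> n \<and> n < N then of_real \<delta> * y (n - d) else 0)" for y n
  proof (cases "n < N")
    case True
    have "(\<Sum>m<N. a' n m * y m)
      = (\<Sum>m<N. if m < d then (if n < d then a n m * y m else 0) else 0) + (\<Sum>m<N. if d \<le> n \<and> m = n - d then of_real \<delta> * y m else 0)"
      unfolding sum.distrib[symmetric] by (intro sum.cong) (auto simp: a'_def b_def chain_def algebra_simps)
    also have "(\<Sum>m<N. if m < d then (if n < d then a n m * y m else 0) else 0) = act a d y n"
    proof -
      have "{..<N} \<inter> {m. m < d} = {..<d}" using dN by auto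
      then show ?thesis by (simp add: sum.If_cases act_def)
    qed
    also have "(\<Sum>m<N. if d \<le> n \<and> m = n - d then of_real \<delta> * y m else 0) = (if d \<le> n then of_real \<delta> * y (n - d) else 0)"
      using True by (cases "d \<le> n") auto
    finally show ?thesis using True by (simp add: act_def[of a'])
  next
    case False
    then show ?thesis using dN by (simp add: act_def)
  qed
  have dist: "dist (mat_op a' N) L < r"
  proof -
    have "norm (mat_op a' N - mat_op a d) \<le> \<delta> * (\<Sum>n<N. 1 / w n)"
    proof (rule norm_mat_op_diff[where g="\<lambda>n. n - d"])
      show "norm (act a' N y n - act a d y n) \<le> (if n < N then \<delta> * norm (y (n - d)) else 0)" for y n
        unfolding act_a' using \<delta>(1) by (auto simp: norm_mult)
    qed (use \<delta> in simp)
    then show ?thesis using \<delta>(2) by (simp add: dist_norm L)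
  qed
  \<comment> \<open>The row vector of \<open>coord0\<close>. The bounds 1/2 and 1 below are those in
    \<open>rec_set\<close>.\<close>
  define y0 :: "nat \<Rightarrow> 'k" where "y0 k = (if k = 0 then 1 else 0)" for k
  have y0supp: "y0 k = 0" if "k \<ge> d" for k using that d by (simp add: y0_def)
  obtain u where u: "\<And>n k. k \<ge> N \<Longrightarrow> u n k = 0" "\<And>k. (\<lambda>n. u n k) \<longlonglongrightarrow> y0 k"
    "\<And>n k. k \<ge> N \<Longrightarrow> (step b N ^^ n) (u n) k = 0" "\<And>k. (\<lambda>n. (step b N ^^ n) (u n) k) \<longlonglongrightarrow> 0"
    using steer_to_0[where y=y0, OF nil K d \<delta>0 y0supp N_def] unfolding b_def by blast
  have lim: "\<forall>\<^sub>F n in sequentially. (\<Sum>k<N. norm (v n k - v' k)) < \<epsilon>" if "\<And>k. (\<lambda>n. v n k) \<longlonglongrightarrow> v' k" "\<epsilon> > 0" for v :: "nat \<Rightarrow> nat \<Rightarrow> 'k" and v' and \<epsilon> :: real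
  proof -
    have "(\<lambda>n. \<Sum>k<N. norm (v n k - v' k :: 'k)) \<longlonglongrightarrow> (\<Sum>k<N. norm (v' k - v' k))"
      by (intro tendsto_intros that(1))
    then show ?thesis using that(2) by (intro order_tendstoD(2)) auto
  qed
  have "\<forall>\<^sub>F n in sequentially. (\<Sum>k<N. norm (u n k - y0 k)) < 1/2" by (rule lim[OF u(2)]) simp
  moreover have "\<forall>\<^sub>F n in sequentially. (\<Sum>k<N. norm ((step b N ^^ n) (u n) k - 0)) < 1" by (rule lim[OF u(4)]) simp
  ultimately have "\<forall>\<^sub>F n in sequentially. (\<Sum>k<N. norm (u n k - y0 k)) < 1/2 \<and> (\<Sum>k<N. norm ((step b N ^^ n) (u n) k - 0)) < 1 \<and> j \<le> n"
    using eventually_ge_at_top[of j] by eventually_elim simp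
  then obtain m where m: "(\<Sum>k<N. norm (u m k - y0 k)) < 1/2" "(\<Sum>k<N. norm ((step b N ^^ m) (u m) k)) < 1" "j \<le> m"
    unfolding eventually_sequentially by auto
  obtain \<Phi> :: "(nat \<Rightarrow>\<^sub>C 'k) \<Rightarrow>\<^sub>L 'k" where \<Phi>: "\<And>y. blinfun_apply \<Phi> y = (\<Sum>k<N. u m k * apply_bcontfun y k)"
    by (rule ex_row_functional[of N "u m"]) (use u(1) in auto)
  have "norm (\<Phi> - coord0) < 1/2"
  proof -
    have N0: "N > 0" using d by (simp add: N_def)
    have "blinfun_apply (\<Phi> - coord0) y = (\<Sum>k<N. (u m k - y0 k) * apply_bcontfun y k)" for y
    proof -
      have "(\<Sum>k<N. y0 k * apply_bcontfun y k) = apply_bcontfun y 0"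
        using N0 by (simp add: y0_def if_distrib[where f="\<lambda>x. x * _"] cong: if_cong)
      then show ?thesis by (simp add: blinfun.diff_left \<Phi> coord0_apply left_diff_distrib sum_subtractf)
    qed
    from norm_row_functional[OF this] m(1) show ?thesis by simp
  qed
  moreover have "norm (\<Phi> o\<^sub>L pw (hat (mat_op a' N)) m) < 1"
  proof -
    have stepb: "(\<Sum>k<N. \<phi> k * step a' N y k) = (\<Sum>k<N. step b N \<phi> k * y k)" for \<phi> y
    proof -
      have "(\<Sum>k<N. \<phi> k * act a' N y k) = (\<Sum>k<N. act b N \<phi> k * y k)"
        unfolding act_pairing by (simp add: a'_def)
      then show ?thesis by (simp add: step_def distrib_left distrib_right sum.distrib)
    qed
    have pair: "(\<Sum>k<N. \<phi> k * (step a' N ^^ n) y k) = (\<Sum>k<N. (step b N ^^ n) \<phi> k * y k)" for n \<phi> y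
    proof (induction n arbitrary: \<phi>)
      case (Suc n)
      have "(\<Sum>k<N. \<phi> k * (step a' N ^^ Suc n) y k) = (\<Sum>k<N. step b N \<phi> k * (step a' N ^^ n) y k)" by (simp add: stepb)
      then show ?case using Suc by (simp add: funpow_swap1)
    qed simp
    have "blinfun_apply (\<Phi> o\<^sub>L pw (hat (mat_op a' N)) m) y = (\<Sum>k<N. (step b N ^^ m) (u m) k * apply_bcontfun y k)" for y
      by (simp add: \<Phi> hat_mat_op pair)
    from norm_row_functional[OF this] m(2) show ?thesis by simp
  qed
  ultimately have "mat_op a' N \<in> rec_set j"
    using m(3) unfolding rec_set_def by (intro UN_I[of m] UN_I[of \<Phi>]) (simp_all add: dist_norm norm_minus_commute)
  moreover have "mat_op a' N \<in> nil_ops" using a'nil by (auto simp: nil_ops_def)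
  ultimately show ?thesis using dist by blast
qed

text \<open>The two countable families of open sets are interleaved by parity. Elements of
  \<open>\<Rightarrow>\<^sub>L\<close> are linear over the reals only; commutation with
  \<open>mult_op c\<close> holds for matrices, is a closed condition, and makes the limit linear
  over \<open>'k\<close>.\<close>

lemma ex_generic_operator:
  obtains L where "\<And>N. L \<in> trans_set N" "\<And>j. L \<in> rec_set j" "\<And>c y. blinfun_apply L (blinfun_apply (mult_op c) y) = blinfun_apply (mult_op c) (blinfun_apply L y)"
proof -
  define W where "W j = (if even j then trans_set (j div 2) else rec_set (j div 2))" for j
  have "\<exists>L\<in>closure nil_ops. \<forall>j. L \<in> W j"
  proof (rule Baire_along[where C=nil_ops and W=W])
    have "act (\<lambda>_ _. 0) 0 y = (\<lambda>_. 0)" for y :: "nat \<Rightarrow> 'k" by (simp add: act_def fun_eq_iff)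
    then have "nilpotent (\<lambda>_ _. 0 :: 'k) 0 1" by (simp add: nilpotent_def)
    then show "nil_ops \<noteq> {}" by (auto simp: nil_ops_def)
    show "open (W j)" for j by (simp add: W_def open_trans_set open_rec_set)
    show "\<exists>c'\<in>nil_ops. dist c' c < r \<and> c' \<in> W j" if "c \<in> nil_ops" "r > 0" for j c r
      unfolding W_def using trans_set_dense[OF that] rec_set_dense[OF that] by auto
  qed
  then obtain L where L: "L \<in> closure nil_ops" "\<And>j. L \<in> W j" by blast
  have "L \<in> trans_set N" for N using L(2)[of "2 * N"] by (simp add: W_def)
  moreover have "L \<in> rec_set j" for j using L(2)[of "2 * j + 1"] by (simp add: W_def)
  moreover have "blinfun_apply L (blinfun_apply (mult_op c) y) = blinfun_apply (mult_op c) (blinfun_apply L y)" for c y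
  proof -
    have "closed {L :: (nat \<Rightarrow>\<^sub>C 'k) \<Rightarrow>\<^sub>L (nat \<Rightarrow>\<^sub>C 'k). blinfun_apply L (blinfun_apply (mult_op c) y) = blinfun_apply (mult_op c) (blinfun_apply L y)}"
      by (intro closed_Collect_eq continuous_intros blinfun.continuous_on)
    moreover have "nil_ops \<subseteq> {L. blinfun_apply L (blinfun_apply (mult_op c) y) = blinfun_apply (mult_op c) (blinfun_apply L y)}"
    proof
      fix L assume "L \<in> nil_ops"
      then obtain a d where "L = mat_op a d" by (auto simp: nil_ops_def)
      then show "L \<in> {L. blinfun_apply L (blinfun_apply (mult_op c) y) = blinfun_apply (mult_op c) (blinfun_apply L y)}"
        by (auto intro!: bcontfun_eqI simp: mat_op_apply mult_op_apply act_def sum_distrib_left mult_ac)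
    qed
    ultimately show ?thesis using L(1) closure_minimal by blast
  qed
  ultimately show ?thesis by (rule that)
qed

section \<open>Transport between the space and the bounded sequences\<close>

definition coords :: "'a \<Rightarrow> nat \<Rightarrow>\<^sub>C 'k" where
  "coords v = Bcontfun (\<lambda>n. f n v)"

lemma coords_apply: "apply_bcontfun (coords v) n = f n v"
  unfolding coords_def by (subst apply_Bcontfun_bound[of _ "P n0 v"]) (auto simp: f_bound)

lemma norm_coords: "norm (coords v) \<le> P n0 v"
  by (rule norm_bound) (simp add: coords_apply f_bound)

lemma coords_add: "coords (u + v) = coords u + coords v"
  by (rule bcontfun_eqI) (simp add: coords_apply lin_form_add[OF f_lin])

lemma coords_diff: "coords (u - v) = coords u - coords v"
  by (rule bcontfun_eqI) (simp add: coords_apply lin_form_diff[OF f_lin])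

lemma coords_smul: "coords (smul c v) = blinfun_apply (mult_op c) (coords v)"
  by (rule bcontfun_eqI) (simp add: coords_apply lin_form_smul[OF f_lin] mult_op_apply)

definition synth :: "(nat \<Rightarrow>\<^sub>C 'k) \<Rightarrow> 'a" where
  "synth c = series (apply_bcontfun c)"

lemma P_synth: "P m (synth c) \<le> norm c * M m"
  unfolding synth_def by (rule P_series_le) (rule norm_bounded)

lemma synth_add: "synth (c + d) = synth c + synth d"
  unfolding synth_def using series_add[of "apply_bcontfun c" "norm c" "apply_bcontfun d" "norm d"]
  by (simp add: norm_bounded plus_bcontfun.rep_eq)

lemma synth_diff: "synth (c - d) = synth c - synth d"
  using synth_add[of "c - d" d] by simp

lemma synth_e: "synth (e i) = b i"
proof -
  have "synth (e i) = (\<Sum>k<Suc i. smul (apply_bcontfun (e i) k) (b k))"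
    unfolding synth_def by (rule series_finite) (simp add: e_apply)
  also have "\<dots> = (\<Sum>k<Suc i. if k = i then b k else 0)" by (intro sum.cong) (auto simp: e_apply)
  finally show ?thesis by simp
qed

lemma coords_synth: "coords (synth c) = blinfun_apply diag c"
  by (rule bcontfun_eqI) (simp add: coords_apply synth_def f_series[OF norm_bounded] diag_apply mult.commute)

lemma span_finite_sum: "v \<in> span (range x) \<Longrightarrow> \<exists>\<beta> K. v = (\<Sum>i<K. smul (\<beta> i) (b i))"
proof -
  assume "v \<in> span (range x)"
  then obtain p where p: "v = of_poly p" using of_poly_surj by blast
  have "basis_mono k = smul (of_real (fact k / (\<Prod>i<k. w i) / w k)) (b k)" for k
  proof -
    have "c / w k * w k = c" for c using w_neq_0[of k] by simp
    then show ?thesis by (simp only: basis_mono_def b_def scale_scale of_real_mult[symmetric])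
  qed
  then have "v = (\<Sum>k<Suc (degree p). smul (coeff p k * of_real (fact k / (\<Prod>i<k. w i) / w k)) (b k))"
    unfolding p of_poly_def lessThan_Suc_atMost by (simp only: scale_scale)
  then show ?thesis by (intro exI)
qed

theorem ex_hypercyclic_nonmixing:
  assumes sep: "separable_space (euclidean :: 'a topology)"
  shows "\<exists>T\<in>continuous_operators smul. hypercyclic T \<and> \<not> mixing T"
proof -
  obtain L where L: "\<And>N. L \<in> trans_set N" "\<And>j. L \<in> rec_set j"
    "\<And>c y. blinfun_apply L (blinfun_apply (mult_op c) y) = blinfun_apply (mult_op c) (blinfun_apply L y)"
    by (rule ex_generic_operator) (rule that)
  define T where "T v = v + synth (blinfun_apply L (coords v))" for v
  have T: "T \<in> continuous_operators smul"
  proof -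
    have "(\<lambda>v. v + series (\<lambda>i. apply_bcontfun (blinfun_apply L (coords v)) i)) \<in> continuous_operators smul"
    proof (rule perturbation_operator[where K="norm L"])
      show "lin_form (\<lambda>v. apply_bcontfun (blinfun_apply L (coords v)) i)" for i
        by (simp add: lin_form_def coords_add coords_smul blinfun.add_right L(3) mult_op_apply)
      show "norm (apply_bcontfun (blinfun_apply L (coords v)) i) \<le> norm L * P n0 v" for i v
      proof -
        have "norm (apply_bcontfun (blinfun_apply L (coords v)) i) \<le> norm (blinfun_apply L (coords v))" by (rule norm_bounded)
        also have "\<dots> \<le> norm L * norm (coords v)" by (rule norm_blinfun)
        also have "\<dots> \<le> norm L * P n0 v" by (intro mult_left_mono norm_coords) simp
        finally show ?thesis .
      qed
    qed
    then show ?thesis by (simp add: T_def[abs_def] synth_def)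
  qed
  have Tadd: "T (u + v) = T u + T v" and Tsmul: "T (smul c v) = smul c (T v)" and Tcont: "continuous_on UNIV T" for u v c
    using T by (auto simp: continuous_operators_def linear_operator_iff)
  have Tn_add: "(T ^^ n) (u + v) = (T ^^ n) u + (T ^^ n) v" for n u v by (induction n) (simp_all add: Tadd)
  have Tn_smul: "(T ^^ n) (smul c v) = smul c ((T ^^ n) v)" for n c v by (induction n) (simp_all add: Tsmul)
  have Tn_sum: "(T ^^ n) (\<Sum>i\<in>A. smul (c i) (g i)) = (\<Sum>i\<in>A. smul (c i) ((T ^^ n) (g i)))" if "finite A" for n A c and g :: "nat \<Rightarrow> 'a"
    using that
  proof induction
    case empty
    show ?case using Tn_smul[of n 0 0] by simp
  qed (simp add: Tn_add Tn_smul)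
  have Tn_cont: "continuous_on UNIV (T ^^ n)" for n
  proof (induction n)
    case (Suc n)
    then show ?case using continuous_on_compose2[OF Tcont Suc] by (simp add: o_def)
  qed (simp add: continuous_on_id id_def)
  \<comment> \<open>\<open>coords\<close> intertwines \<open>T\<close> with \<open>hat L\<close>,
    and \<open>synth\<close> intertwines \<open>chk L\<close> with \<open>T\<close>. Recurrence is
    read off from the one relation and transitivity from the other.\<close>
  have T_coords: "coords ((T ^^ n) v) = blinfun_apply (pw (hat L) n) (coords v)" for n v
    by (induction n) (simp_all add: T_def coords_add coords_synth hat_def blinfun.add_left)
  have T_synth: "(T ^^ n) (synth c) = synth (blinfun_apply (pw (chk L) n) c)" for n c
    by (induction n) (simp_all add: T_def coords_synth synth_add chk_def blinfun.add_left)
  have trans: "\<exists>n\<in>UNIV. (T ^^ n) ` U \<inter> V \<noteq> {}" if UV: "open U" "U \<noteq> {}" "open V" "V \<noteq> {}" for U V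
  proof -
    have dense: "W \<noteq> {} \<Longrightarrow> \<exists>y. y \<in> W \<and> y \<in> span (range x)" if "open W" for W
      using that span_dense unfolding closure_eq_UNIV_iff by blast
    obtain y y' where y: "y \<in> U" "y \<in> span (range x)" "y' \<in> V" "y' \<in> span (range x)"
      using dense[of U] dense[of V] UV by blast
    obtain \<beta> K where \<beta>: "y = (\<Sum>i<K. smul (\<beta> i) (b i))" using span_finite_sum[OF y(2)] by blast
    obtain \<beta>' K' where \<beta>': "y' = (\<Sum>i<K'. smul (\<beta>' i) (b i))" using span_finite_sum[OF y(4)] by blast
    obtain m1 r1 where r1: "r1 > 0" "\<And>z. P m1 (z - y) < r1 \<Longrightarrow> z \<in> U" using UV(1) y(1) by (rule openE_P) (rule that)
    obtain m2 r2 where r2: "r2 > 0" "\<And>z. P m2 (z - y') < r2 \<Longrightarrow> z \<in> V" using UV(3) y(3) by (rule openE_P) (rule that)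
    define m where "m = max m1 m2"
    define r where "r = min r1 r2"
    have r: "r > 0" using r1 r2 by (simp add: r_def)
    have inU: "z \<in> U" if "P m (z - y) < r" for z
      using that P_mono[of m1 m "z - y"] by (intro r1(2)) (simp add: m_def r_def)
    have inV: "z \<in> V" if "P m (z - y') < r" for z
      using that P_mono[of m2 m "z - y'"] by (intro r2(2)) (simp add: m_def r_def)
    \<comment> \<open>The total size of the coefficients of \<open>y\<close> and \<open>y'\<close>.
      With \<open>N\<close> beyond \<open>S * M m / r\<close>, errors of \<open>1 / (N + 1)\<close>
      at each index add up to less than \<open>r\<close> in the space.\<close>
    define S where "S = (\<Sum>i<K. norm (\<beta> i)) + (\<Sum>i<K'. norm (\<beta>' i))"
    have S: "S \<ge> 0" by (simp add: S_def sum_nonneg)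
    obtain N0 where N0: "real N0 > S * M m / r" using reals_Archimedean2 by blast
    define N where "N = N0 + K + K'"
    define \<epsilon> where "\<epsilon> = 1 / real (Suc N)"
    have small: "S * (\<epsilon> * M m) < r"
    proof -
      have "S * M m / r < real (Suc N)" using N0 by (simp add: N_def)
      then have "S * M m < real (Suc N) * r" using r by (simp add: pos_divide_less_eq)
      then show ?thesis by (simp add: \<epsilon>_def pos_divide_less_eq mult.commute del: of_nat_Suc)
    qed
    obtain n where n: "\<And>i. i \<le> N \<Longrightarrow> \<exists>u\<in>ball (e i) \<epsilon>. \<exists>u'\<in>ball 0 \<epsilon>. norm (blinfun_apply (pw (chk L) n) u) < \<epsilon> \<and>
        norm (blinfun_apply (pw (chk L) n) u' - e i) < \<epsilon>"
    proof -
      have "\<exists>n. \<forall>i\<le>N. \<exists>u\<in>ball (e i) \<epsilon>. \<exists>u'\<in>ball 0 \<epsilon>. norm (blinfun_apply (pw (chk L) n) u) < \<epsilon> \<and>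
        norm (blinfun_apply (pw (chk L) n) u' - e i) < \<epsilon>"
        using L(1)[of N] unfolding trans_set_def \<epsilon>_def by (simp only: UN_iff INT_iff Int_iff mem_Collect_eq atMost_iff) blast
      then show ?thesis using that by blast
    qed
    obtain u u' where uu: "\<And>i. i \<le> N \<Longrightarrow> norm (u i - e i) < \<epsilon>" "\<And>i. i \<le> N \<Longrightarrow> norm (u' i) < \<epsilon>"
      "\<And>i. i \<le> N \<Longrightarrow> norm (blinfun_apply (pw (chk L) n) (u i)) < \<epsilon>" "\<And>i. i \<le> N \<Longrightarrow> norm (blinfun_apply (pw (chk L) n) (u' i) - e i) < \<epsilon>"
    proof -
      have "\<forall>i. \<exists>u u'. i \<le> N \<longrightarrow> norm (u - e i) < \<epsilon> \<and> norm u' < \<epsilon> \<and> norm (blinfun_apply (pw (chk L) n) u) < \<epsilon> \<and>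
        norm (blinfun_apply (pw (chk L) n) u' - e i) < \<epsilon>"
        using n by (force simp: dist_norm norm_minus_commute)
      then obtain u u' where "\<forall>i. i \<le> N \<longrightarrow> norm (u i - e i) < \<epsilon> \<and> norm (u' i) < \<epsilon> \<and> norm (blinfun_apply (pw (chk L) n) (u i)) < \<epsilon> \<and>
        norm (blinfun_apply (pw (chk L) n) (u' i) - e i) < \<epsilon>" by metis
      then show ?thesis using that by blast
    qed
    have P_small: "P m (synth c) \<le> \<epsilon> * M m" if "norm c < \<epsilon>" for c
      using P_synth[of m c] mult_right_mono[OF less_imp_le[OF that] M_nonneg[of m]] by linarith
    have est: "P m ((\<Sum>i<K. smul (\<beta> i) (g i)) + (\<Sum>i<K'. smul (\<beta>' i) (g' i))) < r"
      if "\<And>i. i \<le> N \<Longrightarrow> P m (g i) \<le> \<epsilon> * M m" "\<And>i. i \<le> N \<Longrightarrow> P m (g' i) \<le> \<epsilon> * M m" for g g'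
    proof -
      have "P m (\<Sum>i<K. smul (\<beta> i) (g i)) \<le> (\<Sum>i<K. norm (\<beta> i) * (\<epsilon> * M m))"
        using that(1) by (intro order_trans[OF P_sum] sum_mono) (auto simp: P_smul N_def intro!: mult_left_mono)
      moreover have "P m (\<Sum>i<K'. smul (\<beta>' i) (g' i)) \<le> (\<Sum>i<K'. norm (\<beta>' i) * (\<epsilon> * M m))"
        using that(2) by (intro order_trans[OF P_sum] sum_mono) (auto simp: P_smul N_def intro!: mult_left_mono)
      ultimately have "P m ((\<Sum>i<K. smul (\<beta> i) (g i)) + (\<Sum>i<K'. smul (\<beta>' i) (g' i))) \<le> S * (\<epsilon> * M m)"
        using P_add[of m "\<Sum>i<K. smul (\<beta> i) (g i)" "\<Sum>i<K'. smul (\<beta>' i) (g' i)"]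
        by (simp add: S_def distrib_right sum_distrib_right)
      then show ?thesis using small by simp
    qed
    define v where "v = (\<Sum>i<K. smul (\<beta> i) (synth (u i))) + (\<Sum>i<K'. smul (\<beta>' i) (synth (u' i)))"
    have "v - y = (\<Sum>i<K. smul (\<beta> i) (synth (u i - e i))) + (\<Sum>i<K'. smul (\<beta>' i) (synth (u' i)))"
      by (simp add: v_def \<beta> synth_diff synth_e scale_right_diff_distrib sum_subtractf)
    then have "P m (v - y) < r" using est[of "\<lambda>i. synth (u i - e i)" "\<lambda>i. synth (u' i)"] uu(1,2) P_small by simp
    then have "v \<in> U" by (rule inU)
    have "(T ^^ n) v - y' = (\<Sum>i<K. smul (\<beta> i) (synth (blinfun_apply (pw (chk L) n) (u i)))) + (\<Sum>i<K'. smul (\<beta>' i) (synth (blinfun_apply (pw (chk L) n) (u' i) - e i)))"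
      by (simp add: v_def \<beta>' Tn_add Tn_sum T_synth synth_diff synth_e scale_right_diff_distrib sum_subtractf)
    then have "P m ((T ^^ n) v - y') < r" using est uu(3,4) P_small by simp
    then have "(T ^^ n) v \<in> V" by (rule inV)
    with \<open>v \<in> U\<close> show ?thesis by blast
  qed
  have "hypercyclic T"
    unfolding hypercyclic_def by (rule dense_orbit_of_transitive[OF sep, where T="\<lambda>n. T ^^ n" and I=UNIV]) (use Tn_cont trans in auto)
  moreover have "\<not> mixing T"
  proof
    assume mix: "mixing T"
    \<comment> \<open>At the times \<open>m\<close> where \<open>rec_set\<close> supplies
      \<open>\<Phi>\<close>, a vector of \<open>U\<close> cannot reach \<open>V\<close>. Its image
      has coordinates \<open>z\<close> of norm below 4, \<open>\<Phi> z\<close> has norm at most 1,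
      and \<open>\<Phi>\<close> differs from \<open>coord0\<close> at \<open>z\<close> by at most
      \<open>1/2 * 4\<close>; so the first coordinate is at most 3. A multiple of \<open>x 0\<close>
      of size 7/2 lies in \<open>V\<close>.\<close>
    define U where "U = {v. P n0 (v - 0) < 1}"
    define V where "V = {v. norm (coords v) < 4} \<inter> {v. norm (f 0 v) > 3}"
    have cont_coords: "continuous_on UNIV (\<lambda>v. coords v)"
      unfolding continuous_on_def
    proof
      fix v
      have "((\<lambda>u. coords u - coords v) \<longlongrightarrow> 0) (at v within UNIV)"
      proof (rule Lim_null_comparison)
        show "((\<lambda>u. P n0 (u - v)) \<longlongrightarrow> 0) (at v within UNIV)"
          using tendsto_ident_at[of v UNIV] unfolding tendsto_P by blast
        show "\<forall>\<^sub>F u in at v within UNIV. norm (coords u - coords v) \<le> P n0 (u - v)"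
          by (simp add: norm_coords flip: coords_diff)
      qed
      then show "(coords \<longlongrightarrow> coords v) (at v within UNIV)" by (simp add: LIM_zero_iff)
    qed
    have "open V" unfolding V_def
      by (intro open_Int open_Collect_less continuous_intros cont_coords bdd_forms_continuous[OF f_bdd])
    moreover have "V \<noteq> {}"
    proof -
      define v where "v = smul (of_real (7/2)) (x 0)"
      have fv: "f i v = (if i = 0 then of_real (7/2) else 0)" for i by (simp add: v_def lin_form_smul[OF f_lin] f_x)
      have "norm (coords v) \<le> 7/2" by (rule norm_bound) (simp add: coords_apply fv)
      moreover have "norm (f 0 v) = 7/2" using norm_of_real[of "7/2", where 'a='k] by (simp add: fv del: of_real_divide)
      ultimately have "v \<in> V" by (simp add: V_def)
      then show ?thesis by blast
    qed
    moreover have "open U" unfolding U_def by (rule open_P_ball)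
    moreover have "U \<noteq> {}"
    proof -
      have "0 \<in> U" by (simp add: U_def)
      then show ?thesis by blast
    qed
    ultimately obtain \<rho> :: real where \<rho>: "\<And>n::nat. real n > \<rho> \<Longrightarrow> (T ^^ n) ` U \<inter> V \<noteq> {}"
      using mix unfolding mixing_def by meson
    obtain j :: nat where j: "real j > \<rho>" using reals_Archimedean2 by blast
    obtain m \<Phi> where m: "m \<ge> j" "norm (\<Phi> - coord0) < 1/2" "norm (\<Phi> o\<^sub>L pw (hat L) m) < 1"
      using L(2)[of j] unfolding rec_set_def by (auto simp: dist_norm norm_minus_commute)
    obtain v where v: "v \<in> U" "(T ^^ m) v \<in> V" using \<rho>[of m] j m(1) by fastforce
    define z where "z = coords ((T ^^ m) v)"
    have z4: "norm z < 4" and z3: "norm (blinfun_apply coord0 z) > 3"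
      using v(2) by (auto simp: V_def z_def coord0_apply coords_apply)
    have "norm (coords v) < 1" using v(1) norm_coords[of v] by (simp add: U_def)
    then have "norm (\<Phi> o\<^sub>L pw (hat L) m) * norm (coords v) \<le> 1 * 1" using m(3) by (intro mult_mono) auto
    moreover have "blinfun_apply \<Phi> z = blinfun_apply (\<Phi> o\<^sub>L pw (hat L) m) (coords v)" by (simp add: z_def T_coords)
    ultimately have 1: "norm (blinfun_apply \<Phi> z) \<le> 1" using norm_blinfun[of "\<Phi> o\<^sub>L pw (hat L) m" "coords v"] by simp
    have "norm (\<Phi> - coord0) * norm z \<le> 1/2 * 4" using m(2) z4 by (intro mult_mono) auto
    then have 2: "norm (blinfun_apply (\<Phi> - coord0) z) \<le> 2" using norm_blinfun[of "\<Phi> - coord0" z] by simp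
    have "blinfun_apply coord0 z = blinfun_apply \<Phi> z - blinfun_apply (\<Phi> - coord0) z" by (simp add: blinfun.diff_left)
    then have "norm (blinfun_apply coord0 z) \<le> norm (blinfun_apply \<Phi> z) + norm (blinfun_apply (\<Phi> - coord0) z)"
      by (simp add: norm_triangle_ineq4)
    then show False using 1 2 z3 by simp
  qed
  ultimately show ?thesis using T by blast
qed

end

section \<open>Hypercyclic operators on the space of all sequences\<close>

lemma fun_span_image:
  fixes G :: "nat \<Rightarrow> 'a \<Rightarrow> 'f::field"
  assumes "h \<in> fun_space.span (G ` {..<n})"
  shows "\<exists>c. \<forall>v. h v = (\<Sum>j<n. c j * G j v)"
  using assms
proof (induction rule: fun_space.span_induct_alt)
  case base
  show ?case by (intro exI[of _ "\<lambda>_. 0"]) simp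
next
  case (step a g h)
  then obtain i where i: "i < n" "g = G i" by auto
  obtain c where c: "\<And>v. h v = (\<Sum>j<n. c j * G j v)" using step by blast
  have "a * g v + h v = (\<Sum>j<n. (c j + (if j = i then a else 0)) * G j v)" for v
  proof -
    have "(\<Sum>j<n. (c j + (if j = i then a else 0)) * G j v) = (\<Sum>j<n. c j * G j v) + (\<Sum>j<n. if j = i then a * G j v else 0)"
      unfolding sum.distrib[symmetric] by (intro sum.cong) (auto simp: algebra_simps)
    then show ?thesis using i by (simp add: c)
  qed
  then show ?case by (intro exI[of _ "\<lambda>j. c j + (if j = i then a else 0)"]) simp
qed

lemma independent_lessThan:
  fixes G :: "nat \<Rightarrow> 'a \<Rightarrow> 'f::field"
  assumes "\<And>k. k < n \<Longrightarrow> G k \<notin> fun_space.span (G ` {..<k})"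
  shows "fun_space.independent (G ` {..<n}) \<and> card (G ` {..<n}) = n"
  using assms
proof (induction n)
  case (Suc k)
  have "G k \<notin> fun_space.span (G ` {..<k})" using Suc.prems by simp
  moreover from this have "G k \<notin> G ` {..<k}" using fun_space.span_base[of "G k"] by metis
  ultimately show ?case using Suc unfolding lessThan_Suc image_insert by (simp add: fun_space.independent_insert)
qed (simp add: fun_space.independent_empty)

lemma ex_dependent_index:
  fixes G :: "nat \<Rightarrow> 'a \<Rightarrow> 'f::field"
  assumes B: "finite B" "\<And>i. G i \<in> fun_space.span B"
  shows "\<exists>n. G n \<in> fun_space.span (G ` {..<n})"
proof (rule ccontr)
  assume "\<not> ?thesis"
  then have "fun_space.independent (G ` {..<k}) \<and> card (G ` {..<k}) = k" for k by (intro independent_lessThan) blast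
  note ind = this[of "Suc (card B)"]
  have "G ` {..<Suc (card B)} \<subseteq> fun_space.span B" using B(2) by blast
  then have "Suc (card B) \<le> card B"
    using fun_space.independent_span_bound[OF B(1) ind[THEN conjunct1]] ind by simp
  then show False by simp
qed

section \<open>Polynomials in the adjoint of an operator\<close>

definition poly_act :: "('a \<Rightarrow> 'a) \<Rightarrow> 'f::field poly \<Rightarrow> ('a \<Rightarrow> 'f) \<Rightarrow> 'a \<Rightarrow> 'f" where
  "poly_act T p h v = (\<Sum>i\<le>degree p. coeff p i * h ((T ^^ i) v))"

lemma poly_act_bound:
  assumes "degree p \<le> N" shows "poly_act T p h v = (\<Sum>i\<le>N. coeff p i * h ((T ^^ i) v))"
  unfolding poly_act_def using assms by (intro sum.mono_neutral_left) (auto simp: coeff_eq_0)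

lemma poly_act_0 [simp]: "poly_act T 0 h v = 0"
  by (simp add: poly_act_def)

lemma poly_act_add: "poly_act T (p + q) h v = poly_act T p h v + poly_act T q h v"
proof -
  define N where "N = max (degree p) (degree q)"
  have "degree (p + q) \<le> N" "degree p \<le> N" "degree q \<le> N" by (auto simp: N_def degree_add_le)
  then show ?thesis by (simp add: poly_act_bound[of _ N] distrib_right sum.distrib)
qed

lemma poly_act_smult: "poly_act T (smult c p) h v = c * poly_act T p h v"
  by (simp add: poly_act_bound[OF degree_smult_le] poly_act_def sum_distrib_left mult.assoc)

lemma poly_act_diff: "poly_act T (p - q) h v = poly_act T p h v - poly_act T q h v"
  using poly_act_add[of T p "smult (-1) q" h v] poly_act_smult[of T "-1" q h v] by simp

lemma poly_act_sum: "poly_act T (sum p A) h v = (\<Sum>i\<in>A. poly_act T (p i) h v)"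
  by (induction A rule: infinite_finite_induct) (auto simp: poly_act_add)

lemma poly_act_pCons: "poly_act T (pCons a p) h v = a * h v + poly_act T p h (T v)"
proof -
  have "poly_act T (pCons a p) h v = (\<Sum>i\<le>Suc (degree p). coeff (pCons a p) i * h ((T ^^ i) v))"
    by (rule poly_act_bound) (rule degree_pCons_le)
  also have "\<dots> = a * h v + (\<Sum>i\<le>degree p. coeff p i * h ((T ^^ i) (T v)))"
    unfolding sum.atMost_Suc_shift by (simp add: funpow_swap1)
  finally show ?thesis by (simp add: poly_act_def)
qed

lemma poly_act_mult: "poly_act T (p * q) h v = poly_act T p (poly_act T q h) v"
proof (induction p arbitrary: v)
  case (pCons a p)
  then show ?case by (simp add: poly_act_add poly_act_smult poly_act_pCons)
qed simp

lemma poly_act_monom: "poly_act T (monom c n) h v = c * h ((T ^^ n) v)"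
  by (induction n arbitrary: v) (simp_all add: monom_0 monom_Suc poly_act_pCons funpow_swap1)

lemma poly_act_combination:
  "poly_act T p (\<lambda>v. \<Sum>i\<in>A. c i * h i v) v = (\<Sum>i\<in>A. c i * poly_act T p (h i) v)"
proof -
  have "poly_act T p (\<lambda>v. \<Sum>i\<in>A. c i * h i v) v = (\<Sum>k\<le>degree p. \<Sum>i\<in>A. c i * (coeff p k * h i ((T ^^ k) v)))"
    by (simp add: poly_act_def sum_distrib_left mult.left_commute)
  also have "\<dots> = (\<Sum>i\<in>A. \<Sum>k\<le>degree p. c i * (coeff p k * h i ((T ^^ k) v)))" by (rule sum.swap)
  finally show ?thesis by (simp add: poly_act_def sum_distrib_left)
qed

lemma poly_act_commute: "poly_act T p (poly_act T q h) v = poly_act T q (poly_act T p h) v"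
  by (metis poly_act_mult mult.commute)

lemma poly_act_in:
  assumes sub: "fun_space.subspace M" and h: "h \<in> M" and inv: "\<And>h. h \<in> M \<Longrightarrow> (\<lambda>v. h (T v)) \<in> M"
  shows "poly_act T p h \<in> M"
proof (induction p)
  case 0
  have "poly_act T 0 h = 0" by (rule ext) simp
  then show ?case using fun_space.subspace_0[OF sub] by (simp add: zero_fun_def)
next
  case (pCons a p)
  have "poly_act T (pCons a p) h = (\<lambda>v. a * h v) + (\<lambda>v. poly_act T p h (T v))" by (rule ext) (simp add: poly_act_pCons)
  then show ?case using fun_space.subspace_add[OF sub fun_space.subspace_scale[OF sub h] inv[OF pCons(2)]] by (simp only:)
qed

text \<open>Among the nonzero polynomials that take \<open>h0\<close> into \<open>L\<close>, one of
  least degree has a root \<open>\<mu>\<close>. Without its linear factor it takes \<open>h0\<close>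
  to an eigenvector modulo \<open>L\<close>. The finite dimension of \<open>span B\<close> provides
  such a polynomial.\<close>

lemma ex_eigen_mod:
  fixes M L :: "('a \<Rightarrow> complex) set"
  assumes M: "fun_space.subspace M" and L: "fun_space.subspace L" and h0: "h0 \<in> M" "h0 \<notin> L"
    and B: "finite B" "M \<subseteq> fun_space.span B"
    and invM: "\<And>h. h \<in> M \<Longrightarrow> (\<lambda>v. h (S v)) \<in> M"
  shows "\<exists>h \<mu>. h \<in> M \<and> h \<notin> L \<and> (\<lambda>v. h (S v) - \<mu> * h v) \<in> L"
proof -
  define G where "G i v = h0 ((S ^^ i) v)" for i v
  have G: "G i \<in> M" for i
  proof (induction i)
    case 0
    show ?case using h0 by (simp add: G_def[abs_def])
  next
    case (Suc i)
    then show ?case using invM[OF Suc] by (simp add: G_def[abs_def] funpow_swap1)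
  qed
  then obtain n where "G n \<in> fun_space.span (G ` {..<n})" using ex_dependent_index[OF B(1), of G] B(2) by blast
  then obtain c where c: "\<And>v. G n v = (\<Sum>j<n. c j * G j v)" using fun_span_image by blast
  define p0 where "p0 = monom 1 n - (\<Sum>j<n. monom (c j) j)"
  have "coeff p0 n = 1"
  proof -
    have "(\<Sum>j<n. coeff (monom (c j) j) n) = 0" by (rule sum.neutral) simp
    then show ?thesis by (simp add: p0_def coeff_sum)
  qed
  then have p0: "p0 \<noteq> 0" by auto
  have "poly_act S p0 h0 v = 0" for v
    using c[of v] by (simp add: p0_def poly_act_diff poly_act_sum poly_act_monom G_def)
  then have "poly_act S p0 h0 = 0" by (auto simp: fun_eq_iff)
  then have "p0 \<noteq> 0 \<and> poly_act S p0 h0 \<in> L" using p0 fun_space.subspace_0[OF L] by simp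
  from ex_has_least_nat[of "\<lambda>p. p \<noteq> 0 \<and> poly_act S p h0 \<in> L", OF this, of degree]
  obtain p where p: "p \<noteq> 0" "poly_act S p h0 \<in> L" and least: "\<And>q. q \<noteq> 0 \<Longrightarrow> poly_act S q h0 \<in> L \<Longrightarrow> degree p \<le> degree q"
    by blast
  have "degree p \<noteq> 0"
  proof
    assume "degree p = 0"
    then obtain k where k: "p = [:k:]" by (rule degree_eq_zeroE)
    then have "poly_act S p h0 = (\<lambda>v. k * h0 v)" by (auto simp: poly_act_pCons)
    then have "(\<lambda>v. inverse k * (k * h0 v)) \<in> L" using p(2) fun_space.subspace_scale[OF L] by metis
    then show False using h0(2) p(1) k by (simp add: mult.assoc[symmetric])
  qed
  then have "\<not> constant (poly p)" by (simp add: constant_degree)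
  then obtain \<mu> where "poly p \<mu> = 0" using fundamental_theorem_of_algebra by blast
  then obtain q where q: "p = [:-\<mu>, 1:] * q" unfolding poly_eq_0_iff_dvd by (auto elim: dvdE)
  have q0: "q \<noteq> 0" using p(1) q by auto
  have "degree p = Suc (degree q)" unfolding q using q0 by (subst degree_mult_eq) auto
  then have notin: "poly_act S q h0 \<notin> L" using least[OF q0] by auto
  have "poly_act S p h0 = (\<lambda>v. poly_act S q h0 (S v) - \<mu> * poly_act S q h0 v)"
    unfolding q poly_act_mult[abs_def] by (rule ext) (simp add: poly_act_mult poly_act_pCons)
  then have "(\<lambda>v. poly_act S q h0 (S v) - \<mu> * poly_act S q h0 v) \<in> L" using p(2) by simp
  then show ?thesis using notin poly_act_in[OF M h0(1), of S q] invM by blast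
qed

section \<open>Complex functionals and hypercyclic operators\<close>

context frechet_space
begin

text \<open>The continuous dual over the complex scalars, and its complexification over the reals.
  Complex multiples stay within it, so eigenvectors can be looked for.\<close>

definition cform :: "('a \<Rightarrow> complex) \<Rightarrow> bool" where
  "cform h \<longleftrightarrow> continuous_on UNIV h \<and> (\<forall>u v. h (u + v) = h u + h v) \<and> (\<forall>c v. h (smul c v) = emb c * h v)"

lemma cform_continuous: "cform h \<Longrightarrow> continuous_on UNIV h"
  and cform_add: "cform h \<Longrightarrow> h (u + v) = h u + h v"
  and cform_smul: "cform h \<Longrightarrow> h (smul c v) = emb c * h v"
  by (auto simp: cform_def)

lemma cform_0: "cform h \<Longrightarrow> h 0 = 0"
  using cform_smul[of h 0 0] by simp

lemma cform_combine: "cform h \<Longrightarrow> cform g \<Longrightarrow> cform (\<lambda>v. a * h v + b * g v)"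
  by (auto simp: cform_def algebra_simps intro!: continuous_intros)

lemma cform_scale: "cform h \<Longrightarrow> cform (\<lambda>v. a * h v)"
  using cform_combine[of h h a 0] by simp

lemma cform_comp:
  assumes "cform h" "T \<in> continuous_operators smul" shows "cform (\<lambda>v. h (T v))"
  using assms continuous_on_compose2[of UNIV h UNIV T]
  by (auto simp: cform_def continuous_operators_def linear_operator_iff)

lemma cform_emb: "lin_form g \<Longrightarrow> continuous_on UNIV g \<Longrightarrow> cform (\<lambda>v. emb (g v))"
  by (auto simp: cform_def lin_form_def emb_add emb_mult intro: continuous_intros)

lemma subspace_cform: "fun_space.subspace {h. cform h}"
proof (rule fun_space.subspaceI)
  show "0 \<in> {h. cform h}" by (simp add: cform_def zero_fun_def)
  show "f + g \<in> {h. cform h}" if "f \<in> {h. cform h}" "g \<in> {h. cform h}" for f g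
    using cform_combine[of f g 1 1] that by (simp add: plus_fun_def)
qed (simp add: cform_scale)

lemma cform_span: "(\<And>h. h \<in> S \<Longrightarrow> cform h) \<Longrightarrow> h \<in> fun_space.span S \<Longrightarrow> cform h"
  using fun_space.span_minimal[OF _ subspace_cform, of S] by blast

lemma dense_induct:
  assumes "closure S = UNIV" "\<And>v. v \<in> S \<Longrightarrow> F v \<le> G v"
    and "continuous_on UNIV F" "continuous_on UNIV (G :: 'a \<Rightarrow> real)"
  shows "F v \<le> G v"
proof -
  have "closed {v. F v \<le> G v}" using assms(3,4) by (rule closed_Collect_le)
  then have "closure S \<subseteq> {v. F v \<le> G v}" using assms(2) by (intro closure_minimal) auto
  then show ?thesis using assms(1) by auto
qed

text \<open>On the orbit the modulus of \<open>H\<close> is \<open>norm \<mu> ^ n\<close> times its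
  value at \<open>x\<close>. For \<open>norm \<mu> \<le> 1\<close> this would bound \<open>H\<close>
  everywhere. Otherwise \<open>norm (H x)\<close> is a lower bound everywhere, in particular at 0,
  so \<open>H\<close> vanishes on the orbit.\<close>

lemma hypercyclic_no_eigenform:
  assumes x: "closure (range (\<lambda>n. (T ^^ n) x)) = UNIV" and H: "cform H" and eig: "\<And>v. H (T v) = \<mu> * H v"
  shows "H v = 0"
proof (rule ccontr)
  assume v: "H v \<noteq> 0"
  have orbit: "norm (H ((T ^^ n) x)) = norm \<mu> ^ n * norm (H x)" for n
    by (induction n) (simp_all add: eig norm_mult)
  have cont: "continuous_on UNIV (\<lambda>v. norm (H v))" using cform_continuous[OF H] by (intro continuous_intros)
  show False
  proof (cases "norm \<mu> \<le> 1")
    case True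
    have "norm (H u) \<le> norm (H x)" for u
    proof (rule dense_induct[OF x _ cont continuous_on_const])
      fix u assume "u \<in> range (\<lambda>n. (T ^^ n) x)"
      then obtain n where "u = (T ^^ n) x" by auto
      then show "norm (H u) \<le> norm (H x)" using orbit[of n] True by (simp add: mult_left_le_one_le power_le_one)
    qed
    \<comment> \<open>A multiple of \<open>v\<close> at which the modulus of \<open>H\<close> is
      \<open>norm (H x) + 1\<close>.\<close>
    from this[of "smul (of_real ((norm (H x) + 1) / norm (H v))) v"] show False
      using v by (simp add: cform_smul[OF H] norm_mult del: of_real_divide)
  next
    case False
    have "norm (H x) \<le> norm (H u)" for u
    proof (rule dense_induct[OF x _ continuous_on_const cont])
      fix u assume "u \<in> range (\<lambda>n. (T ^^ n) x)"
      then obtain n where "u = (T ^^ n) x" by auto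
      moreover have "1 * norm (H x) \<le> norm \<mu> ^ n * norm (H x)" using False by (intro mult_right_mono one_le_power) auto
      ultimately show "norm (H x) \<le> norm (H u)" using orbit[of n] by simp
    qed
    from this[of 0] have Hx: "H x = 0" by (simp add: cform_0[OF H])
    have "norm (H u) \<le> 0" for u
    proof (rule dense_induct[OF x _ cont continuous_on_const])
      fix u assume "u \<in> range (\<lambda>n. (T ^^ n) x)"
      then obtain n where "u = (T ^^ n) x" by auto
      then show "norm (H u) \<le> 0" using orbit[of n] Hx by simp
    qed
    then show False using v by simp
  qed
qed

text \<open>If a nonzero polynomial in the adjoint annihilates \<open>h\<close>, the iterates of
  \<open>h\<close> below its degree span an invariant space of finite dimension. Unless
  \<open>h\<close> is zero, this space contains an eigenvector of the adjoint.\<close>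

lemma hypercyclic_torsion_free:
  assumes T: "T \<in> continuous_operators smul" and x: "closure (range (\<lambda>n. (T ^^ n) x)) = UNIV"
    and h: "lin_form h" "continuous_on UNIV h" and p: "p \<noteq> 0" and zero: "\<And>v. poly_act T p h v = 0"
  shows "h v = 0"
proof (cases "degree p = 0")
  case True
  then obtain k where "p = [:k:]" by (rule degree_eq_zeroE)
  then show ?thesis using p zero[of v] by (simp add: poly_act_pCons)
next
  case False
  define d where "d = degree p"
  have d: "d > 0" "coeff p d \<noteq> 0" using False p by (simp_all add: d_def)
  define G where "G i v = emb (h ((T ^^ i) v))" for i v
  define M where "M = fun_space.span (G ` {..<d})"
  have G0: "G 0 = (\<lambda>v. emb (h v))" by (simp add: G_def fun_eq_iff)
  have GS: "G (Suc i) = (\<lambda>v. G i (T v))" for i by (simp add: G_def fun_eq_iff funpow_swap1)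
  have Gc: "cform (G i)" for i
  proof (induction i)
    case 0
    show ?case unfolding G0 by (rule cform_emb[OF h])
  next
    case (Suc i)
    show ?case unfolding GS by (rule cform_comp[OF Suc T])
  qed
  have Mc: "cform H" if "H \<in> M" for H using cform_span[of "G ` {..<d}" H] that Gc unfolding M_def by blast
  have Gd: "G d \<in> M"
  proof -
    have "G d u = (\<Sum>i<d. - emb (coeff p i) / emb (coeff p d) * G i u)" for u
    proof -
      have "(\<Sum>i\<le>d. coeff p i * h ((T ^^ i) u)) = 0" using zero[of u] by (simp add: poly_act_def d_def)
      then have "coeff p d * h ((T ^^ d) u) + (\<Sum>i<d. coeff p i * h ((T ^^ i) u)) = 0"
        by (simp add: lessThan_Suc_atMost[symmetric] add.commute)
      then have "emb (coeff p d * h ((T ^^ d) u) + (\<Sum>i<d. coeff p i * h ((T ^^ i) u))) = 0" by simp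
      then have "emb (coeff p d) * G d u + (\<Sum>i<d. emb (coeff p i) * G i u) = 0"
        by (simp add: emb_add emb_sum emb_mult G_def)
      then have "G d u = - (\<Sum>i<d. emb (coeff p i) * G i u) / emb (coeff p d)"
        using d(2) by (simp add: field_simps add_eq_0_iff2)
      then show ?thesis by (simp add: sum_divide_distrib sum_negf)
    qed
    then have "G d = (\<lambda>u. \<Sum>i<d. - emb (coeff p i) / emb (coeff p d) * G i u)" by (rule ext)
    also have "\<dots> \<in> M" unfolding M_def by (rule sum_in_fun_span) auto
    finally show ?thesis .
  qed
  have Gi: "G i \<in> M" if "i \<le> d" for i
    using that Gd by (cases "i = d") (auto simp: M_def intro: fun_space.span_base)
  have inv: "(\<lambda>v. H (T v)) \<in> M" if "H \<in> M" for H
    using that unfolding M_def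
  proof (induction rule: fun_space.span_induct_alt)
    case base
    show ?case using fun_space.span_zero by (simp add: zero_fun_def)
  next
    case (step c g H)
    then obtain i where i: "i < d" "g = G i" by auto
    have "(\<lambda>v. g (T v)) \<in> M" using Gi[of "Suc i"] i by (simp add: GS)
    then have "(\<lambda>v. c * g (T v)) + (\<lambda>v. H (T v)) \<in> M" using step unfolding M_def
      by (intro fun_space.span_add fun_space.span_scale)
    then show ?case by (simp add: M_def plus_fun_def)
  qed
  show ?thesis
  proof (rule ccontr)
    assume hv: "h v \<noteq> 0"
    have "G 0 \<in> M" using Gi[of 0] by simp
    moreover have "G 0 \<notin> {0}" using hv by (auto simp: G_def fun_eq_iff)
    ultimately obtain H \<mu> where H: "H \<in> M" "H \<notin> {0}" "(\<lambda>v. H (T v) - \<mu> * H v) \<in> {0}"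
      using ex_eigen_mod[of M "{0}" "G 0" "G ` {..<d}" T] inv fun_space.subspace_single_0
      by (auto simp: M_def fun_space.subspace_span)
    have "H (T u) = \<mu> * H u" for u using H(3) by (auto simp: fun_eq_iff)
    then have "H u = 0" for u using hypercyclic_no_eigenform[OF x Mc[OF H(1)]] by blast
    then show False using H(2) by (auto simp: fun_eq_iff)
  qed
qed

end

text \<open>The properties of coordinate functionals that characterise \<omega>; with them the
  arguments stay on the given space and no isomorphism has to be carried along.\<close>

locale omega_like = frechet_space smul
  for smul :: "'k::real_or_complex \<Rightarrow> 'a::{uniform_topological_group_add, ab_group_add} \<Rightarrow> 'a" +
  fixes g :: "nat \<Rightarrow> 'a \<Rightarrow> 'k"
  assumes g_lin: "lin_form (g i)" and g_cont: "continuous_on UNIV (g i)"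
    and g_nhd: "open S \<Longrightarrow> v \<in> S \<Longrightarrow> \<exists>N. \<exists>e>0. \<forall>u. (\<forall>i<N. norm (g i u - g i v) < e) \<longrightarrow> u \<in> S"
    and g_surj: "\<exists>v. \<forall>i. g i v = c i"
begin

definition unit :: "nat \<Rightarrow> 'a" where "unit j = (SOME v. \<forall>i. g i v = (if i = j then 1 else 0))"

lemma g_unit: "g i (unit j) = (if i = j then 1 else 0)"
  using someI_ex[OF g_surj[of "\<lambda>i. if i = j then 1 else 0"]] unfolding unit_def by blast

lemma combination_unit:
  assumes "i < N" shows "(\<Sum>k<N. \<alpha> k * g k (unit i)) = \<alpha> i"
proof -
  have "(\<Sum>k<N. \<alpha> k * g k (unit i)) = (\<Sum>k<N. if k = i then \<alpha> k else 0)"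
    by (intro sum.cong) (auto simp: g_unit)
  then show ?thesis using assms by simp
qed

text \<open>Two finite-dimensional spaces of functionals, one of them moved by a high power of the
  adjoint, are in direct sum: the functionals form a torsion-free \<open>'k[X]\<close>-module, and in
  coordinates with respect to a maximal independent subset of \<open>g 0, \<dots>, g (N - 1)\<close>
  multiplication by \<open>X ^ n\<close> raises the degree by \<open>n\<close>.\<close>

lemma functionals_separate:
  assumes T: "T \<in> continuous_operators smul" and x: "closure (range (\<lambda>n. (T ^^ n) x)) = UNIV"
  shows "\<exists>D. \<forall>n>D. \<forall>\<alpha> \<beta>. (\<forall>v. (\<Sum>i<N. \<alpha> i * g i ((T ^^ n) v)) = (\<Sum>i<N. \<beta> i * g i v)) \<longrightarrow> (\<forall>i<N. \<alpha> i = 0)"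
proof -
  \<comment> \<open>Independence of the \<open>g j\<close> with \<open>j \<in> S\<close> over the
    polynomials. A set of greatest cardinality plays the part of a basis up to torsion.\<close>
  define ind where "ind S \<longleftrightarrow> S \<subseteq> {..<N} \<and> (\<forall>P. (\<forall>v. (\<Sum>j\<in>S. poly_act T (P j) (g j) v) = 0) \<longrightarrow> (\<forall>j\<in>S. P j = 0))" for S
  have "ind {}" by (simp add: ind_def)
  moreover have "\<forall>S. ind S \<longrightarrow> card S < Suc N"
    using card_mono[of "{..<N}"] by (auto simp: ind_def less_Suc_eq_le)
  ultimately have "\<exists>S. ind S \<and> (\<forall>S'. ind S' \<longrightarrow> card S' \<le> card S)"
    using ex_has_greatest_nat[of ind "{}" card "Suc N"] by (metis less_imp_le)
  then obtain S where S: "ind S" and max: "\<And>S'. ind S' \<Longrightarrow> card S' \<le> card S" by blast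
  have SN: "S \<subseteq> {..<N}" using S by (simp add: ind_def)
  have Sind: "P j = 0" if "\<And>v. (\<Sum>j\<in>S. poly_act T (P j) (g j) v) = 0" "j \<in> S" for P j
    using S[unfolded ind_def, THEN conjunct2, THEN spec[of _ P]] that by simp
  have finS: "finite S" using SN finite_subset by blast
  have "\<exists>q p. q \<noteq> 0 \<and> (\<forall>v. poly_act T q (g i) v = (\<Sum>j\<in>S. poly_act T (p j) (g j) v))" if i: "i < N" for i
  proof (cases "i \<in> S")
    case True
    have "(\<Sum>j\<in>S. poly_act T (if j = i then 1 else 0) (g j) v) = poly_act T 1 (g i) v" for v
    proof -
      have "(\<Sum>j\<in>S. poly_act T (if j = i then 1 else 0) (g j) v) = (\<Sum>j\<in>S. if j = i then poly_act T 1 (g j) v else 0)"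
        by (intro sum.cong) auto
      then show ?thesis using True finS by simp
    qed
    then show ?thesis by (intro exI[of _ 1] exI[of _ "\<lambda>j. if j = i then 1 else 0"]) simp
  next
    case False
    have "card (insert i S) = Suc (card S)" using False finS by simp
    \<comment> \<open>By maximality the index \<open>i\<close> creates a relation, and the
      coefficient of \<open>g i\<close> in it is nonzero because the others are independent.\<close>
    then have "\<not> ind (insert i S)" using max by fastforce
    then obtain P j where P: "\<And>v. (\<Sum>j\<in>insert i S. poly_act T (P j) (g j) v) = 0" "j \<in> insert i S" "P j \<noteq> 0"
      using i SN unfolding ind_def by auto
    have sum0: "poly_act T (P i) (g i) v + (\<Sum>j\<in>S. poly_act T (P j) (g j) v) = 0" for v
      using P(1)[of v] False finS by simp
    have "P i \<noteq> 0"
    proof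
      assume Pi: "P i = 0"
      then have "P j = 0" if "j \<in> S" for j using Sind[of P j] sum0 that by simp
      then show False using P(2,3) Pi by auto
    qed
    moreover have "\<forall>v. poly_act T (P i) (g i) v = (\<Sum>j\<in>S. poly_act T (smult (-1) (P j)) (g j) v)"
      unfolding poly_act_smult using sum0 by (simp add: sum_negf eq_neg_iff_add_eq_0)
    ultimately show ?thesis by (intro exI conjI)
  qed
  then obtain q p where q: "\<And>i. i < N \<Longrightarrow> q i \<noteq> 0"
    and qp: "\<And>i v. i < N \<Longrightarrow> poly_act T (q i) (g i) v = (\<Sum>j\<in>S. poly_act T (p i j) (g j) v)" by metis
  \<comment> \<open>A common denominator: after multiplication by \<open>Q\<close> every
    \<open>g i\<close> has polynomial coordinates, of degree at most \<open>D\<close>.\<close>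
  define Q where "Q = (\<Prod>i<N. q i)"
  define R where "R i = (\<Prod>l\<in>{..<N} - {i}. q l)" for i
  have Q0: "Q \<noteq> 0" using q by (simp add: Q_def)
  have QR: "Q = R i * q i" if "i < N" for i
    using that by (simp add: Q_def R_def prod.remove[of "{..<N}" i] mult.commute)
  have Qg: "poly_act T Q (g i) v = (\<Sum>j\<in>S. poly_act T (R i * p i j) (g j) v)" if i: "i < N" for i v
  proof -
    have "poly_act T Q (g i) v = poly_act T (R i) (poly_act T (q i) (g i)) v" by (simp add: QR[OF i] poly_act_mult)
    also have "poly_act T (q i) (g i) = (\<lambda>v. \<Sum>j\<in>S. 1 * poly_act T (p i j) (g j) v)" using qp[OF i] by auto
    also have "poly_act T (R i) \<dots> v = (\<Sum>j\<in>S. poly_act T (R i) (poly_act T (p i j) (g j)) v)"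
      unfolding poly_act_combination by simp
    finally show ?thesis by (simp add: poly_act_mult)
  qed
  define D where "D = (\<Sum>i<N. \<Sum>j\<in>S. degree (R i * p i j))"
  have D: "degree (R i * p i j) \<le> D" if "i < N" "j \<in> S" for i j
  proof -
    have "degree (R i * p i j) \<le> (\<Sum>j\<in>S. degree (R i * p i j))" using that finS by (intro member_le_sum) auto
    also have "\<dots> \<le> D" unfolding D_def using that by (intro member_le_sum) auto
    finally show ?thesis .
  qed
  define C where "C \<alpha> j = (\<Sum>i<N. smult (\<alpha> i) (R i * p i j))" for \<alpha> :: "nat \<Rightarrow> 'k" and j
  have degC: "degree (C \<alpha> j) \<le> D" if "j \<in> S" for \<alpha> j
    unfolding C_def using D that by (intro degree_sum_le) (auto intro: order_trans[OF degree_smult_le])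
  have QC: "poly_act T Q (\<lambda>v. \<Sum>i<N. \<alpha> i * g i v) v = (\<Sum>j\<in>S. poly_act T (C \<alpha> j) (g j) v)" for \<alpha> v
  proof -
    have "poly_act T Q (\<lambda>v. \<Sum>i<N. \<alpha> i * g i v) v = (\<Sum>i<N. \<Sum>j\<in>S. \<alpha> i * poly_act T (R i * p i j) (g j) v)"
      by (simp add: poly_act_combination Qg sum_distrib_left)
    also have "\<dots> = (\<Sum>j\<in>S. \<Sum>i<N. \<alpha> i * poly_act T (R i * p i j) (g j) v)" by (rule sum.swap)
    finally show ?thesis by (simp add: C_def poly_act_sum poly_act_smult)
  qed
  have "\<forall>i<N. \<alpha> i = 0" if n: "n > D" and eq: "\<And>v. (\<Sum>i<N. \<alpha> i * g i ((T ^^ n) v)) = (\<Sum>i<N. \<beta> i * g i v)" for n \<alpha> \<beta>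
  proof -
    have zero: "(\<Sum>j\<in>S. poly_act T (monom 1 n * C \<alpha> j - C \<beta> j) (g j) v) = 0" for v
    proof -
      have "(\<Sum>j\<in>S. poly_act T (monom 1 n * C \<alpha> j) (g j) v) = poly_act T Q (\<lambda>v. \<Sum>i<N. \<alpha> i * g i v) ((T ^^ n) v)"
        by (simp add: poly_act_mult poly_act_monom QC)
      also have "\<dots> = poly_act T (monom 1 n) (poly_act T Q (\<lambda>v. \<Sum>i<N. \<alpha> i * g i v)) v" by (simp add: poly_act_monom)
      also have "\<dots> = poly_act T Q (poly_act T (monom 1 n) (\<lambda>v. \<Sum>i<N. \<alpha> i * g i v)) v" by (rule poly_act_commute)
      also have "poly_act T (monom 1 n) (\<lambda>v. \<Sum>i<N. \<alpha> i * g i v) = (\<lambda>v. \<Sum>i<N. \<beta> i * g i v)"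
        using eq by (auto simp: poly_act_monom)
      finally show ?thesis by (simp add: QC poly_act_diff sum_subtractf)
    qed
    \<comment> \<open>Multiplication by \<open>X ^ n\<close> would push the degree of a nonzero
      coordinate beyond \<open>D\<close>, whereas the coordinates of the other side stay within
      \<open>D\<close>.\<close>
    have "C \<alpha> j = 0" if j: "j \<in> S" for j
    proof (rule ccontr)
      assume nz: "C \<alpha> j \<noteq> 0"
      have "monom 1 n * C \<alpha> j - C \<beta> j = 0" using Sind[OF zero j] .
      then have "degree (monom 1 n * C \<alpha> j) \<le> D" using degC[OF j] by simp
      moreover have "degree (monom 1 n * C \<alpha> j) = n + degree (C \<alpha> j)"
        using nz by (subst degree_mult_eq) (auto simp: degree_monom_eq monom_eq_0_iff)
      ultimately show False using n by simp
    qed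
    then have "poly_act T Q (\<lambda>v. \<Sum>i<N. \<alpha> i * g i v) v = 0" for v by (simp add: QC)
    moreover have "lin_form (\<lambda>v. \<Sum>i<N. \<alpha> i * g i v)" using g_lin by (rule lin_form_combination)
    moreover have "continuous_on UNIV (\<lambda>v. \<Sum>i<N. \<alpha> i * g i v)" by (intro continuous_intros g_cont)
    ultimately have "(\<Sum>i<N. \<alpha> i * g i v) = 0" for v using hypercyclic_torsion_free[OF T x _ _ Q0] by blast
    then show ?thesis by (metis combination_unit)
  qed
  then show ?thesis by blast
qed

text \<open>Once the coordinates below \<open>N\<close> and their images under the
  \<open>n\<close>-th power of the adjoint are independent, all \<open>2 * N\<close> values can be
  prescribed at one vector: it lies in \<open>U\<close> and its image lies in
  \<open>V\<close>.\<close>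

theorem hypercyclic_imp_mixing:
  assumes T: "T \<in> continuous_operators smul" and "hypercyclic T"
  shows "mixing T"
  unfolding mixing_def
proof (intro allI impI)
  fix U V :: "'a set" assume UV: "open U \<and> U \<noteq> {} \<and> open V \<and> V \<noteq> {}"
  obtain x where x: "closure (range (\<lambda>n. (T ^^ n) x)) = UNIV" using assms(2) by (auto simp: hypercyclic_def)
  obtain a b where a: "a \<in> U" and b: "b \<in> V" using UV by blast
  obtain N1 e1 where 1: "e1 > 0" "\<And>u. (\<And>i. i < N1 \<Longrightarrow> norm (g i u - g i a) < e1) \<Longrightarrow> u \<in> U"
    using g_nhd[of U a] UV a by blast
  obtain N2 e2 where 2: "e2 > 0" "\<And>u. (\<And>i. i < N2 \<Longrightarrow> norm (g i u - g i b) < e2) \<Longrightarrow> u \<in> V"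
    using g_nhd[of V b] UV b by blast
  define N where "N = max N1 N2"
  obtain D where D: "\<And>n \<alpha> \<beta> i. n > D \<Longrightarrow> (\<And>v. (\<Sum>i<N. \<alpha> i * g i ((T ^^ n) v)) = (\<Sum>i<N. \<beta> i * g i v)) \<Longrightarrow> i < N \<Longrightarrow> \<alpha> i = 0"
    using functionals_separate[OF T x, of N] by blast
  have Tn: "lin_form (\<lambda>v. h ((T ^^ n) v))" if "lin_form h" for h n
  proof (induction n)
    case (Suc n)
    then show ?case using T by (auto simp: lin_form_def continuous_operators_def linear_operator_iff funpow_swap1)
  qed (use that in simp)
  have "(T ^^ n) ` U \<inter> V \<noteq> {}" if n: "n > D" for n
  proof -
    define G where "G i v = (if i < N then g i v else g (i - N) ((T ^^ n) v))" for i v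
    have Glin: "lin_form (G i)" for i
      unfolding G_def[abs_def] using g_lin Tn[OF g_lin] by (cases "i < N") auto
    have "\<exists>y. \<forall>i<2*N. \<forall>j<2*N. G i (y j) = (if i = j then 1 else 0)"
    proof (rule dual_vectors)
      fix i assume i: "i < 2 * N"
      show "G i \<notin> fun_space.span (G ` {..<i})"
      proof
        assume "G i \<in> fun_space.span (G ` {..<i})"
        then obtain c where c: "\<And>v. G i v = (\<Sum>j<i. c j * G j v)" using fun_span_image by blast
        show False
        proof (cases "i < N")
          case True
          have "(\<Sum>j<i. c j * G j (unit i)) = 0" using True by (intro sum.neutral) (auto simp: G_def g_unit)
          then show False using c[of "unit i"] True by (simp add: G_def g_unit)
        next
          case False
          \<comment> \<open>The relation solved for its moved part: coefficient 1 at the dependent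
            functional, negated coefficients below it and 0 above.\<close>
          define \<alpha> where "\<alpha> j = (if j = i - N then 1 else if j < i - N then - c (j + N) else 0)" for j
          have "(\<Sum>j<N. \<alpha> j * g j ((T ^^ n) v)) = (\<Sum>j<N. c j * g j v)" for v
          proof -
            have "(\<Sum>j<i. c j * G j v) = (\<Sum>j<N. c j * g j v) + (\<Sum>j<i - N. c (j + N) * g j ((T ^^ n) v))"
            proof -
              have split: "{..<i} = {..<N} \<union> (\<lambda>j. j + N) ` {..<i - N}"
              proof (intro set_eqI iffI)
                fix j assume "j \<in> {..<i}"
                then show "j \<in> {..<N} \<union> (\<lambda>j. j + N) ` {..<i - N}"
                  by (cases "j < N") (auto intro!: image_eqI[of _ _ "j - N"])
              qed (use False in auto)
              have "(\<Sum>j<i. c j * G j v) = (\<Sum>j<N. c j * G j v) + (\<Sum>j\<in>(\<lambda>j. j + N) ` {..<i - N}. c j * G j v)"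
                unfolding split by (rule sum.union_disjoint) auto
              then show ?thesis by (simp add: sum.reindex inj_on_def G_def)
            qed
            moreover have "(\<Sum>j<N. \<alpha> j * g j ((T ^^ n) v)) = g (i - N) ((T ^^ n) v) - (\<Sum>j<i - N. c (j + N) * g j ((T ^^ n) v))"
            proof -
              have "(\<Sum>j<N. \<alpha> j * g j ((T ^^ n) v)) = (\<Sum>j<Suc (i - N). \<alpha> j * g j ((T ^^ n) v))"
                using i by (intro sum.mono_neutral_right) (auto simp: \<alpha>_def)
              then show ?thesis by (simp add: \<alpha>_def sum_negf)
            qed
            ultimately show ?thesis using c[of v] False by (simp add: G_def)
          qed
          then have "\<alpha> (i - N) = 0" using i False by (intro D[OF n, of \<alpha> c]) auto
          then show False by (simp add: \<alpha>_def)
        qed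
      qed
    qed (rule Glin)
    then obtain y where y: "\<And>i j. i < 2*N \<Longrightarrow> j < 2*N \<Longrightarrow> G i (y j) = (if i = j then 1 else 0)" by blast
    define t where "t i = (if i < N then g i a else g (i - N) b)" for i
    define u where "u = (\<Sum>j<2*N. smul (t j) (y j))"
    have Gu: "G i u = t i" if "i < 2 * N" for i
    proof -
      have "G i u = (\<Sum>j<2*N. if i = j then t j else 0)"
        unfolding u_def lin_form_sum[OF Glin] by (intro sum.cong) (auto simp: lin_form_smul[OF Glin] y that)
      then show ?thesis using that by simp
    qed
    have "g i u = g i a" if "i < N" for i using Gu[of i] that by (simp add: G_def t_def)
    then have "u \<in> U" using 1 by (intro 1(2)) (simp add: N_def)
    moreover have "g i ((T ^^ n) u) = g i b" if "i < N" for i using Gu[of "i + N"] that by (simp add: G_def t_def)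
    then have "(T ^^ n) u \<in> V" using 2 by (intro 2(2)) (simp add: N_def)
    ultimately show ?thesis by blast
  qed
  then show "\<exists>r::real. r > 0 \<and> (\<forall>n::nat. real n > r \<longrightarrow> (T ^^ n) ` U \<inter> V \<noteq> {})"
    by (intro exI[of _ "real (Suc D)"]) auto
qed

end

section \<open>Supercyclic semigroups on the space of all sequences\<close>

text \<open>Cauchy's functional equation on the half line. Additivity settles rational arguments,
  and the \<open>q n\<close> are nonnegative rationals that approximate \<open>t\<close>.\<close>

lemma additive_continuous_linear:
  fixes \<beta> :: "real \<Rightarrow> complex"
  assumes cont: "continuous_on {0..} \<beta>" and add: "\<And>s t. 0 \<le> s \<Longrightarrow> 0 \<le> t \<Longrightarrow> \<beta> (s + t) = \<beta> s + \<beta> t"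
    and t: "0 \<le> t"
  shows "\<beta> t = of_real t * \<beta> 1"
proof -
  have mult: "\<beta> (real n * s) = of_nat n * \<beta> s" if "s \<ge> 0" for n s
  proof (induction n)
    case 0
    show ?case using add[of 0 0] by simp
  next
    case (Suc n)
    have "\<beta> (real (Suc n) * s) = \<beta> (real n * s + s)" by (simp add: algebra_simps)
    also have "\<dots> = \<beta> (real n * s) + \<beta> s" using that by (intro add) auto
    finally show ?case using Suc by (simp add: algebra_simps)
  qed
  define q where "q n = real (nat \<lfloor>real n * t\<rfloor>) / real n" for n :: nat
  have q0: "q n \<ge> 0" for n by (simp add: q_def)
  have eq: "of_real (q n) * \<beta> 1 = \<beta> (q n)" if "n > 0" for n
  proof -
    have "\<beta> 1 = of_nat n * \<beta> (1 / real n)" using mult[of "1 / real n" n] that by simp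
    moreover have "\<beta> (q n) = of_nat (nat \<lfloor>real n * t\<rfloor>) * \<beta> (1 / real n)" using mult[of "1 / real n" "nat \<lfloor>real n * t\<rfloor>"] by (simp add: q_def)
    ultimately show ?thesis using that by (simp add: q_def)
  qed
  have "\<forall>\<^sub>F n in sequentially. of_real (q n) * \<beta> 1 = \<beta> (q n)"
    by (rule eventually_mono[OF eventually_gt_at_top[of 0] eq])
  moreover have q: "q \<longlonglongrightarrow> t"
  proof (rule LIM_zero_cancel, rule Lim_null_comparison)
    show "(\<lambda>n. 1 / real n) \<longlonglongrightarrow> 0" by (rule lim_1_over_n)
    show "\<forall>\<^sub>F n in sequentially. norm (q n - t) \<le> 1 / real n"
      using eventually_gt_at_top[of 0]
    proof eventually_elim
      case (elim n)
      have "real (nat \<lfloor>real n * t\<rfloor>) = of_int \<lfloor>real n * t\<rfloor>" using t by simp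
      then have "\<bar>real (nat \<lfloor>real n * t\<rfloor>) - real n * t\<bar> \<le> 1" by linarith
      moreover have "q n - t = (real (nat \<lfloor>real n * t\<rfloor>) - real n * t) / real n" using elim by (simp add: q_def field_simps)
      ultimately show ?case using elim by (simp add: divide_right_mono)
    qed
  qed
  then have "(\<lambda>n. of_real (q n) * \<beta> 1) \<longlonglongrightarrow> of_real t * \<beta> 1" by (intro tendsto_intros)
  ultimately have 1: "(\<lambda>n. \<beta> (q n)) \<longlonglongrightarrow> of_real t * \<beta> 1" by (rule Lim_transform_eventually[rotated])
  have "(\<lambda>n. \<beta> (q n)) \<longlonglongrightarrow> \<beta> t"
    by (rule continuous_on_tendsto_compose[OF cont q]) (use t q0 in auto)
  then show ?thesis using 1 LIMSEQ_unique by blast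
qed

text \<open>The vanishing of the derivative at the minimum \<open>s = 0\<close>.\<close>

lemma real_quadratic_nonneg:
  fixes a b :: real
  assumes "\<And>s. s * a + s\<^sup>2 * b \<ge> 0" shows "a = 0"
proof (rule ccontr)
  assume a: "a \<noteq> 0"
  define c where "c = \<bar>b\<bar> + 1"
  have c: "c > 0" "b \<le> c" by (auto simp: c_def)
  define s where "s = - a / c"
  have "s / 2 * a + (s / 2)\<^sup>2 * b \<le> s / 2 * a + (s / 2)\<^sup>2 * c" using c by (intro add_left_mono mult_left_mono) auto
  also have "\<dots> = - (a * a) / (4 * c)" using c by (simp add: s_def power2_eq_square field_simps)
  also have "\<dots> < 0" using a c by (intro divide_neg_pos) (auto simp: not_square_less_zero less_le)
  finally show False using assms[of "s / 2"] by simp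
qed

lemma subspace_eqI:
  fixes A C :: "('a \<Rightarrow> complex) set"
  assumes A: "fun_space.subspace A" and sub: "A \<subseteq> C" and B: "finite B" "C \<subseteq> fun_space.span B"
    and dim: "fun_space.dim C \<le> fun_space.dim A"
  shows "A = C"
proof (rule ccontr)
  assume "A \<noteq> C"
  then obtain y where y: "y \<in> C" "y \<notin> A" using sub by blast
  obtain a where a: "a \<subseteq> A" "fun_space.independent a" "A \<subseteq> fun_space.span a" "card a = fun_space.dim A"
    using fun_space.basis_exists by blast
  obtain c where c: "c \<subseteq> C" "fun_space.independent c" "C \<subseteq> fun_space.span c" "card c = fun_space.dim C"
    using fun_space.basis_exists by blast
  have fina: "finite a" and finc: "finite c"
    using fun_space.independent_span_bound[OF B(1)] a c sub B(2) by (meson order_trans)+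
  have "fun_space.span a \<subseteq> A" using fun_space.span_minimal[OF a(1) A] .
  then have ny: "y \<notin> fun_space.span a" using y by blast
  then have ya: "y \<notin> a" using fun_space.span_base by blast
  have "fun_space.independent (insert y a)" using a(2) ny ya by (simp add: fun_space.independent_insert)
  moreover have "insert y a \<subseteq> fun_space.span c" using y(1) a(1) sub c(3) by blast
  ultimately have "card (insert y a) \<le> card c" using fun_space.independent_span_bound[OF finc] by blast
  then show False using ya fina a(4) c(4) dim by simp
qed

locale omega_supercyclic = omega_like smul g
  for smul :: "'k::real_or_complex \<Rightarrow> 'a::{uniform_topological_group_add, ab_group_add} \<Rightarrow> 'a"
    and g :: "nat \<Rightarrow> 'a \<Rightarrow> 'k" +
  fixes T :: "real \<Rightarrow> 'a \<Rightarrow> 'a" and x :: 'a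
  assumes semigroup: "operator_semigroup smul T" and strong: "strongly_continuous_semigroup T"
    and orbit_dense: "closure {smul z (T t x) | z t. t \<ge> 0} = UNIV"
begin

lemma T_op: "t \<ge> 0 \<Longrightarrow> T t \<in> continuous_operators smul"
  using semigroup by (auto simp: operator_semigroup_def)

lemma T_add: "t \<ge> 0 \<Longrightarrow> T t (u + v) = T t u + T t v"
  and T_smul: "t \<ge> 0 \<Longrightarrow> T t (smul c v) = smul c (T t v)"
  using T_op by (auto simp: continuous_operators_def linear_operator_iff)

lemma T_0: "T 0 v = v"
  using semigroup by (simp add: operator_semigroup_def)

lemma T_plus: "s \<ge> 0 \<Longrightarrow> t \<ge> 0 \<Longrightarrow> T (s + t) v = T t (T s v)"
  using semigroup by (simp add: operator_semigroup_def)

lemma T_commute: "s \<ge> 0 \<Longrightarrow> t \<ge> 0 \<Longrightarrow> T t (T s v) = T s (T t v)"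
  by (metis T_plus add.commute)

lemma orbit_continuous: "continuous_on {0..} (\<lambda>t. T t v)"
  using strong by (simp add: strongly_continuous_semigroup_def)

lemma cform_orbit: "cform h \<Longrightarrow> continuous_on {0..} (\<lambda>t. h (T t v))"
  by (rule continuous_on_compose2[OF cform_continuous orbit_continuous]) auto

text \<open>By Baire's theorem the values for all \<open>t \<le> 1\<close> are jointly bounded on
  some open set, and this contains a translate of the common kernel of finitely many coordinates. A
  linear functional that is bounded on such a translate vanishes on the kernel.\<close>

lemma local_coordinates:
  "\<exists>N. \<forall>t\<in>{0..1}. \<forall>v. (\<forall>j<N. g j v = 0) \<longrightarrow> g i (T t v) = 0"
proof -
  define F where "F k = (\<Inter>t\<in>{0..1}. {v. norm (g i (T t v)) \<le> real k})" for k :: nat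
  have lin: "lin_form (\<lambda>v. g i (T t v))" if "t \<ge> 0" for t
    using that by (simp add: lin_form_def T_add T_smul lin_form_add[OF g_lin] lin_form_smul[OF g_lin])
  have cont: "continuous_on UNIV (\<lambda>v. g i (T t v))" if "t \<ge> 0" for t
    using continuous_on_compose2[OF g_cont, of UNIV "T t"] T_op[OF that] by (auto simp: continuous_operators_def)
  have "closed (F k)" for k
    unfolding F_def by (intro closed_INT ballI closed_Collect_le continuous_intros cont) auto
  moreover have "(\<Union>k. F k) = UNIV"
  proof (intro set_eqI iffI UNIV_I)
    fix v
    have "continuous_on {0..1} (\<lambda>t. g i (T t v))"
      by (rule continuous_on_compose2[OF g_cont continuous_on_subset[OF orbit_continuous]]) auto
    then have "compact ((\<lambda>t. g i (T t v)) ` {0..1})" by (rule compact_continuous_image) simp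
    then obtain b where b: "\<And>t. t \<in> {0..1} \<Longrightarrow> norm (g i (T t v)) \<le> b"
      using compact_imp_bounded bounded_iff by (metis image_eqI)
    obtain k :: nat where "b \<le> real k" using real_arch_simple by blast
    then have "v \<in> F k" unfolding F_def using \<open>b \<le> real k\<close> by (auto intro!: order_trans[OF b])
    then show "v \<in> (\<Union>k. F k)" by blast
  qed
  ultimately obtain k u n e where e: "e > 0" "\<And>y. P n (y - u) < e \<Longrightarrow> y \<in> F k"
    by (rule Baire_closed) (rule that)
  obtain N d where N: "d > 0" "\<And>v. (\<And>j. j < N \<Longrightarrow> norm (g j v - g j 0) < d) \<Longrightarrow> P n (v - 0) < e"
    using g_nhd[OF open_P_ball[of n 0 e], of 0] e(1) by auto
  have "g i (T t v) = 0" if t: "t \<in> {0..1}" and v: "\<forall>j<N. g j v = 0" for t v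
  proof (rule ccontr)
    assume nz: "g i (T t v) \<noteq> 0"
    \<comment> \<open>Scales the value at \<open>v\<close> to modulus \<open>2 * k + 1\<close>,
      above the largest distance \<open>2 * k\<close> of two values attained on
      \<open>F k\<close>.\<close>
    define c :: 'k where "c = of_real ((2 * real k + 1) / norm (g i (T t v)))"
    have nc: "norm c * norm (g i (T t v)) = 2 * real k + 1"
      using nz unfolding c_def norm_of_real by simp
    have "P n (smul c v - 0) < e" using v N(1) by (intro N(2)) (simp add: lin_form_smul[OF g_lin] lin_form_0[OF g_lin])
    then have "u + smul c v \<in> F k" by (intro e(2)) simp
    moreover have "u \<in> F k" using e by simp
    ultimately have "norm (g i (T t (u + smul c v))) \<le> real k" "norm (g i (T t u)) \<le> real k" using t by (auto simp: F_def)
    moreover have "g i (T t (u + smul c v)) = g i (T t u) + c * g i (T t v)"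
      using lin[of t] t by (simp add: lin_form_def)
    ultimately have "norm (c * g i (T t v)) \<le> 2 * real k"
      using norm_triangle_ineq4[of "g i (T t (u + smul c v))" "g i (T t u)"] by simp
    then show False using nc by (simp add: norm_mult)
  qed
  then show ?thesis by blast
qed

definition G :: "nat \<Rightarrow> 'a \<Rightarrow> complex" where "G i v = emb (g i v)"

lemma G_cform: "cform (G i)"
  unfolding G_def[abs_def] by (rule cform_emb[OF g_lin g_cont])

definition invariant :: "('a \<Rightarrow> complex) set \<Rightarrow> bool" where
  "invariant W \<longleftrightarrow> (\<forall>h\<in>W. \<forall>t\<ge>0. (\<lambda>v. h (T t v)) \<in> W)"

text \<open>The spaces \<open>W \<delta>\<close> shrink with \<open>\<delta>\<close> and have finite
  dimension for \<open>\<delta> \<le> 1\<close>, so for some \<open>d\<close> the dimension is least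
  and \<open>W (d / 2) = W d\<close>. Hence times up to \<open>d / 2\<close> preserve
  \<open>W d\<close>, and every other time is a multiple of such a time.\<close>

lemma ex_invariant_space:
  "\<exists>W B. fun_space.subspace W \<and> finite B \<and> W \<subseteq> fun_space.span B \<and> (\<forall>h\<in>W. cform h) \<and> invariant W \<and> (\<forall>i<3. G i \<in> W)"
proof -
  obtain N where N: "\<And>i t v. t \<in> {0..1} \<Longrightarrow> (\<And>j. j < N i \<Longrightarrow> g j v = 0) \<Longrightarrow> g i (T t v) = 0"
    using local_coordinates by metis
  define N' where "N' = (\<Sum>i<3. N i)"
  have N': "N i \<le> N'" if "i < 3" for i unfolding N'_def using that by (intro member_le_sum) auto
  define B where "B = G ` {..<N'}"
  define D where "D \<delta> = {\<lambda>v. G i (T t v) | i t. i < (3::nat) \<and> 0 \<le> t \<and> t \<le> \<delta>}" for \<delta> :: real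
  define W where "W \<delta> = fun_space.span (D \<delta>)" for \<delta>
  have genB: "(\<lambda>v. G i (T t v)) \<in> fun_space.span B" if "i < 3" "t \<in> {0..1}" for i t
  proof -
    have lin: "lin_form (\<lambda>v. g i (T t v))"
      using that by (simp add: lin_form_def T_add T_smul lin_form_add[OF g_lin] lin_form_smul[OF g_lin])
    have eq: "g i (T t v) = (\<Sum>j<N'. g i (T t (unit j)) * g j v)" for v
      by (rule lin_form_in_span[OF g_lin _ lin]) (use N[of t i] N'[of i] that in \<open>auto simp: g_unit\<close>)
    have "(\<lambda>v. G i (T t v)) = (\<lambda>v. \<Sum>j<N'. emb (g i (T t (unit j))) * G j v)"
    proof
      fix v
      show "G i (T t v) = (\<Sum>j<N'. emb (g i (T t (unit j))) * G j v)"
        by (simp only: G_def eq[of v] emb_sum emb_mult)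
    qed
    also have "\<dots> \<in> fun_space.span B" unfolding B_def by (rule sum_in_fun_span) auto
    finally show ?thesis .
  qed
  have WB: "W \<delta> \<subseteq> fun_space.span B" if "\<delta> \<le> 1" for \<delta>
    unfolding W_def using genB that by (intro fun_space.span_minimal fun_space.subspace_span) (auto simp: D_def)
  have mono: "W \<delta> \<subseteq> W \<delta>'" if "\<delta> \<le> \<delta>'" for \<delta> \<delta>'
    unfolding W_def D_def using that by (intro fun_space.span_mono) (blast intro: order_trans)
  have "0 < (1::real) \<and> (1::real) \<le> 1" by simp
  from ex_has_least_nat[of "\<lambda>\<delta>. 0 < \<delta> \<and> \<delta> \<le> 1", OF this, of "\<lambda>\<delta>. fun_space.dim (W \<delta>)"]
  obtain d where d: "0 < d" "d \<le> 1" and least: "\<And>\<delta>. 0 < \<delta> \<Longrightarrow> \<delta> \<le> 1 \<Longrightarrow> fun_space.dim (W d) \<le> fun_space.dim (W \<delta>)"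
    by blast
  have finB: "finite B" by (simp add: B_def)
  have half: "W (d / 2) = W d"
    using d by (intro subspace_eqI[OF _ mono finB WB] least) (auto simp: W_def fun_space.subspace_span)
  have small: "(\<lambda>v. h (T s v)) \<in> W d" if "h \<in> W d" "0 \<le> s" "s \<le> d / 2" for h s
  proof -
    have "h \<in> fun_space.span (D (d / 2))" using that(1) half by (simp add: W_def)
    then show ?thesis
    proof (induction rule: fun_space.span_induct_alt)
      case base
      show ?case using fun_space.span_zero by (simp add: W_def zero_fun_def)
    next
      case (step c f h)
      then obtain i t where f: "f = (\<lambda>v. G i (T t v))" "i < 3" "0 \<le> t" "t \<le> d / 2" by (auto simp: D_def)
      have "(\<lambda>v. f (T s v)) = (\<lambda>v. G i (T (s + t) v))" using f that by (simp add: T_plus)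
      then have "(\<lambda>v. f (T s v)) \<in> D d" unfolding D_def using f that by (auto intro!: exI[of _ i] exI[of _ "s + t"])
      then have "(\<lambda>v. f (T s v)) \<in> W d" unfolding W_def by (rule fun_space.span_base)
      then have "(\<lambda>v. c * f (T s v)) + (\<lambda>v. h (T s v)) \<in> W d" using step.IH unfolding W_def
        by (intro fun_space.span_add fun_space.span_scale)
      then show ?case by (simp add: plus_fun_def)
    qed
  qed
  have "invariant (W d)"
    unfolding invariant_def
  proof (intro ballI allI impI)
    fix h and s :: real assume h: "h \<in> W d" and s: "0 \<le> s"
    obtain n :: nat where n: "s / (d / 2) < real n" using reals_Archimedean2 by blast
    then have n0: "real n > 0" using s d by (meson divide_nonneg_pos half_gt_zero le_less_trans)
    define r where "r = s / real n"
    have r: "0 \<le> r" "r \<le> d / 2" using s n n0 d by (simp_all add: r_def field_simps)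
    have "(\<lambda>v. h (T (real k * r) v)) \<in> W d" for k
    proof (induction k)
      case 0
      show ?case using h by (simp add: T_0)
    next
      case (Suc k)
      have "(\<lambda>v. h (T (real (Suc k) * r) v)) = (\<lambda>v. h (T (real k * r) (T r v)))"
        using r T_plus[of r "real k * r"] by (simp add: distrib_right)
      then show ?case using small[OF Suc r] by simp
    qed
    from this[of n] show "(\<lambda>v. h (T s v)) \<in> W d" using n0 by (simp add: r_def)
  qed
  moreover have "G i \<in> W d" if "i < 3" for i
  proof -
    have "(\<lambda>v. G i (T 0 v)) \<in> D d" unfolding D_def using that d by (intro CollectI exI[of _ i] exI[of _ 0]) simp
    then show ?thesis unfolding W_def T_0 by (rule fun_space.span_base)
  qed
  moreover have "cform h" if "h \<in> W d" for h
    using that WB[OF d(2)] cform_span[of B h] G_cform by (auto simp: B_def)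
  moreover have "fun_space.subspace (W d)" by (simp add: W_def fun_space.subspace_span)
  ultimately show ?thesis using finB WB[OF d(2)] by (intro exI[of _ "W d"] exI[of _ B]) auto
qed

text \<open>Let \<open>M\<close> be an invariant space between \<open>L\<close> and
  \<open>W\<close>, not contained in \<open>L\<close>, of least dimension. At each time the
  eigenvectors modulo \<open>L\<close> for a fixed eigenvalue form an invariant subspace because the
  semigroup is commutative, so by minimality they fill \<open>M\<close>. One element of
  \<open>M\<close> outside \<open>L\<close> thus serves all times.\<close>

lemma common_eigen_mod:
  assumes W: "fun_space.subspace W" "invariant W" and B: "finite B" "W \<subseteq> fun_space.span B"
    and L: "fun_space.subspace L" "invariant L" "L \<subseteq> W" "L \<noteq> W"
  shows "\<exists>h. h \<in> W \<and> h \<notin> L \<and> (\<forall>s\<ge>0. \<exists>\<mu>. (\<lambda>v. h (T s v) - \<mu> * h v) \<in> L)"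
proof -
  define Q where "Q M \<longleftrightarrow> fun_space.subspace M \<and> invariant M \<and> L \<subseteq> M \<and> M \<subseteq> W \<and> \<not> M \<subseteq> L" for M
  have "Q W" using W L by (auto simp: Q_def)
  from ex_has_least_nat[of Q, OF this, of fun_space.dim]
  obtain M where M: "Q M" and least: "\<And>M'. Q M' \<Longrightarrow> fun_space.dim M \<le> fun_space.dim M'" by blast
  have MB: "M \<subseteq> fun_space.span B" using M B(2) by (auto simp: Q_def)
  obtain h where h: "h \<in> M" "h \<notin> L" using M by (auto simp: Q_def)
  have "\<exists>\<mu>. (\<lambda>v. h (T s v) - \<mu> * h v) \<in> L" if s: "s \<ge> 0" for s
  proof -
    have "\<exists>h \<mu>. h \<in> M \<and> h \<notin> L \<and> (\<lambda>v. h (T s v) - \<mu> * h v) \<in> L"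
      using M L(1) h B(1) MB s by (intro ex_eigen_mod[of M L h B]) (auto simp: Q_def invariant_def)
    then obtain h1 \<mu> where h1: "h1 \<in> M" "h1 \<notin> L" "(\<lambda>v. h1 (T s v) - \<mu> * h1 v) \<in> L" by blast
    define M' where "M' = {h \<in> M. (\<lambda>v. h (T s v) - \<mu> * h v) \<in> L}"
    have subM: "fun_space.subspace M" using M by (simp add: Q_def)
    have "fun_space.subspace M'"
    proof (rule fun_space.subspaceI)
      show "0 \<in> M'" using fun_space.subspace_0[OF subM] fun_space.subspace_0[OF L(1)] by (simp add: M'_def zero_fun_def)
      show "f + f' \<in> M'" if "f \<in> M'" "f' \<in> M'" for f f'
      proof -
        have "(\<lambda>v. (f + f') (T s v) - \<mu> * (f + f') v) = (\<lambda>v. f (T s v) - \<mu> * f v) + (\<lambda>v. f' (T s v) - \<mu> * f' v)"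
          by (rule ext) (simp add: algebra_simps)
        then show ?thesis using that fun_space.subspace_add[OF subM] fun_space.subspace_add[OF L(1)] by (simp add: M'_def)
      qed
      show "(\<lambda>v. c * f v) \<in> M'" if "f \<in> M'" for c f
      proof -
        have "(\<lambda>v. c * f (T s v) - \<mu> * (c * f v)) = (\<lambda>v. c * (f (T s v) - \<mu> * f v))"
          by (rule ext) (simp add: algebra_simps)
        then show ?thesis using that fun_space.subspace_scale[OF subM] fun_space.subspace_scale[OF L(1)] by (simp add: M'_def)
      qed
    qed
    moreover have "invariant M'"
      unfolding invariant_def
    proof (intro ballI allI impI)
      fix f and r :: real assume f: "f \<in> M'" and r: "r \<ge> 0"
      have "(\<lambda>v. f (T r v)) \<in> M" using f r M by (auto simp: M'_def Q_def invariant_def)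
      have "(\<lambda>v. f (T s v) - \<mu> * f v) \<in> L" using f by (simp add: M'_def)
      from L(2)[unfolded invariant_def, rule_format, OF this r]
      have "(\<lambda>v. f (T s (T r v)) - \<mu> * f (T r v)) \<in> L" .
      moreover note \<open>(\<lambda>v. f (T r v)) \<in> M\<close>
      ultimately show "(\<lambda>v. f (T r v)) \<in> M'" using T_commute[OF r s] by (simp add: M'_def)
    qed
    moreover have "L \<subseteq> M'"
    proof
      fix f assume f: "f \<in> L"
      then have "(\<lambda>v. f (T s v)) \<in> L" using L(2) s by (auto simp: invariant_def)
      then have "(\<lambda>v. f (T s v)) - (\<lambda>v. \<mu> * f v) \<in> L" using f fun_space.subspace_diff[OF L(1)] fun_space.subspace_scale[OF L(1)] by blast
      then show "f \<in> M'" using f M by (auto simp: M'_def Q_def fun_diff_def)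
    qed
    moreover have "M' \<subseteq> W" "\<not> M' \<subseteq> L" using M h1 by (auto simp: M'_def Q_def)
    ultimately have "Q M'" by (simp add: Q_def)
    then have "M' = M"
      using least MB \<open>fun_space.subspace M'\<close> by (intro subspace_eqI[OF _ _ B(1)]) (auto simp: M'_def)
    then show ?thesis using h(1) by (auto simp: M'_def)
  qed
  then show ?thesis using h M by (auto simp: Q_def)
qed

section \<open>Joint eigenvectors of the adjoint semigroup\<close>

lemma orbit_induct:
  assumes "\<And>z t. t \<ge> 0 \<Longrightarrow> F (smul z (T t x)) \<le> H (smul z (T t x))"
    and "continuous_on UNIV F" "continuous_on UNIV (H :: 'a \<Rightarrow> real)"
  shows "F v \<le> H v"
  by (rule dense_induct[OF orbit_dense]) (use assms in auto)

text \<open>The value 1 at the supercyclic vector makes \<open>h (T t x)\<close> the eigenvalue at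
  time \<open>t\<close>, and proportional eigenvectors become equal.\<close>

definition eigen :: "('a \<Rightarrow> complex) \<Rightarrow> bool" where
  "eigen h \<longleftrightarrow> cform h \<and> h x = 1 \<and> (\<forall>t\<ge>0. \<forall>v. h (T t v) = h (T t x) * h v)"

lemma eigen_cform: "eigen h \<Longrightarrow> cform h"
  and eigen_x: "eigen h \<Longrightarrow> h x = 1"
  and eigen_T: "eigen h \<Longrightarrow> t \<ge> 0 \<Longrightarrow> h (T t v) = h (T t x) * h v"
  unfolding eigen_def by blast+

text \<open>An eigenvector that vanishes at \<open>x\<close> would vanish at all multiples of the
  orbit, hence everywhere.\<close>

lemma eigenI:
  assumes h: "cform h" and nz: "h \<noteq> 0" and eig: "\<And>t v. t \<ge> 0 \<Longrightarrow> h (T t v) = \<theta> t * h v"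
  shows "h x \<noteq> 0" "eigen (\<lambda>v. inverse (h x) * h v)"
proof -
  show hx: "h x \<noteq> 0"
  proof
    assume "h x = 0"
    have "norm (h v) \<le> 0" for v
      by (rule orbit_induct) (auto simp: cform_smul[OF h] eig \<open>h x = 0\<close> intro!: continuous_intros cform_continuous[OF h])
    then show False using nz by (auto simp: fun_eq_iff)
  qed
  show "eigen (\<lambda>v. inverse (h x) * h v)"
    unfolding eigen_def by (intro conjI cform_scale[OF h] allI impI) (simp_all add: hx eig)
qed

lemma eigen_mult: "eigen h \<Longrightarrow> s \<ge> 0 \<Longrightarrow> t \<ge> 0 \<Longrightarrow> h (T (s + t) x) = h (T s x) * h (T t x)"
  using eigen_T[of h t "T s x"] by (simp add: T_plus)

text \<open>A zero at time \<open>t\<close> would pass by square roots to the times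
  \<open>t / 2 ^ n\<close>, against continuity at time 0, where the value is 1.\<close>

lemma eigen_nonzero:
  assumes h: "eigen h" and t: "t \<ge> 0" shows "h (T t x) \<noteq> 0"
proof
  assume z: "h (T t x) = 0"
  have zero: "h (T (t / 2 ^ n) x) = 0" for n
  proof (induction n)
    case (Suc n)
    have "t / 2 ^ n = t / 2 ^ Suc n + t / 2 ^ Suc n" by simp
    then show ?case using Suc eigen_mult[OF h, of "t / 2 ^ Suc n" "t / 2 ^ Suc n"] t by simp
  qed (use z in simp)
  have "(\<lambda>n. t / 2 ^ n) \<longlonglongrightarrow> 0"
    using tendsto_mult[OF tendsto_const[of t] LIMSEQ_power_zero[of "1/2::real"]] by (simp add: power_divide)
  then have "(\<lambda>n. h (T (t / 2 ^ n) x)) \<longlonglongrightarrow> h (T 0 x)"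
    by (intro continuous_on_tendsto_compose[OF cform_orbit[OF eigen_cform[OF h]]]) (use t in auto)
  then have "(\<lambda>n. 0) \<longlonglongrightarrow> h x" by (simp add: zero T_0)
  then have "h x = 0" using LIMSEQ_unique tendsto_const by blast
  then show False using eigen_x[OF h] by simp
qed

lemma eigen_orbit: "eigen h \<Longrightarrow> t \<ge> 0 \<Longrightarrow> h (smul z (T t x)) = emb z * h (T t x)"
  by (simp add: eigen_cform cform_smul)

text \<open>A form \<open>Re (k \<cdot> cnj (c h))\<close> that is nonnegative along the orbit is nonnegative everywhere; if it
  vanishes at \<open>x\<close>, then \<open>x\<close> is a minimum and the derivative at \<open>x\<close> vanishes.\<close>

lemma form_vanishes:
  assumes h: "cform h" "h x = 1" and k: "cform k" "k x = 0"
    and orbit: "\<And>t. t \<ge> 0 \<Longrightarrow> Re (k (T t x) * cnj (c * h (T t x))) \<ge> 0"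
  shows "Re (k v * cnj c) = 0"
proof -
  define F where "F v = Re (k v * cnj (c * h v))" for v
  have "0 \<le> F v" for v
  proof (rule orbit_induct)
    show "0 \<le> F (smul z (T t x))" if "t \<ge> 0" for z t
    proof -
      have "F (smul z (T t x)) = Re (of_real ((norm (emb z))\<^sup>2) * (k (T t x) * cnj (c * h (T t x))))"
        unfolding F_def complex_norm_square by (simp add: cform_smul[OF h(1)] cform_smul[OF k(1)] mult_ac)
      also have "\<dots> = (norm (emb z))\<^sup>2 * Re (k (T t x) * cnj (c * h (T t x)))" by (simp only: scaleR_conv_of_real[symmetric] scaleR_complex.sel)
      finally show ?thesis using orbit[OF that] by simp
    qed
    show "continuous_on UNIV F" unfolding F_def
      by (intro continuous_intros cform_continuous[OF h(1)] cform_continuous[OF k(1)])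
  qed auto
  then have pos: "0 \<le> F (x + smul (of_real s) v)" for s .
  have "F (x + smul (of_real s) v) = s * Re (k v * cnj c) + s\<^sup>2 * Re (k v * cnj (c * h v))" for s
    by (simp add: F_def cform_add[OF h(1)] cform_add[OF k(1)] cform_smul[OF h(1)] cform_smul[OF k(1)] h(2) k(2) algebra_simps power2_eq_square)
  with pos show ?thesis using real_quadratic_nonneg[of "Re (k v * cnj c)" "Re (k v * cnj (c * h v))"] by simp
qed

text \<open>The quotient of \<open>b\<close> by the eigenvalue is additive and continuous, hence
  linear with slope \<open>c\<close>. Along the orbit, \<open>k - k x * h\<close> is therefore
  \<open>t * c\<close> times \<open>h\<close>; testing it against \<open>c\<close> and
  \<open>\<i> * c\<close> with \<open>form_vanishes\<close> shows that it is zero.\<close>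

lemma eigen_jordan:
  assumes h: "eigen h" and k: "cform k" and eq: "\<And>t v. t \<ge> 0 \<Longrightarrow> k (T t v) = h (T t x) * k v + b t * h v"
  shows "k v = k x * h v"
proof -
  have hc: "cform h" and hx: "h x = 1" by (rule eigen_cform[OF h], rule eigen_x[OF h])
  have nz: "h (T t x) \<noteq> 0" if "t \<ge> 0" for t using eigen_nonzero[OF h that] .
  define \<beta> where "\<beta> t = k (T t x) / h (T t x) - k x" for t
  have bt: "b t = \<beta> t * h (T t x)" if "t \<ge> 0" for t
    using eq[OF that, of x] nz[OF that] hx by (simp add: \<beta>_def field_simps)
  have "continuous_on {0..} \<beta>" unfolding \<beta>_def
    by (intro continuous_intros cform_orbit[OF hc] cform_orbit[OF k]) (use nz in auto)
  moreover have "\<beta> (s + t) = \<beta> s + \<beta> t" if "0 \<le> s" "0 \<le> t" for s t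
  proof -
    have "k (T (s + t) x) = h (T t x) * (h (T s x) * k x + b s) + b t * h (T s x)"
      using that eq[of t "T s x"] eq[of s x] hx by (simp add: T_plus)
    then show ?thesis
      using that nz[of s] nz[of t] eigen_mult[OF h that] unfolding bt[OF that(1)] bt[OF that(2)] \<beta>_def[of "s + t"] by (simp add: field_simps)
  qed
  ultimately have lin: "\<beta> t = of_real t * \<beta> 1" if "t \<ge> 0" for t using additive_continuous_linear[of \<beta> t] that by blast
  define c where "c = \<beta> 1"
  define k' where "k' v = k v - k x * h v" for v
  have k': "cform k'" using cform_combine[OF k hc, of 1 "- k x"] by (simp add: k'_def[abs_def])
  have k'x: "k' x = 0" using hx by (simp add: k'_def)
  have orb: "k' (T t x) = of_real t * c * h (T t x)" if "t \<ge> 0" for t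
  proof -
    have "k' (T t x) = \<beta> t * h (T t x)" using nz[OF that] by (simp add: k'_def \<beta>_def field_simps)
    then show ?thesis using lin[OF that] by (simp add: c_def)
  qed
  have "k' v = 0"
  proof (cases "c = 0")
    case True
    have "norm (k' v) \<le> 0"
      by (rule orbit_induct) (auto simp: cform_smul[OF k'] orb True intro!: continuous_intros cform_continuous[OF k'])
    then show ?thesis by simp
  next
    case False
    have prod: "k' (T t x) * cnj (d * c * h (T t x)) = of_real (t * (norm (c * h (T t x)))\<^sup>2) * cnj d" if "t \<ge> 0" for t d
      unfolding orb[OF that] of_real_mult complex_norm_square by (simp add: mult_ac)
    have "Re (k' v * cnj c) = 0"
      by (rule form_vanishes[OF hc hx k' k'x]) (use prod[of _ 1] in simp)
    moreover have "Re (k' v * cnj (\<i> * c)) = 0"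
      by (rule form_vanishes[OF hc hx k' k'x]) (simp only: prod, simp)
    then have "Im (k' v * cnj c) = 0" by (simp add: algebra_simps)
    ultimately have "k' v * cnj c = 0" by (simp only: complex_eq_iff zero_complex.sel)
    then show ?thesis using False by simp
  qed
  then show ?thesis by (simp add: k'_def)
qed

text \<open>Comparing the squared moduli at \<open>x + s v\<close> to first order in
  \<open>s\<close> gives equal real parts. The imaginary part of \<open>h\<close> is then dominated
  by that of \<open>k\<close>, so it vanishes where the latter does and is a real multiple of
  it.\<close>

lemma eigen_dominated:
  assumes h: "cform h" "h x = 1" and k: "cform k" "k x = 1" and le: "\<And>v. norm (h v) \<le> norm (k v)"
  shows "Re (h v) = Re (k v)" "\<exists>\<gamma>::real. \<forall>v. Im (h v) = \<gamma> * Im (k v)"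
proof -
  have Re: "Re (h v) = Re (k v)" for v
  proof -
    have *: "s * (2 * (Re (k v) - Re (h v))) + s\<^sup>2 * ((norm (k v))\<^sup>2 - (norm (h v))\<^sup>2) \<ge> 0" for s
    proof -
      have "(norm (h (x + smul (of_real s) v)))\<^sup>2 \<le> (norm (k (x + smul (of_real s) v)))\<^sup>2"
        using le by (intro power_mono) auto
      then have "(norm (1 + of_real s * h v))\<^sup>2 \<le> (norm (1 + of_real s * k v))\<^sup>2"
        by (simp add: cform_add[OF h(1)] cform_add[OF k(1)] cform_smul[OF h(1)] cform_smul[OF k(1)] h(2) k(2))
      then show ?thesis unfolding cmod_power2 by (simp add: algebra_simps power2_eq_square)
    qed
    show ?thesis using real_quadratic_nonneg[OF *] by simp
  qed
  then show "Re (h v) = Re (k v)" .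
  have Im: "\<bar>Im (h v)\<bar> \<le> \<bar>Im (k v)\<bar>" for v
  proof -
    have "(norm (h v))\<^sup>2 \<le> (norm (k v))\<^sup>2" using le by (intro power_mono) auto
    then show ?thesis by (simp add: cmod_power2 Re abs_le_square_iff)
  qed
  show "\<exists>\<gamma>::real. \<forall>v. Im (h v) = \<gamma> * Im (k v)"
  proof (cases "\<exists>u. Im (k u) \<noteq> 0")
    case False
    then show ?thesis using Im by fastforce
  next
    case True
    then obtain u where u: "Im (k u) \<noteq> 0" by blast
    have "Im (h v) = Im (h u) / Im (k u) * Im (k v)" for v
    proof -
      define s where "s = - Im (k v) / Im (k u)"
      have "Im (k (v + smul (of_real s) u)) = Im (k v) + s * Im (k u)" by (simp add: cform_add[OF k(1)] cform_smul[OF k(1)])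
      then have "Im (k (v + smul (of_real s) u)) = 0" using u by (simp add: s_def)
      then have "Im (h (v + smul (of_real s) u)) = 0" using Im[of "v + smul (of_real s) u"] by simp
      then have "Im (h v) + s * Im (h u) = 0" by (simp add: cform_add[OF h(1)] cform_smul[OF h(1)])
      then show ?thesis using u by (simp add: s_def field_simps)
    qed
    then show ?thesis by blast
  qed
qed

text \<open>The logarithm of the quotient of the two moduli along the orbit is additive and
  continuous in time, hence linear, so its sign does not change. Density extends the comparison to
  all vectors.\<close>

lemma eigen_compare:
  assumes h: "eigen h" and k: "eigen k"
  shows "(\<forall>v. norm (h v) \<le> norm (k v)) \<or> (\<forall>v. norm (k v) \<le> norm (h v))"
proof -
  have from_orbit: "norm (h v) \<le> norm (k v)" if hk: "eigen h" "eigen k" "\<And>t. t \<ge> 0 \<Longrightarrow> norm (h (T t x)) \<le> norm (k (T t x))" for h k v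
  proof (rule orbit_induct)
    show "norm (h (smul z (T t x))) \<le> norm (k (smul z (T t x)))" if "t \<ge> 0" for z t
      using hk(3)[OF that] that by (simp add: eigen_orbit[OF hk(1)] eigen_orbit[OF hk(2)] norm_mult mult_left_mono)
  qed (intro continuous_intros cform_continuous eigen_cform hk)+
  define \<beta> where "\<beta> t = complex_of_real (ln (norm (h (T t x)) / norm (k (T t x))))" for t
  have pos: "norm (h (T t x)) > 0" "norm (k (T t x)) > 0" if "t \<ge> 0" for t
    using eigen_nonzero[OF h that] eigen_nonzero[OF k that] by auto
  have cont: "continuous_on {0..} \<beta>" unfolding \<beta>_def
    by (intro continuous_intros cform_orbit eigen_cform h k) (use eigen_nonzero[OF h] eigen_nonzero[OF k] in auto)
  have "\<beta> (s + t) = \<beta> s + \<beta> t" if "0 \<le> s" "0 \<le> t" for s t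
    using that pos[of s] pos[of t] unfolding \<beta>_def eigen_mult[OF h that] eigen_mult[OF k that]
    by (simp add: norm_mult ln_mult ln_div)
  with cont have lin: "\<beta> t = of_real t * \<beta> 1" if "t \<ge> 0" for t using additive_continuous_linear[of \<beta> t] that by blast
  define r where "r = ln (norm (h (T 1 x)) / norm (k (T 1 x)))"
  have ln: "ln (norm (h (T t x)) / norm (k (T t x))) = t * r" if "t \<ge> 0" for t
    using lin[OF that] unfolding \<beta>_def r_def of_real_mult[symmetric] of_real_eq_iff .
  show ?thesis
  proof (cases "r \<le> 0")
    case True
    have "norm (h (T t x)) \<le> norm (k (T t x))" if "t \<ge> 0" for t
    proof -
      have "ln (norm (h (T t x)) / norm (k (T t x))) \<le> 0" using ln[OF that] True that by (simp add: mult_nonneg_nonpos)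
      then show ?thesis using pos[OF that] by (simp add: ln_le_zero_iff)
    qed
    then show ?thesis using from_orbit[OF h k] by blast
  next
    case False
    have "norm (k (T t x)) \<le> norm (h (T t x))" if "t \<ge> 0" for t
    proof -
      have "ln (norm (h (T t x)) / norm (k (T t x))) \<ge> 0" using ln[OF that] False that by simp
      then show ?thesis using pos[OF that] by (simp add: ln_ge_zero_iff)
    qed
    then show ?thesis using from_orbit[OF k h] by blast
  qed
qed

lemma eigen_Im: 
  assumes "eigen h" "eigen k"
  shows "Re (h v) = Re (k v)" "(\<exists>\<gamma>::real. \<forall>v. Im (h v) = \<gamma> * Im (k v)) \<or> (\<exists>\<gamma>::real. \<forall>v. Im (k v) = \<gamma> * Im (h v))"
proof -
  have c: "cform h" "h x = 1" "cform k" "k x = 1" by (intro eigen_cform eigen_x assms)+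
  from eigen_compare[OF assms] have "Re (h v) = Re (k v) \<and> ((\<exists>\<gamma>::real. \<forall>v. Im (h v) = \<gamma> * Im (k v)) \<or> (\<exists>\<gamma>::real. \<forall>v. Im (k v) = \<gamma> * Im (h v)))"
    using eigen_dominated[OF c] eigen_dominated[OF c(3,4,1,2)] by metis
  then show "Re (h v) = Re (k v)" "(\<exists>\<gamma>::real. \<forall>v. Im (h v) = \<gamma> * Im (k v)) \<or> (\<exists>\<gamma>::real. \<forall>v. Im (k v) = \<gamma> * Im (h v))"
    by blast+
qed

text \<open>All three have the same real part and imaginary parts proportional to that of one
  \<open>a\<close>, so they satisfy a linear relation. Applying the semigroup to it shows that
  \<open>e1\<close> and \<open>e2\<close> have the same eigenvalues, and \<open>eigen_jordan\<close>
  with \<open>b = 0\<close> makes them equal.\<close>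

lemma no_three_eigen:
  assumes e: "eigen e1" "eigen e2" "eigen e3" and ne: "e1 \<noteq> e2" "e1 \<noteq> e3" "e2 \<noteq> e3"
  shows False
proof -
  define dom where "dom h k \<longleftrightarrow> (\<exists>\<gamma>::real. \<forall>v. Im (h v) = \<gamma> * Im (k v))" for h k :: "'a \<Rightarrow> complex"
  have refl: "dom h h" for h unfolding dom_def by (intro exI[of _ 1]) simp
  have trans: "dom h l" if hk: "dom h k" "dom k l" for h k l
  proof -
    obtain a b where "\<forall>v. Im (h v) = a * Im (k v)" "\<forall>v. Im (k v) = b * Im (l v)" using hk unfolding dom_def by blast
    then show ?thesis unfolding dom_def by (intro exI[of _ "a * b"]) simp
  qed
  have "dom e1 e2 \<or> dom e2 e1" "dom e1 e3 \<or> dom e3 e1" "dom e2 e3 \<or> dom e3 e2"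
    using eigen_Im(2)[OF e(1,2)] eigen_Im(2)[OF e(1,3)] eigen_Im(2)[OF e(2,3)] by (auto simp: dom_def)
  then obtain a where "dom e1 a" "dom e2 a" "dom e3 a" using refl trans by metis
  then obtain \<gamma>1 \<gamma>2 \<gamma>3 where Im: "\<And>v. Im (e1 v) = \<gamma>1 * Im (a v)" "\<And>v. Im (e2 v) = \<gamma>2 * Im (a v)" "\<And>v. Im (e3 v) = \<gamma>3 * Im (a v)"
    unfolding dom_def by blast
  have Re: "Re (e2 v) = Re (e1 v)" "Re (e3 v) = Re (e1 v)" for v using eigen_Im(1)[OF e(2,1)] eigen_Im(1)[OF e(3,1)] by auto
  have g13: "\<gamma>1 \<noteq> \<gamma>3"
  proof
    assume "\<gamma>1 = \<gamma>3"
    then have "e1 = e3" by (intro ext) (simp add: complex_eq_iff Im Re)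
    then show False using ne by simp
  qed
  have comb: "of_real (\<gamma>1 - \<gamma>2) * e3 v = of_real (\<gamma>3 - \<gamma>2) * e1 v + of_real (\<gamma>1 - \<gamma>3) * e2 v" for v
    by (simp add: complex_eq_iff Im Re algebra_simps)
  have ex: "e1 x = 1" "e2 x = 1" "e3 x = 1" using e by (auto dest: eigen_x)
  have "e2 (T t x) = e1 (T t x)" if t: "t \<ge> 0" for t
  proof -
    define X1 where "X1 = e1 (T t x)"
    define X2 where "X2 = e2 (T t x)"
    define X3 where "X3 = e3 (T t x)"
    have act: "e1 (T t v) = X1 * e1 v" "e2 (T t v) = X2 * e2 v" "e3 (T t v) = X3 * e3 v" for v
      unfolding X1_def X2_def X3_def by (intro eigen_T e t)+
    \<comment> \<open>The relation at \<open>T t v\<close> minus \<open>X1\<close> times the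
      relation at \<open>v\<close>, which eliminates \<open>e1\<close>.\<close>
    have rel: "of_real (\<gamma>1 - \<gamma>2) * (X3 - X1) * e3 v = of_real (\<gamma>1 - \<gamma>3) * (X2 - X1) * e2 v" for v
    proof -
      have A: "of_real (\<gamma>1 - \<gamma>2) * (X3 * e3 v) = of_real (\<gamma>3 - \<gamma>2) * (X1 * e1 v) + of_real (\<gamma>1 - \<gamma>3) * (X2 * e2 v)"
        using comb[of "T t v"] by (simp only: act)
      have B: "of_real (\<gamma>1 - \<gamma>2) * (X1 * e3 v) = of_real (\<gamma>3 - \<gamma>2) * (X1 * e1 v) + of_real (\<gamma>1 - \<gamma>3) * (X1 * e2 v)"
        using arg_cong[OF comb[of v], of "\<lambda>y. X1 * y"] by (simp only: distrib_left mult.left_commute)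
      have "of_real (\<gamma>1 - \<gamma>2) * (X3 - X1) * e3 v = of_real (\<gamma>1 - \<gamma>2) * (X3 * e3 v) - of_real (\<gamma>1 - \<gamma>2) * (X1 * e3 v)"
        by (simp add: algebra_simps)
      also have "\<dots> = of_real (\<gamma>1 - \<gamma>3) * (X2 - X1) * e2 v" unfolding A B by (simp add: algebra_simps)
      finally show ?thesis .
    qed
    \<comment> \<open>At \<open>x\<close> both functionals are 1, so the two coefficients in
      \<open>rel\<close> agree; at this \<open>v\<close> the common coefficient must be 0.\<close>
    obtain v where v: "e2 v \<noteq> e3 v" using ne(3) by (auto simp: fun_eq_iff)
    have "of_real (\<gamma>1 - \<gamma>3) * (X2 - X1) * (e3 v - e2 v) = 0"
      using rel[of x] rel[of v] ex by (simp add: right_diff_distrib)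
    then have "X2 = X1" using v g13 by auto
    then show ?thesis by (simp add: X1_def X2_def)
  qed
  then have "e2 (T t v) = e1 (T t x) * e2 v + 0 * e1 v" if "t \<ge> 0" for t v
    using eigen_T[OF e(2) that, of v] that by simp
  then have "e2 v = e2 x * e1 v" for v by (rule eigen_jordan[OF e(1) eigen_cform[OF e(2)]])
  then have "e1 = e2" using ex by auto
  then show False using ne by simp
qed

text \<open>Commutativity of the semigroup makes \<open>b1\<close> proportional to
  \<open>\<theta>1 - \<theta>\<close> as soon as these eigenvalue functions differ at one time
  \<open>s\<close>, where the factor \<open>\<kappa>\<close> is read off. Subtracting
  \<open>\<kappa>\<close> times \<open>e1\<close> absorbs the term.\<close>

lemma remove_eigen:
  assumes h: "\<And>t v. t \<ge> 0 \<Longrightarrow> h (T t v) = \<theta> t * h v + b1 t * e1 v + b2 t * e2 v"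
    and e1: "\<And>t v. t \<ge> 0 \<Longrightarrow> e1 (T t v) = \<theta>1 t * e1 v" and e2: "\<And>t v. t \<ge> 0 \<Longrightarrow> e2 (T t v) = \<theta>2 t * e2 v"
    and ind: "\<And>\<alpha> \<beta>. (\<And>v. \<alpha> * e1 v + \<beta> * e2 v = 0) \<Longrightarrow> \<alpha> = (0::complex)"
    and s: "s \<ge> 0" "\<theta> s \<noteq> \<theta>1 s"
  shows "\<exists>\<kappa>. \<forall>t\<ge>0. \<forall>v. h (T t v) - \<kappa> * e1 (T t v) = \<theta> t * (h v - \<kappa> * e1 v) + b2 t * e2 v"
proof -
  define \<kappa> where "\<kappa> = b1 s / (\<theta>1 s - \<theta> s)"
  have b1: "b1 t = \<kappa> * (\<theta>1 t - \<theta> t)" if t: "t \<ge> 0" for t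
  proof -
    have "(\<theta> t * b1 s + b1 t * \<theta>1 s - \<theta> s * b1 t - b1 s * \<theta>1 t) * e1 v
      + (\<theta> t * b2 s + b2 t * \<theta>2 s - \<theta> s * b2 t - b2 s * \<theta>2 t) * e2 v = 0" for v
    proof -
      have "h (T t (T s v)) = h (T s (T t v))" using T_commute[OF s(1) t] by simp
      then show ?thesis using s(1) t by (simp add: h e1 e2 algebra_simps)
    qed
    then have "\<theta> t * b1 s + b1 t * \<theta>1 s - \<theta> s * b1 t - b1 s * \<theta>1 t = 0" by (rule ind)
    then have "b1 t * (\<theta>1 s - \<theta> s) = b1 s * (\<theta>1 t - \<theta> t)" by (simp add: algebra_simps)
    moreover have "\<theta>1 s - \<theta> s \<noteq> 0" using s(2) by auto
    ultimately show ?thesis unfolding \<kappa>_def by (simp add: nonzero_eq_divide_eq)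
  qed
  have "h (T t v) - \<kappa> * e1 (T t v) = \<theta> t * (h v - \<kappa> * e1 v) + b2 t * e2 v" if "t \<ge> 0" for t v
    using h[OF that] e1[OF that] b1[OF that] by (simp add: algebra_simps)
  then show ?thesis by blast
qed

lemma span_pair: "h \<in> fun_space.span {e1, e2} \<Longrightarrow> \<exists>a b. \<forall>v. h v = a * e1 v + b * (e2 v :: complex)"
proof -
  assume h: "h \<in> fun_space.span {e1, e2}"
  have "{e1, e2} = (\<lambda>i::nat. if i = 0 then e1 else e2) ` {..<2}" by (simp add: numeral_2_eq_2 lessThan_Suc insert_commute)
  with h have "h \<in> fun_space.span ((\<lambda>i::nat. if i = 0 then e1 else e2) ` {..<2})" by (simp only:)
  from fun_span_image[OF this]
  obtain c where "\<And>v. h v = (\<Sum>j<(2::nat). c j * (if j = 0 then e1 else e2) v)" by blast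
  then show ?thesis by (intro exI[of _ "c 0"] exI[of _ "c 1"]) (simp add: numeral_2_eq_2)
qed

lemma span_pairI: "(\<And>v. h v = a * e1 v + b * (e2 v :: complex)) \<Longrightarrow> h \<in> fun_space.span {e1, e2}"
proof -
  assume "\<And>v. h v = a * e1 v + b * e2 v"
  then have "h = (\<lambda>v. a * e1 v) + (\<lambda>v. b * e2 v)" by (auto simp: fun_eq_iff)
  then show ?thesis by (simp only:) (intro fun_space.span_add fun_space.span_scale fun_space.span_base; simp)
qed

text \<open>Triangular form with respect to \<open>e1\<close>, \<open>e2\<close> and a vector
  \<open>h\<close> beyond their span. Its eigenvalue function \<open>\<theta>\<close> coincides with
  that of at most one of the joint eigenvectors; terms along eigenvectors with a different function
  are removed, and what remains is a further joint eigenvector or a proper Jordan chain.\<close>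

lemma no_supercyclic_orbit: False
proof -
  obtain W B where W: "fun_space.subspace W" "finite B" "W \<subseteq> fun_space.span B" "\<And>h. h \<in> W \<Longrightarrow> cform h" "invariant W" "\<And>i. i < 3 \<Longrightarrow> G i \<in> W"
    using ex_invariant_space by blast
  \<comment> \<open>Three independent coordinates do not fit into the span of two
    functionals.\<close>
  have big: "W \<noteq> fun_space.span {e1, e2}" for e1 e2
  proof
    assume eq: "W = fun_space.span {e1, e2}"
    have "G k \<notin> fun_space.span (G ` {..<k})" for k
    proof
      assume "G k \<in> fun_space.span (G ` {..<k})"
      then obtain c where "\<And>v. G k v = (\<Sum>j<k. c j * G j v)" using fun_span_image by blast
      from this[of "unit k"] show False by (simp add: G_def g_unit)
    qed
    then have "fun_space.independent (G ` {..<3}) \<and> card (G ` {..<3}) = 3" by (intro independent_lessThan)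
    moreover have "G ` {..<3} \<subseteq> fun_space.span {e1, e2}" using W(6) eq by auto
    ultimately have "3 \<le> card {e1, e2}" using fun_space.independent_span_bound[of "{e1, e2}" "G ` {..<3}"] by simp
    moreover have "card {e1, e2} \<le> 2" by (simp add: card_insert_if)
    ultimately show False by simp
  qed
  have norm_eigen: "\<exists>e. eigen e \<and> e \<in> W \<and> (\<exists>c. c \<noteq> 0 \<and> (\<forall>v. e v = c * h v))"
    if h: "h \<in> W" "h \<noteq> 0" "\<And>t v. t \<ge> 0 \<Longrightarrow> h (T t v) = \<theta> t * h v" for h \<theta>
    using eigenI[OF W(4)[OF h(1)] h(2), of \<theta>] h(3) fun_space.subspace_scale[OF W(1) h(1), of "inverse (h x)"]
    by (intro exI[of _ "\<lambda>v. inverse (h x) * h v"] conjI exI[of _ "inverse (h x)"]) auto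
  obtain e1 where e1: "eigen e1" "e1 \<in> W"
  proof -
    have "invariant {0}" by (auto simp: invariant_def zero_fun_def)
    moreover have "{0} \<noteq> W" using big[of 0 0] by (auto simp: fun_space.span_zero)
    moreover have "{0} \<subseteq> W" using fun_space.subspace_0[OF W(1)] by simp
    ultimately obtain h where h: "h \<in> W" "h \<notin> {0}" "\<And>s. s \<ge> 0 \<Longrightarrow> \<exists>\<mu>. (\<lambda>v. h (T s v) - \<mu> * h v) \<in> {0}"
      using common_eigen_mod[OF W(1,5,2,3) fun_space.subspace_single_0] by blast
    then have "\<forall>s. \<exists>\<mu>. s \<ge> 0 \<longrightarrow> (\<forall>v. h (T s v) = \<mu> * h v)" by (auto simp: fun_eq_iff)
    then obtain \<theta> where "\<And>s v. s \<ge> 0 \<Longrightarrow> h (T s v) = \<theta> s * h v" by metis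
    then show ?thesis using norm_eigen[of h \<theta>] h that by auto
  qed
  \<comment> \<open>The default 0 stands for the absence of a second joint eigenvector, so that this
    case is covered by the same formulas.\<close>
  define e2 where "e2 = (if \<exists>e\<in>W. eigen e \<and> e \<noteq> e1 then SOME e. e \<in> W \<and> eigen e \<and> e \<noteq> e1 else 0)"
  have e2: "(e2 \<in> W \<and> eigen e2 \<and> e2 \<noteq> e1) \<or> (e2 = 0 \<and> (\<forall>e\<in>W. eigen e \<longrightarrow> e = e1))"
  proof (cases "\<exists>e\<in>W. eigen e \<and> e \<noteq> e1")
    case True
    then have "\<exists>e. e \<in> W \<and> eigen e \<and> e \<noteq> e1" by blast
    from someI_ex[OF this] True show ?thesis by (simp add: e2_def)
  qed (auto simp: e2_def)
  have only: "e \<in> fun_space.span {e1, e2}" if "e \<in> W" "eigen e" for e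
  proof -
    have "e = e1 \<or> e = e2" using e2 that e1 no_three_eigen[of e1 e2 e] by blast
    then show ?thesis using fun_space.span_base[of e "{e1, e2}"] by blast
  qed
  have e1x: "e1 x = 1" using e1 by (simp add: eigen_x)
  define \<theta>1 where "\<theta>1 t = e1 (T t x)" for t
  define \<theta>2 where "\<theta>2 t = e2 (T t x)" for t
  have E1: "e1 (T t v) = \<theta>1 t * e1 v" if "t \<ge> 0" for t v unfolding \<theta>1_def by (rule eigen_T[OF e1(1) that])
  have E2: "e2 (T t v) = \<theta>2 t * e2 v" if "t \<ge> 0" for t v
    using e2
  proof
    assume "e2 \<in> W \<and> eigen e2 \<and> e2 \<noteq> e1"
    then show ?thesis unfolding \<theta>2_def by (intro eigen_T that) blast
  qed simp
  have e2W: "e2 \<in> W" using e2 fun_space.subspace_0[OF W(1)] by auto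
  have ind1: "\<alpha> = 0" if "\<And>v. \<alpha> * e1 v + \<beta> * e2 v = 0" for \<alpha> \<beta>
  proof (cases "e2 = 0")
    case True
    then show ?thesis using that[of x] e1x by simp
  next
    case False
    then have "e2 x = 1" "e2 \<noteq> e1" using e2 by (auto dest: eigen_x)
    then obtain v where v: "e1 v \<noteq> e2 v" by (metis ext)
    have "\<beta> = - \<alpha>" using that[of x] e1x \<open>e2 x = 1\<close> by (simp add: eq_neg_iff_add_eq_0 add.commute)
    then have "\<alpha> * (e1 v - e2 v) = 0" using that[of v] by (simp add: algebra_simps)
    then show ?thesis using v by simp
  qed
  have ind2: "\<alpha> = 0" if "e2 \<noteq> 0" "\<And>v. \<alpha> * e2 v + \<beta> * e1 v = 0" for \<alpha> \<beta>
  proof -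
    have "\<beta> = 0" using ind1[of \<beta> \<alpha>] that(2) by (simp add: add.commute)
    moreover have "e2 x = 1" using e2 that(1) by (auto dest: eigen_x)
    ultimately show ?thesis using that(2)[of x] by simp
  qed
  define L where "L = fun_space.span {e1, e2}"
  have "invariant L"
    unfolding invariant_def
  proof (intro ballI allI impI)
    fix h and t :: real assume "h \<in> L" and t: "t \<ge> 0"
    then obtain a b where ab: "\<And>v. h v = a * e1 v + b * e2 v" using span_pair unfolding L_def by blast
    show "(\<lambda>v. h (T t v)) \<in> L" unfolding L_def
      by (rule span_pairI[of _ "a * \<theta>1 t" _ "b * \<theta>2 t"]) (simp add: ab E1 E2 t)
  qed
  moreover have "L \<subseteq> W" unfolding L_def using e1 e2W by (intro fun_space.span_minimal W(1)) auto
  moreover have "L \<noteq> W" using big unfolding L_def by blast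
  moreover have "fun_space.subspace L" by (simp add: L_def fun_space.subspace_span)
  ultimately obtain h where h: "h \<in> W" "h \<notin> L" "\<And>s. s \<ge> 0 \<Longrightarrow> \<exists>\<mu>. (\<lambda>v. h (T s v) - \<mu> * h v) \<in> L"
    using common_eigen_mod[OF W(1,5,2,3), of L] by blast
  have "\<forall>s. \<exists>\<mu> a b. s \<ge> 0 \<longrightarrow> (\<forall>v. h (T s v) = \<mu> * h v + a * e1 v + b * e2 v)"
  proof
    fix s
    show "\<exists>\<mu> a b. s \<ge> 0 \<longrightarrow> (\<forall>v. h (T s v) = \<mu> * h v + a * e1 v + b * e2 v)"
    proof (cases "s \<ge> 0")
      case True
      then obtain \<mu> where "(\<lambda>v. h (T s v) - \<mu> * h v) \<in> L" using h(3) by blast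
      then obtain a b where "\<And>v. h (T s v) - \<mu> * h v = a * e1 v + b * e2 v" using span_pair unfolding L_def by blast
      then show ?thesis by (intro exI[of _ \<mu>] exI[of _ a] exI[of _ b]) (simp add: algebra_simps diff_eq_eq)
    qed simp
  qed
  then obtain \<theta> b1 b2 where hT: "\<And>s v. s \<ge> 0 \<Longrightarrow> h (T s v) = \<theta> s * h v + b1 s * e1 v + b2 s * e2 v" by metis
  have shift: "(\<lambda>v. k v - \<kappa> * e v) \<in> W \<and> (\<lambda>v. k v - \<kappa> * e v) \<notin> L" if "k \<in> W" "k \<notin> L" "e \<in> {e1, e2}" for k \<kappa> e
  proof
    have eW: "e \<in> W" and eL: "e \<in> L" using that(3) e1 e2W by (auto simp: L_def intro: fun_space.span_base)
    have "k - (\<lambda>v. \<kappa> * e v) \<in> W" using that eW by (intro fun_space.subspace_diff[OF W(1)] fun_space.subspace_scale[OF W(1)])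
    then show "(\<lambda>v. k v - \<kappa> * e v) \<in> W" by (simp add: fun_diff_def)
    show "(\<lambda>v. k v - \<kappa> * e v) \<notin> L"
    proof
      assume "(\<lambda>v. k v - \<kappa> * e v) \<in> L"
      then have "(\<lambda>v. k v - \<kappa> * e v) + (\<lambda>v. \<kappa> * e v) \<in> L" using eL unfolding L_def
        by (intro fun_space.span_add fun_space.span_scale)
      then show False using that(2) by (simp add: plus_fun_def)
    qed
  qed
  have no_jordan: False if k: "k \<in> W" "k \<notin> L" and e: "e \<in> {e1, e2}" "eigen e"
    and eq: "\<And>t v. t \<ge> 0 \<Longrightarrow> k (T t v) = e (T t x) * k v + b t * e v" for k e b
  proof -
    have "k v = k x * e v" for v by (rule eigen_jordan[OF e(2) W(4)[OF k(1)] eq])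
    then have "k = (\<lambda>v. k x * e v)" by (rule ext)
    also have "\<dots> \<in> L" unfolding L_def using e(1) by (intro fun_space.span_scale fun_space.span_base)
    finally show False using k(2) by simp
  qed
  have no_eigen: False if k: "k \<in> W" "k \<notin> L" and eq: "\<And>t v. t \<ge> 0 \<Longrightarrow> k (T t v) = \<theta> t * k v" for k
  proof -
    have "k \<noteq> 0" using k(2) by (auto simp: L_def fun_space.span_zero)
    then obtain e c where e: "eigen e" "e \<in> W" "c \<noteq> 0" "\<And>v. e v = c * k v" using norm_eigen[OF k(1) _ eq] by blast
    have "k = (\<lambda>v. inverse c * e v)" using e(3,4) by (auto simp: fun_eq_iff)
    also have "\<dots> \<in> L" using only[OF e(2,1)] unfolding L_def by (rule fun_space.span_scale)
    finally show False using k(2) by simp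
  qed
  show False
  proof (cases "\<forall>t\<ge>0. \<theta> t = \<theta>1 t")
    case True
    show False
    proof (cases "e2 = 0")
      case z: True
      show False by (rule no_jordan[OF h(1,2), of e1 b1]) (use e1 hT True z in \<open>auto simp: \<theta>1_def\<close>)
    next
      case nz: False
      then have e2e: "eigen e2" "e2 \<noteq> e1" using e2 by auto
      \<comment> \<open>Otherwise \<open>e1\<close> and \<open>e2\<close> would share one eigenvalue
        function, and \<open>eigen_jordan\<close> with \<open>b = 0\<close> would identify
        them.\<close>
      have "\<exists>s\<ge>0. \<theta> s \<noteq> \<theta>2 s"
      proof (rule ccontr)
        assume "\<not> ?thesis"
        then have eq: "e2 (T t v) = e1 (T t x) * e2 v + 0 * e1 v" if "t \<ge> 0" for t v
          using E2[OF that, of v] True that by (simp add: \<theta>1_def)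
        have "e2 v = e2 x * e1 v" for v by (rule eigen_jordan[OF e1(1) W(4)[OF e2W] eq])
        then show False using e2e eigen_x[OF e2e(1)] by (auto simp: fun_eq_iff)
      qed
      then obtain s where s: "s \<ge> 0" "\<theta> s \<noteq> \<theta>2 s" by blast
      have "\<exists>\<kappa>. \<forall>t\<ge>0. \<forall>v. h (T t v) - \<kappa> * e2 (T t v) = \<theta> t * (h v - \<kappa> * e2 v) + b1 t * e1 v"
      proof (rule remove_eigen[where h=h and \<theta>=\<theta> and ?e1.0=e2 and ?e2.0=e1 and ?b1.0=b2 and ?b2.0=b1 and ?\<theta>1.0=\<theta>2 and ?\<theta>2.0=\<theta>1, OF _ E2 E1 _ s])
        show "h (T t v) = \<theta> t * h v + b2 t * e2 v + b1 t * e1 v" if "t \<ge> 0" for t v using hT[OF that, of v] by simp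
        show "\<alpha> = 0" if "\<And>v. \<alpha> * e2 v + \<beta> * e1 v = 0" for \<alpha> \<beta> using ind2[OF nz that] .
      qed
      then obtain \<kappa> where \<kappa>: "\<And>t v. t \<ge> 0 \<Longrightarrow> h (T t v) - \<kappa> * e2 (T t v) = \<theta> t * (h v - \<kappa> * e2 v) + b1 t * e1 v" by blast
      show False
        by (rule no_jordan[of "\<lambda>v. h v - \<kappa> * e2 v" e1 b1]) (use shift[OF h(1,2), of e2 \<kappa>] e1 \<kappa> True in \<open>auto simp: \<theta>1_def\<close>)
    qed
  next
    case False
    then obtain s where s: "s \<ge> 0" "\<theta> s \<noteq> \<theta>1 s" by blast
    obtain \<kappa> where \<kappa>: "\<And>t v. t \<ge> 0 \<Longrightarrow> h (T t v) - \<kappa> * e1 (T t v) = \<theta> t * (h v - \<kappa> * e1 v) + b2 t * e2 v"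
    proof -
      have "\<exists>\<kappa>. \<forall>t\<ge>0. \<forall>v. h (T t v) - \<kappa> * e1 (T t v) = \<theta> t * (h v - \<kappa> * e1 v) + b2 t * e2 v"
      proof (rule remove_eigen[where h=h and \<theta>=\<theta> and ?e1.0=e1 and ?e2.0=e2 and ?b1.0=b1 and ?b2.0=b2 and ?\<theta>1.0=\<theta>1 and ?\<theta>2.0=\<theta>2, OF hT E1 E2 _ s])
        show "\<alpha> = 0" if "\<And>v. \<alpha> * e1 v + \<beta> * e2 v = 0" for \<alpha> \<beta> using ind1[OF that] .
      qed
      then show ?thesis using that by blast
    qed
    define k where "k v = h v - \<kappa> * e1 v" for v
    have k: "k \<in> W" "k \<notin> L" using shift[OF h(1,2), of e1 \<kappa>] by (simp_all add: k_def[abs_def])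
    have kT: "k (T t v) = \<theta> t * k v + b2 t * e2 v" if "t \<ge> 0" for t v using \<kappa>[OF that] by (simp add: k_def)
    show False
    proof (cases "e2 = 0")
      case True
      show False by (rule no_eigen[OF k]) (use kT True in simp)
    next
      case nz: False
      then have e2e: "eigen e2" using e2 by auto
      show False
      proof (cases "\<forall>t\<ge>0. \<theta> t = \<theta>2 t")
        case True
        show False by (rule no_jordan[OF k, of e2 b2]) (use e2e kT True in \<open>auto simp: \<theta>2_def\<close>)
      next
        case False
        then obtain s' where s': "s' \<ge> 0" "\<theta> s' \<noteq> \<theta>2 s'" by blast
        have "\<exists>\<kappa>. \<forall>t\<ge>0. \<forall>v. k (T t v) - \<kappa> * e2 (T t v) = \<theta> t * (k v - \<kappa> * e2 v) + 0 * e1 v"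
          by (rule remove_eigen[where h=k and \<theta>=\<theta> and ?e1.0=e2 and ?e2.0=e1 and ?b1.0=b2 and ?b2.0="\<lambda>_. 0" and ?\<theta>1.0=\<theta>2 and ?\<theta>2.0=\<theta>1, OF _ E2 E1 ind2[OF nz] s']) (use kT in auto)
        then obtain \<kappa>' where "\<And>t v. t \<ge> 0 \<Longrightarrow> k (T t v) - \<kappa>' * e2 (T t v) = \<theta> t * (k v - \<kappa>' * e2 v)" by auto
        then show False using no_eigen[of "\<lambda>v. k v - \<kappa>' * e2 v"] shift[OF k, of e2 \<kappa>'] by simp
      qed
    qed
  qed
qed

end

section \<open>The equivalence\<close>

lemma open_coordinates:
  fixes S :: "(nat \<Rightarrow> 'k::metric_space) set"
  assumes "open S" "x \<in> S"
  shows "\<exists>N. \<exists>e>0. \<forall>y. (\<forall>i<N. dist (y i) (x i) < e) \<longrightarrow> y \<in> S"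
proof -
  have "openin (product_topology (\<lambda>i. euclidean) UNIV) S" using assms(1) by (simp add: open_fun_def)
  from product_topology_open_contains_basis[OF this assms(2)]
  obtain X where "x \<in> (\<Pi>\<^sub>E i\<in>UNIV. X i) \<and> (\<forall>i. openin euclidean (X i)) \<and> finite {i. X i \<noteq> topspace euclidean} \<and> (\<Pi>\<^sub>E i\<in>UNIV. X i) \<subseteq> S"
    by (rule exE)
  note H = this[unfolded topspace_euclidean open_openin[symmetric]]
  have xX: "x \<in> (\<Pi>\<^sub>E i\<in>UNIV. X i)" using H by (elim conjE)
  have XS: "(\<Pi>\<^sub>E i\<in>UNIV. X i) \<subseteq> S" using H by (elim conjE)
  have fin: "finite {i. X i \<noteq> UNIV}" using H by (elim conjE)
  have open_X: "open (X i)" for i using H by (elim conjE allE)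
  have mem: "y \<in> (\<Pi>\<^sub>E i\<in>UNIV. X i) \<longleftrightarrow> (\<forall>i. y i \<in> X i)" for y by (simp add: PiE_iff)
  obtain N where N: "\<forall>i\<in>{i. X i \<noteq> UNIV}. i < N"
    using fin unfolding finite_nat_set_iff_bounded by (rule exE)
  have "\<forall>i. \<exists>e>0. \<forall>y. dist y (x i) < e \<longrightarrow> y \<in> X i"
    using xX open_X unfolding mem open_dist by blast
  then obtain e where e: "\<And>i. e i > (0::real)" "\<And>i y. dist y (x i) < e i \<Longrightarrow> y \<in> X i" by metis
  \<comment> \<open>The element 1 keeps the minimum defined when no coordinate is
    restricted.\<close>
  define d where "d = Min (insert 1 (e ` {..<N}))"
  have "d > 0" unfolding d_def using e(1) by (subst Min_gr_iff) auto
  moreover have "y \<in> S" if y: "\<And>i. i < N \<Longrightarrow> dist (y i) (x i) < d" for y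
  proof -
    have "y i \<in> X i" for i
    proof (cases "i < N")
      case True
      then have "d \<le> e i" unfolding d_def by (intro Min_le) auto
      then show ?thesis using y[OF True] by (intro e(2)) simp
    next
      case False
      then have "X i = UNIV" using N by blast
      then show ?thesis by simp
    qed
    then show ?thesis using XS mem by blast
  qed
  ultimately show ?thesis by blast
qed

context frechet_space
begin

lemma isomorphic_imp_omega_like:
  assumes "isomorphic_tvs smul (omega_smul :: 'k \<Rightarrow> (nat \<Rightarrow> 'k) \<Rightarrow> nat \<Rightarrow> 'k)"
  shows "\<exists>g. omega_like smul g"
proof -
  obtain f h where f: "Vector_Spaces.linear smul (omega_smul :: 'k \<Rightarrow> (nat \<Rightarrow> 'k) \<Rightarrow> nat \<Rightarrow> 'k) f"
    and hom: "homeomorphism UNIV UNIV f h"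
    using assms by (auto simp: isomorphic_tvs_def)
  interpret f: Vector_Spaces.linear smul omega_smul f by (rule f)
  have hf: "h (f v) = v" and fh: "f (h c) = c" for v c
    using hom by (auto simp: homeomorphism_def)
  have cont: "continuous_on UNIV f" "continuous_on UNIV h" using hom by (auto simp: homeomorphism_def)
  have "omega_like smul (\<lambda>i v. f v i)"
  proof
    show "lin_form (\<lambda>v. f v i)" for i by (simp add: lin_form_def f.add f.scale omega_smul_def)
    show "continuous_on UNIV (\<lambda>v. f v i)" for i
      using continuous_on_compose2[OF continuous_on_product_coordinates[of i] cont(1)] by simp
    show "\<exists>N. \<exists>e>0. \<forall>u. (\<forall>i<N. norm (f u i - f v i) < e) \<longrightarrow> u \<in> S" if S: "open S" "v \<in> S" for S v
    proof -
      have "open (h -` S)" using open_vimage[OF S(1) cont(2)] .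
      moreover have "f v \<in> h -` S" using S(2) by (simp add: hf)
      ultimately obtain N e where "e > 0" "\<And>y. (\<forall>i<N. dist (y i) (f v i) < e) \<Longrightarrow> y \<in> h -` S"
        using open_coordinates[of "h -` S" "f v"] by blast
      then have "\<forall>u. (\<forall>i<N. norm (f u i - f v i) < e) \<longrightarrow> u \<in> S" by (metis dist_norm hf vimage_eq)
      then show ?thesis using \<open>e > 0\<close> by blast
    qed
    show "\<exists>v. \<forall>i. f v i = c i" for c using fh[of c] by metis
  qed
  then show ?thesis by blast
qed

end

theorem corollary1p10:
  fixes smul :: "'k::real_or_complex \<Rightarrow> 'a::{uniform_topological_group_add, ab_group_add} \<Rightarrow> 'a"
  assumes "frechet_space smul"
    and "separable_space (euclidean :: 'a topology)"
    and "infinite_dimensional smul"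
  shows "((\<exists>T \<in> continuous_operators smul. hypercyclic T \<and> \<not> mixing T)
            \<longleftrightarrow> (\<exists>T. operator_semigroup smul T \<and> uniformly_continuous_semigroup T
                    \<and> mixing_semigroup T))
       \<and> ((\<exists>T. operator_semigroup smul T \<and> uniformly_continuous_semigroup T
                    \<and> mixing_semigroup T)
            \<longleftrightarrow> (\<exists>T. operator_semigroup smul T \<and> strongly_continuous_semigroup T
                    \<and> supercyclic_semigroup smul T))
       \<and> ((\<exists>T. operator_semigroup smul T \<and> strongly_continuous_semigroup T
                    \<and> supercyclic_semigroup smul T)
            \<longleftrightarrow> \<not> isomorphic_tvs smul (omega_smul :: 'k \<Rightarrow> (nat \<Rightarrow> 'k) \<Rightarrow> (nat \<Rightarrow> 'k)))"
    (is "(?hyp \<longleftrightarrow> ?mix) \<and> (?mix \<longleftrightarrow> ?super) \<and> (?super \<longleftrightarrow> \<not> ?iso)")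
proof -
  interpret frechet_space smul by (rule assms(1))
  have mix_super: "?mix \<Longrightarrow> ?super"
    using uniformly_imp_strongly_continuous mixing_imp_supercyclic_semigroup[OF assms(2)] by blast
  show ?thesis
  proof (cases ?iso)
    case True
    then obtain g where "omega_like smul g" using isomorphic_imp_omega_like by blast
    then interpret omega_like smul g .
    have "\<not> ?hyp" using hypercyclic_imp_mixing by blast
    moreover have "\<not> ?super"
    proof
      assume ?super
      then obtain T x where "operator_semigroup smul T" "strongly_continuous_semigroup T"
        "closure {smul z (T t x) | z t. t \<ge> 0} = UNIV"
        unfolding supercyclic_semigroup_def by blast
      then have "omega_supercyclic smul g T x" by unfold_locales
      then show False by (rule omega_supercyclic.no_supercyclic_orbit)
    qed
    ultimately show ?thesis using mix_super True by blast
  next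
    case False
    then obtain n where "\<nexists>B. finite B \<and> bdd_forms n \<subseteq> fun_space.span B"
      using isomorphic_omega[OF assms(3)] by blast
    from ex_biorthogonal_system[OF assms(2) this]
    obtain x :: "nat \<Rightarrow> 'a" and f where xf: "\<forall>i. lin_form (f i)" "\<forall>i v. norm (f i v) \<le> P n v"
      "\<forall>i j. f i (x j) = (if i = j then 1 else 0)" "closure (span (range x)) = UNIV"
      by (elim exE conjE) (rule that)
    interpret biorthogonal_space smul x f n
      by unfold_locales (use xf in simp_all)
    have ?mix using operator_semigroup_shift_exp uniformly_continuous_shift_exp mixing_shift_exp by blast
    moreover have ?hyp by (rule ex_hypercyclic_nonmixing[OF assms(2)])
    ultimately show ?thesis using mix_super False by blast
  qed
qed

end
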